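(* Let $\mathscr{E}$ be a type-theoretic model topos and let $\mathrm{s}\mathscr{E} := \mathscr{E}^{\Delta^{\mathrm{op}}}$ be the type-theoretic model topos of simplicial objects in $\mathscr{E}$, in which simplicial homotopy type theory is interpreted. Let $\pi : \widetilde{\mathcal{U}} \to \mathcal{U}$ be the universal fibration for small fibrations in $\mathrm{s}\mathscr{E}$, together with a fixed splitting (a fixed choice, for each $A:\Gamma\to\mathcal{U}$, of a pullback $p_A : \Gamma.A \to \Gamma$ of $\pi$ along $A$). Let $j : \varphi \to \psi$ be a fixed shape inclusion relative to some cube $I$. Then there is an interpretation $(\mathrm{Ext@}j, \lambda\mathrm{@}j, \mathrm{app@}j)$ of the extension types for $j$ in $\mathrm{s}\mathscr{E}$ that is strictly stable under pullback. That is, for every object $\Gamma$, every family $A : \Gamma\times\psi \to \mathcal{U}$, every partial section $a$ of $A$ over $\Gamma\times\varphi$, and every morphism $\sigma : \Delta \to \Gamma$, the following equalities of morphisms hold on the nose: (1) $\sigma^*\big(\mathrm{Ext@}j(A,a)\big) = \mathrm{Ext@}j(\sigma^*A,\sigma^*a)$; (2) $\sigma^*\big(\lambda\mathrm{@}j_{A,a}(b)\big) = \lambda\mathrm{@}j_{\sigma^*A,\sigma^*a}(\sigma^*b)$ for every total section $b$ of $A$ extending $a$; (3) $\sigma^*\big(\mathrm{app@}j_{A,a}(f,s)\big) = \mathrm{app@}j_{\sigma^*A,\sigma^*a}(\sigma^*f,\sigma^*s)$ for every term $f$ of $\mathrm{Ext@}j(A,a)$ and every $s : \Gamma \to \ps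i$.
   Context: **Type-theoretic model topos** (Shulman): a Grothendieck 1-topos equipped with a right proper simplicial Cisinski model structure (combinatorial, cofibrations exactly the monomorphisms) that is simplicially locally cartesian closed, and with a locally representable, relatively acyclic notion of fibered structure whose underlying class of maps is the class of all fibrations. If $\mathscr{E}$ is one, so is $\mathrm{s}\mathscr{E}=\mathscr{E}^{\Delta^{\mathrm{op}}}$ with the injective model structure. In particular $\mathrm{s}\mathscr{E}$ is a locally cartesian closed category in which dependent product along a fibration preserves fibrations. **Universe.** "Small" means $\kappa$-small for a fixed sufficiently large inaccessible cardinal $\kappa$. $\pi:\widetilde{\mathcal{U}}\to\mathcal{U}$ is a small fibration with fibrant base such that every small fibration is a (1-categorical) pullback of $\pi$. Small fibrations are stable under pullback and composition and under dependent product along small fibrations. For $A:\Gamma\to\mathcal{U}$ write $p_A:\Gamma.A\to\Gamma$ and $q_A:\Gamma.A\to\widetilde{\mathcal{U}}$ for the chosen pullback of $\pi$ along $A$. A term (section) of $A$ is identified with a map $t:\Gamma\to\widetilde{\mathcal{U}}$ with $\pi\circ t=A$ (equivalently, a section of $p_A$). **Shapes.** Cubes are the finite powers of the directed interval $\Delta[1]$ (viewed in $\mathrm{s}\mathscr{E}$ as a levelwise discrete object). Shapes $\varphi,\psi$ relative to a cube $I$ are subobjects of $I$ definable by topes (formulas built from $\le$, $=$, $\top,\bot,\wedge,\vee$), and a shape inclusion $j:\varphi\to\psi$ is a monomorphism over $I$. Shapes are assumed to be small and fibrant. **Input data and reindexing.** For an object $\Gamma$, a family is a map $A:\Gamma\times\psi\to\mathcal{U}$.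 A partial section is a map $a:\Gamma\times\varphi\to\widetilde{\mathcal{U}}$ with $\pi\circ a=A\circ(\Gamma\times j)$. A total section extending $a$ is a map $b:\Gamma\times\psi\to\widetilde{\mathcal{U}}$ with $\pi\circ b=A$ and $b\circ(\Gamma\times j)=a$. For $\sigma:\Delta\to\Gamma$, reindexing $\sigma^*$ is precomposition: $\sigma^*A=A\circ(\sigma\times\psi)$, $\sigma^*a=a\circ(\sigma\times\varphi)$, $\sigma^*b=b\circ(\sigma\times\psi)$, and $\sigma^*x=x\circ\sigma$ for any map $x$ with domain $\Gamma$ (types $\Gamma\to\mathcal{U}$, terms $\Gamma\to\widetilde{\mathcal{U}}$, and $s:\Gamma\to\psi$). **Semantic extension type.** Given $(\Gamma,A,a)$, the semantic extension type $\langle\Pi[\psi][A]|^{\varphi}_a\rangle\to\Gamma$ is the object over $\Gamma$ such that, naturally in $\sigma:\Delta\to\Gamma$, maps $\Delta\to\langle\Pi[\psi][A]|^{\varphi}_a\rangle$ over $\Gamma$ correspond bijectively to total sections of $\sigma^*A$ extending $\sigma^*a$. Equivalently, with $\mathbf{A}:=(\Gamma\times\psi).A$, it is the pullback of the Leibniz cotensor map $\mathbf{A}^\psi\to \mathbf{A}^\varphi\times_{(\Gamma\times\psi)^\varphi}(\Gamma\times\psi)^\psi$ along the map $\Gamma\to \mathbf{A}^\varphi\times_{(\Gamma\times\psi)^\varphi}(\Gamma\times\psi)^\psi$ whose components are the transpose of $a$ (viewed as a map $\Gamma\times\varphi\to\mathbf{A}$ over $\Gamma\times\psi$) and the transpose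 of $\mathrm{id}_{\Gamma\times\psi}$. **Interpretation of the extension types for $j$.** This consists of a choice, for every $(\Gamma,A,a)$, of a map $\mathrm{Ext@}j(A,a):\Gamma\to\mathcal{U}$ together with an isomorphism over $\Gamma$ between $\Gamma.\mathrm{Ext@}j(A,a)$ and $\langle\Pi[\psi][A]|^{\varphi}_a\rangle$. Consequently terms $f:\Gamma\to\widetilde{\mathcal{U}}$ of $\mathrm{Ext@}j(A,a)$ (i.e. $\pi\circ f=\mathrm{Ext@}j(A,a)$) correspond bijectively to total sections $b$ of $A$ extending $a$. Write $\lambda\mathrm{@}j_{A,a}(b):\Gamma\to\widetilde{\mathcal{U}}$ for the term corresponding to $b$. If $f$ corresponds to $b$ and $s:\Gamma\to\psi$, put $\mathrm{app@}j_{A,a}(f,s):=b\circ\langle\mathrm{id}_\Gamma,s\rangle:\Gamma\to\widetilde{\mathcal{U}}$, a term of $A\circ\langle\mathrm{id}_\Gamma,s\rangle$. *)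

theory Defs
  imports Main "HOL-Library.FuncSet"
begin

unbundle cardinal_syntax

section \<open>Sizes\<close>

text \<open>
  Two sizes occur.  The ambient universe of small sets is given by a type \<open>'u\<close> whose cardinality
  is assumed inaccessible (in the theorem): a set is small if it has fewer elements than \<open>'u\<close>.
  It bounds the (co)limits that exist in a topos, the sites, generating sets and so on.
  The smaller inaccessible cardinal \<open>\<kappa>\<close>, a well-order on a subset of \<open>'u\<close>, bounds the
  fibrations that are classified by the universe \<open>\<pi>\<close>.
\<close>

definition usmall :: "'u itself \<Rightarrow> 'a set \<Rightarrow> bool" where
  "usmall _ A \<longleftrightarrow> |A| <o |UNIV :: 'u set|"

definition regular_cardinal :: "'k rel \<Rightarrow> bool" where
  "regular_cardinal r \<longleftrightarrow> Card_order r \<and> natLeq \<le>o r \<and> regularCard r"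

definition inaccessible :: "'k rel \<Rightarrow> bool" where
  "inaccessible r \<longleftrightarrow> regular_cardinal r \<and> natLeq <o r \<and>
     (\<forall>A \<subseteq> Field r. |A| <o r \<longrightarrow> |Pow A| <o r)"


section \<open>Categories\<close>

record ('o, 'm) cat =
  Ob :: "'o set"
  Ar :: "'m set"
  Dom :: "'m \<Rightarrow> 'o"
  Cod :: "'m \<Rightarrow> 'o"
  Idn :: "'o \<Rightarrow> 'm"
  Cmp :: "'m \<Rightarrow> 'm \<Rightarrow> 'm"  (infixr \<open>\<bullet>\<index>\<close> 70)

definition hom :: "('o, 'm, 'z) cat_scheme \<Rightarrow> 'o \<Rightarrow> 'o \<Rightarrow> 'm set" where
  "hom C X Y = {f \<in> Ar C. Dom C f = X \<and> Cod C f = Y}"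

definition category :: "('o, 'm, 'z) cat_scheme \<Rightarrow> bool" where
  "category C \<longleftrightarrow>
     (\<forall>f\<in>Ar C. Dom C f \<in> Ob C \<and> Cod C f \<in> Ob C) \<and>
     (\<forall>X\<in>Ob C. Idn C X \<in> hom C X X) \<and>
     (\<forall>X Y Z. \<forall>f\<in>hom C X Y. \<forall>g\<in>hom C Y Z. g \<bullet>\<^bsub>C\<^esub> f \<in> hom C X Z) \<and>
     (\<forall>X Y. \<forall>f\<in>hom C X Y. f \<bullet>\<^bsub>C\<^esub> Idn C X = f \<and> Idn C Y \<bullet>\<^bsub>C\<^esub> f = f) \<and>
     (\<forall>W X Y Z. \<forall>f\<in>hom C W X. \<forall>g\<in>hom C X Y. \<forall>h\<in>hom C Y Z.
        h \<bullet>\<^bsub>C\<^esub> (g \<bullet>\<^bsub>C\<^esub> f) = (h \<bullet>\<^bsub>C\<^esub> g) \<bullet>\<^bsub>C\<^esub> f)"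

definition opcat :: "('o, 'm, 'z) cat_scheme \<Rightarrow> ('o, 'm) cat" where
  "opcat C = \<lparr>Ob = Ob C, Ar = Ar C, Dom = Cod C, Cod = Dom C, Idn = Idn C,
              Cmp = (\<lambda>g f. f \<bullet>\<^bsub>C\<^esub> g)\<rparr>"

definition is_mono :: "('o, 'm, 'z) cat_scheme \<Rightarrow> 'm \<Rightarrow> bool" where
  "is_mono C i \<longleftrightarrow> i \<in> Ar C \<and>
     (\<forall>W. \<forall>u\<in>hom C W (Dom C i). \<forall>v\<in>hom C W (Dom C i). i \<bullet>\<^bsub>C\<^esub> u = i \<bullet>\<^bsub>C\<^esub> v \<longrightarrow> u = v)"

definition is_iso :: "('o, 'm, 'z) cat_scheme \<Rightarrow> 'm \<Rightarrow> bool" where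
  "is_iso C f \<longleftrightarrow> f \<in> Ar C \<and>
     (\<exists>g\<in>hom C (Cod C f) (Dom C f). g \<bullet>\<^bsub>C\<^esub> f = Idn C (Dom C f) \<and> f \<bullet>\<^bsub>C\<^esub> g = Idn C (Cod C f))"

definition is_functor :: "('a, 'b, 'y) cat_scheme \<Rightarrow> ('o, 'm, 'z) cat_scheme
    \<Rightarrow> ('a \<Rightarrow> 'o) \<times> ('b \<Rightarrow> 'm) \<Rightarrow> bool" where
  "is_functor A C F \<longleftrightarrow>
     (\<forall>a\<in>Ob A. fst F a \<in> Ob C) \<and>
     (\<forall>a b. \<forall>f\<in>hom A a b. snd F f \<in> hom C (fst F a) (fst F b)) \<and>
     (\<forall>a\<in>Ob A. snd F (Idn A a) = Idn C (fst F a)) \<and>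
     (\<forall>a b c. \<forall>f\<in>hom A a b. \<forall>g\<in>hom A b c. snd F (g \<bullet>\<^bsub>A\<^esub> f) = snd F g \<bullet>\<^bsub>C\<^esub> snd F f)"

text \<open>
  Arrows of the functor category are triples (source, target, components).  Functors and
  families of components are extensional, so that each is represented exactly once.
\<close>

definition functor_cat :: "('a, 'b, 'y) cat_scheme \<Rightarrow> ('o, 'm, 'z) cat_scheme \<Rightarrow>
    (('a \<Rightarrow> 'o) \<times> ('b \<Rightarrow> 'm),
     (('a \<Rightarrow> 'o) \<times> ('b \<Rightarrow> 'm)) \<times> (('a \<Rightarrow> 'o) \<times> ('b \<Rightarrow> 'm)) \<times> ('a \<Rightarrow> 'm)) cat" where
  "functor_cat A C =
    (let Obs = {F. is_functor A C F \<and> fst F \<in> extensional (Ob A) \<and> snd F \<in> extensional (Ar A)}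
     in \<lparr>Ob = Obs,
         Ar = {(F, G, t). F \<in> Obs \<and> G \<in> Obs \<and> t \<in> extensional (Ob A) \<and>
                 (\<forall>a\<in>Ob A. t a \<in> hom C (fst F a) (fst G a)) \<and>
                 (\<forall>a b. \<forall>f\<in>hom A a b. snd G f \<bullet>\<^bsub>C\<^esub> t a = t b \<bullet>\<^bsub>C\<^esub> snd F f)},
         Dom = (\<lambda>(F, G, t). F),
         Cod = (\<lambda>(F, G, t). G),
         Idn = (\<lambda>F. (F, F, \<lambda>a\<in>Ob A. Idn C (fst F a))),
         Cmp = (\<lambda>(G', H, t) (F, G, s). (F, H, \<lambda>a\<in>Ob A. t a \<bullet>\<^bsub>C\<^esub> s a))\<rparr>)"

definition full_subcat :: "('o, 'm, 'z) cat_scheme \<Rightarrow> 'o set \<Rightarrow> ('o, 'm) cat" where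
  "full_subcat C S = \<lparr>Ob = Ob C \<inter> S, Ar = {f \<in> Ar C. Dom C f \<in> S \<and> Cod C f \<in> S},
     Dom = Dom C, Cod = Cod C, Idn = Idn C, Cmp = Cmp C\<rparr>"

definition is_equivalence :: "('a, 'b, 'y) cat_scheme \<Rightarrow> ('o, 'm, 'z) cat_scheme
    \<Rightarrow> ('a \<Rightarrow> 'o) \<times> ('b \<Rightarrow> 'm) \<Rightarrow> bool" where
  "is_equivalence A C F \<longleftrightarrow> is_functor A C F \<and>
     (\<forall>a\<in>Ob A. \<forall>b\<in>Ob A. bij_betw (snd F) (hom A a b) (hom C (fst F a) (fst F b))) \<and>
     (\<forall>X\<in>Ob C. \<exists>a\<in>Ob A. \<exists>f\<in>hom C (fst F a) X. is_iso C f)"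

definition set_cat :: "'u itself \<Rightarrow> ('u set, 'u set \<times> 'u set \<times> ('u \<Rightarrow> 'u)) cat" where
  "set_cat u = \<lparr>Ob = {A. usmall u A},
     Ar = {(A, B, f). usmall u A \<and> usmall u B \<and> f \<in> A \<rightarrow>\<^sub>E B},
     Dom = (\<lambda>(A, B, f). A), Cod = (\<lambda>(A, B, f). B),
     Idn = (\<lambda>A. (A, A, \<lambda>x\<in>A. x)),
     Cmp = (\<lambda>(B', C, g) (A, B, f). (A, C, compose A g f))\<rparr>"


section \<open>Limits and colimits\<close>

definition is_limit :: "('a, 'b, 'y) cat_scheme \<Rightarrow> ('o, 'm, 'z) cat_scheme
    \<Rightarrow> ('a \<Rightarrow> 'o) \<times> ('b \<Rightarrow> 'm) \<Rightarrow> 'o \<Rightarrow> ('a \<Rightarrow> 'm) \<Rightarrow> bool" where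
  "is_limit A C D L c \<longleftrightarrow>
    (let cone = (\<lambda>M d. M \<in> Ob C \<and> (\<forall>a\<in>Ob A. d a \<in> hom C M (fst D a)) \<and>
                   (\<forall>a b. \<forall>f\<in>hom A a b. snd D f \<bullet>\<^bsub>C\<^esub> d a = d b))
     in cone L c \<and>
        (\<forall>M d. cone M d \<longrightarrow> (\<exists>!h. h \<in> hom C M L \<and> (\<forall>a\<in>Ob A. c a \<bullet>\<^bsub>C\<^esub> h = d a))))"

definition is_colimit :: "('a, 'b, 'y) cat_scheme \<Rightarrow> ('o, 'm, 'z) cat_scheme
    \<Rightarrow> ('a \<Rightarrow> 'o) \<times> ('b \<Rightarrow> 'm) \<Rightarrow> 'o \<Rightarrow> ('a \<Rightarrow> 'm) \<Rightarrow> bool" where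
  "is_colimit A C D L c \<longleftrightarrow>
    (let cocone = (\<lambda>M d. M \<in> Ob C \<and> (\<forall>a\<in>Ob A. d a \<in> hom C (fst D a) M) \<and>
                     (\<forall>a b. \<forall>f\<in>hom A a b. d b \<bullet>\<^bsub>C\<^esub> snd D f = d a))
     in cocone L c \<and>
        (\<forall>M d. cocone M d \<longrightarrow> (\<exists>!h. h \<in> hom C L M \<and> (\<forall>a\<in>Ob A. h \<bullet>\<^bsub>C\<^esub> c a = d a))))"

definition complete_cat :: "'u itself \<Rightarrow> ('o, 'm, 'z) cat_scheme \<Rightarrow> bool" where
  "complete_cat u C \<longleftrightarrow> (\<forall>(A :: ('u, 'u) cat) D.
     category A \<and> usmall u (Ob A) \<and> usmall u (Ar A) \<and> is_functor A C D
     \<longrightarrow> (\<exists>L c. is_limit A C D L c))"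

definition cocomplete_cat :: "'u itself \<Rightarrow> ('o, 'm, 'z) cat_scheme \<Rightarrow> bool" where
  "cocomplete_cat u C \<longleftrightarrow> (\<forall>(A :: ('u, 'u) cat) D.
     category A \<and> usmall u (Ob A) \<and> usmall u (Ar A) \<and> is_functor A C D
     \<longrightarrow> (\<exists>L c. is_colimit A C D L c))"

definition is_terminal :: "('o, 'm, 'z) cat_scheme \<Rightarrow> 'o \<Rightarrow> bool" where
  "is_terminal C T \<longleftrightarrow> T \<in> Ob C \<and> (\<forall>X\<in>Ob C. \<exists>!f. f \<in> hom C X T)"

text \<open>\<open>p\<close> and \<open>q\<close> are the projections to the domains of \<open>f\<close> and \<open>g\<close> respectively.\<close>

definition is_pullback :: "('o, 'm, 'z) cat_scheme \<Rightarrow> 'm \<Rightarrow> 'm \<Rightarrow> 'm \<Rightarrow> 'm \<Rightarrow> bool" where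
  "is_pullback C p q f g \<longleftrightarrow>
     f \<in> Ar C \<and> g \<in> Ar C \<and> Cod C f = Cod C g \<and>
     p \<in> hom C (Dom C p) (Dom C f) \<and> q \<in> hom C (Dom C p) (Dom C g) \<and> f \<bullet>\<^bsub>C\<^esub> p = g \<bullet>\<^bsub>C\<^esub> q \<and>
     (\<forall>W. \<forall>u\<in>hom C W (Dom C f). \<forall>v\<in>hom C W (Dom C g). f \<bullet>\<^bsub>C\<^esub> u = g \<bullet>\<^bsub>C\<^esub> v \<longrightarrow>
        (\<exists>!h. h \<in> hom C W (Dom C p) \<and> p \<bullet>\<^bsub>C\<^esub> h = u \<and> q \<bullet>\<^bsub>C\<^esub> h = v))"

definition is_product :: "('o, 'm, 'z) cat_scheme \<Rightarrow> 'o \<Rightarrow> 'o \<Rightarrow> 'm \<Rightarrow> 'm \<Rightarrow> bool" where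
  "is_product C X Y p q \<longleftrightarrow>
     p \<in> hom C (Dom C p) X \<and> q \<in> hom C (Dom C p) Y \<and>
     (\<forall>W. \<forall>u\<in>hom C W X. \<forall>v\<in>hom C W Y.
        \<exists>!h. h \<in> hom C W (Dom C p) \<and> p \<bullet>\<^bsub>C\<^esub> h = u \<and> q \<bullet>\<^bsub>C\<^esub> h = v)"

text \<open>A fixed choice of binary products, and the maps determined by it.\<close>

definition pr1 :: "('o, 'm, 'z) cat_scheme \<Rightarrow> 'o \<Rightarrow> 'o \<Rightarrow> 'm" where
  "pr1 C X Y = fst (SOME pq. is_product C X Y (fst pq) (snd pq))"

definition pr2 :: "('o, 'm, 'z) cat_scheme \<Rightarrow> 'o \<Rightarrow> 'o \<Rightarrow> 'm" where
  "pr2 C X Y = snd (SOME pq. is_product C X Y (fst pq) (snd pq))"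

definition prod_ob :: "('o, 'm, 'z) cat_scheme \<Rightarrow> 'o \<Rightarrow> 'o \<Rightarrow> 'o" where
  "prod_ob C X Y = Dom C (pr1 C X Y)"

definition pairing :: "('o, 'm, 'z) cat_scheme \<Rightarrow> 'm \<Rightarrow> 'm \<Rightarrow> 'm" where
  "pairing C u v =
    (THE h. h \<in> hom C (Dom C u) (prod_ob C (Cod C u) (Cod C v)) \<and>
            pr1 C (Cod C u) (Cod C v) \<bullet>\<^bsub>C\<^esub> h = u \<and> pr2 C (Cod C u) (Cod C v) \<bullet>\<^bsub>C\<^esub> h = v)"

definition prod_ar :: "('o, 'm, 'z) cat_scheme \<Rightarrow> 'm \<Rightarrow> 'm \<Rightarrow> 'm" where
  "prod_ar C f g = pairing C (f \<bullet>\<^bsub>C\<^esub> pr1 C (Dom C f) (Dom C g)) (g \<bullet>\<^bsub>C\<^esub> pr2 C (Dom C f) (Dom C g))"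

text \<open>
  \<open>copow C A\<close> is a chosen coproduct of copies of the terminal object indexed by the set \<open>A\<close>,
  consisting of the object and the family of injections.
\<close>

definition is_copow :: "('o, 'm, 'z) cat_scheme \<Rightarrow> 'a set \<Rightarrow> 'o \<Rightarrow> ('a \<Rightarrow> 'm) \<Rightarrow> bool" where
  "is_copow C A L c \<longleftrightarrow> L \<in> Ob C \<and>
     (\<exists>T. is_terminal C T \<and> (\<forall>a\<in>A. c a \<in> hom C T L) \<and>
        (\<forall>M d. M \<in> Ob C \<and> (\<forall>a\<in>A. d a \<in> hom C T M) \<longrightarrow>
           (\<exists>!h. h \<in> hom C L M \<and> (\<forall>a\<in>A. h \<bullet>\<^bsub>C\<^esub> c a = d a))))"

definition one_ob :: "('o, 'm, 'z) cat_scheme \<Rightarrow> 'o" where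
  "one_ob C = (SOME T. is_terminal C T)"

definition copow :: "('o, 'm, 'z) cat_scheme \<Rightarrow> 'a set \<Rightarrow> 'o \<times> ('a \<Rightarrow> 'm)" where
  "copow C A = (SOME Lc. is_copow C A (fst Lc) (snd Lc) \<and>
                         (\<forall>a\<in>A. Dom C (snd Lc a) = one_ob C))"

definition copow_map :: "('o, 'm, 'z) cat_scheme \<Rightarrow> 'a set \<Rightarrow> 'b set \<Rightarrow> ('a \<Rightarrow> 'b) \<Rightarrow> 'm" where
  "copow_map C A B f =
    (THE h. h \<in> hom C (fst (copow C A)) (fst (copow C B)) \<and>
            (\<forall>a\<in>A. h \<bullet>\<^bsub>C\<^esub> snd (copow C A) a = snd (copow C B) (f a)))"


section \<open>Presentability\<close>

definition poset_cat :: "'i set \<Rightarrow> ('i \<Rightarrow> 'i \<Rightarrow> bool) \<Rightarrow> ('i, 'i \<times> 'i) cat" where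
  "poset_cat I le = \<lparr>Ob = I, Ar = {(i, k). i \<in> I \<and> k \<in> I \<and> le i k}, Dom = fst, Cod = snd,
     Idn = (\<lambda>i. (i, i)), Cmp = (\<lambda>(b', c) (a, b). (a, c))\<rparr>"

definition directed_poset :: "'k rel \<Rightarrow> 'i set \<Rightarrow> ('i \<Rightarrow> 'i \<Rightarrow> bool) \<Rightarrow> bool" where
  "directed_poset \<mu> I le \<longleftrightarrow>
     (\<forall>i\<in>I. le i i) \<and> (\<forall>i\<in>I. \<forall>k\<in>I. le i k \<and> le k i \<longrightarrow> i = k) \<and>
     (\<forall>i\<in>I. \<forall>k\<in>I. \<forall>l\<in>I. le i k \<and> le k l \<longrightarrow> le i l) \<and>
     (\<forall>S \<subseteq> I. |S| <o \<mu> \<longrightarrow> (\<exists>k\<in>I. \<forall>i\<in>S. le i k))"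

text \<open>
  The last two conjuncts say that the canonical map from the colimit of the sets
  \<open>hom C X (D i)\<close> to \<open>hom C X L\<close> is surjective and injective.
\<close>

definition presentable :: "'u itself \<Rightarrow> 'k rel \<Rightarrow> ('o, 'm, 'z) cat_scheme \<Rightarrow> 'o \<Rightarrow> bool" where
  "presentable u \<mu> C X \<longleftrightarrow> X \<in> Ob C \<and>
     (\<forall>(I :: 'u set) le D L c.
        usmall u I \<and> directed_poset \<mu> I le \<and> is_functor (poset_cat I le) C D \<and>
        is_colimit (poset_cat I le) C D L c \<longrightarrow>
        (\<forall>f\<in>hom C X L. \<exists>i\<in>I. \<exists>g\<in>hom C X (fst D i). c i \<bullet>\<^bsub>C\<^esub> g = f) \<and>
        (\<forall>i\<in>I. \<forall>k\<in>I. \<forall>g\<in>hom C X (fst D i). \<forall>h\<in>hom C X (fst D k).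
           c i \<bullet>\<^bsub>C\<^esub> g = c k \<bullet>\<^bsub>C\<^esub> h \<longrightarrow>
           (\<exists>l\<in>I. le i l \<and> le k l \<and> snd D (i, l) \<bullet>\<^bsub>C\<^esub> g = snd D (k, l) \<bullet>\<^bsub>C\<^esub> h)))"

definition locally_presentable :: "'u itself \<Rightarrow> 'u rel \<Rightarrow> ('o, 'm, 'z) cat_scheme \<Rightarrow> bool" where
  "locally_presentable u \<mu> C \<longleftrightarrow>
     regular_cardinal \<mu> \<and> \<mu> <o |UNIV :: 'u set| \<and>
     category C \<and> (\<forall>X\<in>Ob C. \<forall>Y\<in>Ob C. usmall u (hom C X Y)) \<and> cocomplete_cat u C \<and>
     (\<exists>G. usmall u G \<and> (\<forall>X\<in>G. presentable u \<mu> C X) \<and>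
        (\<forall>X\<in>Ob C. \<exists>(I :: 'u set) le D c.
           usmall u I \<and> directed_poset \<mu> I le \<and> is_functor (poset_cat I le) C D \<and>
           fst D ` I \<subseteq> G \<and> is_colimit (poset_cat I le) C D X c))"

definition relatively_presentable ::
    "'u itself \<Rightarrow> 'k rel \<Rightarrow> ('o, 'm, 'z) cat_scheme \<Rightarrow> 'm \<Rightarrow> bool" where
  "relatively_presentable u \<kappa> C f \<longleftrightarrow> f \<in> Ar C \<and>
     (\<forall>z p q. presentable u \<kappa> C (Dom C z) \<and> is_pullback C p q z f
        \<longrightarrow> presentable u \<kappa> C (Dom C p))"


section \<open>Grothendieck toposes\<close>

definition is_sieve :: "('a, 'b, 'y) cat_scheme \<Rightarrow> 'a \<Rightarrow> 'b set \<Rightarrow> bool" where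
  "is_sieve A a R \<longleftrightarrow> R \<subseteq> {f \<in> Ar A. Cod A f = a} \<and>
     (\<forall>f\<in>R. \<forall>g\<in>Ar A. Cod A g = Dom A f \<longrightarrow> f \<bullet>\<^bsub>A\<^esub> g \<in> R)"

definition sieve_pullback :: "('a, 'b, 'y) cat_scheme \<Rightarrow> 'b \<Rightarrow> 'b set \<Rightarrow> 'b set" where
  "sieve_pullback A h R = {g \<in> Ar A. Cod A g = Dom A h \<and> h \<bullet>\<^bsub>A\<^esub> g \<in> R}"

definition grothendieck_topology :: "('a, 'b, 'y) cat_scheme \<Rightarrow> ('a \<Rightarrow> 'b set set) \<Rightarrow> bool" where
  "grothendieck_topology A J \<longleftrightarrow>
     (\<forall>a\<in>Ob A. \<forall>R\<in>J a. is_sieve A a R) \<and>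
     (\<forall>a\<in>Ob A. {f \<in> Ar A. Cod A f = a} \<in> J a) \<and>
     (\<forall>h\<in>Ar A. \<forall>R\<in>J (Cod A h). sieve_pullback A h R \<in> J (Dom A h)) \<and>
     (\<forall>a\<in>Ob A. \<forall>R\<in>J a. \<forall>S. is_sieve A a S \<and> (\<forall>h\<in>R. sieve_pullback A h S \<in> J (Dom A h))
        \<longrightarrow> S \<in> J a)"

definition presheaf_cat where
  "presheaf_cat u A = functor_cat (opcat A) (set_cat u)"

definition is_sheaf :: "('a, 'b, 'y) cat_scheme \<Rightarrow> ('a \<Rightarrow> 'b set set)
    \<Rightarrow> ('a \<Rightarrow> 'u set) \<times> ('b \<Rightarrow> 'u set \<times> 'u set \<times> ('u \<Rightarrow> 'u)) \<Rightarrow> bool" where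
  "is_sheaf A J P \<longleftrightarrow>
    (let res = (\<lambda>f. snd (snd (snd P f)))
     in \<forall>a\<in>Ob A. \<forall>R\<in>J a. \<forall>x.
          (\<forall>f\<in>R. x f \<in> fst P (Dom A f)) \<and>
          (\<forall>f\<in>R. \<forall>g\<in>Ar A. Cod A g = Dom A f \<longrightarrow> res g (x f) = x (f \<bullet>\<^bsub>A\<^esub> g))
          \<longrightarrow> (\<exists>!y. y \<in> fst P a \<and> (\<forall>f\<in>R. res f y = x f)))"

definition grothendieck_topos :: "'u itself \<Rightarrow> ('o, 'm, 'z) cat_scheme \<Rightarrow> bool" where
  "grothendieck_topos u C \<longleftrightarrow> category C \<and>
     (\<exists>(A :: ('u, 'u) cat) J F.
        category A \<and> usmall u (Ob A) \<and> usmall u (Ar A) \<and> grothendieck_topology A J \<and>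
        is_equivalence C (full_subcat (presheaf_cat u A) {P. is_sheaf A J P}) F)"


section \<open>The simplex category and simplicial sets\<close>

type_synonym dmap = "nat \<times> nat \<times> (nat \<Rightarrow> nat)"

text \<open>The number \<open>n\<close> stands for the ordinal \<open>{0, \<dots>, n}\<close>.\<close>

definition Delta :: "(nat, dmap) cat" where
  "Delta = \<lparr>Ob = UNIV, Ar = {(m, n, f). f \<in> {..m} \<rightarrow>\<^sub>E {..n} \<and> mono_on {..m} f},
     Dom = (\<lambda>(m, n, f). m), Cod = (\<lambda>(m, n, f). n),
     Idn = (\<lambda>n. (n, n, \<lambda>i\<in>{..n}. i)),
     Cmp = (\<lambda>(n', l, g) (m, n, f). (m, l, compose {..m} g f))\<rparr>"

definition to_zero :: "nat \<Rightarrow> dmap" where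
  "to_zero n = (n, 0, \<lambda>i\<in>{..n}. 0)"

type_synonym 'a sset = "(nat \<Rightarrow> 'a set) \<times> (dmap \<Rightarrow> 'a \<Rightarrow> 'a)"

definition is_sset :: "'a sset \<Rightarrow> bool" where
  "is_sset K \<longleftrightarrow>
     (\<forall>m n. \<forall>\<alpha>\<in>hom Delta m n. snd K \<alpha> \<in> fst K n \<rightarrow> fst K m) \<and>
     (\<forall>n. \<forall>x\<in>fst K n. snd K (Idn Delta n) x = x) \<and>
     (\<forall>l m n. \<forall>\<alpha>\<in>hom Delta l m. \<forall>\<beta>\<in>hom Delta m n. \<forall>x\<in>fst K n.
        snd K (\<beta> \<bullet>\<^bsub>Delta\<^esub> \<alpha>) x = snd K \<alpha> (snd K \<beta> x))"

definition smaps :: "'a sset \<Rightarrow> 'b sset \<Rightarrow> (nat \<Rightarrow> 'a \<Rightarrow> 'b) set" where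
  "smaps K L = {f. (\<forall>n. f n \<in> fst K n \<rightarrow>\<^sub>E fst L n) \<and>
     (\<forall>m n. \<forall>\<alpha>\<in>hom Delta m n. \<forall>x\<in>fst K n. f m (snd K \<alpha> x) = snd L \<alpha> (f n x))}"

definition std_simplex :: "nat \<Rightarrow> dmap sset" where
  "std_simplex n = ((\<lambda>m. hom Delta m n), (\<lambda>\<alpha> x. x \<bullet>\<^bsub>Delta\<^esub> \<alpha>))"

definition boundary :: "nat \<Rightarrow> dmap sset" where
  "boundary n = ((\<lambda>m. {x \<in> hom Delta m n. snd (snd x) ` {..m} \<noteq> {..n}}), snd (std_simplex n))"

definition horn :: "nat \<Rightarrow> nat \<Rightarrow> dmap sset" where
  "horn n k = ((\<lambda>m. {x \<in> hom Delta m n. \<not> {..n} - {k} \<subseteq> snd (snd x) ` {..m}}), snd (std_simplex n))"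

definition sprod :: "'a sset \<Rightarrow> 'b sset \<Rightarrow> ('a \<times> 'b) sset" where
  "sprod K L = ((\<lambda>n. fst K n \<times> fst L n), (\<lambda>\<alpha>. map_prod (snd K \<alpha>) (snd L \<alpha>)))"

text \<open>\<open>p : K \<rightarrow> L\<close> has the right lifting property against the inclusion of \<open>A\<close> in \<open>B\<close>.\<close>

definition slifts :: "'c sset \<Rightarrow> 'c sset \<Rightarrow> 'a sset \<Rightarrow> 'b sset \<Rightarrow> (nat \<Rightarrow> 'a \<Rightarrow> 'b) \<Rightarrow> bool" where
  "slifts A B K L p \<longleftrightarrow>
     (\<forall>u\<in>smaps A K. \<forall>v\<in>smaps B L. (\<forall>n. \<forall>x\<in>fst A n. p n (u n x) = v n x) \<longrightarrow>
        (\<exists>w\<in>smaps B K. (\<forall>n. \<forall>x\<in>fst A n. w n x = u n x) \<and> (\<forall>n. \<forall>x\<in>fst B n. p n (w n x) = v n x)))"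

definition kan_fibration :: "'a sset \<Rightarrow> 'b sset \<Rightarrow> (nat \<Rightarrow> 'a \<Rightarrow> 'b) \<Rightarrow> bool" where
  "kan_fibration K L p \<longleftrightarrow> (\<forall>n\<ge>1. \<forall>k\<le>n. slifts (horn n k) (std_simplex n) K L p)"

definition trivial_kan_fibration :: "'a sset \<Rightarrow> 'b sset \<Rightarrow> (nat \<Rightarrow> 'a \<Rightarrow> 'b) \<Rightarrow> bool" where
  "trivial_kan_fibration K L p \<longleftrightarrow> (\<forall>n. slifts (boundary n) (std_simplex n) K L p)"


section \<open>Model structures\<close>

definition has_lift :: "('o, 'm, 'z) cat_scheme \<Rightarrow> 'm \<Rightarrow> 'm \<Rightarrow> bool" where
  "has_lift C i p \<longleftrightarrow>
     (\<forall>u\<in>hom C (Dom C i) (Dom C p). \<forall>v\<in>hom C (Cod C i) (Cod C p). p \<bullet>\<^bsub>C\<^esub> u = v \<bullet>\<^bsub>C\<^esub> i \<longrightarrow>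
        (\<exists>h\<in>hom C (Cod C i) (Dom C p). h \<bullet>\<^bsub>C\<^esub> i = u \<and> p \<bullet>\<^bsub>C\<^esub> h = v))"

definition rlp :: "('o, 'm, 'z) cat_scheme \<Rightarrow> 'm set \<Rightarrow> 'm set" where
  "rlp C S = {p \<in> Ar C. \<forall>i\<in>S. has_lift C i p}"

definition llp :: "('o, 'm, 'z) cat_scheme \<Rightarrow> 'm set \<Rightarrow> 'm set" where
  "llp C S = {i \<in> Ar C. \<forall>p\<in>S. has_lift C i p}"

definition weak_factorization_system :: "('o, 'm, 'z) cat_scheme \<Rightarrow> 'm set \<Rightarrow> 'm set \<Rightarrow> bool" where
  "weak_factorization_system C L R \<longleftrightarrow> L = llp C R \<and> R = rlp C L \<and>
     (\<forall>f\<in>Ar C. \<exists>i\<in>L. \<exists>p\<in>R. Dom C p = Cod C i \<and> f = p \<bullet>\<^bsub>C\<^esub> i)"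

text \<open>
  Data for a simplicially enriched category with classes of weak equivalences, cofibrations and
  fibrations: the mapping simplicial sets, the composition \<open>ecmp X Y Z n g f\<close> of \<open>n\<close>-simplices
  \<open>g\<close> of \<open>MapS Y Z\<close> and \<open>f\<close> of \<open>MapS X Y\<close>, and the identification \<open>emb\<close> of arrows with vertices.
\<close>

record ('o, 'm, 's) smcat = "('o, 'm) cat" +
  weq :: "'m set"
  cof :: "'m set"
  fib :: "'m set"
  MapS :: "'o \<Rightarrow> 'o \<Rightarrow> 's sset"
  ecmp :: "'o \<Rightarrow> 'o \<Rightarrow> 'o \<Rightarrow> nat \<Rightarrow> 's \<Rightarrow> 's \<Rightarrow> 's"
  emb :: "'m \<Rightarrow> 's"

definition model_category :: "'u itself \<Rightarrow> ('o, 'm, 's, 'z) smcat_scheme \<Rightarrow> bool" where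
  "model_category u E \<longleftrightarrow>
     category E \<and> complete_cat u E \<and> cocomplete_cat u E \<and>
     weq E \<subseteq> Ar E \<and>
     (\<forall>X Y Z. \<forall>f\<in>hom E X Y. \<forall>g\<in>hom E Y Z.
        (f \<in> weq E \<and> g \<in> weq E \<longrightarrow> g \<bullet>\<^bsub>E\<^esub> f \<in> weq E) \<and>
        (f \<in> weq E \<and> g \<bullet>\<^bsub>E\<^esub> f \<in> weq E \<longrightarrow> g \<in> weq E) \<and>
        (g \<in> weq E \<and> g \<bullet>\<^bsub>E\<^esub> f \<in> weq E \<longrightarrow> f \<in> weq E)) \<and>
     weak_factorization_system E (cof E \<inter> weq E) (fib E) \<and>
     weak_factorization_system E (cof E) (fib E \<inter> weq E)"

definition combinatorial :: "'u itself \<Rightarrow> ('o, 'm, 's, 'z) smcat_scheme \<Rightarrow> bool" where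
  "combinatorial u E \<longleftrightarrow> (\<exists>\<mu>. locally_presentable u \<mu> E) \<and>
     (\<exists>I \<subseteq> Ar E. \<exists>J \<subseteq> Ar E. usmall u I \<and> usmall u J \<and>
        fib E \<inter> weq E = rlp E I \<and> fib E = rlp E J)"

definition right_proper :: "('o, 'm, 's, 'z) smcat_scheme \<Rightarrow> bool" where
  "right_proper E \<longleftrightarrow> (\<forall>p q w f. is_pullback E p q w f \<and> w \<in> weq E \<and> f \<in> fib E \<longrightarrow> q \<in> weq E)"

definition cisinski_model_category :: "'u itself \<Rightarrow> ('o, 'm, 's, 'z) smcat_scheme \<Rightarrow> bool" where
  "cisinski_model_category u E \<longleftrightarrow> grothendieck_topos u E \<and> model_category u E \<and>
     combinatorial u E \<and> cof E = {i. is_mono E i}"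


section \<open>Simplicial model categories\<close>

text \<open>\<open>dgn E f n\<close> is the degenerate \<open>n\<close>-simplex on the vertex given by the arrow \<open>f\<close>.\<close>

definition dgn :: "('o, 'm, 's, 'z) smcat_scheme \<Rightarrow> 'm \<Rightarrow> nat \<Rightarrow> 's" where
  "dgn E f n = snd (MapS E (Dom E f) (Cod E f)) (to_zero n) (emb E f)"

definition post :: "('o, 'm, 's, 'z) smcat_scheme \<Rightarrow> 'o \<Rightarrow> 'm \<Rightarrow> nat \<Rightarrow> 's \<Rightarrow> 's" where
  "post E W f n x = ecmp E W (Dom E f) (Cod E f) n (dgn E f n) x"

definition pre :: "('o, 'm, 's, 'z) smcat_scheme \<Rightarrow> 'm \<Rightarrow> 'o \<Rightarrow> nat \<Rightarrow> 's \<Rightarrow> 's" where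
  "pre E f Z n x = ecmp E (Dom E f) (Cod E f) Z n x (dgn E f n)"

definition simplicially_enriched :: "('o, 'm, 's, 'z) smcat_scheme \<Rightarrow> bool" where
  "simplicially_enriched E \<longleftrightarrow> category E \<and>
     (\<forall>X\<in>Ob E. \<forall>Y\<in>Ob E. is_sset (MapS E X Y)) \<and>
     (\<forall>X\<in>Ob E. \<forall>Y\<in>Ob E. \<forall>Z\<in>Ob E. \<forall>n. \<forall>f\<in>fst (MapS E X Y) n. \<forall>g\<in>fst (MapS E Y Z) n.
        ecmp E X Y Z n g f \<in> fst (MapS E X Z) n \<and>
        (\<forall>m. \<forall>\<alpha>\<in>hom Delta m n. snd (MapS E X Z) \<alpha> (ecmp E X Y Z n g f) =
           ecmp E X Y Z m (snd (MapS E Y Z) \<alpha> g) (snd (MapS E X Y) \<alpha> f))) \<and>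
     (\<forall>W\<in>Ob E. \<forall>X\<in>Ob E. \<forall>Y\<in>Ob E. \<forall>Z\<in>Ob E. \<forall>n.
        \<forall>f\<in>fst (MapS E W X) n. \<forall>g\<in>fst (MapS E X Y) n. \<forall>h\<in>fst (MapS E Y Z) n.
          ecmp E W Y Z n h (ecmp E W X Y n g f) = ecmp E W X Z n (ecmp E X Y Z n h g) f) \<and>
     (\<forall>X\<in>Ob E. \<forall>Y\<in>Ob E. \<forall>n. \<forall>f\<in>fst (MapS E X Y) n.
        ecmp E X X Y n f (dgn E (Idn E X) n) = f \<and> ecmp E X Y Y n (dgn E (Idn E Y) n) f = f) \<and>
     (\<forall>X\<in>Ob E. \<forall>Y\<in>Ob E. bij_betw (emb E) (hom E X Y) (fst (MapS E X Y) 0)) \<and>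
     (\<forall>X Y Z. \<forall>f\<in>hom E X Y. \<forall>g\<in>hom E Y Z. emb E (g \<bullet>\<^bsub>E\<^esub> f) = ecmp E X Y Z 0 (emb E g) (emb E f))"

text \<open>
  Tensors and cotensors with a simplicial set \<open>K\<close>, given by their unit \<open>\<eta>\<close>.  The bijections say
  that the induced maps of simplicial sets from \<open>MapS T Y\<close> (resp. \<open>MapS Y T\<close>) to the internal hom
  of \<open>K\<close> into \<open>MapS X Y\<close> (resp. \<open>MapS Y X\<close>) are isomorphisms; the \<open>n\<close>-simplices of the internal
  hom are the maps out of the product of the standard \<open>n\<close>-simplex and \<open>K\<close>.
\<close>

definition is_tensor ::
    "('o, 'm, 's, 'z) smcat_scheme \<Rightarrow> 'a sset \<Rightarrow> 'o \<Rightarrow> 'o \<Rightarrow> (nat \<Rightarrow> 'a \<Rightarrow> 's) \<Rightarrow> bool" where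
  "is_tensor E K X T \<eta> \<longleftrightarrow> T \<in> Ob E \<and> \<eta> \<in> smaps K (MapS E X T) \<and>
     (\<forall>Y\<in>Ob E. \<forall>n. bij_betw
        (\<lambda>u k. \<lambda>(\<alpha>, x) \<in> hom Delta k n \<times> fst K k. ecmp E X T Y k (snd (MapS E T Y) \<alpha> u) (\<eta> k x))
        (fst (MapS E T Y) n) (smaps (sprod (std_simplex n) K) (MapS E X Y)))"

definition is_cotensor ::
    "('o, 'm, 's, 'z) smcat_scheme \<Rightarrow> 'a sset \<Rightarrow> 'o \<Rightarrow> 'o \<Rightarrow> (nat \<Rightarrow> 'a \<Rightarrow> 's) \<Rightarrow> bool" where
  "is_cotensor E K X T \<eta> \<longleftrightarrow> T \<in> Ob E \<and> \<eta> \<in> smaps K (MapS E T X) \<and>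
     (\<forall>Y\<in>Ob E. \<forall>n. bij_betw
        (\<lambda>u k. \<lambda>(\<alpha>, x) \<in> hom Delta k n \<times> fst K k. ecmp E Y T X k (\<eta> k x) (snd (MapS E Y T) \<alpha> u))
        (fst (MapS E Y T) n) (smaps (sprod (std_simplex n) K) (MapS E Y X)))"

text \<open>The comparison map from \<open>MapS B X\<close> to the fibre product of \<open>MapS A X\<close> and \<open>MapS B Y\<close> over
  \<open>MapS A Y\<close>, for \<open>i : A \<rightarrow> B\<close> and \<open>p : X \<rightarrow> Y\<close>.\<close>

definition pullback_hom :: "('o, 'm, 's, 'z) smcat_scheme \<Rightarrow> 'm \<Rightarrow> 'm \<Rightarrow> ('s \<times> 's) sset" where
  "pullback_hom E i p =
     ((\<lambda>n. {(a, b). a \<in> fst (MapS E (Dom E i) (Dom E p)) n \<and> b \<in> fst (MapS E (Cod E i) (Cod E p)) n \<and>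
              post E (Dom E i) p n a = pre E i (Cod E p) n b}),
      (\<lambda>\<alpha>. map_prod (snd (MapS E (Dom E i) (Dom E p)) \<alpha>) (snd (MapS E (Cod E i) (Cod E p)) \<alpha>)))"

definition pullback_hom_map :: "('o, 'm, 's, 'z) smcat_scheme \<Rightarrow> 'm \<Rightarrow> 'm \<Rightarrow> nat \<Rightarrow> 's \<Rightarrow> 's \<times> 's" where
  "pullback_hom_map E i p n x = (pre E i (Dom E p) n x, post E (Cod E i) p n x)"

definition simplicial_model_category :: "'u itself \<Rightarrow> ('o, 'm, 's, 'z) smcat_scheme \<Rightarrow> bool" where
  "simplicial_model_category u E \<longleftrightarrow>
     model_category u E \<and> simplicially_enriched E \<and>
     (\<forall>(K :: 'u sset) X. is_sset K \<and> (\<forall>n. usmall u (fst K n)) \<and> X \<in> Ob E \<longrightarrow>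
        (\<exists>T \<eta>. is_tensor E K X T \<eta>) \<and> (\<exists>T \<eta>. is_cotensor E K X T \<eta>)) \<and>
     (\<forall>i\<in>cof E. \<forall>p\<in>fib E.
        kan_fibration (MapS E (Cod E i) (Dom E p)) (pullback_hom E i p) (pullback_hom_map E i p) \<and>
        (i \<in> weq E \<or> p \<in> weq E \<longrightarrow>
           trivial_kan_fibration (MapS E (Cod E i) (Dom E p)) (pullback_hom E i p) (pullback_hom_map E i p)))"

text \<open>The simplices of the mapping object from \<open>b\<close> to \<open>p\<close> in the slice over the common codomain.\<close>

definition slice_map :: "('o, 'm, 's, 'z) smcat_scheme \<Rightarrow> 'm \<Rightarrow> 'm \<Rightarrow> nat \<Rightarrow> 's set" where
  "slice_map E b p n = {x \<in> fst (MapS E (Dom E b) (Dom E p)) n. post E (Dom E b) p n x = dgn E b n}"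

text \<open>
  The pullback of the slice simplex \<open>x\<close> along the base, where \<open>r1\<close> is the projection from the
  pullback of the source, and \<open>q1\<close>, \<open>q2\<close> and \<open>r2\<close> are the projections from the pullback of the
  target, respectively from those pullbacks to the new base.
\<close>

definition slice_pull ::
    "('o, 'm, 's, 'z) smcat_scheme \<Rightarrow> 'm \<Rightarrow> 'm \<Rightarrow> 'm \<Rightarrow> 'm \<Rightarrow> nat \<Rightarrow> 's \<Rightarrow> 's" where
  "slice_pull E q1 q2 r1 r2 n x =
     (THE w. w \<in> slice_map E r2 q2 n \<and>
             post E (Dom E r2) q1 n w = pre E r1 (Cod E q1) n x)"

text \<open>
  Each pullback functor \<open>f\<^sup>*\<close> between slices has a simplicially enriched right adjoint: for every
  \<open>g\<close> over the domain of \<open>f\<close> there are \<open>p\<close> over its codomain and a counit \<open>\<epsilon> : f\<^sup>* p \<rightarrow> g\<close> that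
  induces isomorphisms of mapping simplicial sets.
\<close>

definition simplicially_lccc :: "('o, 'm, 's, 'z) smcat_scheme \<Rightarrow> bool" where
  "simplicially_lccc E \<longleftrightarrow>
     (\<forall>f\<in>Ar E. \<forall>g\<in>Ar E. Cod E g = Dom E f \<longrightarrow>
       (\<exists>p q1 q2 \<epsilon>. p \<in> Ar E \<and> is_pullback E q1 q2 p f \<and>
          \<epsilon> \<in> hom E (Dom E q2) (Dom E g) \<and> g \<bullet>\<^bsub>E\<^esub> \<epsilon> = q2 \<and>
          (\<forall>b r1 r2 n. is_pullback E r1 r2 b f \<longrightarrow>
             bij_betw (\<lambda>x. post E (Dom E r2) \<epsilon> n (slice_pull E q1 q2 r1 r2 n x))
               (slice_map E b p n) (slice_map E r2 g n))))"


section \<open>Notions of fibered structure\<close>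

text \<open>
  \<open>St f\<close> is the set of structures on \<open>f\<close>.  For a pullback square from \<open>f'\<close> to \<open>f\<close> with top map
  \<open>h\<close> and bottom map \<open>k\<close>, \<open>pb f' f h k\<close> restricts structures on \<open>f\<close> to structures on \<open>f'\<close>.
\<close>

definition fibered_structure :: "'u itself \<Rightarrow> ('o, 'm, 'z) cat_scheme
    \<Rightarrow> ('m \<Rightarrow> 'u set) \<Rightarrow> ('m \<Rightarrow> 'm \<Rightarrow> 'm \<Rightarrow> 'm \<Rightarrow> 'u \<Rightarrow> 'u) \<Rightarrow> bool" where
  "fibered_structure u C St pb \<longleftrightarrow>
     (\<forall>f\<in>Ar C. usmall u (St f)) \<and>
     (\<forall>f' f h k. is_pullback C f' h k f \<longrightarrow> pb f' f h k \<in> St f \<rightarrow> St f') \<and>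
     (\<forall>f\<in>Ar C. \<forall>s\<in>St f. pb f f (Idn C (Dom C f)) (Idn C (Cod C f)) s = s) \<and>
     (\<forall>f'' f' f h' k' h k. is_pullback C f'' h' k' f' \<and> is_pullback C f' h k f \<longrightarrow>
        (\<forall>s\<in>St f. pb f'' f (h \<bullet>\<^bsub>C\<^esub> h') (k \<bullet>\<^bsub>C\<^esub> k') s = pb f'' f' h' k' (pb f' f h k s)))"

text \<open>For each \<open>f\<close>, the structures on its pullbacks are represented by an object \<open>r\<close> over the
  codomain of \<open>f\<close>, with universal structure \<open>s\<close> on the pullback \<open>f'\<close> of \<open>f\<close> along \<open>r\<close>.\<close>

definition locally_representable :: "('o, 'm, 'z) cat_scheme
    \<Rightarrow> ('m \<Rightarrow> 'u set) \<Rightarrow> ('m \<Rightarrow> 'm \<Rightarrow> 'm \<Rightarrow> 'm \<Rightarrow> 'u \<Rightarrow> 'u) \<Rightarrow> bool" where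
  "locally_representable C St pb \<longleftrightarrow>
     (\<forall>f\<in>Ar C. \<exists>r f' h s. is_pullback C f' h r f \<and> s \<in> St f' \<and>
        (\<forall>k g l. is_pullback C g l k f \<longrightarrow>
           (\<forall>t\<in>St g. \<exists>!w. w \<in> hom C (Dom C k) (Dom C r) \<and> r \<bullet>\<^bsub>C\<^esub> w = k \<and>
              pb g f' (THE v. v \<in> hom C (Dom C g) (Dom C f') \<and> h \<bullet>\<^bsub>C\<^esub> v = l \<and> f' \<bullet>\<^bsub>C\<^esub> v = w \<bullet>\<^bsub>C\<^esub> g) w s = t)))"

definition relatively_acyclic :: "('o, 'm, 'z) cat_scheme \<Rightarrow> 'm set
    \<Rightarrow> ('m \<Rightarrow> 'u set) \<Rightarrow> ('m \<Rightarrow> 'm \<Rightarrow> 'm \<Rightarrow> 'm \<Rightarrow> 'u \<Rightarrow> 'u) \<Rightarrow> bool" where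
  "relatively_acyclic C cofs St pb \<longleftrightarrow>
     (\<forall>f' f h k. is_pullback C f' h k f \<and> k \<in> cofs \<and> St f \<noteq> {} \<longrightarrow>
        (\<forall>s'\<in>St f'. \<exists>s\<in>St f. pb f' f h k s = s'))"


section \<open>Type-theoretic model toposes\<close>

definition type_theoretic_model_topos :: "'u itself \<Rightarrow> ('o, 'm, 's, 'z) smcat_scheme \<Rightarrow> bool" where
  "type_theoretic_model_topos u E \<longleftrightarrow>
     grothendieck_topos u E \<and>
     simplicial_model_category u E \<and> cisinski_model_category u E \<and> right_proper E \<and>
     simplicially_lccc E \<and>
     (\<exists>(St :: 'm \<Rightarrow> 'u set) pb. fibered_structure u E St pb \<and> locally_representable E St pb \<and>
        relatively_acyclic E (cof E) St pb \<and> {f \<in> Ar E. St f \<noteq> {}} = fib E)"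

type_synonym ('o, 'm) sob = "(nat \<Rightarrow> 'o) \<times> (dmap \<Rightarrow> 'm)"
type_synonym ('o, 'm) sar = "('o, 'm) sob \<times> ('o, 'm) sob \<times> (nat \<Rightarrow> 'm)"

definition simp_cat :: "('o, 'm, 'z) cat_scheme \<Rightarrow> (('o, 'm) sob, ('o, 'm) sar) cat" where
  "simp_cat C = functor_cat (opcat Delta) C"

text \<open>The injective model structure: weak equivalences and cofibrations are levelwise.\<close>

definition inj_weq :: "('o, 'm, 's, 'z) smcat_scheme \<Rightarrow> ('o, 'm) sar set" where
  "inj_weq E = {f \<in> Ar (simp_cat E). \<forall>n. snd (snd f) n \<in> weq E}"

definition inj_cof :: "('o, 'm, 's, 'z) smcat_scheme \<Rightarrow> ('o, 'm) sar set" where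
  "inj_cof E = {f \<in> Ar (simp_cat E). \<forall>n. snd (snd f) n \<in> cof E}"

definition inj_fib :: "('o, 'm, 's, 'z) smcat_scheme \<Rightarrow> ('o, 'm) sar set" where
  "inj_fib E = rlp (simp_cat E) (inj_cof E \<inter> inj_weq E)"

definition fibrant :: "('o, 'm, 's, 'z) smcat_scheme \<Rightarrow> ('o, 'm) sob \<Rightarrow> bool" where
  "fibrant E X \<longleftrightarrow> X \<in> Ob (simp_cat E) \<and>
     (\<forall>T. is_terminal (simp_cat E) T \<longrightarrow> hom (simp_cat E) X T \<subseteq> inj_fib E)"


section \<open>Small fibrations and the universe\<close>

definition small_fib :: "'u rel \<Rightarrow> ('o, 'm, 's, 'z) smcat_scheme \<Rightarrow> ('o, 'm) sar set" where
  "small_fib \<kappa> E = {f \<in> inj_fib E. relatively_presentable TYPE('u) \<kappa> (simp_cat E) f}"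

definition small_object :: "'u rel \<Rightarrow> ('o, 'm, 's, 'z) smcat_scheme \<Rightarrow> ('o, 'm) sob \<Rightarrow> bool" where
  "small_object \<kappa> E X \<longleftrightarrow> X \<in> Ob (simp_cat E) \<and>
     (\<forall>T. is_terminal (simp_cat E) T \<longrightarrow>
        (\<forall>f\<in>hom (simp_cat E) X T. relatively_presentable TYPE('u) \<kappa> (simp_cat E) f))"

text \<open>\<open>p\<close> is the dependent product of \<open>g\<close> along \<open>f\<close>, with counit \<open>\<epsilon>\<close> defined on the pullback
  of \<open>p\<close> along \<open>f\<close>, whose projections are \<open>q1\<close> and \<open>q2\<close>.\<close>

definition is_dep_prod ::
    "('o, 'm, 'z) cat_scheme \<Rightarrow> 'm \<Rightarrow> 'm \<Rightarrow> 'm \<Rightarrow> 'm \<Rightarrow> 'm \<Rightarrow> 'm \<Rightarrow> bool" where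
  "is_dep_prod C f g p q1 q2 \<epsilon> \<longleftrightarrow>
     f \<in> Ar C \<and> g \<in> Ar C \<and> Cod C g = Dom C f \<and> is_pullback C q1 q2 p f \<and>
     \<epsilon> \<in> hom C (Dom C q2) (Dom C g) \<and> g \<bullet>\<^bsub>C\<^esub> \<epsilon> = q2 \<and>
     (\<forall>b r1 r2. is_pullback C r1 r2 b f \<longrightarrow>
        (\<forall>v. v \<in> hom C (Dom C r2) (Dom C g) \<and> g \<bullet>\<^bsub>C\<^esub> v = r2 \<longrightarrow>
          (\<exists>!x. x \<in> hom C (Dom C b) (Dom C p) \<and> p \<bullet>\<^bsub>C\<^esub> x = b \<and>
             (\<exists>w. w \<in> hom C (Dom C r2) (Dom C q2) \<and> q1 \<bullet>\<^bsub>C\<^esub> w = x \<bullet>\<^bsub>C\<^esub> r1 \<and>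
                  q2 \<bullet>\<^bsub>C\<^esub> w = r2 \<and> \<epsilon> \<bullet>\<^bsub>C\<^esub> w = v))))"

text \<open>
  What is meant by \<open>\<kappa>\<close> being sufficiently large: the category of simplicial objects is locally
  \<open>\<kappa>\<close>-presentable, its \<open>\<kappa>\<close>-presentable objects are closed under finite limits, and small
  fibrations are stable under dependent product along small fibrations.  (Stability of small
  fibrations under pullback and composition holds for any \<open>\<kappa>\<close>.)
\<close>

definition sufficiently_large :: "'u rel \<Rightarrow> ('o, 'm, 's, 'z) smcat_scheme \<Rightarrow> bool" where
  "sufficiently_large \<kappa> E \<longleftrightarrow>
     locally_presentable TYPE('u) \<kappa> (simp_cat E) \<and>
     (\<forall>T. is_terminal (simp_cat E) T \<longrightarrow> presentable TYPE('u) \<kappa> (simp_cat E) T) \<and>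
     (\<forall>p q f g. is_pullback (simp_cat E) p q f g \<and>
        presentable TYPE('u) \<kappa> (simp_cat E) (Dom (simp_cat E) f) \<and>
        presentable TYPE('u) \<kappa> (simp_cat E) (Dom (simp_cat E) g) \<and>
        presentable TYPE('u) \<kappa> (simp_cat E) (Cod (simp_cat E) f)
        \<longrightarrow> presentable TYPE('u) \<kappa> (simp_cat E) (Dom (simp_cat E) p)) \<and>
     (\<forall>f\<in>small_fib \<kappa> E. \<forall>g\<in>small_fib \<kappa> E. \<forall>p q1 q2 \<epsilon>.
        is_dep_prod (simp_cat E) f g p q1 q2 \<epsilon> \<longrightarrow> p \<in> small_fib \<kappa> E)"

definition universal_fibration :: "'u rel \<Rightarrow> ('o, 'm, 's, 'z) smcat_scheme \<Rightarrow> ('o, 'm) sar \<Rightarrow> bool" where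
  "universal_fibration \<kappa> E \<pi> \<longleftrightarrow> \<pi> \<in> small_fib \<kappa> E \<and> fibrant E (Cod (simp_cat E) \<pi>) \<and>
     (\<forall>f\<in>small_fib \<kappa> E. \<exists>A q. is_pullback (simp_cat E) f q A \<pi>)"

definition is_splitting :: "('o, 'm, 'z) cat_scheme \<Rightarrow> 'm \<Rightarrow> ('m \<Rightarrow> 'm) \<Rightarrow> ('m \<Rightarrow> 'm) \<Rightarrow> bool" where
  "is_splitting C \<pi> p q \<longleftrightarrow> (\<forall>A\<in>Ar C. Cod C A = Cod C \<pi> \<longrightarrow> is_pullback C (p A) (q A) A \<pi>)"


section \<open>Cubes, topes and shapes\<close>

datatype cube_term = CVar nat | CZero | COne

datatype tope =
    TTop | TBot
  | TLe cube_term cube_term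
  | TEq cube_term cube_term
  | TAnd tope tope
  | TOr tope tope

definition cube_term_over :: "nat \<Rightarrow> cube_term \<Rightarrow> bool" where
  "cube_term_over n t \<longleftrightarrow> (case t of CVar i \<Rightarrow> i < n | _ \<Rightarrow> True)"

fun tope_over :: "nat \<Rightarrow> tope \<Rightarrow> bool" where
  "tope_over n TTop \<longleftrightarrow> True"
| "tope_over n TBot \<longleftrightarrow> True"
| "tope_over n (TLe s t) \<longleftrightarrow> cube_term_over n s \<and> cube_term_over n t"
| "tope_over n (TEq s t) \<longleftrightarrow> cube_term_over n s \<and> cube_term_over n t"
| "tope_over n (TAnd P Q) \<longleftrightarrow> tope_over n P \<and> tope_over n Q"
| "tope_over n (TOr P Q) \<longleftrightarrow> tope_over n P \<and> tope_over n Q"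

text \<open>The simplicial set \<open>\<Delta>[1]\<^sup>n\<close>: an \<open>m\<close>-simplex is an \<open>n\<close>-tuple of monotone maps from
  \<open>{0, \<dots>, m}\<close> to \<open>{0, 1}\<close>.\<close>

definition cube :: "nat \<Rightarrow> (nat \<Rightarrow> nat \<Rightarrow> nat) sset" where
  "cube n =
     ((\<lambda>m. {..<n} \<rightarrow>\<^sub>E {f \<in> {..m} \<rightarrow>\<^sub>E {..1}. mono_on {..m} f}),
      (\<lambda>\<alpha> x. \<lambda>i\<in>{..<n}. compose {..Dom Delta \<alpha>} (x i) (snd (snd \<alpha>))))"

fun cube_term_val :: "nat \<Rightarrow> (nat \<Rightarrow> nat \<Rightarrow> nat) \<Rightarrow> cube_term \<Rightarrow> nat \<Rightarrow> nat" where
  "cube_term_val m x (CVar i) = x i"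
| "cube_term_val m x CZero = (\<lambda>_\<in>{..m}. 0)"
| "cube_term_val m x COne = (\<lambda>_\<in>{..m}. 1)"

fun tope_holds :: "nat \<Rightarrow> (nat \<Rightarrow> nat \<Rightarrow> nat) \<Rightarrow> tope \<Rightarrow> bool" where
  "tope_holds m x TTop \<longleftrightarrow> True"
| "tope_holds m x TBot \<longleftrightarrow> False"
| "tope_holds m x (TLe s t) \<longleftrightarrow> (\<forall>k\<le>m. cube_term_val m x s k \<le> cube_term_val m x t k)"
| "tope_holds m x (TEq s t) \<longleftrightarrow> cube_term_val m x s = cube_term_val m x t"
| "tope_holds m x (TAnd P Q) \<longleftrightarrow> tope_holds m x P \<and> tope_holds m x Q"
| "tope_holds m x (TOr P Q) \<longleftrightarrow> tope_holds m x P \<or> tope_holds m x Q"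

definition shape_sset :: "nat \<Rightarrow> tope \<Rightarrow> (nat \<Rightarrow> nat \<Rightarrow> nat) sset" where
  "shape_sset n P = ((\<lambda>m. {x \<in> fst (cube n) m. tope_holds m x P}), snd (cube n))"

text \<open>Levelwise discrete simplicial objects: level \<open>n\<close> is the coproduct of copies of the terminal
  object indexed by the \<open>n\<close>-simplices.\<close>

definition disc :: "('o, 'm, 'z) cat_scheme \<Rightarrow> 'a sset \<Rightarrow> ('o, 'm) sob" where
  "disc C K = ((\<lambda>n. fst (copow C (fst K n))),
     (\<lambda>\<alpha>\<in>Ar Delta. copow_map C (fst K (Cod Delta \<alpha>)) (fst K (Dom Delta \<alpha>)) (snd K \<alpha>)))"

definition disc_map :: "('o, 'm, 'z) cat_scheme \<Rightarrow> 'a sset \<Rightarrow> 'b sset \<Rightarrow> (nat \<Rightarrow> 'a \<Rightarrow> 'b) \<Rightarrow> ('o, 'm) sar" where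
  "disc_map C K L f = (disc C K, disc C L, \<lambda>n. copow_map C (fst K n) (fst L n) (f n))"

definition shape :: "('o, 'm, 'z) cat_scheme \<Rightarrow> nat \<Rightarrow> tope \<Rightarrow> ('o, 'm) sob" where
  "shape C n P = disc C (shape_sset n P)"

definition shape_incl :: "('o, 'm, 'z) cat_scheme \<Rightarrow> nat \<Rightarrow> tope \<Rightarrow> ('o, 'm) sar" where
  "shape_incl C n P = disc_map C (shape_sset n P) (cube n) (\<lambda>_ x. x)"

definition is_shape_inclusion ::
    "('o, 'm, 'z) cat_scheme \<Rightarrow> nat \<Rightarrow> tope \<Rightarrow> tope \<Rightarrow> ('o, 'm) sar \<Rightarrow> bool" where
  "is_shape_inclusion C n P Q j \<longleftrightarrow>
     j \<in> hom (simp_cat C) (shape C n P) (shape C n Q) \<and> is_mono (simp_cat C) j \<and>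
     shape_incl C n Q \<bullet>\<^bsub>simp_cat C\<^esub> j = shape_incl C n P"


section \<open>Extension types\<close>

text \<open>In this section \<open>C\<close> is the ambient category, \<open>\<pi>\<close> the universal fibration, and
  \<open>j\<close> the shape inclusion, from \<open>Dom C j\<close> to \<open>Cod C j\<close>.\<close>

definition reix :: "('o, 'm, 'z) cat_scheme \<Rightarrow> 'o \<Rightarrow> 'm \<Rightarrow> 'm \<Rightarrow> 'm" where
  "reix C X \<sigma> x = x \<bullet>\<^bsub>C\<^esub> prod_ar C \<sigma> (Idn C X)"

definition is_family :: "('o, 'm, 'z) cat_scheme \<Rightarrow> 'm \<Rightarrow> 'm \<Rightarrow> 'o \<Rightarrow> 'm \<Rightarrow> bool" where
  "is_family C \<pi> j \<Gamma> A \<longleftrightarrow> \<Gamma> \<in> Ob C \<and> A \<in> hom C (prod_ob C \<Gamma> (Cod C j)) (Cod C \<pi>)"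

definition is_partial_section :: "('o, 'm, 'z) cat_scheme \<Rightarrow> 'm \<Rightarrow> 'm \<Rightarrow> 'o \<Rightarrow> 'm \<Rightarrow> 'm \<Rightarrow> bool" where
  "is_partial_section C \<pi> j \<Gamma> A a \<longleftrightarrow>
     a \<in> hom C (prod_ob C \<Gamma> (Dom C j)) (Dom C \<pi>) \<and> \<pi> \<bullet>\<^bsub>C\<^esub> a = A \<bullet>\<^bsub>C\<^esub> prod_ar C (Idn C \<Gamma>) j"

definition is_total_section :: "('o, 'm, 'z) cat_scheme \<Rightarrow> 'm \<Rightarrow> 'm \<Rightarrow> 'o \<Rightarrow> 'm \<Rightarrow> 'm \<Rightarrow> 'm \<Rightarrow> bool" where
  "is_total_section C \<pi> j \<Gamma> A a b \<longleftrightarrow>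
     b \<in> hom C (prod_ob C \<Gamma> (Cod C j)) (Dom C \<pi>) \<and> \<pi> \<bullet>\<^bsub>C\<^esub> b = A \<and>
     b \<bullet>\<^bsub>C\<^esub> prod_ar C (Idn C \<Gamma>) j = a"

definition input_data :: "('o, 'm, 'z) cat_scheme \<Rightarrow> 'm \<Rightarrow> 'm \<Rightarrow> 'o \<Rightarrow> 'm \<Rightarrow> 'm \<Rightarrow> bool" where
  "input_data C \<pi> j \<Gamma> A a \<longleftrightarrow> is_family C \<pi> j \<Gamma> A \<and> is_partial_section C \<pi> j \<Gamma> A a"

text \<open>
  An object \<open>r\<close> over \<open>\<Gamma>\<close> representing total sections of the reindexings of \<open>A\<close> that extend those
  of \<open>a\<close>; the total section \<open>e\<close> over the domain of \<open>r\<close> is the universal one.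
\<close>

definition is_sem_ext :: "('o, 'm, 'z) cat_scheme \<Rightarrow> 'm \<Rightarrow> 'm \<Rightarrow> 'o \<Rightarrow> 'm \<Rightarrow> 'm \<Rightarrow> 'm \<Rightarrow> 'm \<Rightarrow> bool" where
  "is_sem_ext C \<pi> j \<Gamma> A a r e \<longleftrightarrow>
     r \<in> hom C (Dom C r) \<Gamma> \<and>
     is_total_section C \<pi> j (Dom C r) (reix C (Cod C j) r A) (reix C (Dom C j) r a) e \<and>
     (\<forall>\<Delta> \<sigma> b. \<sigma> \<in> hom C \<Delta> \<Gamma> \<and>
        is_total_section C \<pi> j \<Delta> (reix C (Cod C j) \<sigma> A) (reix C (Dom C j) \<sigma> a) b \<longrightarrow>
        (\<exists>!h. h \<in> hom C \<Delta> (Dom C r) \<and> r \<bullet>\<^bsub>C\<^esub> h = \<sigma> \<and> reix C (Cod C j) h e = b))"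

definition sem_ext :: "('o, 'm, 'z) cat_scheme \<Rightarrow> 'm \<Rightarrow> 'm \<Rightarrow> 'o \<Rightarrow> 'm \<Rightarrow> 'm \<Rightarrow> 'm" where
  "sem_ext C \<pi> j \<Gamma> A a = fst (SOME re. is_sem_ext C \<pi> j \<Gamma> A a (fst re) (snd re))"

definition sem_ext_univ :: "('o, 'm, 'z) cat_scheme \<Rightarrow> 'm \<Rightarrow> 'm \<Rightarrow> 'o \<Rightarrow> 'm \<Rightarrow> 'm \<Rightarrow> 'm" where
  "sem_ext_univ C \<pi> j \<Gamma> A a = snd (SOME re. is_sem_ext C \<pi> j \<Gamma> A a (fst re) (snd re))"

text \<open>
  An interpretation consists of the types \<open>Ext \<Gamma> A a\<close> and of isomorphisms \<open>\<theta> \<Gamma> A a\<close> over \<open>\<Gamma>\<close>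
  from the chosen pullback of \<open>\<pi>\<close> along \<open>Ext \<Gamma> A a\<close> to the semantic extension type (which is part of
  the claim to exist).
\<close>

definition is_interpretation :: "('o, 'm, 'z) cat_scheme \<Rightarrow> 'm \<Rightarrow> ('m \<Rightarrow> 'm) \<Rightarrow> 'm
    \<Rightarrow> ('o \<Rightarrow> 'm \<Rightarrow> 'm \<Rightarrow> 'm) \<Rightarrow> ('o \<Rightarrow> 'm \<Rightarrow> 'm \<Rightarrow> 'm) \<Rightarrow> bool" where
  "is_interpretation C \<pi> p j Ext \<theta> \<longleftrightarrow>
     (\<forall>\<Gamma> A a. input_data C \<pi> j \<Gamma> A a \<longrightarrow>
        is_sem_ext C \<pi> j \<Gamma> A a (sem_ext C \<pi> j \<Gamma> A a) (sem_ext_univ C \<pi> j \<Gamma> A a) \<and>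
        Ext \<Gamma> A a \<in> hom C \<Gamma> (Cod C \<pi>) \<and>
        \<theta> \<Gamma> A a \<in> hom C (Dom C (p (Ext \<Gamma> A a))) (Dom C (sem_ext C \<pi> j \<Gamma> A a)) \<and>
        is_iso C (\<theta> \<Gamma> A a) \<and>
        sem_ext C \<pi> j \<Gamma> A a \<bullet>\<^bsub>C\<^esub> \<theta> \<Gamma> A a = p (Ext \<Gamma> A a))"

definition is_term :: "('o, 'm, 'z) cat_scheme \<Rightarrow> 'm \<Rightarrow> 'm \<Rightarrow> 'm \<Rightarrow> bool" where
  "is_term C \<pi> T f \<longleftrightarrow> f \<in> hom C (Dom C T) (Dom C \<pi>) \<and> \<pi> \<bullet>\<^bsub>C\<^esub> f = T"

text \<open>The section of the projection \<open>p T\<close> that corresponds to a term \<open>f\<close> of \<open>T\<close>.\<close>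

definition term_section :: "('o, 'm, 'z) cat_scheme \<Rightarrow> ('m \<Rightarrow> 'm) \<Rightarrow> ('m \<Rightarrow> 'm) \<Rightarrow> 'm \<Rightarrow> 'm \<Rightarrow> 'm" where
  "term_section C p q T f =
     (THE t. t \<in> hom C (Dom C T) (Dom C (p T)) \<and> p T \<bullet>\<^bsub>C\<^esub> t = Idn C (Dom C T) \<and> q T \<bullet>\<^bsub>C\<^esub> t = f)"

text \<open>The total section that corresponds to a term \<open>f\<close> of the extension type.\<close>

definition total_of :: "('o, 'm, 'z) cat_scheme \<Rightarrow> 'm \<Rightarrow> ('m \<Rightarrow> 'm) \<Rightarrow> ('m \<Rightarrow> 'm) \<Rightarrow> 'm
    \<Rightarrow> ('o \<Rightarrow> 'm \<Rightarrow> 'm \<Rightarrow> 'm) \<Rightarrow> ('o \<Rightarrow> 'm \<Rightarrow> 'm \<Rightarrow> 'm) \<Rightarrow> 'o \<Rightarrow> 'm \<Rightarrow> 'm \<Rightarrow> 'm \<Rightarrow> 'm" where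
  "total_of C \<pi> p q j Ext \<theta> \<Gamma> A a f =
     reix C (Cod C j) (\<theta> \<Gamma> A a \<bullet>\<^bsub>C\<^esub> term_section C p q (Ext \<Gamma> A a) f) (sem_ext_univ C \<pi> j \<Gamma> A a)"

definition ext_lam :: "('o, 'm, 'z) cat_scheme \<Rightarrow> 'm \<Rightarrow> ('m \<Rightarrow> 'm) \<Rightarrow> ('m \<Rightarrow> 'm) \<Rightarrow> 'm
    \<Rightarrow> ('o \<Rightarrow> 'm \<Rightarrow> 'm \<Rightarrow> 'm) \<Rightarrow> ('o \<Rightarrow> 'm \<Rightarrow> 'm \<Rightarrow> 'm) \<Rightarrow> 'o \<Rightarrow> 'm \<Rightarrow> 'm \<Rightarrow> 'm \<Rightarrow> 'm" where
  "ext_lam C \<pi> p q j Ext \<theta> \<Gamma> A a b =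
     (THE f. is_term C \<pi> (Ext \<Gamma> A a) f \<and> total_of C \<pi> p q j Ext \<theta> \<Gamma> A a f = b)"

definition ext_app :: "('o, 'm, 'z) cat_scheme \<Rightarrow> 'm \<Rightarrow> ('m \<Rightarrow> 'm) \<Rightarrow> ('m \<Rightarrow> 'm) \<Rightarrow> 'm
    \<Rightarrow> ('o \<Rightarrow> 'm \<Rightarrow> 'm \<Rightarrow> 'm) \<Rightarrow> ('o \<Rightarrow> 'm \<Rightarrow> 'm \<Rightarrow> 'm) \<Rightarrow> 'o \<Rightarrow> 'm \<Rightarrow> 'm \<Rightarrow> 'm \<Rightarrow> 'm \<Rightarrow> 'm" where
  "ext_app C \<pi> p q j Ext \<theta> \<Gamma> A a f s =
     total_of C \<pi> p q j Ext \<theta> \<Gamma> A a f \<bullet>\<^bsub>C\<^esub> pairing C (Idn C \<Gamma>) s"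

end

theory Submission
  imports Defs "HOL-Library.Countable_Set"
begin

text \<open>
  The extension types are made strictly stable by constructing a single one, over a base that
  classifies all extension problems, and by reindexing it only by composition.

  An extension problem over \<open>\<Gamma>\<close> consists of a family \<open>A\<close> and a partial section \<open>a\<close>.  Write
  \<open>\<pi> : E \<rightarrow> U\<close> for the universal fibration.  By transposition \<open>A\<close> is a map from \<open>\<Gamma>\<close> to \<open>U\<^sup>\<psi>\<close> and
  \<open>a\<close> is a map from \<open>\<Gamma>\<close> to \<open>E\<^sup>\<phi>\<close>, so extension problems are the maps \<open>\<chi> : \<Gamma> \<rightarrow> W\<close> to the fibre product \<open>W\<close> of \<open>U\<^sup>\<psi>\<close>
  and \<open>E\<^sup>\<phi>\<close> over \<open>U\<^sup>\<phi>\<close>, and reindexing along \<open>\<sigma>\<close> is composition with \<open>\<sigma>\<close>.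
  The semantic extension type of the generic problem over \<open>W\<close> is the Leibniz cotensor
  \<open>r : E\<^sup>\<psi> \<rightarrow> W\<close> (\<open>generic_data\<close>).  If \<open>r\<close> is a small fibration, it is the pullback of \<open>\<pi>\<close> along some \<open>T : W \<rightarrow> U\<close>.
  Then \<open>T \<bullet> \<chi>\<close> is the required type, and terms of it are lifts of \<open>\<chi>\<close> through \<open>r\<close>,
  so everything is stable by associativity of composition (\<open>strict_interpretation\<close>).

  It remains to see that \<open>r\<close> is a small fibration.  Two separate arguments are needed.

  Smallness: \<open>E\<^sup>\<psi> \<rightarrow> U\<^sup>\<psi>\<close> is the dependent product of a pullback of \<open>\<pi>\<close> along the projection
  from \<open>U\<^sup>\<psi> \<times> \<psi>\<close> to \<open>U\<^sup>\<psi>\<close> (\<open>exponential_dep_prod\<close>), which is a small fibration as \<open>\<psi>\<close> is small and fibrant; the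
  same holds for \<open>\<phi>\<close>.  Hence \<open>E\<^sup>\<psi> \<rightarrow> U\<^sup>\<psi>\<close> and the pullback \<open>W \<rightarrow> U\<^sup>\<psi>\<close> of \<open>E\<^sup>\<phi> \<rightarrow> U\<^sup>\<phi>\<close> are relatively presentable, and
  relatively presentable maps are left cancellable (\<open>relatively_presentable_cancel\<close>).

  Fibrancy: the lifting property of \<open>r\<close> against a levelwise trivial cofibration \<open>i\<close> is the
  lifting property of \<open>\<pi>\<close> against the pushout product of \<open>i\<close> with the shape inclusion.  Shapes are levelwise coproducts of
  terminal objects.  By distributivity the pushout product is, at each level, a coproduct of copies of \<open>i\<close> and of
  identities.  Such a coproduct is a trivial cofibration, because it inherits the left lifting property
  (\<open>extend_total_section\<close>).

  Exponentials by shapes are limits, because for a simplicial set \<open>K\<close> a map from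
  \<open>\<Gamma> \<times> disc K\<close> to \<open>X\<close> is a compatible family of maps \<open>\<Gamma> n \<rightarrow> X n\<close> indexed by the simplices of \<open>K\<close>
  (\<open>prod_disc_coproduct\<close>, \<open>disc_exponential\<close>).  The distributive law behind this description holds since the base topos is
  cartesian closed (\<open>lccc_exponentials\<close>, \<open>product_copower\<close>).
\<close>

section \<open>Categories, pullbacks and lifting\<close>

lemma hom_iff: "f \<in> hom C X Y \<longleftrightarrow> f \<in> Ar C \<and> Dom C f = X \<and> Cod C f = Y"
  by (auto simp: hom_def)

locale cat_ctx =
  fixes C :: "('o, 'm, 'z) cat_scheme" (structure)
  assumes category_C: "category C"
begin

lemma homI: "f \<in> Ar C \<Longrightarrow> f \<in> hom C (Dom C f) (Cod C f)"
  by (simp add: hom_iff)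

lemma Dom_Ob [simp]: "f \<in> Ar C \<Longrightarrow> Dom C f \<in> Ob C"
  and Cod_Ob [simp]: "f \<in> Ar C \<Longrightarrow> Cod C f \<in> Ob C"
  using category_C by (auto simp: category_def)

lemma hom_Ob: "f \<in> hom C X Y \<Longrightarrow> X \<in> Ob C" "f \<in> hom C X Y \<Longrightarrow> Y \<in> Ob C"
  by (auto simp: hom_iff)

lemma id_hom [simp]: "X \<in> Ob C \<Longrightarrow> Idn C X \<in> hom C X X"
  using category_C by (auto simp: category_def)

lemma id_simps [simp]:
  "X \<in> Ob C \<Longrightarrow> Idn C X \<in> Ar C" "X \<in> Ob C \<Longrightarrow> Dom C (Idn C X) = X" "X \<in> Ob C \<Longrightarrow> Cod C (Idn C X) = X"
  using id_hom[of X] by (auto simp: hom_iff)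

lemma comp_hom: "g \<in> hom C Y Z \<Longrightarrow> f \<in> hom C X Y \<Longrightarrow> g \<bullet> f \<in> hom C X Z"
  using category_C unfolding category_def by blast

lemma comp_simps [simp]:
  assumes "f \<in> Ar C" "g \<in> Ar C" "Cod C f = Dom C g"
  shows "g \<bullet> f \<in> Ar C" "Dom C (g \<bullet> f) = Dom C f" "Cod C (g \<bullet> f) = Cod C g"
proof -
  have "g \<bullet> f \<in> hom C (Dom C f) (Cod C g)"
    using comp_hom assms by (metis homI)
  then show "g \<bullet> f \<in> Ar C" "Dom C (g \<bullet> f) = Dom C f" "Cod C (g \<bullet> f) = Cod C g"
    by (auto simp: hom_iff)
qed

lemma comp_id [simp]: "f \<in> Ar C \<Longrightarrow> Dom C f = X \<Longrightarrow> f \<bullet> Idn C X = f"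
  and id_comp [simp]: "f \<in> Ar C \<Longrightarrow> Cod C f = X \<Longrightarrow> Idn C X \<bullet> f = f"
  using category_C homI unfolding category_def by metis+

lemma comp_assoc [simp]:
  assumes "f \<in> Ar C" "g \<in> Ar C" "h \<in> Ar C" "Cod C f = Dom C g" "Cod C g = Dom C h"
  shows "(h \<bullet> g) \<bullet> f = h \<bullet> (g \<bullet> f)"
proof -
  have "\<forall>W X Y Z. \<forall>f\<in>hom C W X. \<forall>g\<in>hom C X Y. \<forall>h\<in>hom C Y Z. h \<bullet> (g \<bullet> f) = (h \<bullet> g) \<bullet> f"
    using category_C unfolding category_def by blast
  then show ?thesis using assms homI by metis
qed

lemma comp_reassoc:
  assumes "g \<bullet> f = k" "f \<in> Ar C" "g \<in> Ar C" "Cod C f = Dom C g" "x \<in> Ar C" "Cod C x = Dom C f"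
  shows "g \<bullet> (f \<bullet> x) = k \<bullet> x"
  using assms by (metis comp_assoc)

lemma square_reassoc:
  assumes "g \<bullet> f = k \<bullet> l" "f \<in> Ar C" "g \<in> Ar C" "Cod C f = Dom C g"
    "l \<in> Ar C" "k \<in> Ar C" "Cod C l = Dom C k" "Dom C l = Dom C f" "x \<in> Ar C" "Cod C x = Dom C f"
  shows "g \<bullet> (f \<bullet> x) = k \<bullet> (l \<bullet> x)"
  using assms by (metis comp_assoc)

lemma pullbackD:
  assumes "is_pullback C p q f g"
  shows "f \<in> Ar C" "g \<in> Ar C" "p \<in> Ar C" "q \<in> Ar C" "Cod C g = Cod C f" "Cod C p = Dom C f"
    "Cod C q = Dom C g" "Dom C q = Dom C p" "f \<bullet> p = g \<bullet> q"
  using assms by (auto simp: is_pullback_def hom_iff)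

lemma pullback_lift:
  assumes "is_pullback C p q f g" "u \<in> hom C W (Dom C f)" "v \<in> hom C W (Dom C g)" "f \<bullet> u = g \<bullet> v"
  obtains h where "h \<in> hom C W (Dom C p)" "p \<bullet> h = u" "q \<bullet> h = v"
  using assms unfolding is_pullback_def by blast

lemma pullback_eqI:
  assumes pb: "is_pullback C p q f g" and h: "h \<in> hom C W (Dom C p)" and h': "h' \<in> hom C W (Dom C p)"
    and eq: "p \<bullet> h = p \<bullet> h'" "q \<bullet> h = q \<bullet> h'"
  shows "h = h'"
proof -
  note D = pullbackD[OF pb]
  have "p \<bullet> h \<in> hom C W (Dom C f)" "q \<bullet> h \<in> hom C W (Dom C g)"
    using D h by (simp_all add: hom_iff)
  moreover have "f \<bullet> (p \<bullet> h) = g \<bullet> (q \<bullet> h)"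
    using D h by (intro square_reassoc) (simp_all add: hom_iff)
  ultimately have "\<exists>!k. k \<in> hom C W (Dom C p) \<and> p \<bullet> k = p \<bullet> h \<and> q \<bullet> k = q \<bullet> h"
    using pb unfolding is_pullback_def by blast
  then show ?thesis using h h' eq by metis
qed

lemma pullbackI:
  assumes "f \<in> Ar C" "g \<in> Ar C" "Cod C f = Cod C g" "p \<in> hom C P (Dom C f)" "q \<in> hom C P (Dom C g)"
    "f \<bullet> p = g \<bullet> q"
    and ex: "\<And>W u v. u \<in> hom C W (Dom C f) \<Longrightarrow> v \<in> hom C W (Dom C g) \<Longrightarrow> f \<bullet> u = g \<bullet> v \<Longrightarrow>
      \<exists>h. h \<in> hom C W P \<and> p \<bullet> h = u \<and> q \<bullet> h = v"
    and uniq: "\<And>W h h'. h \<in> hom C W P \<Longrightarrow> h' \<in> hom C W P \<Longrightarrow> p \<bullet> h = p \<bullet> h' \<Longrightarrow> q \<bullet> h = q \<bullet> h' \<Longrightarrow> h = h'"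
  shows "is_pullback C p q f g"
  unfolding is_pullback_def
proof (intro conjI allI ballI impI)
  have [simp]: "Dom C p = P" using assms by (simp add: hom_iff)
  show "p \<in> hom C (Dom C p) (Dom C f)" "q \<in> hom C (Dom C p) (Dom C g)" using assms by simp_all
  fix W u v assume "u \<in> hom C W (Dom C f)" "v \<in> hom C W (Dom C g)" "f \<bullet> u = g \<bullet> v"
  then obtain h where "h \<in> hom C W P \<and> p \<bullet> h = u \<and> q \<bullet> h = v" using ex by blast
  then show "\<exists>!h. h \<in> hom C W (Dom C p) \<and> p \<bullet> h = u \<and> q \<bullet> h = v"
    using uniq by (intro ex1I[of _ h]) auto
qed (use assms in auto)

lemma pullback_paste:
  assumes pb: "is_pullback C p q f g" and pb': "is_pullback C p' q' z p"
  shows "is_pullback C p' (q \<bullet> q') (f \<bullet> z) g"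
proof -
  note D = pullbackD[OF pb] pullbackD[OF pb']
  show ?thesis
  proof (rule pullbackI)
    show "(f \<bullet> z) \<bullet> p' = g \<bullet> (q \<bullet> q')"
      using D by (metis comp_assoc)
  next
    fix W u v assume u: "u \<in> hom C W (Dom C (f \<bullet> z))" and v: "v \<in> hom C W (Dom C g)"
      and eq: "(f \<bullet> z) \<bullet> u = g \<bullet> v"
    have "z \<bullet> u \<in> hom C W (Dom C f)" "f \<bullet> (z \<bullet> u) = g \<bullet> v"
      using D u eq by (simp_all add: hom_iff)
    then obtain k where k: "k \<in> hom C W (Dom C p)" "p \<bullet> k = z \<bullet> u" "q \<bullet> k = v"
      using pullback_lift[OF pb _ v] by metis
    then obtain h where "h \<in> hom C W (Dom C p')" "p' \<bullet> h = u" "q' \<bullet> h = k"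
      using pullback_lift[OF pb', of u W k] u D by (auto simp: hom_iff)
    then show "\<exists>h. h \<in> hom C W (Dom C p') \<and> p' \<bullet> h = u \<and> (q \<bullet> q') \<bullet> h = v"
      using k D by (intro exI[of _ h]) (auto simp: hom_iff)
  next
    fix W h h' assume h: "h \<in> hom C W (Dom C p')" "h' \<in> hom C W (Dom C p')"
      and eq: "p' \<bullet> h = p' \<bullet> h'" "(q \<bullet> q') \<bullet> h = (q \<bullet> q') \<bullet> h'"
    have "q' \<bullet> h = q' \<bullet> h'"
    proof (rule pullback_eqI[OF pb])
      show "p \<bullet> q' \<bullet> h = p \<bullet> q' \<bullet> h'"
        using square_reassoc[OF D(18)[symmetric]] D h eq by (simp add: hom_iff)
      show "q \<bullet> q' \<bullet> h = q \<bullet> q' \<bullet> h'" using eq D h by (simp add: hom_iff)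
    qed (use D h in \<open>auto simp: hom_iff\<close>)
    then show "h = h'" using pullback_eqI[OF pb' h eq(1)] by simp
  qed (use D in \<open>auto simp: hom_iff\<close>)
qed

lemma rlp_pullback:
  assumes S: "S \<subseteq> Ar C" and pb: "is_pullback C p q f g" and g: "g \<in> rlp C S"
  shows "p \<in> rlp C S"
  unfolding rlp_def has_lift_def
proof (intro CollectI conjI ballI impI)
  note D = pullbackD[OF pb]
  show "p \<in> Ar C" using D by simp
  fix i u v assume i: "i \<in> S" and u: "u \<in> hom C (Dom C i) (Dom C p)" and v: "v \<in> hom C (Cod C i) (Cod C p)"
    and sq: "p \<bullet> u = v \<bullet> i"
  have iA: "i \<in> Ar C" using i S by auto
  have "g \<bullet> (q \<bullet> u) = (f \<bullet> v) \<bullet> i"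
    using square_reassoc[OF D(9)[symmetric]] sq D u v iA by (simp add: hom_iff)
  moreover have "q \<bullet> u \<in> hom C (Dom C i) (Dom C g)" "f \<bullet> v \<in> hom C (Cod C i) (Cod C g)"
    using D u v by (auto simp: hom_iff)
  ultimately obtain k where k: "k \<in> hom C (Cod C i) (Dom C g)" "k \<bullet> i = q \<bullet> u" "g \<bullet> k = f \<bullet> v"
    using g i unfolding rlp_def has_lift_def by blast
  obtain h where h: "h \<in> hom C (Cod C i) (Dom C p)" "p \<bullet> h = v" "q \<bullet> h = k"
    using pullback_lift[OF pb, of v "Cod C i" k] v k D by (metis)
  have "h \<bullet> i = u"
  proof (rule pullback_eqI[OF pb])
    show "p \<bullet> h \<bullet> i = p \<bullet> u" using comp_reassoc[OF h(2)] h D iA sq by (simp add: hom_iff)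
    show "q \<bullet> h \<bullet> i = q \<bullet> u" using comp_reassoc[OF h(3)] h D iA k by (simp add: hom_iff)
  qed (use u h iA in \<open>auto simp: hom_iff\<close>)
  then show "\<exists>h\<in>hom C (Cod C i) (Dom C p). h \<bullet> i = u \<and> p \<bullet> h = v" using h by blast
qed

lemma relatively_presentable_pullback:
  assumes pb: "is_pullback C p q f g" and g: "relatively_presentable u \<kappa> C g"
  shows "relatively_presentable u \<kappa> C p"
  unfolding relatively_presentable_def
proof (intro conjI allI impI)
  show "p \<in> Ar C" using pullbackD[OF pb] by simp
  fix z p' q' assume *: "presentable u \<kappa> C (Dom C z) \<and> is_pullback C p' q' z p"
  then have "is_pullback C p' (q \<bullet> q') (f \<bullet> z) g" using pullback_paste[OF pb] by blast
  moreover have "Dom C (f \<bullet> z) = Dom C z"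
    using * pullbackD[OF pb] pullbackD[of p' q' z p] by simp
  ultimately show "presentable u \<kappa> C (Dom C p')"
    using g * unfolding relatively_presentable_def by metis
qed

text \<open>
  Closure of presentable objects under fibre products makes relative presentability left
  cancellable: the fibre of \<open>f\<close> over \<open>z\<close> is the fibre, over the section that \<open>z\<close> induces, of the map
  from the fibre of \<open>g \<circ> f\<close> to the fibre of \<open>g\<close>, both taken over \<open>g \<circ> z\<close>.
\<close>

lemma relatively_presentable_cancel:
  assumes pbs: "\<And>f g. f \<in> Ar C \<Longrightarrow> g \<in> Ar C \<Longrightarrow> Cod C f = Cod C g \<Longrightarrow> \<exists>p q. is_pullback C p q f g"
    and closed: "\<And>p q f g. is_pullback C p q f g \<Longrightarrow> presentable u \<kappa> C (Dom C f) \<Longrightarrow>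
      presentable u \<kappa> C (Dom C g) \<Longrightarrow> presentable u \<kappa> C (Cod C f) \<Longrightarrow> presentable u \<kappa> C (Dom C p)"
    and f: "f \<in> Ar C" "Cod C f = Dom C g"
    and g: "relatively_presentable u \<kappa> C g" and gf: "relatively_presentable u \<kappa> C (g \<bullet> f)"
  shows "relatively_presentable u \<kappa> C f"
  unfolding relatively_presentable_def
proof (intro conjI allI impI)
  have gA: "g \<in> Ar C" using g by (simp add: relatively_presentable_def)
  show "f \<in> Ar C" by fact
  fix z p q assume *: "presentable u \<kappa> C (Dom C z) \<and> is_pullback C p q z f"
  then have pb: "is_pullback C p q z f" and Zp: "presentable u \<kappa> C (Dom C z)" by auto
  note D = pullbackD[OF pb]
  have gz: "g \<bullet> z \<in> Ar C" "Dom C (g \<bullet> z) = Dom C z" "Cod C (g \<bullet> z) = Cod C g" using D f gA by simp_all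
  obtain Q1 Q2 where Q: "is_pullback C Q1 Q2 (g \<bullet> z) (g \<bullet> f)"
    using pbs[of "g \<bullet> z" "g \<bullet> f"] D f gA by auto
  obtain R1 R2 where R: "is_pullback C R1 R2 (g \<bullet> z) g"
    using pbs[of "g \<bullet> z" g] D f gA by auto
  note DQ = pullbackD[OF Q] and DR = pullbackD[OF R]
  have Qp: "presentable u \<kappa> C (Dom C Q1)" and Rp: "presentable u \<kappa> C (Dom C R1)"
    using Q R g gf Zp gz unfolding relatively_presentable_def by metis+
  obtain s where s: "s \<in> hom C (Dom C z) (Dom C R1)" "R1 \<bullet> s = Idn C (Dom C z)" "R2 \<bullet> s = z"
    by (rule pullback_lift[OF R, of "Idn C (Dom C z)" "Dom C z" z]) (use D f gA in \<open>simp_all add: hom_iff\<close>)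
  obtain t where t: "t \<in> hom C (Dom C Q1) (Dom C R1)" "R1 \<bullet> t = Q1" "R2 \<bullet> t = f \<bullet> Q2"
    by (rule pullback_lift[OF R, of Q1 "Dom C Q1" "f \<bullet> Q2"]) (use DQ D f gA in \<open>simp_all add: hom_iff\<close>)
  obtain k where k: "k \<in> hom C (Dom C p) (Dom C Q1)" "Q1 \<bullet> k = p" "Q2 \<bullet> k = q"
    by (rule pullback_lift[OF Q, of p "Dom C p" q]) (use D f gA in \<open>simp_all add: hom_iff\<close>)
  have "is_pullback C p k s t"
  proof (rule pullbackI)
    show "s \<bullet> p = t \<bullet> k"
    proof (rule pullback_eqI[OF R])
      show "R1 \<bullet> s \<bullet> p = R1 \<bullet> t \<bullet> k"
        using comp_reassoc[OF s(2)] comp_reassoc[OF t(2)] s t k D DR by (simp add: hom_iff)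
      show "R2 \<bullet> s \<bullet> p = R2 \<bullet> t \<bullet> k"
        using comp_reassoc[OF s(3)] comp_reassoc[OF t(3)] s t k D DR DQ f by (simp add: hom_iff)
    qed (use s t k D in \<open>simp_all add: hom_iff\<close>)
  next
    fix W a b assume a: "a \<in> hom C W (Dom C s)" and b: "b \<in> hom C W (Dom C t)" and eq: "s \<bullet> a = t \<bullet> b"
    have 1: "a = Q1 \<bullet> b"
    proof -
      have "a = R1 \<bullet> s \<bullet> a" using comp_reassoc[OF s(2)] s a D DR by (simp add: hom_iff)
      also have "\<dots> = R1 \<bullet> t \<bullet> b" using eq by simp
      also have "\<dots> = Q1 \<bullet> b" using comp_reassoc[OF t(2)] t b DQ DR by (simp add: hom_iff)
      finally show ?thesis .
    qed
    have 2: "z \<bullet> a = f \<bullet> (Q2 \<bullet> b)"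
    proof -
      have "z \<bullet> a = R2 \<bullet> s \<bullet> a" using comp_reassoc[OF s(3)] s a D DR by (simp add: hom_iff)
      also have "\<dots> = R2 \<bullet> t \<bullet> b" using eq by simp
      also have "\<dots> = f \<bullet> (Q2 \<bullet> b)" using comp_reassoc[OF t(3)] t b DQ DR f D by (simp add: hom_iff)
      finally show ?thesis .
    qed
    obtain h where h: "h \<in> hom C W (Dom C p)" "p \<bullet> h = a" "q \<bullet> h = Q2 \<bullet> b"
      by (rule pullback_lift[OF pb, of a W "Q2 \<bullet> b"]) (use 2 a b s t DQ D f gA in \<open>simp_all add: hom_iff\<close>)
    have "k \<bullet> h = b"
    proof (rule pullback_eqI[OF Q])
      show "Q1 \<bullet> k \<bullet> h = Q1 \<bullet> b" using comp_reassoc[OF k(2)] 1 h k DQ by (simp add: hom_iff)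
      show "Q2 \<bullet> k \<bullet> h = Q2 \<bullet> b" using comp_reassoc[OF k(3)] h k DQ by (simp add: hom_iff)
    qed (use h k b t in \<open>simp_all add: hom_iff\<close>)
    then show "\<exists>h. h \<in> hom C W (Dom C p) \<and> p \<bullet> h = a \<and> k \<bullet> h = b" using h by blast
  next
    fix W h h' assume h: "h \<in> hom C W (Dom C p)" "h' \<in> hom C W (Dom C p)"
      and eq: "p \<bullet> h = p \<bullet> h'" "k \<bullet> h = k \<bullet> h'"
    have "q \<bullet> h = q \<bullet> h'"
    proof -
      have "q \<bullet> h = Q2 \<bullet> k \<bullet> h" using comp_reassoc[OF k(3)] h k DQ by (simp add: hom_iff)
      also have "\<dots> = Q2 \<bullet> k \<bullet> h'" using eq by simp
      also have "\<dots> = q \<bullet> h'" using comp_reassoc[OF k(3)] h k DQ by (simp add: hom_iff)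
      finally show ?thesis .
    qed
    then show "h = h'" using pullback_eqI[OF pb h eq(1)] by simp
  qed (use s t k D in \<open>simp_all add: hom_iff\<close>)
  moreover have "Dom C s = Dom C z" "Dom C t = Dom C Q1" "Cod C s = Dom C R1" using s t by (auto simp: hom_iff)
  ultimately show "presentable u \<kappa> C (Dom C p)" using closed Zp Qp Rp by metis
qed

end


section \<open>Products and reindexing\<close>

locale prod_ctx = cat_ctx +
  assumes products: "X \<in> Ob C \<Longrightarrow> Y \<in> Ob C \<Longrightarrow> \<exists>p q. is_product C X Y p q"
begin

lemma prod_is_product:
  assumes "X \<in> Ob C" "Y \<in> Ob C"
  shows "is_product C X Y (pr1 C X Y) (pr2 C X Y)"
proof -
  have "\<exists>pq. is_product C X Y (fst pq) (snd pq)" using products[OF assms] by auto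
  then show ?thesis unfolding pr1_def pr2_def by (rule someI_ex)
qed

lemma pr_hom:
  assumes "X \<in> Ob C" "Y \<in> Ob C"
  shows "pr1 C X Y \<in> hom C (prod_ob C X Y) X" "pr2 C X Y \<in> hom C (prod_ob C X Y) Y"
  using prod_is_product[OF assms] by (auto simp: is_product_def prod_ob_def)

lemma pr_simps [simp]:
  assumes "X \<in> Ob C" "Y \<in> Ob C"
  shows "pr1 C X Y \<in> Ar C" "Dom C (pr1 C X Y) = prod_ob C X Y" "Cod C (pr1 C X Y) = X"
    "pr2 C X Y \<in> Ar C" "Dom C (pr2 C X Y) = prod_ob C X Y" "Cod C (pr2 C X Y) = Y" "prod_ob C X Y \<in> Ob C"
  using pr_hom[OF assms] hom_Ob(1)[OF pr_hom(1)[OF assms]] by (simp_all add: hom_iff)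

lemma prod_lift:
  assumes "u \<in> hom C W X" "v \<in> hom C W Y"
  shows "\<exists>!h. h \<in> hom C W (prod_ob C X Y) \<and> pr1 C X Y \<bullet> h = u \<and> pr2 C X Y \<bullet> h = v"
  using prod_is_product[of X Y] assms hom_Ob[OF assms(1)] hom_Ob[OF assms(2)]
  unfolding is_product_def prod_ob_def by blast

lemma pairing_simps [simp]:
  assumes "u \<in> Ar C" "v \<in> Ar C" "Dom C u = Dom C v"
  shows "pairing C u v \<in> Ar C" "Dom C (pairing C u v) = Dom C v"
    "Cod C (pairing C u v) = prod_ob C (Cod C u) (Cod C v)"
    "Cod C u = X \<Longrightarrow> Cod C v = Y \<Longrightarrow> pr1 C X Y \<bullet> pairing C u v = u"
    "Cod C u = X \<Longrightarrow> Cod C v = Y \<Longrightarrow> pr2 C X Y \<bullet> pairing C u v = v"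
proof -
  have "\<exists>!h. h \<in> hom C (Dom C u) (prod_ob C (Cod C u) (Cod C v)) \<and>
            pr1 C (Cod C u) (Cod C v) \<bullet> h = u \<and> pr2 C (Cod C u) (Cod C v) \<bullet> h = v"
    using assms by (intro prod_lift) (auto simp: hom_iff)
  from theI'[OF this] show "pairing C u v \<in> Ar C" "Dom C (pairing C u v) = Dom C v"
    "Cod C (pairing C u v) = prod_ob C (Cod C u) (Cod C v)"
    "Cod C u = X \<Longrightarrow> Cod C v = Y \<Longrightarrow> pr1 C X Y \<bullet> pairing C u v = u"
    "Cod C u = X \<Longrightarrow> Cod C v = Y \<Longrightarrow> pr2 C X Y \<bullet> pairing C u v = v"
    using assms by (auto simp: pairing_def hom_iff)
qed

lemma prod_eqI:
  assumes "h \<in> hom C W (prod_ob C X Y)" "h' \<in> hom C W (prod_ob C X Y)" "X \<in> Ob C" "Y \<in> Ob C"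
    "pr1 C X Y \<bullet> h = pr1 C X Y \<bullet> h'" "pr2 C X Y \<bullet> h = pr2 C X Y \<bullet> h'"
  shows "h = h'"
  using prod_lift[of "pr1 C X Y \<bullet> h" W X "pr2 C X Y \<bullet> h" Y] assms by (auto simp: hom_iff)

lemma prod_ar_simps [simp]:
  assumes "f \<in> Ar C" "g \<in> Ar C"
  shows "prod_ar C f g \<in> Ar C" "Dom C (prod_ar C f g) = prod_ob C (Dom C f) (Dom C g)"
    "Cod C (prod_ar C f g) = prod_ob C (Cod C f) (Cod C g)"
  using assms by (auto simp: prod_ar_def)

lemma pr_prod_ar [simp]:
  assumes "f \<in> Ar C" "g \<in> Ar C" "Cod C f = X" "Cod C g = Y"
  shows "pr1 C X Y \<bullet> prod_ar C f g = f \<bullet> pr1 C (Dom C f) (Dom C g)"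
    "pr2 C X Y \<bullet> prod_ar C f g = g \<bullet> pr2 C (Dom C f) (Dom C g)"
  using assms by (auto simp: prod_ar_def)

lemma pr_prod_ar_assoc [simp]:
  assumes "f \<in> Ar C" "g \<in> Ar C" "Cod C f = X" "Cod C g = Y" "x \<in> Ar C" "Cod C x = prod_ob C (Dom C f) (Dom C g)"
  shows "pr1 C X Y \<bullet> (prod_ar C f g \<bullet> x) = f \<bullet> (pr1 C (Dom C f) (Dom C g) \<bullet> x)"
    "pr2 C X Y \<bullet> (prod_ar C f g \<bullet> x) = g \<bullet> (pr2 C (Dom C f) (Dom C g) \<bullet> x)"
  using assms square_reassoc[OF pr_prod_ar(1)[OF assms(1-4)]]
    square_reassoc[OF pr_prod_ar(2)[OF assms(1-4)]] by auto

lemma prod_ar_comp: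
  assumes "f \<in> Ar C" "g \<in> Ar C" "f' \<in> Ar C" "g' \<in> Ar C" "Cod C f' = Dom C f" "Cod C g' = Dom C g"
  shows "prod_ar C f g \<bullet> prod_ar C f' g' = prod_ar C (f \<bullet> f') (g \<bullet> g')"
  by (rule prod_eqI[of _ "prod_ob C (Dom C f') (Dom C g')" "Cod C f" "Cod C g"])
    (use assms in \<open>auto simp: hom_iff\<close>)

lemma prod_ar_id [simp]: "X \<in> Ob C \<Longrightarrow> Y \<in> Ob C \<Longrightarrow> prod_ar C (Idn C X) (Idn C Y) = Idn C (prod_ob C X Y)"
  by (rule prod_eqI[of _ "prod_ob C X Y" X Y]) (auto simp: hom_iff)

lemma prod_ar_pairing:
  assumes "f \<in> Ar C" "g \<in> Ar C" "u \<in> Ar C" "v \<in> Ar C" "Dom C u = Dom C v" "Cod C u = Dom C f" "Cod C v = Dom C g"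
  shows "prod_ar C f g \<bullet> pairing C u v = pairing C (f \<bullet> u) (g \<bullet> v)"
  by (rule prod_eqI[of _ "Dom C v" "Cod C f" "Cod C g"])
    (use assms in \<open>auto simp: hom_iff\<close>)

lemma pairing_comp:
  assumes "u \<in> Ar C" "v \<in> Ar C" "Dom C u = Dom C v" "x \<in> Ar C" "Cod C x = Dom C v"
  shows "pairing C u v \<bullet> x = pairing C (u \<bullet> x) (v \<bullet> x)"
proof -
  have "pr1 C (Cod C u) (Cod C v) \<bullet> pairing C u v \<bullet> x = u \<bullet> x"
    by (rule comp_reassoc[OF pairing_simps(4)]) (use assms in simp_all)
  moreover have "pr2 C (Cod C u) (Cod C v) \<bullet> pairing C u v \<bullet> x = v \<bullet> x"
    by (rule comp_reassoc[OF pairing_simps(5)]) (use assms in simp_all)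
  ultimately show ?thesis
    by - (rule prod_eqI[of _ "Dom C x" "Cod C u" "Cod C v"]; use assms in \<open>simp add: hom_iff\<close>)
qed

lemma reix_hom:
  assumes "\<sigma> \<in> hom C \<Delta> \<Gamma>" "X \<in> Ob C" "x \<in> hom C (prod_ob C \<Gamma> X) Z"
  shows "reix C X \<sigma> x \<in> hom C (prod_ob C \<Delta> X) Z"
  using assms by (auto simp: reix_def hom_iff)

lemma reix_reix:
  assumes "\<sigma> \<in> hom C \<Delta> \<Gamma>" "\<tau> \<in> hom C \<Theta> \<Delta>" "X \<in> Ob C" "x \<in> hom C (prod_ob C \<Gamma> X) Z"
  shows "reix C X \<tau> (reix C X \<sigma> x) = reix C X (\<sigma> \<bullet> \<tau>) x"
  using assms by (auto simp: reix_def hom_iff prod_ar_comp)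

lemma reix_id: "\<Gamma> \<in> Ob C \<Longrightarrow> X \<in> Ob C \<Longrightarrow> x \<in> hom C (prod_ob C \<Gamma> X) Z \<Longrightarrow> reix C X (Idn C \<Gamma>) x = x"
  by (auto simp: reix_def hom_iff)

lemma reix_post:
  assumes "\<sigma> \<in> hom C \<Delta> \<Gamma>" "X \<in> Ob C" "x \<in> hom C (prod_ob C \<Gamma> X) Z" "f \<in> Ar C" "Dom C f = Z"
  shows "reix C X \<sigma> (f \<bullet> x) = f \<bullet> reix C X \<sigma> x"
  using assms by (auto simp: reix_def hom_iff)

lemma reix_restrict:
  assumes "\<sigma> \<in> hom C \<Delta> \<Gamma>" "j \<in> Ar C" "x \<in> hom C (prod_ob C \<Gamma> (Cod C j)) Z"
  shows "reix C (Cod C j) \<sigma> x \<bullet> prod_ar C (Idn C \<Delta>) j = reix C (Dom C j) \<sigma> (x \<bullet> prod_ar C (Idn C \<Gamma>) j)"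
  using assms hom_Ob[OF assms(1)] by (auto simp: reix_def hom_iff prod_ar_comp)

lemma total_section_reix:
  assumes "is_total_section C \<pi> j \<Gamma> A a b" "\<sigma> \<in> hom C \<Delta> \<Gamma>" "j \<in> Ar C" "\<pi> \<in> Ar C"
  shows "is_total_section C \<pi> j \<Delta> (reix C (Cod C j) \<sigma> A) (reix C (Dom C j) \<sigma> a) (reix C (Cod C j) \<sigma> b)"
  using assms unfolding is_total_section_def
  using reix_hom[OF assms(2)] reix_restrict[OF assms(2,3)] reix_post[OF assms(2)] by (metis Cod_Ob)

lemma input_data_reix:
  assumes "input_data C \<pi> j \<Gamma> A a" "\<sigma> \<in> hom C \<Delta> \<Gamma>" "j \<in> Ar C" "\<pi> \<in> Ar C"
  shows "input_data C \<pi> j \<Delta> (reix C (Cod C j) \<sigma> A) (reix C (Dom C j) \<sigma> a)"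
  using assms unfolding input_data_def is_family_def is_partial_section_def
  using reix_hom[OF assms(2)] reix_restrict[OF assms(2,3)] reix_post[OF assms(2)] hom_Ob[OF assms(2)]
  by (metis Cod_Ob Dom_Ob)

end

section \<open>Strict stability from a generic extension problem\<close>

text \<open>A universal element of the presheaf of extension problems, which sends \<open>\<Gamma>\<close> to the pairs of a family
  and a partial section over \<open>\<Gamma>\<close>.\<close>

definition is_generic_data :: "('o, 'm, 'z) cat_scheme \<Rightarrow> 'm \<Rightarrow> 'm \<Rightarrow> 'o \<Rightarrow> 'm \<Rightarrow> 'm \<Rightarrow> bool" where
  "is_generic_data C \<pi> j W A0 a0 \<longleftrightarrow> input_data C \<pi> j W A0 a0 \<and>
     (\<forall>\<Gamma> A a. input_data C \<pi> j \<Gamma> A a \<longrightarrow>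
        (\<exists>!h. h \<in> hom C \<Gamma> W \<and> reix C (Cod C j) h A0 = A \<and> reix C (Dom C j) h a0 = a))"

context cat_ctx
begin

lemma pullback_cancel:
  assumes pb: "is_pullback C P q f g" and big: "is_pullback C p Q (f \<bullet> z) g"
    and z: "z \<in> Ar C" "Cod C z = Dom C f"
    and v: "v \<in> hom C (Dom C p) (Dom C P)" "P \<bullet> v = z \<bullet> p" "q \<bullet> v = Q"
  shows "is_pullback C p v z P"
proof (rule pullbackI)
  note D = pullbackD[OF pb] pullbackD[OF big]
  show "z \<in> Ar C" "P \<in> Ar C" "Cod C z = Cod C P" "p \<in> hom C (Dom C p) (Dom C z)"
    "v \<in> hom C (Dom C p) (Dom C P)" "z \<bullet> p = P \<bullet> v"
    using D z v by (simp_all add: hom_iff)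
  fix W
  {
    fix x y assume x: "x \<in> hom C W (Dom C z)" and y: "y \<in> hom C W (Dom C P)" and eq: "z \<bullet> x = P \<bullet> y"
    have "(f \<bullet> z) \<bullet> x = g \<bullet> (q \<bullet> y)"
      using square_reassoc[OF D(9)] D x y z eq by (simp add: hom_iff)
    moreover have "x \<in> hom C W (Dom C (f \<bullet> z))" "q \<bullet> y \<in> hom C W (Dom C g)"
      using x y z D by (simp_all add: hom_iff)
    ultimately obtain h where h: "h \<in> hom C W (Dom C p)" "p \<bullet> h = x" "Q \<bullet> h = q \<bullet> y"
      using pullback_lift[OF big] by metis
    have "v \<bullet> h = y"
    proof (rule pullback_eqI[OF pb])
      show "P \<bullet> v \<bullet> h = P \<bullet> y"
        using square_reassoc[OF v(2)] h v z D eq by (simp add: hom_iff)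
      show "q \<bullet> v \<bullet> h = q \<bullet> y"
        using comp_reassoc[OF v(3)] h v z D by (simp add: hom_iff)
    qed (use h v y in \<open>simp_all add: hom_iff\<close>)
    then show "\<exists>h. h \<in> hom C W (Dom C p) \<and> p \<bullet> h = x \<and> v \<bullet> h = y" using h by blast
  next
    fix h h' assume h: "h \<in> hom C W (Dom C p)" "h' \<in> hom C W (Dom C p)"
      and eq: "p \<bullet> h = p \<bullet> h'" "v \<bullet> h = v \<bullet> h'"
    have "Q \<bullet> h = Q \<bullet> h'"
      using comp_reassoc[OF v(3), of h] comp_reassoc[OF v(3), of h'] h v D eq by (simp add: hom_iff)
    then show "h = h'" using pullback_eqI[OF big h eq(1)] by simp
  }
qed

end

locale ext_ctx = prod_ctx +
  fixes \<pi> j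
  assumes pi_Ar [simp]: "\<pi> \<in> Ar C" and j_Ar [simp]: "j \<in> Ar C"
begin

abbreviation "\<phi> \<equiv> Dom C j"
abbreviation "\<psi> \<equiv> Cod C j"

lemma sem_extD:
  assumes "is_sem_ext C \<pi> j \<Gamma> A a r e"
  shows "r \<in> hom C (Dom C r) \<Gamma>" "e \<in> hom C (prod_ob C (Dom C r) \<psi>) (Dom C \<pi>)"
    "is_total_section C \<pi> j (Dom C r) (reix C \<psi> r A) (reix C \<phi> r a) e"
  using assms by (auto simp: is_sem_ext_def is_total_section_def)

lemma sem_ext_lift:
  assumes "is_sem_ext C \<pi> j \<Gamma> A a r e" "\<sigma> \<in> hom C \<Delta> \<Gamma>"
    "is_total_section C \<pi> j \<Delta> (reix C \<psi> \<sigma> A) (reix C \<phi> \<sigma> a) b"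
  shows "\<exists>!h. h \<in> hom C \<Delta> (Dom C r) \<and> r \<bullet> h = \<sigma> \<and> reix C \<psi> h e = b"
  using assms unfolding is_sem_ext_def by blast

lemma input_dataD:
  assumes "input_data C \<pi> j \<Gamma> A a"
  shows "\<Gamma> \<in> Ob C" "A \<in> hom C (prod_ob C \<Gamma> \<psi>) (Cod C \<pi>)" "a \<in> hom C (prod_ob C \<Gamma> \<phi>) (Dom C \<pi>)"
  using assms by (auto simp: input_data_def is_family_def is_partial_section_def)

lemma sem_ext_eqI:
  assumes se: "is_sem_ext C \<pi> j \<Gamma> A a r e" and inp: "input_data C \<pi> j \<Gamma> A a"
    and h: "h \<in> hom C \<Delta> (Dom C r)" "h' \<in> hom C \<Delta> (Dom C r)"
    and eq: "r \<bullet> h = r \<bullet> h'" "reix C \<psi> h e = reix C \<psi> h' e"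
  shows "h = h'"
proof -
  note D = sem_extD[OF se] input_dataD[OF inp]
  have "is_total_section C \<pi> j \<Delta> (reix C \<psi> h (reix C \<psi> r A)) (reix C \<phi> h (reix C \<phi> r a)) (reix C \<psi> h e)"
    using total_section_reix[OF D(3) h(1)] by simp
  then have "is_total_section C \<pi> j \<Delta> (reix C \<psi> (r \<bullet> h) A) (reix C \<phi> (r \<bullet> h) a) (reix C \<psi> h e)"
    using reix_reix[OF D(1) h(1)] D by simp
  moreover have "r \<bullet> h \<in> hom C \<Delta> \<Gamma>" using D(1) h(1) by (rule comp_hom)
  ultimately show ?thesis using sem_ext_lift[OF se] h eq by metis
qed

text \<open>Both objects represent the same presheaf.\<close>

lemma sem_ext_compare:
  assumes se: "is_sem_ext C \<pi> j \<Gamma> A a r e" and se': "is_sem_ext C \<pi> j \<Gamma> A a r' e'"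
    and inp: "input_data C \<pi> j \<Gamma> A a"
  obtains t where "t \<in> hom C (Dom C r) (Dom C r')" "is_iso C t" "r' \<bullet> t = r" "reix C \<psi> t e' = e"
proof -
  note D = sem_extD[OF se] and D' = sem_extD[OF se']
  obtain t where t: "t \<in> hom C (Dom C r) (Dom C r')" "r' \<bullet> t = r" "reix C \<psi> t e' = e"
    using sem_ext_lift[OF se' D(1,3)] by blast
  obtain s where s: "s \<in> hom C (Dom C r') (Dom C r)" "r \<bullet> s = r'" "reix C \<psi> s e = e'"
    using sem_ext_lift[OF se D'(1,3)] by blast
  have ob: "Dom C r \<in> Ob C" "Dom C r' \<in> Ob C" using D(1) D'(1) hom_Ob by blast+
  have "s \<bullet> t = Idn C (Dom C r)"
  proof (rule sem_ext_eqI[OF se inp])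
    show "r \<bullet> s \<bullet> t = r \<bullet> Idn C (Dom C r)"
      using comp_reassoc[OF s(2)] s t D D' by (simp add: hom_iff)
    show "reix C \<psi> (s \<bullet> t) e = reix C \<psi> (Idn C (Dom C r)) e"
      using reix_reix[OF s(1) t(1) _ D(2)] reix_id[OF ob(1) _ D(2)] s t by simp
  qed (use s t ob in \<open>simp_all add: hom_iff\<close>)
  moreover have "t \<bullet> s = Idn C (Dom C r')"
  proof (rule sem_ext_eqI[OF se' inp])
    show "r' \<bullet> t \<bullet> s = r' \<bullet> Idn C (Dom C r')"
      using comp_reassoc[OF t(2)] s t D D' by (simp add: hom_iff)
    show "reix C \<psi> (t \<bullet> s) e' = reix C \<psi> (Idn C (Dom C r')) e'"
      using reix_reix[OF t(1) s(1) _ D'(2)] reix_id[OF ob(2) _ D'(2)] s t by simp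
  qed (use s t ob in \<open>simp_all add: hom_iff\<close>)
  ultimately have "is_iso C t" using s t unfolding is_iso_def by (auto simp: hom_iff)
  then show ?thesis using that t by blast
qed

text \<open>A map to the fibre product of \<open>\<Gamma>\<close> and \<open>Dom C r\<close> is a map \<open>\<sigma>\<close> to \<open>\<Gamma>\<close> with a lift of
  \<open>x \<bullet> \<sigma>\<close> through \<open>r\<close>, and such lifts are the total sections over the restriction along \<open>x \<bullet> \<sigma>\<close>.\<close>

lemma sem_ext_pullback:
  assumes se: "is_sem_ext C \<pi> j W A0 a0 r e" and inp: "input_data C \<pi> j W A0 a0"
    and x: "x \<in> hom C \<Gamma> W" and pb: "is_pullback C p v x r"
  shows "is_sem_ext C \<pi> j \<Gamma> (reix C \<psi> x A0) (reix C \<phi> x a0) p (reix C \<psi> v e)"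
  unfolding is_sem_ext_def
proof (intro conjI allI impI)
  note D = sem_extD[OF se] input_dataD[OF inp] pullbackD[OF pb]
  have p: "p \<in> hom C (Dom C p) \<Gamma>" and v: "v \<in> hom C (Dom C p) (Dom C r)" using D x by (auto simp: hom_iff)
  show "p \<in> hom C (Dom C p) \<Gamma>" by fact
  have rr: "reix C \<psi> p (reix C \<psi> x A0) = reix C \<psi> v (reix C \<psi> r A0)"
    "reix C \<phi> p (reix C \<phi> x a0) = reix C \<phi> v (reix C \<phi> r a0)"
    using reix_reix[OF x p] reix_reix[OF D(1) v] D by simp_all
  show "is_total_section C \<pi> j (Dom C p) (reix C \<psi> p (reix C \<psi> x A0)) (reix C \<phi> p (reix C \<phi> x a0)) (reix C \<psi> v e)"
    unfolding rr using total_section_reix[OF D(3) v] by simp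
  fix \<Delta> \<sigma> b
  assume *: "\<sigma> \<in> hom C \<Delta> \<Gamma> \<and>
    is_total_section C \<pi> j \<Delta> (reix C \<psi> \<sigma> (reix C \<psi> x A0)) (reix C \<phi> \<sigma> (reix C \<phi> x a0)) b"
  then have s: "\<sigma> \<in> hom C \<Delta> \<Gamma>" and xs: "x \<bullet> \<sigma> \<in> hom C \<Delta> W" using x comp_hom by auto
  have "is_total_section C \<pi> j \<Delta> (reix C \<psi> (x \<bullet> \<sigma>) A0) (reix C \<phi> (x \<bullet> \<sigma>) a0) b"
    using * reix_reix[OF x s] D by simp
  then obtain k where k: "k \<in> hom C \<Delta> (Dom C r)" "r \<bullet> k = x \<bullet> \<sigma>" "reix C \<psi> k e = b"
    using sem_ext_lift[OF se xs] by blast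
  obtain h where h: "h \<in> hom C \<Delta> (Dom C p)" "p \<bullet> h = \<sigma>" "v \<bullet> h = k"
    using pullback_lift[OF pb _ k(1)] k s x by (metis hom_iff)
  show "\<exists>!h. h \<in> hom C \<Delta> (Dom C p) \<and> p \<bullet> h = \<sigma> \<and> reix C \<psi> h (reix C \<psi> v e) = b"
  proof (rule ex1I[of _ h])
    show "h \<in> hom C \<Delta> (Dom C p) \<and> p \<bullet> h = \<sigma> \<and> reix C \<psi> h (reix C \<psi> v e) = b"
      using h k reix_reix[OF v h(1) _ D(2)] by simp
    fix h' assume h': "h' \<in> hom C \<Delta> (Dom C p) \<and> p \<bullet> h' = \<sigma> \<and> reix C \<psi> h' (reix C \<psi> v e) = b"
    then have "reix C \<psi> (v \<bullet> h') e = b" using reix_reix[OF v _ _ D(2), of h'] by auto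
    moreover have "r \<bullet> v \<bullet> h' = x \<bullet> \<sigma>"
      using square_reassoc[OF D(15)[symmetric]] h' D by (simp add: hom_iff)
    moreover have "v \<bullet> h' \<in> hom C \<Delta> (Dom C r)" using v h' comp_hom by blast
    ultimately have "v \<bullet> h' = k" using sem_ext_eqI[OF se inp _ k(1)] k by simp
    then show "h' = h" using pullback_eqI[OF pb] h h' by metis
  qed
qed

text \<open>
  Pullbacks are strictly functorial when they are written as compositions with a classifying map.
  An extension problem over \<open>\<Gamma>\<close> is named by a unique map \<open>\<chi> : \<Gamma> \<rightarrow> W\<close>, and reindexing along \<open>\<sigma>\<close> replaces
  \<open>\<chi>\<close> by \<open>\<chi> \<bullet> \<sigma>\<close>.  If \<open>T\<close> names the generic semantic extension type \<open>r\<close>, then the type \<open>T \<bullet> \<chi>\<close>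
  is stable by associativity.  The terms of \<open>T \<bullet> \<chi>\<close> correspond to the lifts of \<open>\<chi>\<close> through \<open>r\<close>, in
  a way that involves neither the chosen pullbacks over \<open>\<Gamma>\<close> nor the chosen semantic extension
  types; so abstraction and application are stable as well.
\<close>

theorem strict_interpretation:
  assumes gen: "is_generic_data C \<pi> j W A0 a0"
    and se: "is_sem_ext C \<pi> j W A0 a0 r e"
    and pb: "is_pullback C r q0 T \<pi>"
    and spl: "is_splitting C \<pi> p q"
  shows "\<exists>Ext \<theta>.
    is_interpretation C \<pi> p j Ext \<theta> \<and>
    (\<forall>\<Gamma> A a \<Delta> \<sigma>. input_data C \<pi> j \<Gamma> A a \<and> \<sigma> \<in> hom C \<Delta> \<Gamma> \<longrightarrow>
      (let A' = reix C \<psi> \<sigma> A; a' = reix C \<phi> \<sigma> a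
       in
        Ext \<Gamma> A a \<bullet> \<sigma> = Ext \<Delta> A' a' \<and>
        (\<forall>b. is_total_section C \<pi> j \<Gamma> A a b \<longrightarrow>
          ext_lam C \<pi> p q j Ext \<theta> \<Gamma> A a b \<bullet> \<sigma> = ext_lam C \<pi> p q j Ext \<theta> \<Delta> A' a' (reix C \<psi> \<sigma> b)) \<and>
        (\<forall>f s. is_term C \<pi> (Ext \<Gamma> A a) f \<and> s \<in> hom C \<Gamma> \<psi> \<longrightarrow>
          ext_app C \<pi> p q j Ext \<theta> \<Gamma> A a f s \<bullet> \<sigma> = ext_app C \<pi> p q j Ext \<theta> \<Delta> A' a' (f \<bullet> \<sigma>) (s \<bullet> \<sigma>))))"
proof -
  have inp0: "input_data C \<pi> j W A0 a0" using gen by (simp add: is_generic_data_def)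
  note D0 = input_dataD[OF inp0] and De = sem_extD[OF se] and Dp = pullbackD[OF pb]
  have T: "T \<in> hom C W (Cod C \<pi>)" using Dp De by (simp add: hom_iff)

  define \<chi> where "\<chi> \<Gamma> A a = (THE h. h \<in> hom C \<Gamma> W \<and> reix C \<psi> h A0 = A \<and> reix C \<phi> h a0 = a)" for \<Gamma> A a
  define Ext where "Ext \<Gamma> A a = T \<bullet> \<chi> \<Gamma> A a" for \<Gamma> A a
  have chi_ex: "\<exists>!h. h \<in> hom C \<Gamma> W \<and> reix C \<psi> h A0 = A \<and> reix C \<phi> h a0 = a"
    if "input_data C \<pi> j \<Gamma> A a" for \<Gamma> A a
    using gen that unfolding is_generic_data_def by blast
  have chi: "\<chi> \<Gamma> A a \<in> hom C \<Gamma> W" "reix C \<psi> (\<chi> \<Gamma> A a) A0 = A" "reix C \<phi> (\<chi> \<Gamma> A a) a0 = a"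
    if "input_data C \<pi> j \<Gamma> A a" for \<Gamma> A a
    using theI'[OF chi_ex[OF that]] by (auto simp: \<chi>_def)
  have chi_nat: "\<chi> \<Delta> (reix C \<psi> \<sigma> A) (reix C \<phi> \<sigma> a) = \<chi> \<Gamma> A a \<bullet> \<sigma>"
    if inp: "input_data C \<pi> j \<Gamma> A a" and s: "\<sigma> \<in> hom C \<Delta> \<Gamma>" for \<Gamma> A a \<Delta> \<sigma>
  proof -
    note c = chi[OF inp]
    have "reix C \<psi> (\<chi> \<Gamma> A a \<bullet> \<sigma>) A0 = reix C \<psi> \<sigma> A" "reix C \<phi> (\<chi> \<Gamma> A a \<bullet> \<sigma>) a0 = reix C \<phi> \<sigma> a"
      using reix_reix[OF c(1) s _ D0(2)] reix_reix[OF c(1) s _ D0(3)] c by simp_all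
    moreover have "\<chi> \<Gamma> A a \<bullet> \<sigma> \<in> hom C \<Delta> W" using c(1) s by (rule comp_hom)
    ultimately show ?thesis
      using chi_ex[OF input_data_reix[OF inp s]] chi[OF input_data_reix[OF inp s]] by auto
  qed
  have Ext: "Ext \<Gamma> A a \<in> hom C \<Gamma> (Cod C \<pi>)" if "input_data C \<pi> j \<Gamma> A a" for \<Gamma> A a
    unfolding Ext_def using T chi(1)[OF that] by (rule comp_hom)
  have pq: "is_pullback C (p (Ext \<Gamma> A a)) (q (Ext \<Gamma> A a)) (Ext \<Gamma> A a) \<pi>"
    if "input_data C \<pi> j \<Gamma> A a" for \<Gamma> A a
    using spl Ext[OF that] unfolding is_splitting_def by (auto simp: hom_iff)

  \<comment> \<open>The chosen pullback over \<open>\<Gamma>\<close> is a pullback of \<open>r\<close>, hence represents the extensions of \<open>a\<close>.\<close>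
  have "\<exists>v. v \<in> hom C (Dom C (p (Ext \<Gamma> A a))) (Dom C r) \<and> r \<bullet> v = \<chi> \<Gamma> A a \<bullet> p (Ext \<Gamma> A a) \<and>
      q0 \<bullet> v = q (Ext \<Gamma> A a)" if inp: "input_data C \<pi> j \<Gamma> A a" for \<Gamma> A a
  proof -
    note D = pullbackD[OF pq[OF inp]] chi(1)[OF inp] Ext[OF inp]
    have "Ext \<Gamma> A a \<bullet> x = T \<bullet> \<chi> \<Gamma> A a \<bullet> x" if "x \<in> hom C X \<Gamma>" for x X
      unfolding Ext_def using that T chi(1)[OF inp] by (simp add: hom_iff)
    moreover have "p (Ext \<Gamma> A a) \<in> hom C (Dom C (p (Ext \<Gamma> A a))) \<Gamma>"
      using D(3,6) Ext[OF inp] by (simp add: hom_iff)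
    ultimately have "T \<bullet> \<chi> \<Gamma> A a \<bullet> p (Ext \<Gamma> A a) = \<pi> \<bullet> q (Ext \<Gamma> A a)"
      using D(9) by metis
    then show ?thesis
      using pullback_lift[OF pb, of "\<chi> \<Gamma> A a \<bullet> p (Ext \<Gamma> A a)" "Dom C (p (Ext \<Gamma> A a))" "q (Ext \<Gamma> A a)"] D T
      by (auto simp: hom_iff)
  qed
  then obtain v where v: "v \<Gamma> A a \<in> hom C (Dom C (p (Ext \<Gamma> A a))) (Dom C r)"
      "r \<bullet> v \<Gamma> A a = \<chi> \<Gamma> A a \<bullet> p (Ext \<Gamma> A a)" "q0 \<bullet> v \<Gamma> A a = q (Ext \<Gamma> A a)"
      if "input_data C \<pi> j \<Gamma> A a" for \<Gamma> A a
    by metis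
  have se': "is_sem_ext C \<pi> j \<Gamma> A a (p (Ext \<Gamma> A a)) (reix C \<psi> (v \<Gamma> A a) e)"
    if inp: "input_data C \<pi> j \<Gamma> A a" for \<Gamma> A a
  proof -
    have "is_pullback C (p (Ext \<Gamma> A a)) (v \<Gamma> A a) (\<chi> \<Gamma> A a) r"
      using pullback_cancel[OF pb pq[OF inp, unfolded Ext_def]] v[OF inp, unfolded Ext_def] chi(1)[OF inp] T
      by (simp add: hom_iff Ext_def)
    from sem_ext_pullback[OF se inp0 chi(1)[OF inp] this] show ?thesis using chi[OF inp] by simp
  qed
  have sem: "is_sem_ext C \<pi> j \<Gamma> A a (sem_ext C \<pi> j \<Gamma> A a) (sem_ext_univ C \<pi> j \<Gamma> A a)"
    if inp: "input_data C \<pi> j \<Gamma> A a" for \<Gamma> A a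
  proof -
    have "\<exists>re. is_sem_ext C \<pi> j \<Gamma> A a (fst re) (snd re)" using se'[OF inp] by auto
    then show ?thesis unfolding sem_ext_def sem_ext_univ_def by (rule someI_ex)
  qed
  have "\<exists>t. t \<in> hom C (Dom C (p (Ext \<Gamma> A a))) (Dom C (sem_ext C \<pi> j \<Gamma> A a)) \<and> is_iso C t \<and>
      sem_ext C \<pi> j \<Gamma> A a \<bullet> t = p (Ext \<Gamma> A a) \<and>
      reix C \<psi> t (sem_ext_univ C \<pi> j \<Gamma> A a) = reix C \<psi> (v \<Gamma> A a) e"
    if inp: "input_data C \<pi> j \<Gamma> A a" for \<Gamma> A a
    using sem_ext_compare[OF se'[OF inp] sem[OF inp] inp] by metis
  then obtain \<theta> where \<theta>: "\<theta> \<Gamma> A a \<in> hom C (Dom C (p (Ext \<Gamma> A a))) (Dom C (sem_ext C \<pi> j \<Gamma> A a))"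
      "is_iso C (\<theta> \<Gamma> A a)" "sem_ext C \<pi> j \<Gamma> A a \<bullet> \<theta> \<Gamma> A a = p (Ext \<Gamma> A a)"
      "reix C \<psi> (\<theta> \<Gamma> A a) (sem_ext_univ C \<pi> j \<Gamma> A a) = reix C \<psi> (v \<Gamma> A a) e"
      if "input_data C \<pi> j \<Gamma> A a" for \<Gamma> A a
    by metis
  have interp: "is_interpretation C \<pi> p j Ext \<theta>"
    unfolding is_interpretation_def using sem Ext \<theta> by blast

  \<comment> \<open>The term \<open>f\<close> corresponds to the lift \<open>l\<close> of the classifying map, and its total section is
    the restriction of \<open>e\<close> along \<open>l\<close>.\<close>
  let ?lift = "\<lambda>\<Gamma> A a f l. l \<in> hom C \<Gamma> (Dom C r) \<and> r \<bullet> l = \<chi> \<Gamma> A a \<and> q0 \<bullet> l = f"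
  let ?tot = "\<lambda>\<Gamma> A a f. total_of C \<pi> p q j Ext \<theta> \<Gamma> A a f"
  have term_lift: "\<exists>l. ?lift \<Gamma> A a f l \<and> ?tot \<Gamma> A a f = reix C \<psi> l e"
    if inp: "input_data C \<pi> j \<Gamma> A a" and f: "is_term C \<pi> (Ext \<Gamma> A a) f" for \<Gamma> A a f
  proof -
    note D = pullbackD[OF pq[OF inp]] chi(1)[OF inp] Ext[OF inp] v[OF inp]
    let ?P = "\<lambda>t. t \<in> hom C (Dom C (Ext \<Gamma> A a)) (Dom C (p (Ext \<Gamma> A a))) \<and>
      p (Ext \<Gamma> A a) \<bullet> t = Idn C (Dom C (Ext \<Gamma> A a)) \<and> q (Ext \<Gamma> A a) \<bullet> t = f"
    have "Ext \<Gamma> A a \<bullet> Idn C (Dom C (Ext \<Gamma> A a)) = \<pi> \<bullet> f" "f \<in> hom C (Dom C (Ext \<Gamma> A a)) (Dom C \<pi>)"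
      "Idn C (Dom C (Ext \<Gamma> A a)) \<in> hom C (Dom C (Ext \<Gamma> A a)) (Dom C (Ext \<Gamma> A a))"
      using f D(1) by (simp_all add: is_term_def)
    then have "\<exists>t. ?P t" using pullback_lift[OF pq[OF inp]] by metis
    moreover have "t = t'" if "?P t" "?P t'" for t t'
      by (rule pullback_eqI[OF pq[OF inp], of t "Dom C (Ext \<Gamma> A a)" t']) (use that in simp_all)
    ultimately have "\<exists>!t. ?P t" by (rule ex_ex1I)
    then have "?P (term_section C p q (Ext \<Gamma> A a) f)"
      unfolding term_section_def by (rule theI')
    moreover define t where "t = term_section C p q (Ext \<Gamma> A a) f"
    moreover have "Dom C (Ext \<Gamma> A a) = \<Gamma>" using Ext[OF inp] by (simp add: hom_iff)
    ultimately have t: "t \<in> hom C \<Gamma> (Dom C (p (Ext \<Gamma> A a)))" "p (Ext \<Gamma> A a) \<bullet> t = Idn C \<Gamma>" "q (Ext \<Gamma> A a) \<bullet> t = f"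
      by simp_all
    have "?tot \<Gamma> A a f = reix C \<psi> (\<theta> \<Gamma> A a \<bullet> t) (sem_ext_univ C \<pi> j \<Gamma> A a)"
      by (simp add: total_of_def t_def)
    also have "\<dots> = reix C \<psi> t (reix C \<psi> (v \<Gamma> A a) e)"
      using reix_reix[OF \<theta>(1)[OF inp] t(1) _ sem_extD(2)[OF sem[OF inp]]] \<theta>(4)[OF inp] by simp
    also have "\<dots> = reix C \<psi> (v \<Gamma> A a \<bullet> t) e"
      using reix_reix[OF v(1)[OF inp] t(1) _ De(2)] by simp
    finally have "?tot \<Gamma> A a f = reix C \<psi> (v \<Gamma> A a \<bullet> t) e" .
    moreover have "v \<Gamma> A a \<bullet> t \<in> hom C \<Gamma> (Dom C r)" using v(1)[OF inp] t(1) by (rule comp_hom)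
    moreover have "r \<bullet> v \<Gamma> A a \<bullet> t = \<chi> \<Gamma> A a"
    proof -
      have "r \<bullet> v \<Gamma> A a \<bullet> t = \<chi> \<Gamma> A a \<bullet> p (Ext \<Gamma> A a) \<bullet> t"
        using square_reassoc[OF v(2)[OF inp]] D t Dp by (simp add: hom_iff)
      then show ?thesis using t(2) chi(1)[OF inp] by (simp add: hom_iff)
    qed
    moreover have "q0 \<bullet> v \<Gamma> A a \<bullet> t = f"
      using comp_reassoc[OF v(3)[OF inp]] D t Dp by (simp add: hom_iff)
    ultimately show ?thesis by blast
  qed
  have lift_unique: "l = l'" if "?lift \<Gamma> A a f l" "?lift \<Gamma> A a f l'" for \<Gamma> A a f l l'
    by (rule pullback_eqI[OF pb, of l \<Gamma> l']) (use that in simp_all)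
  have lift_term: "is_term C \<pi> (Ext \<Gamma> A a) f"
    if inp: "input_data C \<pi> j \<Gamma> A a" and l: "?lift \<Gamma> A a f l" for \<Gamma> A a f l
  proof -
    have "T \<bullet> r \<bullet> l = \<pi> \<bullet> q0 \<bullet> l"
      by (rule square_reassoc[OF Dp(9)]) (use l Dp in \<open>auto simp: hom_iff\<close>)
    then have "\<pi> \<bullet> f = T \<bullet> r \<bullet> l" using l by metis
    moreover have "f \<in> hom C \<Gamma> (Dom C \<pi>)" using l Dp by (auto simp: hom_iff)
    ultimately show ?thesis using l Ext[OF inp] unfolding is_term_def by (simp add: hom_iff Ext_def)
  qed
  have lift_nat: "?lift \<Delta> (reix C \<psi> \<sigma> A) (reix C \<phi> \<sigma> a) (f \<bullet> \<sigma>) (l \<bullet> \<sigma>)"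
    if inp: "input_data C \<pi> j \<Gamma> A a" and s: "\<sigma> \<in> hom C \<Delta> \<Gamma>" and l: "?lift \<Gamma> A a f l" for \<Gamma> A a \<Delta> \<sigma> f l
    using comp_reassoc[of r l "\<chi> \<Gamma> A a" \<sigma>] comp_reassoc[of q0 l f \<sigma>] l s Dp chi_nat[OF inp s]
    by (simp add: hom_iff)
  have tot_nat: "?tot \<Delta> (reix C \<psi> \<sigma> A) (reix C \<phi> \<sigma> a) (f \<bullet> \<sigma>) = reix C \<psi> \<sigma> (?tot \<Gamma> A a f)"
    "is_term C \<pi> (Ext \<Delta> (reix C \<psi> \<sigma> A) (reix C \<phi> \<sigma> a)) (f \<bullet> \<sigma>)"
    "?tot \<Gamma> A a f \<in> hom C (prod_ob C \<Gamma> \<psi>) (Dom C \<pi>)"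
    if inp: "input_data C \<pi> j \<Gamma> A a" and s: "\<sigma> \<in> hom C \<Delta> \<Gamma>" and f: "is_term C \<pi> (Ext \<Gamma> A a) f"
    for \<Gamma> A a \<Delta> \<sigma> f
  proof -
    have inp': "input_data C \<pi> j \<Delta> (reix C \<psi> \<sigma> A) (reix C \<phi> \<sigma> a)" using input_data_reix[OF inp s] by simp
    obtain l where l: "?lift \<Gamma> A a f l" "?tot \<Gamma> A a f = reix C \<psi> l e" using term_lift[OF inp f] by blast
    note n = lift_nat[OF inp s l(1)]
    show f': "is_term C \<pi> (Ext \<Delta> (reix C \<psi> \<sigma> A) (reix C \<phi> \<sigma> a)) (f \<bullet> \<sigma>)" using lift_term[OF inp' n] .
    obtain l' where l': "?lift \<Delta> (reix C \<psi> \<sigma> A) (reix C \<phi> \<sigma> a) (f \<bullet> \<sigma>) l'"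
      "?tot \<Delta> (reix C \<psi> \<sigma> A) (reix C \<phi> \<sigma> a) (f \<bullet> \<sigma>) = reix C \<psi> l' e"
      using term_lift[OF inp' f'] by blast
    have "l' = l \<bullet> \<sigma>" using lift_unique[OF l'(1) n] .
    then show "?tot \<Delta> (reix C \<psi> \<sigma> A) (reix C \<phi> \<sigma> a) (f \<bullet> \<sigma>) = reix C \<psi> \<sigma> (?tot \<Gamma> A a f)"
      using l' l reix_reix[OF _ s _ De(2), of l] by simp
    show "?tot \<Gamma> A a f \<in> hom C (prod_ob C \<Gamma> \<psi>) (Dom C \<pi>)"
      using l reix_hom[OF _ _ De(2), of l] by simp
  qed
  have lam: "\<exists>!f. is_term C \<pi> (Ext \<Gamma> A a) f \<and> ?tot \<Gamma> A a f = b"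
    if inp: "input_data C \<pi> j \<Gamma> A a" and b: "is_total_section C \<pi> j \<Gamma> A a b" for \<Gamma> A a b
  proof -
    obtain l where l: "l \<in> hom C \<Gamma> (Dom C r)" "r \<bullet> l = \<chi> \<Gamma> A a" "reix C \<psi> l e = b"
      using sem_ext_lift[OF se chi(1)[OF inp]] b chi[OF inp] by metis
    then have ll: "?lift \<Gamma> A a (q0 \<bullet> l) l" by simp
    have tm: "is_term C \<pi> (Ext \<Gamma> A a) (q0 \<bullet> l)" using lift_term[OF inp ll] .
    obtain l' where l': "?lift \<Gamma> A a (q0 \<bullet> l) l'" "?tot \<Gamma> A a (q0 \<bullet> l) = reix C \<psi> l' e"
      using term_lift[OF inp tm] by blast
    have tot: "?tot \<Gamma> A a (q0 \<bullet> l) = b" using lift_unique[OF l'(1) ll] l' l by simp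
    show ?thesis
    proof (rule ex1I[of _ "q0 \<bullet> l"])
      fix f assume f: "is_term C \<pi> (Ext \<Gamma> A a) f \<and> ?tot \<Gamma> A a f = b"
      then obtain k where k: "?lift \<Gamma> A a f k" "?tot \<Gamma> A a f = reix C \<psi> k e"
        using term_lift[OF inp] by blast
      have "k = l" using sem_ext_eqI[OF se inp0 _ l(1), of k] k l f by simp
      then show "f = q0 \<bullet> l" using k by simp
    qed (use tm tot in simp)
  qed
  have "Ext \<Gamma> A a \<bullet> \<sigma> = Ext \<Delta> (reix C \<psi> \<sigma> A) (reix C \<phi> \<sigma> a)"
    if inp: "input_data C \<pi> j \<Gamma> A a" and s: "\<sigma> \<in> hom C \<Delta> \<Gamma>" for \<Gamma> A a \<Delta> \<sigma>
    using chi_nat[OF inp s] chi(1)[OF inp] s T by (simp add: Ext_def hom_iff)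
  moreover have "ext_lam C \<pi> p q j Ext \<theta> \<Gamma> A a b \<bullet> \<sigma> =
      ext_lam C \<pi> p q j Ext \<theta> \<Delta> (reix C \<psi> \<sigma> A) (reix C \<phi> \<sigma> a) (reix C \<psi> \<sigma> b)"
    if inp: "input_data C \<pi> j \<Gamma> A a" and s: "\<sigma> \<in> hom C \<Delta> \<Gamma>" and b: "is_total_section C \<pi> j \<Gamma> A a b" for \<Gamma> A a \<Delta> \<sigma> b
  proof -
    have inp': "input_data C \<pi> j \<Delta> (reix C \<psi> \<sigma> A) (reix C \<phi> \<sigma> a)" using input_data_reix[OF inp s] by simp
    have b': "is_total_section C \<pi> j \<Delta> (reix C \<psi> \<sigma> A) (reix C \<phi> \<sigma> a) (reix C \<psi> \<sigma> b)"
      using total_section_reix[OF b s] by simp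
    define f where "f = ext_lam C \<pi> p q j Ext \<theta> \<Gamma> A a b"
    have f: "is_term C \<pi> (Ext \<Gamma> A a) f" "?tot \<Gamma> A a f = b"
      using theI'[OF lam[OF inp b]] by (auto simp: f_def ext_lam_def)
    have "is_term C \<pi> (Ext \<Delta> (reix C \<psi> \<sigma> A) (reix C \<phi> \<sigma> a)) (f \<bullet> \<sigma>) \<and>
        ?tot \<Delta> (reix C \<psi> \<sigma> A) (reix C \<phi> \<sigma> a) (f \<bullet> \<sigma>) = reix C \<psi> \<sigma> b"
      using tot_nat[OF inp s f(1)] f by simp
    then have "ext_lam C \<pi> p q j Ext \<theta> \<Delta> (reix C \<psi> \<sigma> A) (reix C \<phi> \<sigma> a) (reix C \<psi> \<sigma> b) = f \<bullet> \<sigma>"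
      unfolding ext_lam_def by (rule the1_equality[OF lam[OF inp' b']])
    then show ?thesis by (simp add: f_def)
  qed
  moreover have "ext_app C \<pi> p q j Ext \<theta> \<Gamma> A a f s \<bullet> \<sigma> =
      ext_app C \<pi> p q j Ext \<theta> \<Delta> (reix C \<psi> \<sigma> A) (reix C \<phi> \<sigma> a) (f \<bullet> \<sigma>) (s \<bullet> \<sigma>)"
    if inp: "input_data C \<pi> j \<Gamma> A a" and s: "\<sigma> \<in> hom C \<Delta> \<Gamma>" and f: "is_term C \<pi> (Ext \<Gamma> A a) f"
      and x: "s \<in> hom C \<Gamma> \<psi>" for \<Gamma> A a \<Delta> \<sigma> f s
  proof -
    note n = tot_nat[OF inp s f]
    have ob: "\<Gamma> \<in> Ob C" "\<Delta> \<in> Ob C" using hom_Ob[OF s] by simp_all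
    have "pairing C (Idn C \<Gamma>) s \<bullet> \<sigma> = pairing C \<sigma> (s \<bullet> \<sigma>)"
      using pairing_comp[of "Idn C \<Gamma>" s \<sigma>] s x ob by (simp add: hom_iff)
    also have "\<dots> = prod_ar C \<sigma> (Idn C \<psi>) \<bullet> pairing C (Idn C \<Delta>) (s \<bullet> \<sigma>)"
      using prod_ar_pairing[of \<sigma> "Idn C \<psi>" "Idn C \<Delta>" "s \<bullet> \<sigma>"] s x ob by (simp add: hom_iff)
    finally have "?tot \<Gamma> A a f \<bullet> pairing C (Idn C \<Gamma>) s \<bullet> \<sigma> =
        ?tot \<Gamma> A a f \<bullet> prod_ar C \<sigma> (Idn C \<psi>) \<bullet> pairing C (Idn C \<Delta>) (s \<bullet> \<sigma>)" by simp
    then show ?thesis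
      unfolding ext_app_def n(1) reix_def[of C \<psi> \<sigma> "?tot \<Gamma> A a f"] using s x n(3) ob by (simp add: hom_iff)
  qed
  ultimately show ?thesis using interp unfolding Let_def by blast
qed

end

section \<open>The generic extension problem\<close>

definition is_exponential :: "('o, 'm, 'z) cat_scheme \<Rightarrow> 'o \<Rightarrow> 'o \<Rightarrow> 'o \<Rightarrow> 'm \<Rightarrow> bool" where
  "is_exponential C X Z P ev \<longleftrightarrow> P \<in> Ob C \<and> ev \<in> hom C (prod_ob C P X) Z \<and>
     (\<forall>\<Gamma> b. \<Gamma> \<in> Ob C \<and> b \<in> hom C (prod_ob C \<Gamma> X) Z \<longrightarrow> (\<exists>!h. h \<in> hom C \<Gamma> P \<and> reix C X h ev = b))"

context cat_ctx
begin

lemma exponential_lift: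
  assumes "is_exponential C X Z P ev" "\<Gamma> \<in> Ob C" "b \<in> hom C (prod_ob C \<Gamma> X) Z"
  obtains h where "h \<in> hom C \<Gamma> P" "reix C X h ev = b"
  using assms unfolding is_exponential_def by blast

end

context prod_ctx
begin

lemma exponential_eqI:
  assumes ex: "is_exponential C X Z P ev" and X: "X \<in> Ob C" and h: "h \<in> hom C \<Gamma> P" "h' \<in> hom C \<Gamma> P"
    and eq: "reix C X h ev = reix C X h' ev"
  shows "h = h'"
proof -
  have "reix C X h ev \<in> hom C (prod_ob C \<Gamma> X) Z"
    using ex X h(1) unfolding is_exponential_def by (blast intro: reix_hom)
  moreover have "\<Gamma> \<in> Ob C" using h(1) hom_Ob by blast
  ultimately have "\<exists>!k. k \<in> hom C \<Gamma> P \<and> reix C X k ev = reix C X h ev"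
    using ex unfolding is_exponential_def by blast
  then show ?thesis using h eq by metis
qed

lemma reix_base_hom:
  assumes "\<sigma> \<in> hom C \<Delta> \<Gamma>" "X \<in> Ob C"
  shows "prod_ar C \<sigma> (Idn C X) \<in> hom C (prod_ob C \<Delta> X) (prod_ob C \<Gamma> X)"
  using assms by (simp add: hom_iff)

lemma is_pullback_prod:
  assumes p: "p \<in> hom C Q P" and X: "X \<in> Ob C"
  shows "is_pullback C (pr1 C Q X) (prod_ar C p (Idn C X)) p (pr1 C P X)"
proof (rule pullbackI)
  have ob: "Q \<in> Ob C" "P \<in> Ob C" using hom_Ob[OF p] .
  have pA: "p \<in> Ar C" "Dom C p = Q" "Cod C p = P" using p by (simp_all add: hom_iff)
  show "p \<in> Ar C" "pr1 C P X \<in> Ar C" "Cod C p = Cod C (pr1 C P X)"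
    "pr1 C Q X \<in> hom C (prod_ob C Q X) (Dom C p)"
    "prod_ar C p (Idn C X) \<in> hom C (prod_ob C Q X) (Dom C (pr1 C P X))"
    "p \<bullet> pr1 C Q X = pr1 C P X \<bullet> prod_ar C p (Idn C X)"
    using pA ob X by (simp_all add: hom_iff)
  fix W
  {
    fix u v assume u: "u \<in> hom C W (Dom C p)" and v: "v \<in> hom C W (Dom C (pr1 C P X))"
      and eq: "p \<bullet> u = pr1 C P X \<bullet> v"
    have v': "v \<in> Ar C" "Dom C v = W" "Cod C v = prod_ob C P X" using v ob X by (simp_all add: hom_iff)
    have u': "u \<in> Ar C" "Dom C u = W" "Cod C u = Q" using u pA by (simp_all add: hom_iff)
    let ?h = "pairing C u (pr2 C P X \<bullet> v)"
    have h: "?h \<in> hom C W (prod_ob C Q X)" using u' v' ob X by (simp add: hom_iff)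
    moreover have "prod_ar C p (Idn C X) \<bullet> ?h = v"
      by (rule prod_eqI[of _ W P X]) (use u' v' pA ob X eq in \<open>simp_all add: hom_iff\<close>)
    moreover have "pr1 C Q X \<bullet> ?h = u" using u' v' ob X by simp
    ultimately show "\<exists>h. h \<in> hom C W (prod_ob C Q X) \<and> pr1 C Q X \<bullet> h = u \<and> prod_ar C p (Idn C X) \<bullet> h = v"
      by blast
  next
    fix h h' assume h: "h \<in> hom C W (prod_ob C Q X)" "h' \<in> hom C W (prod_ob C Q X)"
      and eq: "pr1 C Q X \<bullet> h = pr1 C Q X \<bullet> h'" "prod_ar C p (Idn C X) \<bullet> h = prod_ar C p (Idn C X) \<bullet> h'"
    have "pr2 C P X \<bullet> prod_ar C p (Idn C X) \<bullet> h = pr2 C P X \<bullet> prod_ar C p (Idn C X) \<bullet> h'"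
      using eq by simp
    then have "pr2 C Q X \<bullet> h = pr2 C Q X \<bullet> h'"
      using h pA ob X by (simp add: hom_iff)
    then show "h = h'" using prod_eqI[OF h] ob X eq by blast
  }
qed

text \<open>
  Write \<open>\<epsilon>U\<close> and \<open>\<epsilon>E\<close> for the evaluation maps of exponentials \<open>P = U\<^sup>X\<close> and \<open>Q = E\<^sup>X\<close>.  Post-composition
  with \<open>\<pi> : E \<rightarrow> U\<close> is a map \<open>p : Q \<rightarrow> P\<close>, and it is the dependent product, along the projection
  from \<open>P \<times> X\<close> to \<open>P\<close>, of the pullback of \<open>\<pi>\<close> along \<open>\<epsilon>U\<close>: a section of that pullback over
  \<open>\<Gamma> \<times> X\<close> is a lift of a map \<open>\<Gamma> \<times> X \<rightarrow> U\<close> through \<open>\<pi>\<close>.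
\<close>

lemma exponential_dep_prod:
  assumes X: "X \<in> Ob C" and pi: "\<pi> \<in> Ar C"
    and exU: "is_exponential C X (Cod C \<pi>) P \<epsilon>U" and exE: "is_exponential C X (Dom C \<pi>) Q \<epsilon>E"
    and p: "p \<in> hom C Q P" "reix C X p \<epsilon>U = \<pi> \<bullet> \<epsilon>E"
    and g: "is_pullback C g q \<epsilon>U \<pi>"
  shows "\<exists>q1 q2 \<epsilon>. is_dep_prod C (pr1 C P X) g p q1 q2 \<epsilon>"
proof -
  have ob: "Q \<in> Ob C" "P \<in> Ob C" using hom_Ob[OF p(1)] .
  have eU: "\<epsilon>U \<in> hom C (prod_ob C P X) (Cod C \<pi>)" and eE: "\<epsilon>E \<in> hom C (prod_ob C Q X) (Dom C \<pi>)"
    using exU exE by (auto simp: is_exponential_def)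
  have pA: "p \<in> Ar C" "Dom C p = Q" "Cod C p = P" using p by (simp_all add: hom_iff)
  have eA: "\<epsilon>U \<in> Ar C" "Dom C \<epsilon>U = prod_ob C P X" "Cod C \<epsilon>U = Cod C \<pi>"
    "\<epsilon>E \<in> Ar C" "Dom C \<epsilon>E = prod_ob C Q X" "Cod C \<epsilon>E = Dom C \<pi>"
    using eU eE by (simp_all add: hom_iff)
  let ?p = "prod_ar C p (Idn C X)"
  note Dg = pullbackD[OF g]
  have p': "?p \<in> hom C (prod_ob C Q X) (prod_ob C P X)" using p X by (rule_tac reix_base_hom)
  have pA': "?p \<in> Ar C" "Dom C ?p = prod_ob C Q X" "Cod C ?p = prod_ob C P X"
    using pA ob X by simp_all
  have "\<epsilon>U \<bullet> ?p = \<pi> \<bullet> \<epsilon>E" using p(2) by (simp add: reix_def)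
  then obtain \<epsilon> where \<epsilon>: "\<epsilon> \<in> hom C (prod_ob C Q X) (Dom C g)" "g \<bullet> \<epsilon> = ?p" "q \<bullet> \<epsilon> = \<epsilon>E"
    using pullback_lift[OF g _ eE] p' eA(2) by metis
  have \<epsilon>A: "\<epsilon> \<in> Ar C" "Dom C \<epsilon> = prod_ob C Q X" "Cod C \<epsilon> = Dom C g" using \<epsilon> by (simp_all add: hom_iff)
  have gA: "g \<in> Ar C" "Cod C g = prod_ob C P X" "q \<in> Ar C" "Dom C q = Dom C g" "Cod C q = Dom C \<pi>"
    using Dg eA by simp_all
  have "is_dep_prod C (pr1 C P X) g p (pr1 C Q X) ?p \<epsilon>"
    unfolding is_dep_prod_def
  proof (intro conjI allI impI)
    show "pr1 C P X \<in> Ar C" "g \<in> Ar C" "Cod C g = Dom C (pr1 C P X)" "g \<bullet> \<epsilon> = ?p"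
      using ob X gA \<epsilon> by simp_all
    show "is_pullback C (pr1 C Q X) ?p p (pr1 C P X)" using p(1) X by (rule is_pullback_prod)
    show "\<epsilon> \<in> hom C (Dom C ?p) (Dom C g)" using \<epsilon> pA' by simp
    fix b r1 r2 v
    assume pb: "is_pullback C r1 r2 b (pr1 C P X)" and v: "v \<in> hom C (Dom C r2) (Dom C g) \<and> g \<bullet> v = r2"
    note Dr = pullbackD[OF pb]
    define B where "B = Dom C b"
    have bA: "b \<in> Ar C" "Dom C b = B" "Cod C b = P" and B: "B \<in> Ob C" using Dr ob X by (simp_all add: B_def)
    have b: "b \<in> hom C B P" using bA by (simp add: hom_iff)
    have rA: "r1 \<in> Ar C" "Cod C r1 = B" "r2 \<in> Ar C" "Cod C r2 = prod_ob C P X" "Dom C r1 = Dom C r2"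
      using Dr ob X bA by simp_all
    have vA: "v \<in> Ar C" "Dom C v = Dom C r2" "Cod C v = Dom C g" "g \<bullet> v = r2" using v by (simp_all add: hom_iff)
    let ?b = "prod_ar C b (Idn C X)"
    have pbB: "is_pullback C (pr1 C B X) ?b b (pr1 C P X)" using b X by (rule is_pullback_prod)
    have bA': "?b \<in> Ar C" "Dom C ?b = prod_ob C B X" "Cod C ?b = prod_ob C P X"
      using bA B X by simp_all
    obtain i where i: "i \<in> hom C (prod_ob C B X) (Dom C r1)" "r1 \<bullet> i = pr1 C B X" "r2 \<bullet> i = ?b"
    proof (rule pullback_lift[OF pb])
      show "b \<bullet> pr1 C B X = pr1 C P X \<bullet> ?b" using pullbackD(9)[OF pbB] .
      show "pr1 C B X \<in> hom C (prod_ob C B X) (Dom C b)" "?b \<in> hom C (prod_ob C B X) (Dom C (pr1 C P X))"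
        using bA bA' B X ob by (simp_all add: hom_iff)
    qed
    have iA: "i \<in> Ar C" "Dom C i = prod_ob C B X" "Cod C i = Dom C r2" using i rA by (simp_all add: hom_iff)
    obtain k where k: "k \<in> hom C (Dom C r2) (prod_ob C B X)" "pr1 C B X \<bullet> k = r1" "?b \<bullet> k = r2"
    proof (rule pullback_lift[OF pbB, of r1 "Dom C r2" r2])
      show "r1 \<in> hom C (Dom C r2) (Dom C b)" "r2 \<in> hom C (Dom C r2) (Dom C (pr1 C P X))"
        using rA bA ob X by (simp_all add: hom_iff)
      show "b \<bullet> r1 = pr1 C P X \<bullet> r2" using Dr by simp
    qed (use that B X in simp)
    have kA: "k \<in> Ar C" "Dom C k = Dom C r2" "Cod C k = prod_ob C B X" using k by (simp_all add: hom_iff)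
    have ik: "i \<bullet> k = Idn C (Dom C r2)"
    proof (rule pullback_eqI[OF pb])
      show "r1 \<bullet> i \<bullet> k = r1 \<bullet> Idn C (Dom C r2)"
        using comp_reassoc[OF i(2)] k(2) iA kA rA by simp
      show "r2 \<bullet> i \<bullet> k = r2 \<bullet> Idn C (Dom C r2)"
        using comp_reassoc[OF i(3)] k(3) iA kA rA by simp
    qed (use iA kA rA in \<open>simp_all add: hom_iff\<close>)
    have unit: "k \<bullet> i = Idn C (prod_ob C B X)"
    proof (rule pullback_eqI[OF pbB])
      show "pr1 C B X \<bullet> k \<bullet> i = pr1 C B X \<bullet> Idn C (prod_ob C B X)"
        using comp_reassoc[OF k(2)] i(2) iA kA rA B X by simp
      show "?b \<bullet> k \<bullet> i = ?b \<bullet> Idn C (prod_ob C B X)"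
        using comp_reassoc[OF k(3)] i(3) iA kA rA bA' by simp
    qed (use iA kA rA B X in \<open>simp_all add: hom_iff\<close>)
    have qvi: "q \<bullet> v \<bullet> i \<in> hom C (prod_ob C B X) (Dom C \<pi>)" using gA vA iA by (simp add: hom_iff)
    have gvi: "g \<bullet> v \<bullet> i = ?b" using comp_reassoc[OF vA(4)] gA vA iA i(3) by simp
    \<comment> \<open>The condition on \<open>x\<close> amounts to \<open>x\<close> being the transpose of the lift \<open>q \<bullet> v \<bullet> i\<close>.\<close>
    have char: "(x \<in> hom C (Dom C b) (Dom C p) \<and> p \<bullet> x = b \<and>
             (\<exists>w. w \<in> hom C (Dom C r2) (Dom C ?p) \<and> pr1 C Q X \<bullet> w = x \<bullet> r1 \<and> ?p \<bullet> w = r2 \<and> \<epsilon> \<bullet> w = v)) \<longleftrightarrow>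
          (x \<in> hom C B Q \<and> reix C X x \<epsilon>E = q \<bullet> v \<bullet> i)" for x
    proof (intro iffI conjI)
      assume *: "x \<in> hom C (Dom C b) (Dom C p) \<and> p \<bullet> x = b \<and>
             (\<exists>w. w \<in> hom C (Dom C r2) (Dom C ?p) \<and> pr1 C Q X \<bullet> w = x \<bullet> r1 \<and> ?p \<bullet> w = r2 \<and> \<epsilon> \<bullet> w = v)"
      then show x: "x \<in> hom C B Q" using bA pA by simp
      then have xA: "x \<in> Ar C" "Dom C x = B" "Cod C x = Q" by (simp_all add: hom_iff)
      obtain w where w: "w \<in> hom C (Dom C r2) (prod_ob C Q X)" "pr1 C Q X \<bullet> w = x \<bullet> r1" "?p \<bullet> w = r2" "\<epsilon> \<bullet> w = v"
        using * pA' by auto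
      have wA: "w \<in> Ar C" "Dom C w = Dom C r2" "Cod C w = prod_ob C Q X" using w by (simp_all add: hom_iff)
      have "w \<bullet> i = prod_ar C x (Idn C X)"
      proof (rule pullback_eqI[OF is_pullback_prod[OF p(1) X]])
        show "pr1 C Q X \<bullet> w \<bullet> i = pr1 C Q X \<bullet> prod_ar C x (Idn C X)"
          using square_reassoc[OF w(2)] i(2) wA iA xA rA ob X by simp
        have "?p \<bullet> w \<bullet> i = ?b" using comp_reassoc[OF w(3)] i(3) wA iA pA' by simp
        moreover have "?p \<bullet> prod_ar C x (Idn C X) = ?b"
          using prod_ar_comp[of p "Idn C X" x "Idn C X"] * pA xA X by simp
        ultimately show "?p \<bullet> w \<bullet> i = ?p \<bullet> prod_ar C x (Idn C X)" by simp
      qed (use wA iA xA ob X in \<open>simp_all add: hom_iff\<close>)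
      moreover have "q \<bullet> v \<bullet> i = \<epsilon>E \<bullet> w \<bullet> i"
      proof -
        have "v \<bullet> i = \<epsilon> \<bullet> w \<bullet> i" using comp_reassoc[OF w(4)] \<epsilon>A wA iA by simp
        then show ?thesis using comp_reassoc[OF \<epsilon>(3), of "w \<bullet> i"] \<epsilon>A wA iA gA by simp
      qed
      ultimately show "reix C X x \<epsilon>E = q \<bullet> v \<bullet> i" by (simp add: reix_def)
    next
      assume *: "x \<in> hom C B Q \<and> reix C X x \<epsilon>E = q \<bullet> v \<bullet> i"
      then have xA: "x \<in> Ar C" "Dom C x = B" "Cod C x = Q" and x: "x \<in> hom C B Q" by (simp_all add: hom_iff)
      show "x \<in> hom C (Dom C b) (Dom C p)" using x pA bA by simp
      let ?x = "prod_ar C x (Idn C X)"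
      have xA': "?x \<in> Ar C" "Dom C ?x = prod_ob C B X" "Cod C ?x = prod_ob C Q X" using xA X by simp_all
      show px: "p \<bullet> x = b"
      proof (rule exponential_eqI[OF exU X])
        have "reix C X (p \<bullet> x) \<epsilon>U = reix C X x (\<pi> \<bullet> \<epsilon>E)" using reix_reix[OF p(1) x X eU] p(2) by simp
        also have "\<dots> = \<pi> \<bullet> q \<bullet> v \<bullet> i" using reix_post[OF x X eE] * pi by simp
        also have "\<dots> = \<epsilon>U \<bullet> g \<bullet> v \<bullet> i"
          using square_reassoc[OF Dg(9)] gA vA iA eA pi by simp
        also have "\<dots> = reix C X b \<epsilon>U" using gvi by (simp add: reix_def)
        finally show "reix C X (p \<bullet> x) \<epsilon>U = reix C X b \<epsilon>U" .
        show "p \<bullet> x \<in> hom C B P" using p(1) x by (rule comp_hom)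
      qed (rule b)
      let ?w = "?x \<bullet> k"
      have wA: "?w \<in> Ar C" "Dom C ?w = Dom C r2" "Cod C ?w = prod_ob C Q X" using xA' kA by simp_all
      have "pr1 C Q X \<bullet> ?w = x \<bullet> r1" using xA kA k(2) X by simp
      moreover have pw: "?p \<bullet> ?w = r2"
      proof -
        have "?p \<bullet> ?x = ?b" using prod_ar_comp[of p "Idn C X" x "Idn C X"] px pA xA X by simp
        then show ?thesis using comp_reassoc[of ?p ?x ?b k] xA' pA' kA k(3) by simp
      qed
      moreover have "\<epsilon> \<bullet> ?w = v"
      proof (rule pullback_eqI[OF g])
        show "g \<bullet> \<epsilon> \<bullet> ?w = g \<bullet> v" using comp_reassoc[OF \<epsilon>(2)] pw vA(4) \<epsilon>A gA wA by simp
        have "q \<bullet> \<epsilon> \<bullet> ?w = \<epsilon>E \<bullet> ?x \<bullet> k" using comp_reassoc[OF \<epsilon>(3)] \<epsilon>A gA wA by simp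
        also have "\<dots> = (q \<bullet> v \<bullet> i) \<bullet> k"
          using * comp_reassoc[of \<epsilon>E ?x "q \<bullet> v \<bullet> i" k] eA xA' kA by (simp add: reix_def)
        also have "\<dots> = q \<bullet> v" using ik gA vA iA kA by simp
        finally show "q \<bullet> \<epsilon> \<bullet> ?w = q \<bullet> v" .
      qed (use wA \<epsilon>A vA in \<open>simp_all add: hom_iff\<close>)
      moreover have "?w \<in> hom C (Dom C r2) (Dom C ?p)" using wA pA' by (simp add: hom_iff)
      ultimately show "\<exists>w. w \<in> hom C (Dom C r2) (Dom C ?p) \<and> pr1 C Q X \<bullet> w = x \<bullet> r1 \<and> ?p \<bullet> w = r2 \<and> \<epsilon> \<bullet> w = v"
        by blast
    qed
    have "\<exists>!x. x \<in> hom C B Q \<and> reix C X x \<epsilon>E = q \<bullet> v \<bullet> i"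
      using exE B qvi unfolding is_exponential_def by blast
    then show "\<exists>!x. x \<in> hom C (Dom C b) (Dom C p) \<and> p \<bullet> x = b \<and>
             (\<exists>w. w \<in> hom C (Dom C r2) (Dom C ?p) \<and> pr1 C Q X \<bullet> w = x \<bullet> r1 \<and> ?p \<bullet> w = r2 \<and> \<epsilon> \<bullet> w = v)"
      unfolding char .
  qed
  then show ?thesis by blast
qed

end

context ext_ctx
begin

lemma phi_Ob: "\<phi> \<in> Ob C" and psi_Ob: "\<psi> \<in> Ob C"
  by simp_all

text \<open>
  The extension problems over \<open>\<Gamma>\<close> are the maps from \<open>\<Gamma>\<close> to the fibre product of \<open>U\<^sup>\<psi>\<close> and
  \<open>E\<^sup>\<phi>\<close> over \<open>U\<^sup>\<phi>\<close>, where \<open>\<pi> : E \<rightarrow> U\<close>, and the generic semantic extension type over this fibre product is the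
  Leibniz cotensor of \<open>\<pi>\<close> with \<open>j\<close>, with domain \<open>E\<^sup>\<psi>\<close>.
\<close>

lemma generic_data:
  assumes pbs: "\<And>f g. f \<in> Ar C \<Longrightarrow> g \<in> Ar C \<Longrightarrow> Cod C f = Cod C g \<Longrightarrow> \<exists>p q. is_pullback C p q f g"
    and U\<psi>: "is_exponential C \<psi> (Cod C \<pi>) U\<psi> \<epsilon>U" and E\<psi>: "is_exponential C \<psi> (Dom C \<pi>) E\<psi> \<epsilon>E"
    and U\<phi>: "is_exponential C \<phi> (Cod C \<pi>) U\<phi> \<eta>U" and E\<phi>: "is_exponential C \<phi> (Dom C \<pi>) E\<phi> \<eta>E"
    and pi\<psi>: "\<pi>\<psi> \<in> hom C E\<psi> U\<psi>" "reix C \<psi> \<pi>\<psi> \<epsilon>U = \<pi> \<bullet> \<epsilon>E"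
    and pi\<phi>: "\<pi>\<phi> \<in> hom C E\<phi> U\<phi>" "reix C \<phi> \<pi>\<phi> \<eta>U = \<pi> \<bullet> \<eta>E"
  obtains W A0 a0 r w1 w2 m where "is_generic_data C \<pi> j W A0 a0" "is_sem_ext C \<pi> j W A0 a0 r \<epsilon>E"
    "is_pullback C w1 w2 m \<pi>\<phi>" "r \<in> hom C E\<psi> (Dom C w1)" "w1 \<bullet> r = \<pi>\<psi>"
proof -
  have eU: "\<epsilon>U \<in> hom C (prod_ob C U\<psi> \<psi>) (Cod C \<pi>)" and eE: "\<epsilon>E \<in> hom C (prod_ob C E\<psi> \<psi>) (Dom C \<pi>)"
    and hU: "\<eta>U \<in> hom C (prod_ob C U\<phi> \<phi>) (Cod C \<pi>)" and hE: "\<eta>E \<in> hom C (prod_ob C E\<phi> \<phi>) (Dom C \<pi>)"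
    using U\<psi> E\<psi> U\<phi> E\<phi> by (auto simp: is_exponential_def)
  have ob: "U\<psi> \<in> Ob C" "E\<psi> \<in> Ob C" "U\<phi> \<in> Ob C" "E\<phi> \<in> Ob C"
    using hom_Ob[OF pi\<psi>(1)] hom_Ob[OF pi\<phi>(1)] by simp_all
  let ?jr = "\<lambda>\<Gamma>. prod_ar C (Idn C \<Gamma>) j"
  have jr: "x \<bullet> ?jr \<Gamma> \<in> hom C (prod_ob C \<Gamma> \<phi>) Z" if "x \<in> hom C (prod_ob C \<Gamma> \<psi>) Z" "\<Gamma> \<in> Ob C" for x \<Gamma> Z
    using that by (simp add: hom_iff)
  have jr_post: "\<pi> \<bullet> x \<bullet> ?jr \<Gamma> = (\<pi> \<bullet> x) \<bullet> ?jr \<Gamma>"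
    if "x \<in> hom C (prod_ob C \<Gamma> \<psi>) (Dom C \<pi>)" "\<Gamma> \<in> Ob C" for x \<Gamma>
    using that by (simp add: hom_iff)
  obtain m where m: "m \<in> hom C U\<psi> U\<phi>" "reix C \<phi> m \<eta>U = \<epsilon>U \<bullet> ?jr U\<psi>"
    using exponential_lift[OF U\<phi> ob(1) jr[OF eU ob(1)]] by metis
  obtain t where t: "t \<in> hom C E\<psi> E\<phi>" "reix C \<phi> t \<eta>E = \<epsilon>E \<bullet> ?jr E\<psi>"
    using exponential_lift[OF E\<phi> ob(2) jr[OF eE ob(2)]] by metis
  have mA: "m \<in> Ar C" "Dom C m = U\<psi>" "Cod C m = U\<phi>" "\<pi>\<phi> \<in> Ar C" "Dom C \<pi>\<phi> = E\<phi>" "Cod C \<pi>\<phi> = U\<phi>"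
    using m pi\<phi> by (simp_all add: hom_iff)
  obtain w1 w2 where w: "is_pullback C w1 w2 m \<pi>\<phi>" using pbs[of m \<pi>\<phi>] mA by auto
  define W where "W = Dom C w1"
  note Dw = pullbackD[OF w]
  have w1: "w1 \<in> hom C W U\<psi>" and w2: "w2 \<in> hom C W E\<phi>" and W: "W \<in> Ob C"
    using Dw mA by (simp_all add: hom_iff W_def)
  define A0 where "A0 = reix C \<psi> w1 \<epsilon>U"
  define a0 where "a0 = reix C \<phi> w2 \<eta>E"
  have A0: "A0 \<in> hom C (prod_ob C W \<psi>) (Cod C \<pi>)" and a0: "a0 \<in> hom C (prod_ob C W \<phi>) (Dom C \<pi>)"
    using reix_hom[OF w1 _ eU] reix_hom[OF w2 _ hE] by (simp_all add: A0_def a0_def)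
  have via_m: "reix C \<phi> (m \<bullet> x) \<eta>U = reix C \<psi> x \<epsilon>U \<bullet> ?jr \<Gamma>" if x: "x \<in> hom C \<Gamma> U\<psi>" for x \<Gamma>
    using reix_reix[OF m(1) x _ hU] m(2) reix_restrict[OF x j_Ar eU] by simp
  have via_pi: "reix C \<phi> (\<pi>\<phi> \<bullet> x) \<eta>U = \<pi> \<bullet> reix C \<phi> x \<eta>E" if x: "x \<in> hom C \<Gamma> E\<phi>" for x \<Gamma>
    using reix_reix[OF pi\<phi>(1) x _ hU] pi\<phi>(2) reix_post[OF x _ hE] by simp
  have via_pi\<psi>: "reix C \<psi> (\<pi>\<psi> \<bullet> x) \<epsilon>U = \<pi> \<bullet> reix C \<psi> x \<epsilon>E" if x: "x \<in> hom C \<Gamma> E\<psi>" for x \<Gamma>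
    using reix_reix[OF pi\<psi>(1) x _ eU] pi\<psi>(2) reix_post[OF x _ eE] by simp
  have via_t: "reix C \<phi> (t \<bullet> x) \<eta>E = reix C \<psi> x \<epsilon>E \<bullet> ?jr \<Gamma>" if x: "x \<in> hom C \<Gamma> E\<psi>" for x \<Gamma>
    using reix_reix[OF t(1) x _ hE] t(2) reix_restrict[OF x j_Ar eE] by simp
  have via_w: "reix C \<psi> x A0 = reix C \<psi> (w1 \<bullet> x) \<epsilon>U" "reix C \<phi> x a0 = reix C \<phi> (w2 \<bullet> x) \<eta>E"
    if x: "x \<in> hom C \<Gamma> W" for x \<Gamma>
    using reix_reix[OF w1 x _ eU] reix_reix[OF w2 x _ hE] by (simp_all add: A0_def a0_def)

  have inp: "input_data C \<pi> j W A0 a0"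
    unfolding input_data_def is_family_def is_partial_section_def
    using W A0 a0 via_m[OF w1] via_pi[OF w2] Dw(9) by (simp add: A0_def a0_def)
  have gen: "is_generic_data C \<pi> j W A0 a0"
    unfolding is_generic_data_def
  proof (intro conjI allI impI inp)
    fix \<Gamma> A a assume *: "input_data C \<pi> j \<Gamma> A a"
    note Di = input_dataD[OF *]
    obtain x where x: "x \<in> hom C \<Gamma> U\<psi>" "reix C \<psi> x \<epsilon>U = A" using exponential_lift[OF U\<psi> Di(1,2)] by metis
    obtain y where y: "y \<in> hom C \<Gamma> E\<phi>" "reix C \<phi> y \<eta>E = a" using exponential_lift[OF E\<phi> Di(1,3)] by metis
    have "m \<bullet> x = \<pi>\<phi> \<bullet> y"
    proof (rule exponential_eqI[OF U\<phi> phi_Ob])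
      show "reix C \<phi> (m \<bullet> x) \<eta>U = reix C \<phi> (\<pi>\<phi> \<bullet> y) \<eta>U"
        using via_m[OF x(1)] via_pi[OF y(1)] x y * by (simp add: input_data_def is_partial_section_def)
    qed (use comp_hom m pi\<phi> x y in blast)+
    then obtain h where h: "h \<in> hom C \<Gamma> W" "w1 \<bullet> h = x" "w2 \<bullet> h = y"
      using pullback_lift[OF w, of x \<Gamma> y] x y mA W_def by metis
    show "\<exists>!h. h \<in> hom C \<Gamma> W \<and> reix C \<psi> h A0 = A \<and> reix C \<phi> h a0 = a"
    proof (rule ex1I[of _ h])
      show "h \<in> hom C \<Gamma> W \<and> reix C \<psi> h A0 = A \<and> reix C \<phi> h a0 = a"
        using h x y via_w[OF h(1)] by simp
      fix h' assume h': "h' \<in> hom C \<Gamma> W \<and> reix C \<psi> h' A0 = A \<and> reix C \<phi> h' a0 = a"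
      have "w1 \<bullet> h' = w1 \<bullet> h"
      proof (rule exponential_eqI[OF U\<psi> psi_Ob])
        show "reix C \<psi> (w1 \<bullet> h') \<epsilon>U = reix C \<psi> (w1 \<bullet> h) \<epsilon>U" using h' h x via_w[of h'] by force
      qed (use comp_hom w1 h h' in blast)+
      moreover have "w2 \<bullet> h' = w2 \<bullet> h"
      proof (rule exponential_eqI[OF E\<phi> phi_Ob])
        show "reix C \<phi> (w2 \<bullet> h') \<eta>E = reix C \<phi> (w2 \<bullet> h) \<eta>E" using h' h y via_w[of h'] by force
      qed (use comp_hom w2 h h' in blast)+
      ultimately show "h' = h" using pullback_eqI[OF w, of h' \<Gamma> h] h h' W_def by simp
    qed
  qed

  have "m \<bullet> \<pi>\<psi> = \<pi>\<phi> \<bullet> t"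
  proof (rule exponential_eqI[OF U\<phi> phi_Ob])
    show "reix C \<phi> (m \<bullet> \<pi>\<psi>) \<eta>U = reix C \<phi> (\<pi>\<phi> \<bullet> t) \<eta>U"
      using via_m[OF pi\<psi>(1)] via_pi[OF t(1)] pi\<psi>(2) t(2) jr_post[OF eE ob(2)] by simp
  qed (use comp_hom m pi\<phi> pi\<psi> t in blast)+
  then obtain r where r: "r \<in> hom C E\<psi> W" "w1 \<bullet> r = \<pi>\<psi>" "w2 \<bullet> r = t"
    using pullback_lift[OF w, of \<pi>\<psi> E\<psi> t] pi\<psi> t mA W_def by metis
  have rD: "Dom C r = E\<psi>" using r by (simp add: hom_iff)
  have "is_sem_ext C \<pi> j W A0 a0 r \<epsilon>E"
    unfolding is_sem_ext_def rD
  proof (intro conjI allI impI)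
    show "r \<in> hom C E\<psi> W" by fact
    show "is_total_section C \<pi> j E\<psi> (reix C \<psi> r A0) (reix C \<phi> r a0) \<epsilon>E"
      unfolding is_total_section_def using eE via_w[OF r(1)] r pi\<psi> t by simp
    fix \<Delta> \<sigma> b
    assume *: "\<sigma> \<in> hom C \<Delta> W \<and> is_total_section C \<pi> j \<Delta> (reix C \<psi> \<sigma> A0) (reix C \<phi> \<sigma> a0) b"
    then have s: "\<sigma> \<in> hom C \<Delta> W" and b: "b \<in> hom C (prod_ob C \<Delta> \<psi>) (Dom C \<pi>)"
      "\<pi> \<bullet> b = reix C \<psi> \<sigma> A0" "b \<bullet> ?jr \<Delta> = reix C \<phi> \<sigma> a0"
      by (auto simp: is_total_section_def)
    have D: "\<Delta> \<in> Ob C" using hom_Ob[OF s] by simp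
    obtain h where h: "h \<in> hom C \<Delta> E\<psi>" "reix C \<psi> h \<epsilon>E = b" using exponential_lift[OF E\<psi> D b(1)] by metis
    have a1: "w1 \<bullet> r \<bullet> h = \<pi>\<psi> \<bullet> h" "w2 \<bullet> r \<bullet> h = t \<bullet> h"
      using comp_reassoc[OF r(2)] comp_reassoc[OF r(3)] r(1) w1 w2 h(1) by (simp_all add: hom_iff)
    have "\<pi>\<psi> \<bullet> h = w1 \<bullet> \<sigma>"
    proof (rule exponential_eqI[OF U\<psi> psi_Ob])
      show "reix C \<psi> (\<pi>\<psi> \<bullet> h) \<epsilon>U = reix C \<psi> (w1 \<bullet> \<sigma>) \<epsilon>U"
        using via_pi\<psi>[OF h(1)] h(2) b(2) via_w[OF s] by simp
    qed (use comp_hom pi\<psi> h w1 s in blast)+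
    moreover have "t \<bullet> h = w2 \<bullet> \<sigma>"
    proof (rule exponential_eqI[OF E\<phi> phi_Ob])
      show "reix C \<phi> (t \<bullet> h) \<eta>E = reix C \<phi> (w2 \<bullet> \<sigma>) \<eta>E"
        using via_t[OF h(1)] h(2) b(3) via_w[OF s] by simp
    qed (use comp_hom t h w2 s in blast)+
    moreover have "r \<bullet> h \<in> hom C \<Delta> W" using r(1) h(1) by (rule comp_hom)
    ultimately have rh: "r \<bullet> h = \<sigma>" using pullback_eqI[OF w, of "r \<bullet> h" \<Delta> \<sigma>] s a1 W_def by simp
    show "\<exists>!h. h \<in> hom C \<Delta> E\<psi> \<and> r \<bullet> h = \<sigma> \<and> reix C \<psi> h \<epsilon>E = b"
    proof (rule ex1I[of _ h])
      show "h \<in> hom C \<Delta> E\<psi> \<and> r \<bullet> h = \<sigma> \<and> reix C \<psi> h \<epsilon>E = b" using h rh by simp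
      fix h' assume "h' \<in> hom C \<Delta> E\<psi> \<and> r \<bullet> h' = \<sigma> \<and> reix C \<psi> h' \<epsilon>E = b"
      then show "h' = h" using exponential_eqI[OF E\<psi> psi_Ob, of h' \<Delta> h] h by simp
    qed
  qed
  then show ?thesis using that[OF gen _ w] r W_def by blast
qed

text \<open>
  A lifting problem of \<open>i\<close> against \<open>r\<close> is, after transposition, an extension problem over the codomain of \<open>i\<close>
  with a solution over its domain.  Lifts are solutions that extend the given one.
\<close>

lemma sem_ext_rlp:
  assumes se: "is_sem_ext C \<pi> j W A0 a0 r e" and inp: "input_data C \<pi> j W A0 a0" and S: "S \<subseteq> Ar C"
    and ext: "\<And>i A a b. i \<in> S \<Longrightarrow> input_data C \<pi> j (Cod C i) A a \<Longrightarrow>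
      is_total_section C \<pi> j (Dom C i) (reix C \<psi> i A) (reix C \<phi> i a) b \<Longrightarrow>
      \<exists>b'. is_total_section C \<pi> j (Cod C i) A a b' \<and> reix C \<psi> i b' = b"
  shows "r \<in> rlp C S"
  unfolding rlp_def has_lift_def
proof (intro CollectI conjI ballI impI)
  note D = sem_extD[OF se] input_dataD[OF inp]
  show "r \<in> Ar C" using D by (simp add: hom_iff)
  fix i u v assume i: "i \<in> S" and u: "u \<in> hom C (Dom C i) (Dom C r)" and v: "v \<in> hom C (Cod C i) (Cod C r)"
    and eq: "r \<bullet> u = v \<bullet> i"
  have iA: "i \<in> hom C (Dom C i) (Cod C i)" and v: "v \<in> hom C (Cod C i) W"
    using i S v D by (auto simp: hom_iff)
  have "is_total_section C \<pi> j (Dom C i) (reix C \<psi> u (reix C \<psi> r A0)) (reix C \<phi> u (reix C \<phi> r a0)) (reix C \<psi> u e)"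
    using total_section_reix[OF D(3) u] by simp
  moreover have "reix C \<psi> u (reix C \<psi> r A0) = reix C \<psi> i (reix C \<psi> v A0)"
    "reix C \<phi> u (reix C \<phi> r a0) = reix C \<phi> i (reix C \<phi> v a0)"
    using reix_reix[OF D(1) u _ D(5)] reix_reix[OF D(1) u _ D(6)]
      reix_reix[OF v iA _ D(5)] reix_reix[OF v iA _ D(6)] eq by simp_all
  moreover have "input_data C \<pi> j (Cod C i) (reix C \<psi> v A0) (reix C \<phi> v a0)"
    using input_data_reix[OF inp v] by simp
  ultimately obtain b where b: "is_total_section C \<pi> j (Cod C i) (reix C \<psi> v A0) (reix C \<phi> v a0) b"
    "reix C \<psi> i b = reix C \<psi> u e"
    using ext[OF i] by metis
  obtain h where h: "h \<in> hom C (Cod C i) (Dom C r)" "r \<bullet> h = v" "reix C \<psi> h e = b"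
    using sem_ext_lift[OF se v b(1)] by blast
  have "h \<bullet> i = u"
  proof (rule sem_ext_eqI[OF se inp _ u])
    show "h \<bullet> i \<in> hom C (Dom C i) (Dom C r)" using h(1) iA by (rule comp_hom)
    show "r \<bullet> h \<bullet> i = r \<bullet> u" using comp_reassoc[OF h(2)] h(1) iA D eq by (simp add: hom_iff)
    show "reix C \<psi> (h \<bullet> i) e = reix C \<psi> u e" using reix_reix[OF h(1) iA _ D(2)] h(3) b(2) by simp
  qed
  then show "\<exists>h\<in>hom C (Cod C i) (Dom C r). h \<bullet> i = u \<and> r \<bullet> h = v" using h by blast
qed

text \<open>
  Let \<open>\<pi> : E \<rightarrow> U\<close>.  For \<open>X\<close> among \<open>\<phi>\<close> and \<open>\<psi>\<close> the map \<open>E\<^sup>X \<rightarrow> U\<^sup>X\<close> is in \<open>Sm\<close>, being a dependent product of such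
  maps.  The domain \<open>W\<close> of \<open>w1\<close> is the base of the generic problem, \<open>w1 : W \<rightarrow> U\<^sup>\<psi>\<close> is a pullback of
  \<open>E\<^sup>\<phi> \<rightarrow> U\<^sup>\<phi>\<close>, and the composite of \<open>r : E\<^sup>\<psi> \<rightarrow> W\<close> with \<open>w1\<close> is \<open>E\<^sup>\<psi> \<rightarrow> U\<^sup>\<psi>\<close>; so \<open>r\<close> is
  relatively presentable by cancellation.  Dependent products do not give the lifting property of \<open>r\<close>, which rests
  on the extension hypothesis.
\<close>

lemma generic_small_fibration:
  assumes pbs: "\<And>f g. f \<in> Ar C \<Longrightarrow> g \<in> Ar C \<Longrightarrow> Cod C f = Cod C g \<Longrightarrow> \<exists>p q. is_pullback C p q f g"
    and expo: "\<And>X Z. X \<in> {\<phi>, \<psi>} \<Longrightarrow> Z \<in> Ob C \<Longrightarrow> \<exists>P ev. is_exponential C X Z P ev"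
    and S: "S \<subseteq> Ar C" and Sm: "Sm = {f \<in> rlp C S. relatively_presentable u \<kappa> C f}"
    and closed: "\<And>p q f g. is_pullback C p q f g \<Longrightarrow> presentable u \<kappa> C (Dom C f) \<Longrightarrow>
      presentable u \<kappa> C (Dom C g) \<Longrightarrow> presentable u \<kappa> C (Cod C f) \<Longrightarrow> presentable u \<kappa> C (Dom C p)"
    and dp: "\<And>f g p q1 q2 \<epsilon>. f \<in> Sm \<Longrightarrow> g \<in> Sm \<Longrightarrow> is_dep_prod C f g p q1 q2 \<epsilon> \<Longrightarrow> p \<in> Sm"
    and pi: "\<pi> \<in> Sm"
    and one: "is_terminal C One" and shapes: "\<And>X f. X \<in> {\<phi>, \<psi>} \<Longrightarrow> f \<in> hom C X One \<Longrightarrow> f \<in> Sm"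
    and ext: "\<And>i A a b. i \<in> S \<Longrightarrow> input_data C \<pi> j (Cod C i) A a \<Longrightarrow>
      is_total_section C \<pi> j (Dom C i) (reix C \<psi> i A) (reix C \<phi> i a) b \<Longrightarrow>
      \<exists>b'. is_total_section C \<pi> j (Cod C i) A a b' \<and> reix C \<psi> i b' = b"
  obtains W A0 a0 r e where "is_generic_data C \<pi> j W A0 a0" "is_sem_ext C \<pi> j W A0 a0 r e" "r \<in> Sm"
proof -
  have Sm_pb: "p \<in> Sm" if "is_pullback C p q f g" "g \<in> Sm" for p q f g
    using rlp_pullback[OF S that(1)] relatively_presentable_pullback[OF that(1)] that(2) unfolding Sm by auto
  have proj: "pr1 C P X \<in> Sm" if X: "X \<in> {\<phi>, \<psi>}" and P: "P \<in> Ob C" for P X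
  proof -
    have Xo: "X \<in> Ob C" using X by auto
    obtain f g where f: "f \<in> hom C P One" and g: "g \<in> hom C X One"
      using one P Xo unfolding is_terminal_def by blast
    have fg: "f \<in> Ar C" "Dom C f = P" "Cod C f = One" "g \<in> Ar C" "Dom C g = X" "Cod C g = One"
      using f g by (simp_all add: hom_iff)
    have eq: "x = y" if "x \<in> hom C Z One" "y \<in> hom C Z One" for x y Z
      using one that hom_Ob[OF that(1)] unfolding is_terminal_def by blast
    have "is_pullback C (pr1 C P X) (pr2 C P X) f g"
    proof (rule pullbackI)
      show "f \<bullet> pr1 C P X = g \<bullet> pr2 C P X"
        using fg P Xo by (intro eq[of _ "prod_ob C P X"]) (simp_all add: hom_iff)
    next
      fix V x y assume "x \<in> hom C V (Dom C f)" "y \<in> hom C V (Dom C g)"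
      then show "\<exists>h. h \<in> hom C V (prod_ob C P X) \<and> pr1 C P X \<bullet> h = x \<and> pr2 C P X \<bullet> h = y"
        using prod_lift[of x V P y X] fg by auto
    next
      fix V h h' assume "h \<in> hom C V (prod_ob C P X)" "h' \<in> hom C V (prod_ob C P X)"
        "pr1 C P X \<bullet> h = pr1 C P X \<bullet> h'" "pr2 C P X \<bullet> h = pr2 C P X \<bullet> h'"
      then show "h = h'" using prod_eqI P Xo by blast
    qed (use fg P Xo in \<open>simp_all add: hom_iff\<close>)
    then show ?thesis using Sm_pb shapes[OF X g] by blast
  qed
  have post: "\<exists>P \<epsilon>U Q \<epsilon>E p. is_exponential C X (Cod C \<pi>) P \<epsilon>U \<and> is_exponential C X (Dom C \<pi>) Q \<epsilon>E \<and>
      p \<in> hom C Q P \<and> reix C X p \<epsilon>U = \<pi> \<bullet> \<epsilon>E \<and> p \<in> Sm" if X: "X \<in> {\<phi>, \<psi>}" for X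
  proof -
    have Xo: "X \<in> Ob C" using X by auto
    obtain P \<epsilon>U where P: "is_exponential C X (Cod C \<pi>) P \<epsilon>U" using expo[OF X, of "Cod C \<pi>"] by auto
    obtain Q \<epsilon>E where Q: "is_exponential C X (Dom C \<pi>) Q \<epsilon>E" using expo[OF X, of "Dom C \<pi>"] by auto
    have Po: "P \<in> Ob C" "Q \<in> Ob C" using P Q by (simp_all add: is_exponential_def)
    have "\<pi> \<bullet> \<epsilon>E \<in> hom C (prod_ob C Q X) (Cod C \<pi>)"
      using Q by (auto simp: is_exponential_def hom_iff)
    then obtain p where p: "p \<in> hom C Q P" "reix C X p \<epsilon>U = \<pi> \<bullet> \<epsilon>E"
      using exponential_lift[OF P Po(2)] by metis
    have "\<epsilon>U \<in> Ar C" "Cod C \<epsilon>U = Cod C \<pi>" using P by (auto simp: is_exponential_def hom_iff)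
    then obtain g q where g: "is_pullback C g q \<epsilon>U \<pi>" using pbs[of \<epsilon>U \<pi>] by auto
    obtain q1 q2 \<epsilon> where d: "is_dep_prod C (pr1 C P X) g p q1 q2 \<epsilon>"
      using exponential_dep_prod[OF Xo pi_Ar P Q p g] by blast
    have "p \<in> Sm" using dp[OF proj[OF X Po(1)] Sm_pb[OF g pi] d] .
    then show ?thesis using P Q p by blast
  qed
  obtain U\<psi> \<epsilon>U E\<psi> \<epsilon>E \<pi>\<psi> where
    1: "is_exponential C \<psi> (Cod C \<pi>) U\<psi> \<epsilon>U" "is_exponential C \<psi> (Dom C \<pi>) E\<psi> \<epsilon>E"
      "\<pi>\<psi> \<in> hom C E\<psi> U\<psi>" "reix C \<psi> \<pi>\<psi> \<epsilon>U = \<pi> \<bullet> \<epsilon>E" "\<pi>\<psi> \<in> Sm"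
    using post[of \<psi>] by blast
  obtain U\<phi> \<eta>U E\<phi> \<eta>E \<pi>\<phi> where
    2: "is_exponential C \<phi> (Cod C \<pi>) U\<phi> \<eta>U" "is_exponential C \<phi> (Dom C \<pi>) E\<phi> \<eta>E"
      "\<pi>\<phi> \<in> hom C E\<phi> U\<phi>" "reix C \<phi> \<pi>\<phi> \<eta>U = \<pi> \<bullet> \<eta>E" "\<pi>\<phi> \<in> Sm"
    using post[of \<phi>] by blast
  obtain W A0 a0 r w1 w2 m where gen: "is_generic_data C \<pi> j W A0 a0" and se: "is_sem_ext C \<pi> j W A0 a0 r \<epsilon>E"
    and w: "is_pullback C w1 w2 m \<pi>\<phi>" and r: "r \<in> hom C E\<psi> (Dom C w1)" "w1 \<bullet> r = \<pi>\<psi>"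
    by (rule generic_data[OF _ 1(1,2) 2(1,2) 1(3,4) 2(3,4)]) (use pbs in blast)+
  have inp: "input_data C \<pi> j W A0 a0" using gen by (simp add: is_generic_data_def)
  have "r \<in> rlp C S" using sem_ext_rlp[OF se inp S ext] by blast
  moreover have "relatively_presentable u \<kappa> C r"
  proof (rule relatively_presentable_cancel[OF pbs closed])
    show "relatively_presentable u \<kappa> C w1" using Sm_pb[OF w 2(5)] by (simp add: Sm)
    show "relatively_presentable u \<kappa> C (w1 \<bullet> r)" using 1(5) r by (simp add: Sm)
    show "r \<in> Ar C" "Cod C r = Dom C w1" using r by (simp_all add: hom_iff)
  qed
  ultimately show ?thesis using that[OF gen se] by (simp add: Sm)
qed

end

section \<open>Small limits and coproducts\<close>

lemma usmall_image:
  assumes "usmall u A"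
  shows "usmall u (f ` A)"
  using assms card_of_image ordLeq_ordLess_trans unfolding usmall_def by blast

lemma usmall_code:
  assumes "usmall TYPE('u) A"
  obtains g :: "'a \<Rightarrow> 'u" where "inj_on g A"
  using assms unfolding usmall_def
  by (metis card_of_ordLeq ordLess_imp_ordLeq)

lemma usmall_countable:
  assumes "inaccessible |UNIV :: 'u set|" "countable A"
  shows "usmall TYPE('u) A"
proof -
  have "|A| \<le>o |UNIV :: nat set|"
    using assms(2) unfolding countable_def by (metis card_of_ordLeq subset_UNIV)
  moreover have "|UNIV :: nat set| =o natLeq" by (rule card_of_nat)
  moreover have "natLeq <o |UNIV :: 'u set|" using assms(1) by (simp add: inaccessible_def)
  ultimately show ?thesis
    unfolding usmall_def using ordLeq_ordIso_trans ordLeq_ordLess_trans by blast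
qed

definition is_cone :: "('a, 'b, 'y) cat_scheme \<Rightarrow> ('o, 'm, 'z) cat_scheme
    \<Rightarrow> ('a \<Rightarrow> 'o) \<times> ('b \<Rightarrow> 'm) \<Rightarrow> 'o \<Rightarrow> ('a \<Rightarrow> 'm) \<Rightarrow> bool" where
  "is_cone A C D M d \<longleftrightarrow> M \<in> Ob C \<and> (\<forall>a\<in>Ob A. d a \<in> hom C M (fst D a)) \<and>
     (\<forall>a b. \<forall>f\<in>hom A a b. snd D f \<bullet>\<^bsub>C\<^esub> d a = d b)"

lemma is_limit_iff:
  "is_limit A C D L c \<longleftrightarrow> is_cone A C D L c \<and>
     (\<forall>M d. is_cone A C D M d \<longrightarrow> (\<exists>!h. h \<in> hom C M L \<and> (\<forall>a\<in>Ob A. c a \<bullet>\<^bsub>C\<^esub> h = d a)))"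
  unfolding is_limit_def is_cone_def Let_def by simp

text \<open>Completeness is stated for diagrams coded in the type of small sets; a small diagram of any
  other type is isomorphic to a coded one.\<close>

lemma complete_limit:
  fixes A :: "('a, 'b) cat" and C :: "('o, 'm, 'z) cat_scheme" (structure)
  assumes comp: "complete_cat TYPE('u) C" and A: "category A"
    and small: "usmall TYPE('u) (Ob A)" "usmall TYPE('u) (Ar A)" and D: "is_functor A C D"
  shows "\<exists>L c. is_limit A C D L c"
proof -
  interpret A: cat_ctx A by unfold_locales (rule A)
  obtain go :: "'a \<Rightarrow> 'u" where go: "inj_on go (Ob A)" using usmall_code[OF small(1)] .
  obtain ga :: "'b \<Rightarrow> 'u" where ga: "inj_on ga (Ar A)" using usmall_code[OF small(2)] .
  define ho where "ho = inv_into (Ob A) go"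
  define ha where "ha = inv_into (Ar A) ga"
  have ho [simp]: "ho (go a) = a" if "a \<in> Ob A" for a using that go by (simp add: ho_def)
  have ha [simp]: "ha (ga f) = f" if "f \<in> Ar A" for f using that ga by (simp add: ha_def)
  define A' :: "('u, 'u) cat" where "A' = \<lparr>Ob = go ` Ob A, Ar = ga ` Ar A, Dom = go \<circ> Dom A \<circ> ha,
    Cod = go \<circ> Cod A \<circ> ha, Idn = ga \<circ> Idn A \<circ> ho, Cmp = (\<lambda>g f. ga (ha g \<bullet>\<^bsub>A\<^esub> ha f))\<rparr>"
  define D' where "D' = (fst D \<circ> ho, snd D \<circ> ha)"
  have homA': "x \<in> hom A' a' b' \<longleftrightarrow> (\<exists>f a b. f \<in> hom A a b \<and> x = ga f \<and> a' = go a \<and> b' = go b)" for x a' b'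
    by (auto simp: hom_iff A'_def)
  have homOb: "f \<in> Ar A" "a \<in> Ob A" "b \<in> Ob A" if "f \<in> hom A a b" for f a b
    using that by (auto simp: hom_iff)
  have go_eq: "go a = go b \<longleftrightarrow> a = b" if "a \<in> Ob A" "b \<in> Ob A" for a b
    using go that by (auto simp: inj_on_def)
  have Idn': "Idn A' (go a) = ga (Idn A a)" if "a \<in> Ob A" for a using that by (simp add: A'_def)
  have Cmp': "ga g \<bullet>\<^bsub>A'\<^esub> ga f = ga (g \<bullet>\<^bsub>A\<^esub> f)" if "f \<in> Ar A" "g \<in> Ar A" for f g
    using that by (simp add: A'_def)
  have "category A'"
    unfolding category_def
  proof (intro conjI allI ballI)
    fix x assume "x \<in> Ar A'"
    then show "Dom A' x \<in> Ob A'" "Cod A' x \<in> Ob A'" by (auto simp: A'_def)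
  next
    fix X assume "X \<in> Ob A'"
    then show "Idn A' X \<in> hom A' X X" by (auto simp: A'_def hom_iff)
  next
    fix X Y Z f g assume "f \<in> hom A' X Y" "g \<in> hom A' Y Z"
    then show "g \<bullet>\<^bsub>A'\<^esub> f \<in> hom A' X Z" by (auto simp: A'_def hom_iff go_eq)
  next
    fix X Y f assume "f \<in> hom A' X Y"
    then show "f \<bullet>\<^bsub>A'\<^esub> Idn A' X = f" "Idn A' Y \<bullet>\<^bsub>A'\<^esub> f = f" by (auto simp: A'_def hom_iff)
  next
    fix W X Y Z f g h assume "f \<in> hom A' W X" "g \<in> hom A' X Y" "h \<in> hom A' Y Z"
    then show "h \<bullet>\<^bsub>A'\<^esub> g \<bullet>\<^bsub>A'\<^esub> f = (h \<bullet>\<^bsub>A'\<^esub> g) \<bullet>\<^bsub>A'\<^esub> f"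
      by (auto simp: A'_def hom_iff go_eq)
  qed
  moreover have "usmall TYPE('u) (Ob A')" "usmall TYPE('u) (Ar A')"
    using small by (simp_all add: A'_def usmall_image)
  moreover have "is_functor A' C D'"
    unfolding is_functor_def
  proof (intro conjI allI ballI)
    fix a assume "a \<in> Ob A'"
    then obtain b where b: "b \<in> Ob A" "a = go b" by (auto simp: A'_def)
    then show "fst D' a \<in> Ob C" using D by (auto simp: D'_def is_functor_def)
    show "snd D' (Idn A' a) = Idn C (fst D' a)" using D b by (auto simp: D'_def is_functor_def Idn')
  next
    fix a b f assume "f \<in> hom A' a b"
    then show "snd D' f \<in> hom C (fst D' a) (fst D' b)"
      using D unfolding homA' is_functor_def by (auto simp: D'_def homOb)
  next
    fix a b c f g assume "f \<in> hom A' a b" "g \<in> hom A' b c"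
    then obtain f0 g0 a0 b0 c0 where "f0 \<in> hom A a0 b0" "f = ga f0" "g0 \<in> hom A b0 c0" "g = ga g0"
      unfolding homA' by (metis go_eq homOb)
    then show "snd D' (g \<bullet>\<^bsub>A'\<^esub> f) = snd D' g \<bullet> snd D' f"
      using D unfolding is_functor_def by (auto simp: D'_def homOb Cmp' hom_iff)
  qed
  ultimately obtain L c where L: "is_limit A' C D' L c"
    using comp unfolding complete_cat_def by blast
  have ObA': "Ob A' = go ` Ob A" by (simp add: A'_def)
  have cone1: "is_cone A' C D' M (d \<circ> ho)" if "is_cone A C D M d" for M d
    unfolding is_cone_def
  proof (intro conjI ballI allI)
    show "M \<in> Ob C" using that by (simp add: is_cone_def)
    fix a assume "a \<in> Ob A'"
    then show "(d \<circ> ho) a \<in> hom C M (fst D' a)" using that by (auto simp: is_cone_def ObA' D'_def)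
  next
    fix a b x assume "x \<in> hom A' a b"
    then obtain f a0 b0 where f: "f \<in> hom A a0 b0" "x = ga f" "a = go a0" "b = go b0" unfolding homA' by blast
    then have "snd D f \<bullet> d a0 = d b0" using that by (auto simp: is_cone_def)
    then show "snd D' x \<bullet> (d \<circ> ho) a = (d \<circ> ho) b" using f homOb[OF f(1)] by (simp add: D'_def)
  qed
  have cone2: "is_cone A C D M (d \<circ> go)" if "is_cone A' C D' M d" for M d
    unfolding is_cone_def
  proof (intro conjI ballI allI)
    show "M \<in> Ob C" using that by (simp add: is_cone_def)
    fix a assume "a \<in> Ob A"
    then show "(d \<circ> go) a \<in> hom C M (fst D a)" using that by (force simp: is_cone_def ObA' D'_def)
  next
    fix a b f assume f: "f \<in> hom A a b"
    then have "ga f \<in> hom A' (go a) (go b)" unfolding homA' by blast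
    then have "snd D' (ga f) \<bullet> d (go a) = d (go b)" using that by (auto simp: is_cone_def)
    then show "snd D f \<bullet> (d \<circ> go) a = (d \<circ> go) b" using f by (simp add: D'_def homOb)
  qed
  have "is_limit A C D L (c \<circ> go)"
    unfolding is_limit_iff
  proof (intro conjI allI impI)
    show "is_cone A C D L (c \<circ> go)" using L cone2 by (simp add: is_limit_iff)
    fix M d assume "is_cone A C D M d"
    then have "\<exists>!h. h \<in> hom C M L \<and> (\<forall>a\<in>Ob A'. c a \<bullet> h = (d \<circ> ho) a)"
      using L cone1 unfolding is_limit_iff by blast
    then show "\<exists>!h. h \<in> hom C M L \<and> (\<forall>a\<in>Ob A. (c \<circ> go) a \<bullet> h = d a)"
      by (simp add: ObA')
  qed
  then show ?thesis by blast
qed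

lemma category_poset:
  assumes "\<And>i. i \<in> I \<Longrightarrow> le i i" "\<And>i k l. i \<in> I \<Longrightarrow> k \<in> I \<Longrightarrow> l \<in> I \<Longrightarrow> le i k \<Longrightarrow> le k l \<Longrightarrow> le i l"
  shows "category (poset_cat I le)"
proof -
  have h: "x \<in> hom (poset_cat I le) a b \<longleftrightarrow> x = (a, b) \<and> a \<in> I \<and> b \<in> I \<and> le a b" for x a b
    by (auto simp: hom_iff poset_cat_def)
  show ?thesis
    unfolding category_def
  proof (intro conjI allI ballI)
    fix X Y Z f g assume "f \<in> hom (poset_cat I le) X Y" "g \<in> hom (poset_cat I le) Y Z"
    then show "g \<bullet>\<^bsub>poset_cat I le\<^esub> f \<in> hom (poset_cat I le) X Z"
      using assms(2)[of X Y Z] unfolding h by (simp add: poset_cat_def)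
  qed (use assms(1) in \<open>unfold h, auto simp: poset_cat_def\<close>)
qed

lemma complete_terminal:
  fixes C :: "('o, 'm, 'z) cat_scheme"
  assumes inacc: "inaccessible |UNIV :: 'u set|" and comp: "complete_cat TYPE('u) C"
  shows "\<exists>T. is_terminal C T"
proof -
  let ?A = "poset_cat ({} :: nat set) (=)"
  let ?D = "(\<lambda>_. undefined, \<lambda>_. undefined)"
  have OA: "Ob ?A = {}" "Ar ?A = {}" by (auto simp: poset_cat_def)
  have hA: "hom ?A a b = {}" for a b by (simp add: hom_def OA)
  have "is_functor ?A C ?D" by (simp add: is_functor_def OA hA)
  moreover have "category ?A" by (rule category_poset) auto
  moreover have "usmall TYPE('u) (Ob ?A)" "usmall TYPE('u) (Ar ?A)"
    by (rule usmall_countable[OF inacc]; simp add: OA)+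
  ultimately obtain L c where "is_limit ?A C ?D L c" using complete_limit[OF comp] by blast
  then have "L \<in> Ob C" "\<exists>!h. h \<in> hom C M L" if "M \<in> Ob C" for M
    using that by (simp_all add: is_limit_iff is_cone_def OA hA)
  then have "is_terminal C L"
    using \<open>is_limit ?A C ?D L c\<close> by (simp add: is_terminal_def is_limit_iff is_cone_def)
  then show ?thesis by blast
qed

text \<open>The indexing poset is \<open>0 \<le> 2 \<ge> 3\<close>.\<close>

lemma complete_pullback:
  fixes C :: "('o, 'm, 'z) cat_scheme" (structure)
  assumes inacc: "inaccessible |UNIV :: 'u set|" and comp: "complete_cat TYPE('u) C" and C: "category C"
    and f: "f \<in> Ar C" and g: "g \<in> Ar C" and fg: "Cod C f = Cod C g"
  shows "\<exists>p q. is_pullback C p q f g"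
proof -
  interpret cat_ctx C by unfold_locales (rule C)
  let ?le = "\<lambda>i k. i = k \<or> k = (2 :: nat)"
  let ?A = "poset_cat {0, 3, 2 :: nat} ?le"
  define D0 where "D0 i = (if i = (0 :: nat) then Dom C f else if i = 3 then Dom C g else Cod C f)" for i
  define D1 where "D1 = (\<lambda>(i, k). if i = k then Idn C (D0 i) else if i = 0 then f else g)"
  have hA: "x \<in> hom ?A a b \<longleftrightarrow> x = (a, b) \<and> a \<in> {0, 3, 2} \<and> b \<in> {0, 3, 2} \<and> ?le a b" for x a b
    by (auto simp: hom_iff poset_cat_def)
  have D0 [simp]: "D0 0 = Dom C f" "D0 3 = Dom C g" "D0 2 = Cod C f" by (auto simp: D0_def)
  have D1 [simp]: "D1 (0, 2) = f" "D1 (3, 2) = g" "D1 (i, i) = Idn C (D0 i)" for i by (auto simp: D1_def)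
  have D0_Ob: "D0 i \<in> Ob C" for i using f g by (auto simp: D0_def)
  have D1_hom: "D1 (a, b) \<in> hom C (D0 a) (D0 b)" if "a \<in> {0, 3, 2}" "?le a b" for a b
    using that f g fg D0_Ob by (auto simp: hom_iff)
  have "is_functor ?A C (D0, D1)"
    unfolding is_functor_def
  proof (intro conjI ballI allI)
    fix a b x assume "x \<in> hom ?A a b"
    then show "snd (D0, D1) x \<in> hom C (fst (D0, D1) a) (fst (D0, D1) b)"
      using D1_hom unfolding hA by auto
  next
    fix a b c x y assume "x \<in> hom ?A a b" "y \<in> hom ?A b c"
    then have x: "x = (a, b)" "a \<in> {0, 3, 2}" "?le a b" and y: "y = (b, c)" "b \<in> {0, 3, 2}" "?le b c"
      by (simp_all only: hA)
    note h = D1_hom[OF x(2,3)] D1_hom[OF y(2,3)]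
    consider "a = b" | "b = c" using x y by auto
    then have "D1 (a, c) = D1 (b, c) \<bullet> D1 (a, b)"
      using h by cases (simp_all add: hom_iff)
    then show "snd (D0, D1) (y \<bullet>\<^bsub>?A\<^esub> x) = snd (D0, D1) y \<bullet> snd (D0, D1) x"
      using x y by (simp add: poset_cat_def)
  qed (use D0_Ob in \<open>auto simp: poset_cat_def\<close>)
  moreover have "category ?A" by (rule category_poset) auto
  moreover have "usmall TYPE('u) (Ob ?A)" "usmall TYPE('u) (Ar ?A)"
    by (rule usmall_countable[OF inacc]; simp add: poset_cat_def)+
  ultimately obtain L c where L: "is_limit ?A C (D0, D1) L c" using complete_limit[OF comp] by blast
  have ObA: "Ob ?A = {0, 3, 2}" by (simp add: poset_cat_def)
  have coneI: "is_cone ?A C (D0, D1) M d"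
    if "d 0 \<in> hom C M (Dom C f)" "d 3 \<in> hom C M (Dom C g)" "f \<bullet> d 0 = d 2" "g \<bullet> d 3 = d 2" for M d
    unfolding is_cone_def
  proof (intro conjI ballI allI)
    have d2: "d 2 \<in> hom C M (Cod C f)"
      using that(1) f unfolding that(3)[symmetric] by (simp add: hom_iff)
    show dh: "d a \<in> hom C M (fst (D0, D1) a)" if "a \<in> Ob ?A" for a
      using that \<open>d 0 \<in> _\<close> \<open>d 3 \<in> _\<close> d2 unfolding ObA by auto
    show "M \<in> Ob C" using hom_Ob[OF that(1)] by simp
    fix a b x assume "x \<in> hom ?A a b"
    then have x: "x = (a, b)" "a \<in> {0, 3, 2}" "?le a b" by (simp_all only: hA)
    have da: "d a \<in> hom C M (fst (D0, D1) a)" by (rule dh) (unfold ObA, rule x(2))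
    consider "a = b" | "a = 0" "b = 2" | "a = 3" "b = 2" using x by auto
    then show "snd (D0, D1) x \<bullet> d a = d b"
    proof cases
      assume "a = b"
      then show ?thesis using da unfolding x(1) by (simp add: hom_iff)
    next
      assume "a = 0" "b = 2"
      then show ?thesis unfolding x(1) using that(3) by simp
    next
      assume "a = 3" "b = 2"
      then show ?thesis unfolding x(1) using that(4) by simp
    qed
  qed
  have coneD: "d 0 \<in> hom C M (Dom C f)" "d 3 \<in> hom C M (Dom C g)" "f \<bullet> d 0 = d 2" "g \<bullet> d 3 = d 2"
    if "is_cone ?A C (D0, D1) M d" for M d
  proof -
    have "d 0 \<in> hom C M (D0 0)" "d 3 \<in> hom C M (D0 3)" using that by (auto simp: is_cone_def ObA)
    then show "d 0 \<in> hom C M (Dom C f)" "d 3 \<in> hom C M (Dom C g)" by simp_all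
    have "(0, 2) \<in> hom ?A 0 2" "(3, 2) \<in> hom ?A 3 2" unfolding hA by auto
    then have "D1 (0, 2) \<bullet> d 0 = d 2" "D1 (3, 2) \<bullet> d 3 = d 2"
      using that unfolding is_cone_def snd_conv by blast+
    then show "f \<bullet> d 0 = d 2" "g \<bullet> d 3 = d 2" by simp_all
  qed
  have Lc: "is_cone ?A C (D0, D1) L c" using L by (simp add: is_limit_iff)
  note c = coneD[OF Lc]
  have key: "\<exists>!h. h \<in> hom C W L \<and> c 0 \<bullet> h = u \<and> c 3 \<bullet> h = v"
    if u: "u \<in> hom C W (Dom C f)" and v: "v \<in> hom C W (Dom C g)" and eq: "f \<bullet> u = g \<bullet> v" for W u v
  proof -
    define d where "d i = (if i = (0::nat) then u else if i = 3 then v else f \<bullet> u)" for i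
    have d [simp]: "d 0 = u" "d 3 = v" "d 2 = f \<bullet> u" by (auto simp: d_def)
    have "is_cone ?A C (D0, D1) W d" by (rule coneI) (use u v eq in auto)
    then have ex: "\<exists>!h. h \<in> hom C W L \<and> (\<forall>a\<in>Ob ?A. c a \<bullet> h = d a)"
      using L unfolding is_limit_iff by blast
    have c2: "c 2 \<bullet> h = f \<bullet> c 0 \<bullet> h" if "h \<in> hom C W L" for h
      using comp_reassoc[OF c(3)] that c f by (simp add: hom_iff)
    have "h \<in> hom C W L \<and> (\<forall>a\<in>Ob ?A. c a \<bullet> h = d a) \<longleftrightarrow>
        h \<in> hom C W L \<and> c 0 \<bullet> h = u \<and> c 3 \<bullet> h = v" for h
      using c2 unfolding ObA by auto
    then show ?thesis using ex by auto
  qed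
  have "is_pullback C (c 0) (c 3) f g"
  proof -
    have "Dom C (c 0) = L" using c(1) by (simp add: hom_iff)
    then show ?thesis unfolding is_pullback_def using c f g fg key by simp
  qed
  then show ?thesis by blast
qed

lemma pullback_terminal_product:
  fixes C (structure)
  assumes C: "category C" and T: "is_terminal C T" and pb: "is_pullback C p q f g"
    and f: "f \<in> hom C X T" and g: "g \<in> hom C Y T"
  shows "is_product C X Y p q"
proof -
  interpret cat_ctx C by unfold_locales (rule C)
  note D = pullbackD[OF pb]
  have eq: "f \<bullet> u = g \<bullet> v" if "u \<in> hom C W X" "v \<in> hom C W Y" for u v W
    using T comp_hom[OF f that(1)] comp_hom[OF g that(2)] hom_Ob[OF that(1)]
    unfolding is_terminal_def by blast
  have "Dom C f = X" "Dom C g = Y" using f g by (simp_all add: hom_iff)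
  then show ?thesis using pb eq unfolding is_product_def is_pullback_def by blast
qed

lemma product_terminal_pullback:
  fixes C (structure)
  assumes C: "category C" and T: "is_terminal C T" and pr: "is_product C X Y p q"
    and f: "f \<in> hom C X T" and g: "g \<in> hom C Y T"
  shows "is_pullback C p q f g"
proof -
  interpret cat_ctx C by unfold_locales (rule C)
  have pq: "p \<in> hom C (Dom C p) X" "q \<in> hom C (Dom C p) Y" using pr by (simp_all add: is_product_def)
  have eq: "f \<bullet> u = g \<bullet> v" if "u \<in> hom C W X" "v \<in> hom C W Y" for u v W
    using T comp_hom[OF f that(1)] comp_hom[OF g that(2)] hom_Ob[OF that(1)]
    unfolding is_terminal_def by blast
  have "Dom C f = X" "Dom C g = Y" "f \<in> Ar C" "g \<in> Ar C" "Cod C f = Cod C g" using f g by (simp_all add: hom_iff)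
  then show ?thesis using pr eq[OF pq] pq unfolding is_product_def is_pullback_def by simp
qed

lemma complete_product:
  fixes C :: "('o, 'm, 'z) cat_scheme"
  assumes inacc: "inaccessible |UNIV :: 'u set|" and comp: "complete_cat TYPE('u) C" and C: "category C"
    and X: "X \<in> Ob C" and Y: "Y \<in> Ob C"
  shows "\<exists>p q. is_product C X Y p q"
proof -
  obtain T where T: "is_terminal C T" using complete_terminal[OF inacc comp] by blast
  obtain f g where fg: "f \<in> hom C X T" "g \<in> hom C Y T" using T X Y unfolding is_terminal_def by blast
  then obtain p q where "is_pullback C p q f g"
    using complete_pullback[OF inacc comp C, of f g] by (auto simp: hom_iff)
  then show ?thesis using pullback_terminal_product[OF C T _ fg] by blast
qed

lemma product_iso:
  fixes C (structure)
  assumes C: "category C" and pr: "is_product C X Y p q" and i: "i \<in> hom C Z (Dom C p)" "k \<in> hom C (Dom C p) Z"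
    "i \<bullet> k = Idn C (Dom C p)" "k \<bullet> i = Idn C Z"
  shows "is_product C X Y (p \<bullet> i) (q \<bullet> i)"
  unfolding is_product_def
proof (intro conjI allI ballI)
  interpret cat_ctx C by unfold_locales (rule C)
  have pq: "p \<in> hom C (Dom C p) X" "q \<in> hom C (Dom C p) Y" using pr by (simp_all add: is_product_def)
  have D: "Dom C (p \<bullet> i) = Z" using i pq by (simp add: hom_iff)
  show "p \<bullet> i \<in> hom C (Dom C (p \<bullet> i)) X" "q \<bullet> i \<in> hom C (Dom C (p \<bullet> i)) Y"
    unfolding D using comp_hom pq i by blast+
  fix W u v assume uv: "u \<in> hom C W X" "v \<in> hom C W Y"
  then obtain h where h: "h \<in> hom C W (Dom C p)" "p \<bullet> h = u" "q \<bullet> h = v"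
    and uniq: "\<And>h'. h' \<in> hom C W (Dom C p) \<Longrightarrow> p \<bullet> h' = u \<Longrightarrow> q \<bullet> h' = v \<Longrightarrow> h' = h"
    using pr unfolding is_product_def by metis
  have ik: "i \<bullet> k \<bullet> x = x" if "x \<in> hom C W (Dom C p)" for x
    using comp_reassoc[OF i(3)] i that by (simp add: hom_iff)
  have ki: "k \<bullet> i \<bullet> x = x" if "x \<in> hom C W Z" for x
    using comp_reassoc[OF i(4)] i that by (simp add: hom_iff)
  have assoc: "(p \<bullet> i) \<bullet> x = p \<bullet> i \<bullet> x" "(q \<bullet> i) \<bullet> x = q \<bullet> i \<bullet> x"
    if "x \<in> hom C W Z" for x using pq i that by (simp_all add: hom_iff)
  show "\<exists>!h. h \<in> hom C W (Dom C (p \<bullet> i)) \<and> (p \<bullet> i) \<bullet> h = u \<and> (q \<bullet> i) \<bullet> h = v"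
    unfolding D
  proof (rule ex1I[of _ "k \<bullet> h"])
    have kh: "k \<bullet> h \<in> hom C W Z" using i(2) h(1) by (rule comp_hom)
    then show "k \<bullet> h \<in> hom C W Z \<and> (p \<bullet> i) \<bullet> k \<bullet> h = u \<and> (q \<bullet> i) \<bullet> k \<bullet> h = v"
      using assoc[OF kh] ik[OF h(1)] h by simp
    fix x assume x: "x \<in> hom C W Z \<and> (p \<bullet> i) \<bullet> x = u \<and> (q \<bullet> i) \<bullet> x = v"
    then have "i \<bullet> x = h" using uniq[of "i \<bullet> x"] assoc[of x] comp_hom[OF i(1), of x W] by metis
    then show "x = k \<bullet> h" using ki[of x] x by simp
  qed
qed

definition is_coproduct :: "('o, 'm, 'z) cat_scheme \<Rightarrow> 'i set \<Rightarrow> ('i \<Rightarrow> 'o) \<Rightarrow> 'o \<Rightarrow> ('i \<Rightarrow> 'm) \<Rightarrow> bool" where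
  "is_coproduct C I D L \<iota> \<longleftrightarrow> L \<in> Ob C \<and> (\<forall>i\<in>I. \<iota> i \<in> hom C (D i) L) \<and>
     (\<forall>M d. M \<in> Ob C \<and> (\<forall>i\<in>I. d i \<in> hom C (D i) M) \<longrightarrow>
        (\<exists>!h. h \<in> hom C L M \<and> (\<forall>i\<in>I. h \<bullet>\<^bsub>C\<^esub> \<iota> i = d i)))"

lemma is_copow_iff: "is_copow C A L c \<longleftrightarrow> (\<exists>T. is_terminal C T \<and> is_coproduct C A (\<lambda>_. T) L c)"
  unfolding is_copow_def is_coproduct_def by blast

lemma cocomplete_coproduct:
  fixes C :: "('o, 'm, 'z) cat_scheme" (structure)
  assumes comp: "cocomplete_cat TYPE('u) C" and C: "category C" and I: "usmall TYPE('u) I"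
    and D: "\<And>i. i \<in> I \<Longrightarrow> D i \<in> Ob C"
  shows "\<exists>L \<iota>. is_coproduct C I D L \<iota>"
proof -
  interpret cat_ctx C by unfold_locales (rule C)
  obtain g :: "'a \<Rightarrow> 'u" where g: "inj_on g I" using usmall_code[OF I] .
  define A :: "('u, 'u) cat" where "A = \<lparr>Ob = g ` I, Ar = g ` I, Dom = (\<lambda>x. x), Cod = (\<lambda>x. x), Idn = (\<lambda>x. x),
    Cmp = (\<lambda>x y. x)\<rparr>"
  define F where "F = (\<lambda>x. D (inv_into I g x), \<lambda>x. Idn C (D (inv_into I g x)))"
  have Fg [simp]: "fst F (g i) = D i" "snd F (g i) = Idn C (D i)" if "i \<in> I" for i
    using that g by (simp_all add: F_def)
  have homA: "hom A a b = (if a = b \<and> a \<in> g ` I then {a} else {})" for a b by (auto simp: hom_iff A_def)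
  have "category A" unfolding category_def homA by (auto simp: A_def)
  moreover have "is_functor A C F"
    unfolding is_functor_def homA using D by (auto simp: A_def)
  moreover have "usmall TYPE('u) (Ob A)" "usmall TYPE('u) (Ar A)" using I by (simp_all add: A_def usmall_image)
  ultimately obtain L c where L: "is_colimit A C F L c" using comp unfolding cocomplete_cat_def by blast
  have ObA: "Ob A = g ` I" by (simp add: A_def)
  have L1: "L \<in> Ob C" "\<And>a. a \<in> Ob A \<Longrightarrow> c a \<in> hom C (fst F a) L"
    using L unfolding is_colimit_def Let_def by blast+
  have L2: "\<exists>!h. h \<in> hom C L M \<and> (\<forall>a\<in>Ob A. h \<bullet> c a = d a)"
    if "M \<in> Ob C" "\<forall>a\<in>Ob A. d a \<in> hom C (fst F a) M" "\<forall>a b. \<forall>f\<in>hom A a b. d b \<bullet> snd F f = d a" for M d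
    using L that unfolding is_colimit_def Let_def by blast
  have "is_coproduct C I D L (\<lambda>i. c (g i))"
    unfolding is_coproduct_def
  proof (intro conjI allI ballI impI)
    show "L \<in> Ob C" by fact
    fix i assume "i \<in> I"
    then show "c (g i) \<in> hom C (D i) L" using L1(2)[of "g i"] by (simp add: ObA)
  next
    fix M d assume *: "M \<in> Ob C \<and> (\<forall>i\<in>I. d i \<in> hom C (D i) M)"
    let ?d = "\<lambda>x. d (inv_into I g x)"
    have "\<exists>!h. h \<in> hom C L M \<and> (\<forall>a\<in>Ob A. h \<bullet> c a = ?d a)"
      by (rule L2) (use * g in \<open>auto simp: ObA homA hom_iff split: if_splits\<close>)
    then show "\<exists>!h. h \<in> hom C L M \<and> (\<forall>i\<in>I. h \<bullet> c (g i) = d i)"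
      using g by (simp add: ObA)
  qed
  then show ?thesis by blast
qed

section \<open>Simplicial objects\<close>

lemma Delta_hom: "\<alpha> \<in> hom Delta m n \<longleftrightarrow> (\<exists>f. \<alpha> = (m, n, f) \<and> f \<in> {..m} \<rightarrow>\<^sub>E {..n} \<and> mono_on {..m} f)"
  by (auto simp: hom_iff Delta_def)

lemma Delta_comp_hom: "\<beta> \<in> hom Delta m n \<Longrightarrow> \<alpha> \<in> hom Delta l m \<Longrightarrow> \<beta> \<bullet>\<^bsub>Delta\<^esub> \<alpha> \<in> hom Delta l n"
proof -
  assume "\<beta> \<in> hom Delta m n" "\<alpha> \<in> hom Delta l m"
  then obtain g f where g: "\<beta> = (m, n, g)" "g \<in> {..m} \<rightarrow>\<^sub>E {..n}" "mono_on {..m} g"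
    and f: "\<alpha> = (l, m, f)" "f \<in> {..l} \<rightarrow>\<^sub>E {..m}" "mono_on {..l} f"
    unfolding Delta_hom by blast
  have fm: "f x \<in> {..m}" if "x \<in> {..l}" for x using f(2) that by blast
  then have gn: "g (f x) \<in> {..n}" if "x \<in> {..l}" for x using g(2) that by blast
  have "mono_on {..l} (compose {..l} g f)"
  proof (rule mono_onI)
    fix r s assume rs: "r \<in> {..l}" "s \<in> {..l}" "r \<le> s"
    then have "f r \<le> f s" using f(3) by (simp add: mono_on_def)
    then have "g (f r) \<le> g (f s)" using g(3) fm[OF rs(1)] fm[OF rs(2)] by (simp add: mono_on_def)
    then show "compose {..l} g f r \<le> compose {..l} g f s" using rs by (simp add: compose_def)
  qed
  moreover have "compose {..l} g f \<in> {..l} \<rightarrow>\<^sub>E {..n}" using gn by (auto simp: compose_def)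
  ultimately show ?thesis unfolding Delta_hom g f by (auto simp: Delta_def)
qed

lemma Delta_id_hom: "Idn Delta n \<in> hom Delta n n"
  unfolding Delta_hom by (auto simp: Delta_def mono_on_def)

lemma category_Delta: "category Delta"
  unfolding category_def
proof (intro conjI allI ballI)
  fix f assume "f \<in> Ar Delta"
  show "Dom Delta f \<in> Ob Delta" "Cod Delta f \<in> Ob Delta" by (auto simp: Delta_def)
next
  fix X show "Idn Delta X \<in> hom Delta X X" by (rule Delta_id_hom)
next
  fix X Y Z f g assume "f \<in> hom Delta X Y" "g \<in> hom Delta Y Z"
  then show "g \<bullet>\<^bsub>Delta\<^esub> f \<in> hom Delta X Z" by (rule Delta_comp_hom[rotated])
next
  fix X Y f assume "f \<in> hom Delta X Y"
  then obtain g where g: "f = (X, Y, g)" "g \<in> {..X} \<rightarrow>\<^sub>E {..Y}" unfolding Delta_hom by blast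
  have "compose {..X} g (\<lambda>i\<in>{..X}. i) = g" "compose {..X} (\<lambda>i\<in>{..Y}. i) g = g"
    using g(2) by (auto simp: compose_def fun_eq_iff PiE_def extensional_def)
  then show "f \<bullet>\<^bsub>Delta\<^esub> Idn Delta X = f" "Idn Delta Y \<bullet>\<^bsub>Delta\<^esub> f = f" by (simp_all add: g Delta_def)
next
  fix W X Y Z f g h assume "f \<in> hom Delta W X" "g \<in> hom Delta X Y" "h \<in> hom Delta Y Z"
  then obtain f' g' h' where "f = (W, X, f')" "f' \<in> {..W} \<rightarrow>\<^sub>E {..X}" "g = (X, Y, g')" "h = (Y, Z, h')"
    unfolding Delta_hom by blast
  then show "h \<bullet>\<^bsub>Delta\<^esub> g \<bullet>\<^bsub>Delta\<^esub> f = (h \<bullet>\<^bsub>Delta\<^esub> g) \<bullet>\<^bsub>Delta\<^esub> f"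
    by (auto simp: Delta_def compose_def fun_eq_iff PiE_def Pi_def)
qed

interpretation Delta: cat_ctx Delta
  by unfold_locales (rule category_Delta)

lemma countable_Delta: "countable (Ar Delta)"
proof -
  have "Ar Delta \<subseteq> (\<Union>m n. (\<lambda>f. (m, n, f)) ` ({..m} \<rightarrow>\<^sub>E {..n}))" by (auto simp: Delta_def)
  moreover have "countable ({..m} \<rightarrow>\<^sub>E {..n})" for m n :: nat
    by (intro countable_finite finite_PiE) auto
  then have "countable (\<Union>m n. (\<lambda>f. (m, n, f)) ` ({..m} \<rightarrow>\<^sub>E {..n}) :: dmap set)" by simp
  ultimately show ?thesis by (rule countable_subset)
qed

abbreviation cmp :: "('o, 'm) sar \<Rightarrow> nat \<Rightarrow> 'm" where
  "cmp f \<equiv> snd (snd f)"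

lemma hom_opcat: "hom (opcat C) a b = hom C b a"
  by (auto simp: hom_def opcat_def)

lemma opcat_simps: "Ob (opcat C) = Ob C" "Ar (opcat C) = Ar C" "Idn (opcat C) = Idn C" "g \<bullet>\<^bsub>opcat C\<^esub> f = f \<bullet>\<^bsub>C\<^esub> g"
  by (simp_all add: opcat_def)

lemma Ob_Delta: "Ob Delta = UNIV"
  by (simp add: Delta_def)

lemma sE_Ob:
  fixes E :: "('o, 'm, 'z) cat_scheme" (structure)
  shows "X \<in> Ob (simp_cat E) \<longleftrightarrow> (\<forall>n. fst X n \<in> Ob E) \<and>
    (\<forall>m n. \<forall>\<alpha>\<in>hom Delta m n. snd X \<alpha> \<in> hom E (fst X n) (fst X m)) \<and>
    (\<forall>n. snd X (Idn Delta n) = Idn E (fst X n)) \<and>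
    (\<forall>l m n. \<forall>\<alpha>\<in>hom Delta l m. \<forall>\<beta>\<in>hom Delta m n. snd X (\<beta> \<bullet>\<^bsub>Delta\<^esub> \<alpha>) = snd X \<alpha> \<bullet> snd X \<beta>) \<and>
    snd X \<in> extensional (Ar Delta)"
  by (auto simp: simp_cat_def functor_cat_def is_functor_def opcat_simps hom_opcat Ob_Delta)

lemma sE_hom:
  fixes E :: "('o, 'm, 'z) cat_scheme" (structure)
  shows "f \<in> hom (simp_cat E) X Y \<longleftrightarrow> X \<in> Ob (simp_cat E) \<and> Y \<in> Ob (simp_cat E) \<and> fst f = X \<and> fst (snd f) = Y \<and>
    (\<forall>n. cmp f n \<in> hom E (fst X n) (fst Y n)) \<and>
    (\<forall>m n. \<forall>\<alpha>\<in>hom Delta m n. snd Y \<alpha> \<bullet> cmp f n = cmp f m \<bullet> snd X \<alpha>)"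
proof -
  obtain F G t where f: "f = (F, G, t)" by (cases f)
  show ?thesis
    unfolding f
    by (auto simp: hom_iff[of _ "simp_cat E"])
      (auto simp: simp_cat_def functor_cat_def Let_def opcat_simps hom_opcat Ob_Delta)
qed

lemma sE_comp_cmp [simp]: "cmp (g \<bullet>\<^bsub>simp_cat E\<^esub> f) n = cmp g n \<bullet>\<^bsub>E\<^esub> cmp f n"
  by (auto simp: simp_cat_def functor_cat_def Let_def opcat_simps Ob_Delta split: prod.splits)

lemma sE_comp_ends: "fst (g \<bullet>\<^bsub>simp_cat E\<^esub> f) = fst f" "fst (snd (g \<bullet>\<^bsub>simp_cat E\<^esub> f)) = fst (snd g)"
  by (auto simp: simp_cat_def functor_cat_def Let_def split: prod.splits)

lemma sE_id: "cmp (Idn (simp_cat E) X) n = Idn E (fst X n)" "fst (Idn (simp_cat E) X) = X"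
    "fst (snd (Idn (simp_cat E) X)) = X"
  by (auto simp: simp_cat_def functor_cat_def Let_def opcat_simps Ob_Delta)

lemma sE_eqI:
  assumes "f \<in> hom (simp_cat E) X Y" "g \<in> hom (simp_cat E) X' Y'" "X = X'" "Y = Y'" "\<And>n. cmp f n = cmp g n"
  shows "f = g"
  using assms unfolding sE_hom by (simp add: prod_eq_iff fun_eq_iff)

locale simp_ctx = E: cat_ctx E for E :: "('o, 'm, 'z) cat_scheme" (structure)
begin

abbreviation "sE \<equiv> simp_cat E"

lemma sE_ObD:
  assumes "X \<in> Ob sE"
  shows "fst X n \<in> Ob E" "\<alpha> \<in> hom Delta m n \<Longrightarrow> snd X \<alpha> \<in> hom E (fst X n) (fst X m)"
    "snd X (Idn Delta n) = Idn E (fst X n)"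
    "\<alpha> \<in> hom Delta l m \<Longrightarrow> \<beta> \<in> hom Delta m n \<Longrightarrow> snd X (\<beta> \<bullet>\<^bsub>Delta\<^esub> \<alpha>) = snd X \<alpha> \<bullet> snd X \<beta>"
  using assms unfolding sE_Ob by blast+

lemma sE_homD:
  assumes "f \<in> hom sE X Y"
  shows "cmp f n \<in> hom E (fst X n) (fst Y n)"
    "\<alpha> \<in> hom Delta m n \<Longrightarrow> snd Y \<alpha> \<bullet> cmp f n = cmp f m \<bullet> snd X \<alpha>" "X \<in> Ob sE" "Y \<in> Ob sE"
  using assms unfolding sE_hom by blast+

lemma sE_homI:
  assumes "X \<in> Ob sE" "Y \<in> Ob sE" "\<And>n. t n \<in> hom E (fst X n) (fst Y n)"
    "\<And>m n \<alpha>. \<alpha> \<in> hom Delta m n \<Longrightarrow> snd Y \<alpha> \<bullet> t n = t m \<bullet> snd X \<alpha>"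
  shows "(X, Y, t) \<in> hom sE X Y"
  using assms unfolding sE_hom by simp

lemma sE_Ar: "f \<in> Ar sE \<longleftrightarrow> f \<in> hom sE (Dom sE f) (Cod sE f)"
  by (simp add: hom_iff)

lemma category_sE: "category sE"
  unfolding category_def
proof (intro conjI allI ballI)
  fix f assume "f \<in> Ar sE"
  then show "Dom sE f \<in> Ob sE" "Cod sE f \<in> Ob sE" using sE_homD unfolding sE_Ar by blast+
next
  fix X assume X: "X \<in> Ob sE"
  show "Idn sE X \<in> hom sE X X"
    unfolding sE_hom using X by (auto simp: sE_id sE_ObD dest: sE_ObD(2)[OF X] simp: hom_iff)
next
  fix X Y Z f g assume f: "f \<in> hom sE X Y" and g: "g \<in> hom sE Y Z"
  note F = sE_homD[OF f] and G = sE_homD[OF g]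
  show "g \<bullet>\<^bsub>sE\<^esub> f \<in> hom sE X Z"
    unfolding sE_hom sE_comp_cmp sE_comp_ends
  proof (intro conjI allI ballI)
    show "fst f = X" "fst (snd g) = Z" using f g by (simp_all add: sE_hom)
    show "cmp g n \<bullet> cmp f n \<in> hom E (fst X n) (fst Z n)" for n using G(1) F(1) by (rule E.comp_hom)
    fix m n \<alpha> assume a: "\<alpha> \<in> hom Delta m n"
    note h = F(1)[of n] G(1)[of n] F(1)[of m] G(1)[of m] sE_ObD(2)[OF F(3) a] sE_ObD(2)[OF F(4) a] sE_ObD(2)[OF G(4) a]
    have "snd Z \<alpha> \<bullet> cmp g n \<bullet> cmp f n = cmp g m \<bullet> snd Y \<alpha> \<bullet> cmp f n"
      using E.square_reassoc[OF G(2)[OF a]] h by (simp add: hom_iff)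
    also have "\<dots> = (cmp g m \<bullet> cmp f m) \<bullet> snd X \<alpha>" using F(2)[OF a] h by (simp add: hom_iff)
    finally show "snd Z \<alpha> \<bullet> cmp g n \<bullet> cmp f n = (cmp g m \<bullet> cmp f m) \<bullet> snd X \<alpha>" .
  qed (use F G in auto)
next
  fix X Y f assume f: "f \<in> hom sE X Y"
  have "cmp f n \<bullet> Idn E (fst X n) = cmp f n" "Idn E (fst Y n) \<bullet> cmp f n = cmp f n" for n
    using sE_homD(1)[OF f, of n] by (simp_all add: hom_iff)
  then show "f \<bullet>\<^bsub>sE\<^esub> Idn sE X = f" "Idn sE Y \<bullet>\<^bsub>sE\<^esub> f = f"
    using f unfolding sE_hom by (simp_all add: prod_eq_iff fun_eq_iff sE_comp_ends sE_id)
next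
  fix W X Y Z f g h assume fgh: "f \<in> hom sE W X" "g \<in> hom sE X Y" "h \<in> hom sE Y Z"
  have "cmp h n \<bullet> cmp g n \<bullet> cmp f n = (cmp h n \<bullet> cmp g n) \<bullet> cmp f n" for n
    using sE_homD(1)[OF fgh(1), of n] sE_homD(1)[OF fgh(2), of n] sE_homD(1)[OF fgh(3), of n] by (simp add: hom_iff)
  then show "h \<bullet>\<^bsub>sE\<^esub> g \<bullet>\<^bsub>sE\<^esub> f = (h \<bullet>\<^bsub>sE\<^esub> g) \<bullet>\<^bsub>sE\<^esub> f"
    by (simp add: prod_eq_iff fun_eq_iff sE_comp_ends)
qed

sublocale S: cat_ctx sE
  by unfold_locales (rule category_sE)

text \<open>
  Presheaves \<open>F n\<close> on the base category with compatible operators \<open>tr \<alpha> : F n \<rightarrow> F m\<close> that are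
  represented by objects \<open>P n\<close> make \<open>P\<close> a simplicial object, and maps into \<open>P\<close> are compatible
  families of elements.  Terminal objects, pullbacks and cotensors are obtained in this way.
\<close>

lemma pointwise_representable:
  fixes F :: "nat \<Rightarrow> 'o \<Rightarrow> 'e set" and res :: "nat \<Rightarrow> 'e \<Rightarrow> 'm \<Rightarrow> 'e" and tr :: "dmap \<Rightarrow> 'e \<Rightarrow> 'e"
  assumes P: "\<And>n. P n \<in> Ob E" and u: "\<And>n. u n \<in> F n (P n)"
    and rep: "\<And>n Z x. Z \<in> Ob E \<Longrightarrow> x \<in> F n Z \<Longrightarrow> \<exists>!h. h \<in> hom E Z (P n) \<and> res n (u n) h = x"
    and res: "\<And>n Z Z' x h. x \<in> F n Z \<Longrightarrow> h \<in> hom E Z' Z \<Longrightarrow> res n x h \<in> F n Z'"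
    and res_id: "\<And>n Z x. Z \<in> Ob E \<Longrightarrow> x \<in> F n Z \<Longrightarrow> res n x (Idn E Z) = x"
    and res_comp: "\<And>n Z Z' Z'' x h k. x \<in> F n Z \<Longrightarrow> h \<in> hom E Z' Z \<Longrightarrow> k \<in> hom E Z'' Z' \<Longrightarrow>
      res n (res n x h) k = res n x (h \<bullet> k)"
    and tr: "\<And>m n \<alpha> Z x. x \<in> F n Z \<Longrightarrow> \<alpha> \<in> hom Delta m n \<Longrightarrow> tr \<alpha> x \<in> F m Z"
    and tr_res: "\<And>m n \<alpha> Z Z' x h. x \<in> F n Z \<Longrightarrow> h \<in> hom E Z' Z \<Longrightarrow> \<alpha> \<in> hom Delta m n \<Longrightarrow>
      tr \<alpha> (res n x h) = res m (tr \<alpha> x) h"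
    and tr_id: "\<And>n Z x. x \<in> F n Z \<Longrightarrow> tr (Idn Delta n) x = x"
    and tr_comp: "\<And>l m n \<alpha> \<beta> Z x. x \<in> F n Z \<Longrightarrow> \<alpha> \<in> hom Delta l m \<Longrightarrow> \<beta> \<in> hom Delta m n \<Longrightarrow>
      tr (\<beta> \<bullet>\<^bsub>Delta\<^esub> \<alpha>) x = tr \<alpha> (tr \<beta> x)"
  shows "\<exists>X. X \<in> Ob sE \<and> fst X = P \<and>
    (\<forall>m n. \<forall>\<alpha>\<in>hom Delta m n. res m (u m) (snd X \<alpha>) = tr \<alpha> (u n)) \<and>
    (\<forall>Y e. Y \<in> Ob sE \<and> (\<forall>n. e n \<in> F n (fst Y n)) \<and>
      (\<forall>m n. \<forall>\<alpha>\<in>hom Delta m n. res m (e m) (snd Y \<alpha>) = tr \<alpha> (e n)) \<longrightarrow>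
      (\<exists>!f. f \<in> hom sE Y X \<and> (\<forall>n. res n (u n) (cmp f n) = e n)))"
proof -
  have eqI: "h = h'" if "h \<in> hom E Z (P n)" "h' \<in> hom E Z (P n)" "res n (u n) h = res n (u n) h'" for h h' Z n
    using rep[of Z "res n (u n) h" n] res[OF u that(1)] E.hom_Ob(1)[OF that(1)] that by metis
  have ex: "\<exists>!h. h \<in> hom E (P n) (P m) \<and> res m (u m) h = tr \<alpha> (u n)" if "\<alpha> \<in> hom Delta m n" for \<alpha> m n
    using rep[OF P tr[OF u that]] .
  define X1 where "X1 = (\<lambda>\<alpha>\<in>Ar Delta. THE h. h \<in> hom E (P (Cod Delta \<alpha>)) (P (Dom Delta \<alpha>)) \<and>
    res (Dom Delta \<alpha>) (u (Dom Delta \<alpha>)) h = tr \<alpha> (u (Cod Delta \<alpha>)))"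
  have X1: "X1 \<alpha> \<in> hom E (P n) (P m)" "res m (u m) (X1 \<alpha>) = tr \<alpha> (u n)" if "\<alpha> \<in> hom Delta m n" for \<alpha> m n
    using theI'[OF ex[OF that]] that by (auto simp: X1_def hom_iff[of \<alpha>])
  have X1_comp: "X1 (\<beta> \<bullet>\<^bsub>Delta\<^esub> \<alpha>) = X1 \<alpha> \<bullet> X1 \<beta>"
    if a: "\<alpha> \<in> hom Delta l m" and b: "\<beta> \<in> hom Delta m n" for \<alpha> \<beta> l m n
  proof (rule eqI)
    show "X1 (\<beta> \<bullet>\<^bsub>Delta\<^esub> \<alpha>) \<in> hom E (P n) (P l)" using X1(1)[OF Delta_comp_hom[OF b a]] .
    show "X1 \<alpha> \<bullet> X1 \<beta> \<in> hom E (P n) (P l)" using X1(1)[OF a] X1(1)[OF b] by (rule E.comp_hom)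
    have "res l (u l) (X1 \<alpha> \<bullet> X1 \<beta>) = res l (tr \<alpha> (u m)) (X1 \<beta>)"
      using res_comp[OF u X1(1)[OF a] X1(1)[OF b]] X1(2)[OF a] by simp
    also have "\<dots> = tr (\<beta> \<bullet>\<^bsub>Delta\<^esub> \<alpha>) (u n)"
      using tr_res[OF u X1(1)[OF b] a] X1(2)[OF b] tr_comp[OF u a b] by simp
    finally show "res l (u l) (X1 (\<beta> \<bullet>\<^bsub>Delta\<^esub> \<alpha>)) = res l (u l) (X1 \<alpha> \<bullet> X1 \<beta>)"
      using X1(2)[OF Delta_comp_hom[OF b a]] by simp
  qed
  have X1_id: "X1 (Idn Delta n) = Idn E (P n)" for n
    by (rule eqI[OF X1(1)[OF Delta_id_hom] E.id_hom[OF P]])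
      (use X1(2)[OF Delta_id_hom] tr_id[OF u] res_id[OF P u] in simp)
  define X where "X = (P, X1)"
  have X: "X \<in> Ob sE" unfolding sE_Ob using P X1 X1_id X1_comp by (auto simp: X_def X1_def)
  show ?thesis
  proof (intro exI[of _ X] conjI allI ballI impI X)
    show "fst X = P" by (simp add: X_def)
    show "res m (u m) (snd X \<alpha>) = tr \<alpha> (u n)" if "\<alpha> \<in> hom Delta m n" for m n \<alpha>
      using X1(2)[OF that] by (simp add: X_def)
    fix Y e assume "Y \<in> Ob sE \<and> (\<forall>n. e n \<in> F n (fst Y n)) \<and>
      (\<forall>m n. \<forall>\<alpha>\<in>hom Delta m n. res m (e m) (snd Y \<alpha>) = tr \<alpha> (e n))"
    then have Y: "Y \<in> Ob sE" and e: "\<And>n. e n \<in> F n (fst Y n)"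
      and nat: "\<And>m n \<alpha>. \<alpha> \<in> hom Delta m n \<Longrightarrow> res m (e m) (snd Y \<alpha>) = tr \<alpha> (e n)" by blast+
    note Yo = sE_ObD[OF Y]
    have "\<forall>n. \<exists>h. h \<in> hom E (fst Y n) (P n) \<and> res n (u n) h = e n" using rep[OF Yo(1) e] by blast
    then obtain h where h: "\<And>n. h n \<in> hom E (fst Y n) (P n)" "\<And>n. res n (u n) (h n) = e n" by metis
    have "(Y, X, h) \<in> hom sE Y X"
    proof (rule sE_homI[OF Y X])
      show "h n \<in> hom E (fst Y n) (fst X n)" for n using h by (simp add: X_def)
      fix m n \<alpha> assume a: "\<alpha> \<in> hom Delta m n"
      have "X1 \<alpha> \<bullet> h n = h m \<bullet> snd Y \<alpha>"
      proof (rule eqI)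
        show "X1 \<alpha> \<bullet> h n \<in> hom E (fst Y n) (P m)" using X1(1)[OF a] h(1) by (rule E.comp_hom)
        show "h m \<bullet> snd Y \<alpha> \<in> hom E (fst Y n) (P m)" using h(1) Yo(2)[OF a] by (rule E.comp_hom)
        have "res m (u m) (X1 \<alpha> \<bullet> h n) = tr \<alpha> (e n)"
          using res_comp[OF u X1(1)[OF a] h(1)] X1(2)[OF a] tr_res[OF u h(1) a] h(2) by simp
        moreover have "res m (u m) (h m \<bullet> snd Y \<alpha>) = tr \<alpha> (e n)"
          using res_comp[OF u h(1) Yo(2)[OF a]] h(2) nat[OF a] by simp
        ultimately show "res m (u m) (X1 \<alpha> \<bullet> h n) = res m (u m) (h m \<bullet> snd Y \<alpha>)" by simp
      qed
      then show "snd X \<alpha> \<bullet> h n = h m \<bullet> snd Y \<alpha>" by (simp add: X_def)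
    qed
    then show "\<exists>!f. f \<in> hom sE Y X \<and> (\<forall>n. res n (u n) (cmp f n) = e n)"
    proof (intro ex1I[of _ "(Y, X, h)"])
      fix f assume f: "f \<in> hom sE Y X \<and> (\<forall>n. res n (u n) (cmp f n) = e n)"
      then have "cmp f n = h n" for n
        using eqI[of "cmp f n" "fst Y n" n "h n"] h sE_homD(1)[of f Y X n] by (simp add: X_def)
      then show "f = (Y, X, h)" using f by (simp add: sE_hom prod_eq_iff fun_eq_iff)
    qed (use h in simp)
  qed
qed

lemma sE_terminal:
  assumes T: "is_terminal E T"
  shows "\<exists>X. is_terminal sE X \<and> (\<forall>n. fst X n = T)"
proof -
  have "\<exists>X. X \<in> Ob sE \<and> fst X = (\<lambda>_. T) \<and> (\<forall>m n. \<forall>\<alpha>\<in>hom Delta m n. () = ()) \<and>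
      (\<forall>Y e. Y \<in> Ob sE \<and> (\<forall>n :: nat. e n \<in> {()}) \<and> (\<forall>m n. \<forall>\<alpha>\<in>hom Delta m n. () = ()) \<longrightarrow>
        (\<exists>!f. f \<in> hom sE Y X \<and> (\<forall>n. () = e n)))"
    by (rule pointwise_representable[where F = "\<lambda>n Z. {()}" and P = "\<lambda>_. T" and u = "\<lambda>n. ()"
          and res = "\<lambda>n x h. ()" and tr = "\<lambda>\<alpha> x. ()"])
      (use T in \<open>auto simp: is_terminal_def\<close>)
  then obtain X where X: "X \<in> Ob sE" "fst X = (\<lambda>_. T)" and lift: "\<And>Y. Y \<in> Ob sE \<Longrightarrow> \<exists>!f. f \<in> hom sE Y X"
    by auto
  have "is_terminal sE X" unfolding is_terminal_def using X lift by simp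
  then show ?thesis using X by (intro exI[of _ X]) simp
qed

lemma sE_pullback:
  assumes pbs: "\<And>f g. f \<in> Ar E \<Longrightarrow> g \<in> Ar E \<Longrightarrow> Cod E f = Cod E g \<Longrightarrow> \<exists>p q. is_pullback E p q f g"
    and f: "f \<in> hom sE A S" and g: "g \<in> hom sE B S"
  shows "\<exists>p q. is_pullback sE p q f g \<and> (\<forall>n. is_pullback E (cmp p n) (cmp q n) (cmp f n) (cmp g n))"
proof -
  note f' = sE_homD[OF f] and g' = sE_homD[OF g]
  have A: "A \<in> Ob sE" and B: "B \<in> Ob sE" using f' g' by auto
  have "\<exists>p q. is_pullback E p q (cmp f n) (cmp g n)" for n
    using pbs f'(1)[of n] g'(1)[of n] by (simp add: hom_iff)
  then obtain p q where pq: "\<And>n. is_pullback E (p n) (q n) (cmp f n) (cmp g n)" by metis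
  have D: "p n \<in> hom E (Dom E (p n)) (fst A n)" "q n \<in> hom E (Dom E (p n)) (fst B n)"
    "cmp f n \<bullet> p n = cmp g n \<bullet> q n" "Dom E (cmp f n) = fst A n" "Dom E (cmp g n) = fst B n" for n
    using E.pullbackD[OF pq[of n]] f'(1)[of n] g'(1)[of n] by (simp_all add: hom_iff)
  let ?F = "\<lambda>n Z. {x. fst x \<in> hom E Z (fst A n) \<and> snd x \<in> hom E Z (fst B n) \<and> cmp f n \<bullet> fst x = cmp g n \<bullet> snd x}"
  let ?res = "\<lambda>(n :: nat) x h. (fst x \<bullet> h, snd x \<bullet> h)"
  let ?tr = "\<lambda>\<alpha> x. (snd A \<alpha> \<bullet> fst x, snd B \<alpha> \<bullet> snd x)"
  have "\<exists>X. X \<in> Ob sE \<and> fst X = (\<lambda>n. Dom E (p n)) \<and>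
    (\<forall>m n. \<forall>\<alpha>\<in>hom Delta m n. ?res m (p m, q m) (snd X \<alpha>) = ?tr \<alpha> (p n, q n)) \<and>
    (\<forall>Y e. Y \<in> Ob sE \<and> (\<forall>n. e n \<in> ?F n (fst Y n)) \<and>
      (\<forall>m n. \<forall>\<alpha>\<in>hom Delta m n. ?res m (e m) (snd Y \<alpha>) = ?tr \<alpha> (e n)) \<longrightarrow>
      (\<exists>!f. f \<in> hom sE Y X \<and> (\<forall>n. ?res n (p n, q n) (cmp f n) = e n)))"
  proof (rule pointwise_representable[where F = ?F and P = "\<lambda>n. Dom E (p n)" and u = "\<lambda>n. (p n, q n)"
          and res = ?res and tr = ?tr])
    show "Dom E (p n) \<in> Ob E" for n using E.hom_Ob(1)[OF D(1)] .
    show "(p n, q n) \<in> ?F n (Dom E (p n))" for n using D by simp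
    show "\<exists>!h. h \<in> hom E Z (Dom E (p n)) \<and> ?res n (p n, q n) h = x" if "x \<in> ?F n Z" for n Z x
    proof -
      have "\<exists>!h. h \<in> hom E Z (Dom E (p n)) \<and> p n \<bullet> h = fst x \<and> q n \<bullet> h = snd x"
        using that pq[of n] D[of n] unfolding is_pullback_def by simp
      then show ?thesis by (simp add: prod_eq_iff)
    qed
    fix n Z Z' x h assume x: "x \<in> ?F n Z" and h: "h \<in> hom E Z' Z"
    have sq: "cmp f n \<bullet> fst x \<bullet> h = cmp g n \<bullet> snd x \<bullet> h"
      using E.square_reassoc[of "cmp f n" "fst x" "cmp g n" "snd x" h] x h f'(1)[of n] g'(1)[of n]
      by (simp add: hom_iff)
    show "?res n x h \<in> ?F n Z'" using x h sq E.comp_hom by auto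
    show "?res n (?res n x h) k = ?res n x (h \<bullet> k)" if "k \<in> hom E Z'' Z'" for Z'' k
      using x h that by (simp add: hom_iff)
    show "?tr \<alpha> (?res n x h) = ?res m (?tr \<alpha> x) h" if "\<alpha> \<in> hom Delta m n" for m \<alpha>
      using x h sE_ObD(2)[OF A that] sE_ObD(2)[OF B that] by (simp add: hom_iff)
  next
    fix n Z x assume x: "x \<in> ?F n Z"
    show "?res n x (Idn E Z) = x" using x by (auto simp: hom_iff)
    show "?tr (Idn Delta n) x = x" using x sE_ObD(3)[OF A] sE_ObD(3)[OF B] by (auto simp: hom_iff)
    show "?tr \<alpha> x \<in> ?F m Z" if a: "\<alpha> \<in> hom Delta m n" for m \<alpha>
    proof -
      note aa = sE_ObD(2)[OF A a] sE_ObD(2)[OF B a] sE_ObD(2)[OF f'(4) a] f'(1)[of n] g'(1)[of n] f'(1)[of m] g'(1)[of m]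
      have "cmp f m \<bullet> snd A \<alpha> \<bullet> fst x = snd S \<alpha> \<bullet> cmp f n \<bullet> fst x"
        using E.square_reassoc[OF f'(2)[OF a, symmetric]] aa x by (simp add: hom_iff)
      moreover have "cmp g m \<bullet> snd B \<alpha> \<bullet> snd x = snd S \<alpha> \<bullet> cmp g n \<bullet> snd x"
        using E.square_reassoc[OF g'(2)[OF a, symmetric]] aa x by (simp add: hom_iff)
      ultimately show ?thesis using x aa E.comp_hom by simp
    qed
    show "?tr (\<beta> \<bullet>\<^bsub>Delta\<^esub> \<alpha>) x = ?tr \<alpha> (?tr \<beta> x)" if a: "\<alpha> \<in> hom Delta l m" and b: "\<beta> \<in> hom Delta m n" for l m \<alpha> \<beta>
      using x sE_ObD(4)[OF A a b] sE_ObD(4)[OF B a b]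
        sE_ObD(2)[OF A a] sE_ObD(2)[OF B a] sE_ObD(2)[OF A b] sE_ObD(2)[OF B b] by (simp add: hom_iff)
  qed
  then obtain X where "X \<in> Ob sE \<and> fst X = (\<lambda>n. Dom E (p n)) \<and>
    (\<forall>m n. \<forall>\<alpha>\<in>hom Delta m n. ?res m (p m, q m) (snd X \<alpha>) = ?tr \<alpha> (p n, q n)) \<and>
    (\<forall>Y e. Y \<in> Ob sE \<and> (\<forall>n. e n \<in> ?F n (fst Y n)) \<and>
      (\<forall>m n. \<forall>\<alpha>\<in>hom Delta m n. ?res m (e m) (snd Y \<alpha>) = ?tr \<alpha> (e n)) \<longrightarrow>
      (\<exists>!f. f \<in> hom sE Y X \<and> (\<forall>n. ?res n (p n, q n) (cmp f n) = e n)))" ..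
  then have X: "X \<in> Ob sE" "fst X = (\<lambda>n. Dom E (p n))"
    and nat: "\<And>m n \<alpha>. \<alpha> \<in> hom Delta m n \<Longrightarrow> ?res m (p m, q m) (snd X \<alpha>) = ?tr \<alpha> (p n, q n)"
    and lift: "\<And>Y e. Y \<in> Ob sE \<Longrightarrow> (\<And>n. e n \<in> ?F n (fst Y n)) \<Longrightarrow>
      (\<And>m n \<alpha>. \<alpha> \<in> hom Delta m n \<Longrightarrow> ?res m (e m) (snd Y \<alpha>) = ?tr \<alpha> (e n)) \<Longrightarrow>
      \<exists>!f. f \<in> hom sE Y X \<and> (\<forall>n. ?res n (p n, q n) (cmp f n) = e n)"
    by blast+
  have p: "(X, A, p) \<in> hom sE X A" and q: "(X, B, q) \<in> hom sE X B"
    using X D nat by (auto intro!: sE_homI[OF X(1)] A B)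
  have "is_pullback sE (X, A, p) (X, B, q) f g"
  proof (rule S.pullbackI)
    have fg: "Dom sE f = A" "Dom sE g = B" "Cod sE f = S" "Cod sE g = S" using f g by (simp_all add: hom_iff)
    show "f \<in> Ar sE" "g \<in> Ar sE" "Cod sE f = Cod sE g" using f g by (simp_all add: hom_iff)
    show "(X, A, p) \<in> hom sE X (Dom sE f)" "(X, B, q) \<in> hom sE X (Dom sE g)" using p q fg by simp_all
    show "f \<bullet>\<^bsub>sE\<^esub> (X, A, p) = g \<bullet>\<^bsub>sE\<^esub> (X, B, q)"
      by (rule sE_eqI[OF S.comp_hom[OF f p] S.comp_hom[OF g q]]) (use D in simp_all)
    fix W
    {
      fix a b assume "a \<in> hom sE W (Dom sE f)" "b \<in> hom sE W (Dom sE g)" and eq: "f \<bullet>\<^bsub>sE\<^esub> a = g \<bullet>\<^bsub>sE\<^esub> b"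
      then have a: "a \<in> hom sE W A" and b: "b \<in> hom sE W B" using fg by simp_all
      have eqn: "cmp f n \<bullet> cmp a n = cmp g n \<bullet> cmp b n" for n
        using arg_cong[OF eq, of "\<lambda>x. cmp x n"] by simp
      have "\<exists>!h. h \<in> hom sE W X \<and> (\<forall>n. ?res n (p n, q n) (cmp h n) = (cmp a n, cmp b n))"
        by (rule lift) (use sE_homD[OF a] sE_homD[OF b] eqn in auto)
      then obtain h where h: "h \<in> hom sE W X" "\<And>n. p n \<bullet> cmp h n = cmp a n" "\<And>n. q n \<bullet> cmp h n = cmp b n"
        by auto
      have "(X, A, p) \<bullet>\<^bsub>sE\<^esub> h = a" by (rule sE_eqI[OF S.comp_hom[OF p h(1)] a]) (use h in simp_all)
      moreover have "(X, B, q) \<bullet>\<^bsub>sE\<^esub> h = b" by (rule sE_eqI[OF S.comp_hom[OF q h(1)] b]) (use h in simp_all)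
      ultimately show "\<exists>h. h \<in> hom sE W X \<and> (X, A, p) \<bullet>\<^bsub>sE\<^esub> h = a \<and> (X, B, q) \<bullet>\<^bsub>sE\<^esub> h = b" using h by blast
    next
      fix h h' assume h: "h \<in> hom sE W X" "h' \<in> hom sE W X"
        and eq: "(X, A, p) \<bullet>\<^bsub>sE\<^esub> h = (X, A, p) \<bullet>\<^bsub>sE\<^esub> h'" "(X, B, q) \<bullet>\<^bsub>sE\<^esub> h = (X, B, q) \<bullet>\<^bsub>sE\<^esub> h'"
      have "cmp h n = cmp h' n" for n
      proof (rule E.pullback_eqI[OF pq[of n]])
        show "cmp h n \<in> hom E (fst W n) (Dom E (p n))" "cmp h' n \<in> hom E (fst W n) (Dom E (p n))"
          using sE_homD(1)[OF h(1), of n] sE_homD(1)[OF h(2), of n] X by simp_all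
        show "p n \<bullet> cmp h n = p n \<bullet> cmp h' n" using arg_cong[OF eq(1), of "\<lambda>x. cmp x n"] by simp
        show "q n \<bullet> cmp h n = q n \<bullet> cmp h' n" using arg_cong[OF eq(2), of "\<lambda>x. cmp x n"] by simp
      qed
      then show "h = h'" by (intro sE_eqI[OF h(1) h(2)]) simp_all
    }
  qed
  then show ?thesis using pq by (intro exI[of _ "(X, A, p)"] exI[of _ "(X, B, q)"]) simp
qed

text \<open>Products are computed levelwise, hence so is any product, as products are unique up to isomorphism.\<close>

lemma sE_product:
  assumes pbs: "\<And>f g. f \<in> Ar E \<Longrightarrow> g \<in> Ar E \<Longrightarrow> Cod E f = Cod E g \<Longrightarrow> \<exists>p q. is_pullback E p q f g"
    and T: "is_terminal E T" and X: "X \<in> Ob sE" and Y: "Y \<in> Ob sE"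
  shows "\<exists>p q. is_product sE X Y p q"
    and "is_product sE X Y p q \<Longrightarrow> is_product E (fst X n) (fst Y n) (cmp p n) (cmp q n)"
proof -
  obtain U where U: "is_terminal sE U" "\<And>n. fst U n = T" using sE_terminal[OF T] by auto
  obtain f g where fg: "f \<in> hom sE X U" "g \<in> hom sE Y U" using U(1) X Y unfolding is_terminal_def by blast
  obtain p' q' where pq: "is_pullback sE p' q' f g" "\<And>n. is_pullback E (cmp p' n) (cmp q' n) (cmp f n) (cmp g n)"
    using sE_pullback[OF pbs fg] by blast
  have pr: "is_product sE X Y p' q'" by (rule pullback_terminal_product[OF category_sE U(1) pq(1) fg])
  then show "\<exists>p q. is_product sE X Y p q" by blast
  have prn: "is_product E (fst X n) (fst Y n) (cmp p' n) (cmp q' n)" for n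
    by (rule pullback_terminal_product[OF E.category_C T pq(2)])
      (use sE_homD(1)[OF fg(1), of n] sE_homD(1)[OF fg(2), of n] U(2) in simp_all)
  assume pr': "is_product sE X Y p q"
  have hp: "p \<in> hom sE (Dom sE p) X" "q \<in> hom sE (Dom sE p) Y"
    and hp': "p' \<in> hom sE (Dom sE p') X" "q' \<in> hom sE (Dom sE p') Y"
    using pr pr' by (simp_all add: is_product_def)
  obtain i where i: "i \<in> hom sE (Dom sE p) (Dom sE p')" "p' \<bullet>\<^bsub>sE\<^esub> i = p" "q' \<bullet>\<^bsub>sE\<^esub> i = q"
    using pr hp unfolding is_product_def by metis
  obtain k where k: "k \<in> hom sE (Dom sE p') (Dom sE p)" "p \<bullet>\<^bsub>sE\<^esub> k = p'" "q \<bullet>\<^bsub>sE\<^esub> k = q'"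
    using pr' hp' unfolding is_product_def by metis
  have uniq: "h = Idn sE (Dom sE P)"
    if "is_product sE X Y P Q" "h \<in> hom sE (Dom sE P) (Dom sE P)" "P \<bullet>\<^bsub>sE\<^esub> h = P" "Q \<bullet>\<^bsub>sE\<^esub> h = Q" for P Q h
  proof -
    have PQ: "P \<in> hom sE (Dom sE P) X" "Q \<in> hom sE (Dom sE P) Y" using that(1) by (simp_all add: is_product_def)
    then have "\<exists>!h. h \<in> hom sE (Dom sE P) (Dom sE P) \<and> P \<bullet>\<^bsub>sE\<^esub> h = P \<and> Q \<bullet>\<^bsub>sE\<^esub> h = Q"
      using that(1) unfolding is_product_def by blast
    moreover have "Idn sE (Dom sE P) \<in> hom sE (Dom sE P) (Dom sE P)" "P \<bullet>\<^bsub>sE\<^esub> Idn sE (Dom sE P) = P"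
      "Q \<bullet>\<^bsub>sE\<^esub> Idn sE (Dom sE P) = Q"
      using PQ S.hom_Ob(1)[OF PQ(1)] by (simp_all add: hom_iff)
    ultimately show ?thesis using that by blast
  qed
  have "i \<bullet>\<^bsub>sE\<^esub> k = Idn sE (Dom sE p')"
    by (rule uniq[OF pr S.comp_hom[OF i(1) k(1)]])
      (use S.comp_reassoc[OF i(2)] S.comp_reassoc[OF i(3)] i k hp hp' in \<open>simp_all add: hom_iff\<close>)
  moreover have "k \<bullet>\<^bsub>sE\<^esub> i = Idn sE (Dom sE p)"
    by (rule uniq[OF pr' S.comp_hom[OF k(1) i(1)]])
      (use S.comp_reassoc[OF k(2)] S.comp_reassoc[OF k(3)] i k hp hp' in \<open>simp_all add: hom_iff\<close>)
  ultimately have "cmp (i \<bullet>\<^bsub>sE\<^esub> k) n = Idn E (fst (Dom sE p') n)" "cmp (k \<bullet>\<^bsub>sE\<^esub> i) n = Idn E (fst (Dom sE p) n)"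
    by (simp_all only: sE_id)
  moreover have "Dom E (cmp p' n) = fst (Dom sE p') n" using sE_homD(1)[OF hp'(1), of n] by (simp add: hom_iff)
  moreover have "cmp p n = cmp p' n \<bullet> cmp i n" "cmp q n = cmp q' n \<bullet> cmp i n"
    using arg_cong[OF i(2), of "\<lambda>x. cmp x n"] arg_cong[OF i(3), of "\<lambda>x. cmp x n"] by simp_all
  ultimately show "is_product E (fst X n) (fst Y n) (cmp p n) (cmp q n)"
    using product_iso[OF E.category_C prn[of n], of "cmp i n" "fst (Dom sE p) n" "cmp k n"]
      sE_homD(1)[OF i(1), of n] sE_homD(1)[OF k(1), of n] by simp
qed

end

section \<open>Distributivity\<close>

text \<open>The exponentials of all objects by \<open>Y\<close>, with the universal property stated for every product of
  \<open>B\<close> and \<open>Y\<close> instead of a chosen one.\<close>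

definition has_exponentials_by :: "('o, 'm, 'z) cat_scheme \<Rightarrow> 'o \<Rightarrow> bool" where
  "has_exponentials_by C Y \<longleftrightarrow> (\<forall>M\<in>Ob C. \<exists>H q1 q2 ev. is_product C H Y q1 q2 \<and> ev \<in> hom C (Dom C q1) M \<and>
     (\<forall>B r1 r2 v. is_product C B Y r1 r2 \<and> v \<in> hom C (Dom C r1) M \<longrightarrow>
       (\<exists>!x. x \<in> hom C B H \<and> (\<exists>w. w \<in> hom C (Dom C r1) (Dom C q1) \<and>
          q1 \<bullet>\<^bsub>C\<^esub> w = x \<bullet>\<^bsub>C\<^esub> r1 \<and> q2 \<bullet>\<^bsub>C\<^esub> w = r2 \<and> ev \<bullet>\<^bsub>C\<^esub> w = v))))"

lemma to_zero_0: "to_zero 0 = Idn Delta 0"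
  by (auto simp: to_zero_def Delta_def)

text \<open>On vertices, simplicial local cartesian closure gives dependent products along the map from \<open>Y\<close> to the
  terminal object, and the dependent product of \<open>Y \<times> M \<rightarrow> Y\<close> is the exponential of \<open>M\<close> by \<open>Y\<close>.\<close>

lemma lccc_exponentials:
  fixes E :: "('o, 'm, 's, 'z) smcat_scheme" (structure)
  assumes lccc: "simplicially_lccc E" and enr: "simplicially_enriched E" and T: "is_terminal E T"
    and products: "\<And>X Y. X \<in> Ob E \<Longrightarrow> Y \<in> Ob E \<Longrightarrow> \<exists>p q. is_product E X Y p q" and Y: "Y \<in> Ob E"
  shows "has_exponentials_by E Y"
  unfolding has_exponentials_by_def
proof
  fix M assume M: "M \<in> Ob E"
  have C: "category E" using enr by (simp add: simplicially_enriched_def)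
  interpret cat_ctx E by unfold_locales (rule C)

  \<comment> \<open>Vertices of mapping objects are arrows.\<close>
  have emb: "bij_betw (emb E) (hom E X Z) (fst (MapS E X Z) 0)" if "X \<in> Ob E" "Z \<in> Ob E" for X Z
    using enr that by (simp add: simplicially_enriched_def)
  have emb_inj: "f = g" if "f \<in> hom E X Z" "g \<in> hom E X Z" "emb E f = emb E g" for f g X Z
    using emb[OF hom_Ob[OF that(1)]] that unfolding bij_betw_def inj_on_def by blast
  have emb_img: "fst (MapS E X Z) 0 = emb E ` hom E X Z" if "X \<in> Ob E" "Z \<in> Ob E" for X Z
    using emb[OF that] by (simp add: bij_betw_def)
  have emb_comp: "ecmp E X Y Z 0 (emb E g) (emb E f) = emb E (g \<bullet> f)" if "f \<in> hom E X Y" "g \<in> hom E Y Z" for f g X Y Z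
    using enr that unfolding simplicially_enriched_def by metis
  have dgn0: "dgn E f 0 = emb E f" if "f \<in> Ar E" for f
  proof -
    have "emb E f \<in> fst (MapS E (Dom E f) (Cod E f)) 0"
      using emb_img[of "Dom E f" "Cod E f"] that by (simp add: homI)
    moreover have "is_sset (MapS E (Dom E f) (Cod E f))"
      using enr that unfolding simplicially_enriched_def by simp
    ultimately show ?thesis unfolding dgn_def to_zero_0 is_sset_def by blast
  qed
  have post0: "post E W g 0 (emb E f) = emb E (g \<bullet> f)" if "f \<in> hom E W X" "g \<in> hom E X Z" for f g W X Z
    using that emb_comp[OF that] dgn0[of g] by (simp add: post_def hom_iff)
  have pre0: "pre E f Z 0 (emb E g) = emb E (g \<bullet> f)" if "f \<in> hom E W X" "g \<in> hom E X Z" for f g W X Z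
    using that emb_comp[OF that] dgn0[of f] by (simp add: pre_def hom_iff)
  have slice0: "slice_map E b p 0 = emb E ` {x \<in> hom E B X. p \<bullet> x = b}"
    if "b \<in> hom E B S" "p \<in> hom E X S" for b p B X S
  proof -
    have "slice_map E b p 0 = {x \<in> emb E ` hom E B X. post E B p 0 x = emb E b}"
      using that emb_img[of B X] dgn0[of b] hom_Ob[OF that(1)] hom_Ob[OF that(2)] by (simp add: slice_map_def hom_iff)
    also have "\<dots> = emb E ` {x \<in> hom E B X. p \<bullet> x = b}"
      using post0[OF _ that(2)] emb_inj[OF comp_hom[OF that(2)] that(1)] by auto
    finally show ?thesis .
  qed

  obtain f where f: "f \<in> hom E Y T" using T Y unfolding is_terminal_def by blast
  have fA: "f \<in> Ar E" "Dom E f = Y" "Cod E f = T" using f by (simp_all add: hom_iff)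
  obtain g b where pr: "is_product E Y M g b" using products[OF Y M] by blast
  define G where "G = Dom E g"
  have gb: "g \<in> hom E G Y" "b \<in> hom E G M" using pr by (simp_all add: is_product_def G_def)
  have pr_eq: "h = h'" if "h \<in> hom E W G" "h' \<in> hom E W G" "g \<bullet> h = g \<bullet> h'" "b \<bullet> h = b \<bullet> h'" for W h h'
  proof -
    have "\<exists>!k. k \<in> hom E W G \<and> g \<bullet> k = g \<bullet> h \<and> b \<bullet> k = b \<bullet> h"
      using pr comp_hom[OF gb(1) that(1)] comp_hom[OF gb(2) that(1)] unfolding is_product_def G_def by blast
    then show ?thesis using that by metis
  qed
  have "g \<in> Ar E" "Cod E g = Dom E f" using gb fA by (simp_all add: hom_iff)
  then obtain p q1 q2 \<epsilon> where p: "p \<in> Ar E" and pb: "is_pullback E q1 q2 p f"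
    and \<epsilon>: "\<epsilon> \<in> hom E (Dom E q2) G" "g \<bullet> \<epsilon> = q2"
    and bij: "\<And>b r1 r2 n. is_pullback E r1 r2 b f \<Longrightarrow>
      bij_betw (\<lambda>x. post E (Dom E r2) \<epsilon> n (slice_pull E q1 q2 r1 r2 n x)) (slice_map E b p n) (slice_map E r2 g n)"
    using lccc fA(1) unfolding simplicially_lccc_def G_def by blast
  define H where "H = Dom E p"
  note Dq = pullbackD[OF pb]
  define Q where "Q = Dom E q1"
  have pH: "p \<in> hom E H T" using p Dq fA by (simp add: hom_iff H_def)
  have q: "q1 \<in> hom E Q H" "q2 \<in> hom E Q Y" using Dq fA by (simp_all add: hom_iff H_def Q_def)
  have \<epsilon>Q: "\<epsilon> \<in> hom E Q G" using \<epsilon> Dq by (simp add: Q_def)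
  have prH: "is_product E H Y q1 q2" by (rule pullback_terminal_product[OF C T pb pH f])
  have prH_eq: "h = h'" if "h \<in> hom E W Q" "h' \<in> hom E W Q" "q1 \<bullet> h = q1 \<bullet> h'" "q2 \<bullet> h = q2 \<bullet> h'" for W h h'
    using pullback_eqI[OF pb] that by (simp add: Q_def)
  have "\<exists>!x. x \<in> hom E B H \<and> (\<exists>w. w \<in> hom E (Dom E r1) Q \<and> q1 \<bullet> w = x \<bullet> r1 \<and> q2 \<bullet> w = r2 \<and> (b \<bullet> \<epsilon>) \<bullet> w = v)"
    if prB: "is_product E B Y r1 r2" and v: "v \<in> hom E (Dom E r1) M" for B r1 r2 v
  proof -
    define R where "R = Dom E r1"
    have r: "r1 \<in> hom E R B" "r2 \<in> hom E R Y" using prB by (simp_all add: is_product_def R_def)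
    have v: "v \<in> hom E R M" using v by (simp add: R_def)
    have B: "B \<in> Ob E" using hom_Ob[OF r(1)] by simp
    obtain t where t: "t \<in> hom E B T" using T B unfolding is_terminal_def by blast
    have pt: "p \<bullet> x = t" if "x \<in> hom E B H" for x
      using T B t comp_hom[OF pH that] unfolding is_terminal_def by blast
    have pbB: "is_pullback E r1 r2 t f" by (rule product_terminal_pullback[OF C T prB t f])
    have "Dom E r2 = R" using r by (simp add: hom_iff)
    let ?\<Phi> = "\<lambda>x. post E R \<epsilon> 0 (slice_pull E q1 q2 r1 r2 0 x)"
    have sl1: "slice_map E t p 0 = emb E ` hom E B H" using slice0[OF t pH] pt by auto
    have sl2: "slice_map E r2 g 0 = emb E ` {x \<in> hom E R G. g \<bullet> x = r2}" using slice0[OF r(2) gb(1)] .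
    have \<Phi>: "bij_betw ?\<Phi> (emb E ` hom E B H) (emb E ` {x \<in> hom E R G. g \<bullet> x = r2})"
      using bij[OF pbB, of 0] sl1 sl2 \<open>Dom E r2 = R\<close> by simp
    have \<Phi>_emb: "?\<Phi> (emb E x) = emb E (\<epsilon> \<bullet> w)"
      if x: "x \<in> hom E B H" and w: "w \<in> hom E R Q" "q1 \<bullet> w = x \<bullet> r1" "q2 \<bullet> w = r2" for x w
    proof -
      have "slice_pull E q1 q2 r1 r2 0 (emb E x) = emb E w"
        unfolding slice_pull_def \<open>Dom E r2 = R\<close>
      proof (rule the_equality)
        have sl: "slice_map E r2 q2 0 = emb E ` {x \<in> hom E R Q. q2 \<bullet> x = r2}" using slice0[OF r(2) q(2)] .
        have cod: "Cod E q1 = H" using q by (simp add: hom_iff)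
        have pre: "pre E r1 H 0 (emb E x) = emb E (x \<bullet> r1)" using pre0[OF r(1) x] .
        show "emb E w \<in> slice_map E r2 q2 0 \<and> post E R q1 0 (emb E w) = pre E r1 (Cod E q1) 0 (emb E x)"
          unfolding cod pre sl using post0[OF w(1) q(1)] w by simp
        fix y assume "y \<in> slice_map E r2 q2 0 \<and> post E R q1 0 y = pre E r1 (Cod E q1) 0 (emb E x)"
        then obtain w' where w': "w' \<in> hom E R Q" "q2 \<bullet> w' = r2" "y = emb E w'"
          "post E R q1 0 (emb E w') = emb E (x \<bullet> r1)" unfolding cod pre sl by blast
        have "q1 \<bullet> w' = x \<bullet> r1"
          using emb_inj[OF comp_hom[OF q(1) w'(1)] comp_hom[OF x r(1)]] post0[OF w'(1) q(1)] w'(4) by simp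
        then have "w' = w" using prH_eq[OF w'(1) w(1)] w w' by simp
        then show "y = emb E w" using w' by simp
      qed
      then show ?thesis using post0[OF w(1) \<epsilon>Q] by simp
    qed
    have w_ex: "\<exists>w. w \<in> hom E R Q \<and> q1 \<bullet> w = x \<bullet> r1 \<and> q2 \<bullet> w = r2" if "x \<in> hom E B H" for x
      using prH comp_hom[OF that r(1)] r(2) unfolding is_product_def Q_def by blast
    obtain v' where v': "v' \<in> hom E R G" "g \<bullet> v' = r2" "b \<bullet> v' = v"
      using pr r(2) v unfolding is_product_def G_def by metis
    have assoc: "(b \<bullet> \<epsilon>) \<bullet> w = b \<bullet> \<epsilon> \<bullet> w" "g \<bullet> \<epsilon> \<bullet> w = q2 \<bullet> w" if "w \<in> hom E R Q" for w
      using that gb \<epsilon>Q comp_reassoc[OF \<epsilon>(2), of w] by (simp_all add: hom_iff)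
    have lift_v': "\<epsilon> \<bullet> w = v'" if "w \<in> hom E R Q" "q2 \<bullet> w = r2" "(b \<bullet> \<epsilon>) \<bullet> w = v" for w
      by (rule pr_eq[OF comp_hom[OF \<epsilon>Q that(1)] v'(1)]) (use assoc[OF that(1)] that v' in simp_all)
    have "emb E v' \<in> ?\<Phi> ` emb E ` hom E B H" using \<Phi> v' unfolding bij_betw_def by blast
    then obtain x where x: "x \<in> hom E B H" "?\<Phi> (emb E x) = emb E v'" by force
    obtain w where w: "w \<in> hom E R Q" "q1 \<bullet> w = x \<bullet> r1" "q2 \<bullet> w = r2" using w_ex[OF x(1)] by blast
    have "\<epsilon> \<bullet> w = v'" using emb_inj[OF comp_hom[OF \<epsilon>Q w(1)] v'(1)] \<Phi>_emb[OF x(1) w] x(2) by simp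
    then have bw: "(b \<bullet> \<epsilon>) \<bullet> w = v" using assoc[OF w(1)] v' by simp
    show ?thesis
      unfolding R_def[symmetric]
    proof (rule ex1I[of _ x])
      show "x \<in> hom E B H \<and> (\<exists>w. w \<in> hom E R Q \<and> q1 \<bullet> w = x \<bullet> r1 \<and> q2 \<bullet> w = r2 \<and> (b \<bullet> \<epsilon>) \<bullet> w = v)"
        using x w bw by blast
      fix y assume "y \<in> hom E B H \<and> (\<exists>w. w \<in> hom E R Q \<and> q1 \<bullet> w = y \<bullet> r1 \<and> q2 \<bullet> w = r2 \<and> (b \<bullet> \<epsilon>) \<bullet> w = v)"
      then obtain w' where y: "y \<in> hom E B H" and w': "w' \<in> hom E R Q" "q1 \<bullet> w' = y \<bullet> r1" "q2 \<bullet> w' = r2" "(b \<bullet> \<epsilon>) \<bullet> w' = v"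
        by blast
      have "?\<Phi> (emb E y) = ?\<Phi> (emb E x)"
        using \<Phi>_emb[OF y w'(1-3)] lift_v'[OF w'(1,3,4)] x(2) by simp
      then have "emb E y = emb E x" using \<Phi> y x(1) unfolding bij_betw_def inj_on_def by blast
      then show "y = x" using emb_inj[OF y x(1)] by simp
    qed
  qed
  moreover have "b \<bullet> \<epsilon> \<in> hom E Q M" using gb(2) \<epsilon>Q by (rule comp_hom)
  ultimately show "\<exists>H q1 q2 ev. is_product E H Y q1 q2 \<and> ev \<in> hom E (Dom E q1) M \<and>
     (\<forall>B r1 r2 v. is_product E B Y r1 r2 \<and> v \<in> hom E (Dom E r1) M \<longrightarrow>
       (\<exists>!x. x \<in> hom E B H \<and> (\<exists>w. w \<in> hom E (Dom E r1) (Dom E q1) \<and>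
          q1 \<bullet> w = x \<bullet> r1 \<and> q2 \<bullet> w = r2 \<and> ev \<bullet> w = v)))"
    using prH unfolding Q_def by blast
qed

text \<open>Multiplication with \<open>Y\<close> has a right adjoint and so preserves the coproduct \<open>L\<close> of terminal objects.\<close>

lemma product_copower:
  fixes C (structure)
  assumes C: "category C" and expo: "has_exponentials_by C Y" and T: "is_terminal C T"
    and cop: "is_coproduct C I (\<lambda>_. T) L c" and pr: "is_product C Y L p1 p2" and t: "t \<in> hom C Y T"
    and \<iota>: "\<And>i. i \<in> I \<Longrightarrow> \<iota> i \<in> hom C Y (Dom C p1)" "\<And>i. i \<in> I \<Longrightarrow> p1 \<bullet> \<iota> i = Idn C Y"
      "\<And>i. i \<in> I \<Longrightarrow> p2 \<bullet> \<iota> i = c i \<bullet> t"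
  shows "is_coproduct C I (\<lambda>_. Y) (Dom C p1) \<iota>"
  unfolding is_coproduct_def
proof (intro conjI allI impI ballI)
  interpret cat_ctx C by unfold_locales (rule C)
  define Q where "Q = Dom C p1"
  have p: "p1 \<in> hom C Q Y" "p2 \<in> hom C Q L" using pr by (simp_all add: is_product_def Q_def)
  then show "Dom C p1 \<in> Ob C" using hom_Ob(1)[OF p(1)] by (simp add: Q_def)
  show "\<iota> i \<in> hom C Y (Dom C p1)" if "i \<in> I" for i using \<iota> that by blast
  fix M d assume Md: "M \<in> Ob C \<and> (\<forall>i\<in>I. d i \<in> hom C Y M)"
  have Y: "Y \<in> Ob C" using hom_Ob[OF t] by simp
  have To: "T \<in> Ob C" using T by (simp add: is_terminal_def)
  obtain H q1 q2 ev where prH: "is_product C H Y q1 q2" and ev: "ev \<in> hom C (Dom C q1) M" and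
    tr: "\<And>B r1 r2 v. is_product C B Y r1 r2 \<Longrightarrow> v \<in> hom C (Dom C r1) M \<Longrightarrow>
       \<exists>!x. x \<in> hom C B H \<and> (\<exists>w. w \<in> hom C (Dom C r1) (Dom C q1) \<and>
          q1 \<bullet> w = x \<bullet> r1 \<and> q2 \<bullet> w = r2 \<and> ev \<bullet> w = v)"
  proof -
    have "M \<in> Ob C" using Md by blast
    from bspec[OF expo[unfolded has_exponentials_by_def] this] show thesis
      by (elim exE conjE) (rule that, assumption, assumption, blast)
  qed
  define N where "N = Dom C q1"
  have q: "q1 \<in> hom C N H" "q2 \<in> hom C N Y" using prH by (simp_all add: is_product_def N_def)
  have evN: "ev \<in> hom C N M" using ev by (simp add: N_def)
  have prH_eq: "h = h'" if "h \<in> hom C W N" "h' \<in> hom C W N" "q1 \<bullet> h = q1 \<bullet> h'" "q2 \<bullet> h = q2 \<bullet> h'" for W h h'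
  proof -
    have "\<exists>!k. k \<in> hom C W N \<and> q1 \<bullet> k = q1 \<bullet> h \<and> q2 \<bullet> k = q2 \<bullet> h"
      using prH comp_hom[OF q(1) that(1)] comp_hom[OF q(2) that(1)] unfolding is_product_def N_def by blast
    then show ?thesis using that by metis
  qed
  have prL: "is_product C L Y p2 p1"
  proof -
    have "Dom C p2 = Dom C p1" using p by (simp add: hom_iff)
    moreover have "\<exists>!h. h \<in> hom C W (Dom C p1) \<and> p2 \<bullet> h = u \<and> p1 \<bullet> h = v"
      if "u \<in> hom C W L" "v \<in> hom C W Y" for u v W
    proof -
      have "\<exists>!h. h \<in> hom C W (Dom C p1) \<and> p1 \<bullet> h = v \<and> p2 \<bullet> h = u"
        using pr that unfolding is_product_def by blast
      then show ?thesis by (simp add: conj_commute)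
    qed
    ultimately show ?thesis using p unfolding is_product_def by (simp add: Q_def)
  qed
  have t_uniq: "s = s'" if "s \<in> hom C W T" "s' \<in> hom C W T" for s s' W
    using T that hom_Ob(1)[OF that(1)] unfolding is_terminal_def by blast
  have tA: "t \<in> Ar C" "Dom C t = Y" "Cod C t = T" using t by (simp_all add: hom_iff)
  have prT: "is_product C T Y t (Idn C Y)"
    unfolding is_product_def tA
  proof (intro conjI allI ballI t id_hom Y)
    fix W u v assume u: "u \<in> hom C W T" and v: "v \<in> hom C W Y"
    have "t \<bullet> v = u" using t_uniq[OF comp_hom[OF t v] u] .
    then show "\<exists>!h. h \<in> hom C W Y \<and> t \<bullet> h = u \<and> Idn C Y \<bullet> h = v"
      using v by (auto simp: hom_iff)
  qed
  have cL: "c i \<in> hom C T L" if "i \<in> I" for i using cop that by (simp add: is_coproduct_def)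
  have cop_ex: "\<exists>!h. h \<in> hom C L Z \<and> (\<forall>i\<in>I. h \<bullet> c i = e i)" if "Z \<in> Ob C" "\<forall>i\<in>I. e i \<in> hom C T Z" for Z e
    using cop that unfolding is_coproduct_def by blast
  have iA: "\<iota> i \<in> hom C Y Q" if "i \<in> I" for i using \<iota>(1)[OF that] by (simp add: Q_def)
  have H: "H \<in> Ob C" using hom_Ob(2)[OF q(1)] .
  let ?tr = "\<lambda>B R r1 r2 v x w. x \<in> hom C B H \<and> w \<in> hom C R N \<and>
          q1 \<bullet> w = x \<bullet> r1 \<and> q2 \<bullet> w = r2 \<and> ev \<bullet> w = v"
  have DomL: "Dom C p2 = Q" using p by (simp add: hom_iff)
  have trL: "\<exists>x w. ?tr L Q p2 p1 h x w" if "h \<in> hom C Q M" for h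
    using tr[OF prL, of h] that unfolding DomL N_def by blast
  have trT: "\<exists>x w. ?tr T Y t (Idn C Y) h x w" if "h \<in> hom C Y M" for h
    using tr[OF prT, of h] that unfolding tA N_def by blast
  have trT_uniq: "x = x'" if "?tr T Y t (Idn C Y) h x w" "?tr T Y t (Idn C Y) h x' w'" for h x w x' w'
  proof -
    have "h \<in> hom C (Dom C t) M" using that evN comp_hom tA by auto
    from tr[OF prT this] show ?thesis using that unfolding tA N_def by blast
  qed
  have restr: "?tr T Y t (Idn C Y) (h \<bullet> \<iota> i) (x \<bullet> c i) (w \<bullet> \<iota> i)"
    if x: "?tr L Q p2 p1 h x w" and i: "i \<in> I" for h x w i
  proof -
    have A: "x \<in> Ar C" "Dom C x = L" "Cod C x = H" "w \<in> Ar C" "Dom C w = Q" "Cod C w = N"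
      "\<iota> i \<in> Ar C" "Dom C (\<iota> i) = Y" "Cod C (\<iota> i) = Q" "c i \<in> Ar C" "Dom C (c i) = T" "Cod C (c i) = L"
      "q1 \<in> Ar C" "Dom C q1 = N" "q2 \<in> Ar C" "Dom C q2 = N" "ev \<in> Ar C" "Dom C ev = N"
      "p2 \<in> Ar C" "Dom C p2 = Q" "Cod C p2 = L"
      using x iA[OF i] cL[OF i] q evN p by (simp_all add: hom_iff)
    have "q1 \<bullet> w \<bullet> \<iota> i = x \<bullet> p2 \<bullet> \<iota> i"
      using square_reassoc[of q1 w x p2 "\<iota> i"] x A by simp
    then have "q1 \<bullet> w \<bullet> \<iota> i = (x \<bullet> c i) \<bullet> t" using \<iota>(3)[OF i] A tA by simp
    moreover have "q2 \<bullet> w \<bullet> \<iota> i = Idn C Y" using comp_reassoc[of q2 w p1 "\<iota> i"] x A \<iota>(2)[OF i] by simp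
    moreover have "ev \<bullet> w \<bullet> \<iota> i = h \<bullet> \<iota> i" using comp_reassoc[of ev w h "\<iota> i"] x A by simp
    ultimately show ?thesis using A tA by (simp add: hom_iff)
  qed
  show "\<exists>!h. h \<in> hom C (Dom C p1) M \<and> (\<forall>i\<in>I. h \<bullet> \<iota> i = d i)"
    unfolding Q_def[symmetric]
  proof (rule ex_ex1I)
    have "\<forall>i\<in>I. \<exists>x w. ?tr T Y t (Idn C Y) (d i) x w" using trT Md by blast
    then obtain x w where xw: "\<And>i. i \<in> I \<Longrightarrow> ?tr T Y t (Idn C Y) (d i) (x i) (w i)" by metis
    obtain X where X: "X \<in> hom C L H" "\<And>i. i \<in> I \<Longrightarrow> X \<bullet> c i = x i" using cop_ex[OF H, of x] xw by blast
    obtain V where V: "V \<in> hom C Q N" "q1 \<bullet> V = X \<bullet> p2" "q2 \<bullet> V = p1"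
      using prH comp_hom[OF X(1) p(2)] p(1) unfolding is_product_def N_def by metis
    have XV: "?tr L Q p2 p1 (ev \<bullet> V) X V" using X V by simp
    have "(ev \<bullet> V) \<bullet> \<iota> i = d i" if i: "i \<in> I" for i
    proof -
      have r: "?tr T Y t (Idn C Y) ((ev \<bullet> V) \<bullet> \<iota> i) (x i) (V \<bullet> \<iota> i)"
        using restr[OF XV i] X(2)[OF i] by simp
      then have "V \<bullet> \<iota> i = w i" using prH_eq[of "V \<bullet> \<iota> i" Y "w i"] xw[OF i] by simp
      then show ?thesis using r xw[OF i] by simp
    qed
    then show "\<exists>h. h \<in> hom C Q M \<and> (\<forall>i\<in>I. h \<bullet> \<iota> i = d i)" using comp_hom[OF evN V(1)] by blast
  next
    fix h h' assume h: "h \<in> hom C Q M \<and> (\<forall>i\<in>I. h \<bullet> \<iota> i = d i)" and h': "h' \<in> hom C Q M \<and> (\<forall>i\<in>I. h' \<bullet> \<iota> i = d i)"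
    obtain x w where x: "?tr L Q p2 p1 h x w" using trL h by blast
    obtain x' w' where x': "?tr L Q p2 p1 h' x' w'" using trL h' by blast
    have "x \<bullet> c i = x' \<bullet> c i" if "i \<in> I" for i
      using trT_uniq restr[OF x that] restr[OF x' that] h h' that by metis
    moreover have "x' \<bullet> c i \<in> hom C T H" if "i \<in> I" for i using x' cL[OF that] comp_hom by blast
    ultimately have "x = x'" using cop_ex[OF H, of "\<lambda>i. x' \<bullet> c i"] x x' by blast
    then have "w = w'" using prH_eq[of w Q w'] x x' by simp
    then show "h = h'" using x x' by blast
  qed
qed

lemma coproduct_eqI:
  fixes C (structure)
  assumes C: "category C" and cop: "is_coproduct C I D L \<iota>" and h: "h \<in> hom C L M" "h' \<in> hom C L M"
    and eq: "\<And>i. i \<in> I \<Longrightarrow> h \<bullet> \<iota> i = h' \<bullet> \<iota> i"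
  shows "h = h'"
proof -
  interpret cat_ctx C by unfold_locales (rule C)
  have "\<forall>i\<in>I. \<iota> i \<in> hom C (D i) L" using cop by (simp add: is_coproduct_def)
  then have "M \<in> Ob C \<and> (\<forall>i\<in>I. h \<bullet> \<iota> i \<in> hom C (D i) M)"
    using hom_Ob(2)[OF h(1)] comp_hom[OF h(1)] by blast
  then have "\<exists>!k. k \<in> hom C L M \<and> (\<forall>i\<in>I. k \<bullet> \<iota> i = h \<bullet> \<iota> i)"
    using cop unfolding is_coproduct_def by (elim conjE allE[of _ M] allE[of _ "\<lambda>i. h \<bullet> \<iota> i"]) blast
  moreover have "h' \<in> hom C L M \<and> (\<forall>i\<in>I. h' \<bullet> \<iota> i = h \<bullet> \<iota> i)" using h(2) eq by simp
  moreover have "h \<in> hom C L M \<and> (\<forall>i\<in>I. h \<bullet> \<iota> i = h \<bullet> \<iota> i)" using h(1) by simp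
  ultimately show ?thesis by blast
qed

lemma coproduct_lift:
  fixes C (structure)
  assumes "is_coproduct C I D L \<iota>" "M \<in> Ob C" "\<And>i. i \<in> I \<Longrightarrow> d i \<in> hom C (D i) M"
  obtains h where "h \<in> hom C L M" "\<And>i. i \<in> I \<Longrightarrow> h \<bullet> \<iota> i = d i"
  using assms unfolding is_coproduct_def by metis


section \<open>Levelwise coproducts\<close>

text \<open>
  A simplicial object \<open>S\<close> whose level \<open>n\<close> is a coproduct of objects \<open>D n k\<close> indexed by the \<open>n\<close>-simplices \<open>k\<close>
  of a simplicial set \<open>K\<close>; for \<open>\<alpha> : m \<rightarrow> n\<close> the summand \<open>D n k\<close> is mapped to
  the summand of the face \<open>snd K \<alpha> k\<close> by \<open>DA \<alpha> k\<close>.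
\<close>

definition levelwise_coproduct :: "('o, 'm, 'z) cat_scheme \<Rightarrow> 'a sset \<Rightarrow> (nat \<Rightarrow> 'a \<Rightarrow> 'o) \<Rightarrow> (dmap \<Rightarrow> 'a \<Rightarrow> 'm)
    \<Rightarrow> ('o, 'm) sob \<Rightarrow> (nat \<Rightarrow> 'a \<Rightarrow> 'm) \<Rightarrow> bool" where
  "levelwise_coproduct E K D DA S \<iota> \<longleftrightarrow> S \<in> Ob (simp_cat E) \<and>
     (\<forall>n. is_coproduct E (fst K n) (D n) (fst S n) (\<iota> n)) \<and>
     (\<forall>m n. \<forall>\<alpha>\<in>hom Delta m n. \<forall>k\<in>fst K n. DA \<alpha> k \<in> hom E (D n k) (D m (snd K \<alpha> k)) \<and>
        snd K \<alpha> k \<in> fst K m \<and> snd S \<alpha> \<bullet>\<^bsub>E\<^esub> \<iota> n k = \<iota> m (snd K \<alpha> k) \<bullet>\<^bsub>E\<^esub> DA \<alpha> k)"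

context simp_ctx
begin

lemma levelwise_coproductD:
  assumes "levelwise_coproduct E K D DA S \<iota>"
  shows "S \<in> Ob sE" "is_coproduct E (fst K n) (D n) (fst S n) (\<iota> n)"
    "k \<in> fst K n \<Longrightarrow> \<iota> n k \<in> hom E (D n k) (fst S n)"
    "\<alpha> \<in> hom Delta m n \<Longrightarrow> k \<in> fst K n \<Longrightarrow> DA \<alpha> k \<in> hom E (D n k) (D m (snd K \<alpha> k))"
    "\<alpha> \<in> hom Delta m n \<Longrightarrow> k \<in> fst K n \<Longrightarrow> snd K \<alpha> k \<in> fst K m"
    "\<alpha> \<in> hom Delta m n \<Longrightarrow> k \<in> fst K n \<Longrightarrow> snd S \<alpha> \<bullet> \<iota> n k = \<iota> m (snd K \<alpha> k) \<bullet> DA \<alpha> k"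
  using assms unfolding levelwise_coproduct_def is_coproduct_def by blast+

lemma levelwise_coproduct_eqI:
  assumes lc: "levelwise_coproduct E K D DA S \<iota>" and f: "f \<in> hom sE S X" and g: "g \<in> hom sE S X"
    and eq: "\<And>n k. k \<in> fst K n \<Longrightarrow> cmp f n \<bullet> \<iota> n k = cmp g n \<bullet> \<iota> n k"
  shows "f = g"
proof (rule sE_eqI[OF f g])
  show "cmp f n = cmp g n" for n
    using coproduct_eqI[OF E.category_C levelwise_coproductD(2)[OF lc] sE_homD(1)[OF f] sE_homD(1)[OF g] eq] .
qed simp_all

lemma levelwise_coproduct_natural:
  assumes lc: "levelwise_coproduct E K D DA S \<iota>" and f: "f \<in> hom sE S X" and a: "\<alpha> \<in> hom Delta m n" and k: "k \<in> fst K n"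
  shows "snd X \<alpha> \<bullet> cmp f n \<bullet> \<iota> n k = cmp f m \<bullet> \<iota> m (snd K \<alpha> k) \<bullet> DA \<alpha> k"
proof -
  note D = levelwise_coproductD[OF lc] and F = sE_homD[OF f]
  note h = D(3)[OF k] D(3)[OF D(5)[OF a k]] D(4)[OF a k] F(1)[of n] F(1)[of m] sE_ObD(2)[OF F(3) a] sE_ObD(2)[OF F(4) a]
  have "snd X \<alpha> \<bullet> cmp f n \<bullet> \<iota> n k = cmp f m \<bullet> snd S \<alpha> \<bullet> \<iota> n k"
    using E.square_reassoc[OF F(2)[OF a]] h by (simp add: hom_iff)
  then show ?thesis using D(6)[OF a k] by simp
qed

lemma levelwise_coproduct_lift:
  assumes lc: "levelwise_coproduct E K D DA S \<iota>" and X: "X \<in> Ob sE"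
    and c: "\<And>n k. k \<in> fst K n \<Longrightarrow> c n k \<in> hom E (D n k) (fst X n)"
    and nat: "\<And>m n \<alpha> k. \<alpha> \<in> hom Delta m n \<Longrightarrow> k \<in> fst K n \<Longrightarrow> snd X \<alpha> \<bullet> c n k = c m (snd K \<alpha> k) \<bullet> DA \<alpha> k"
  obtains f where "f \<in> hom sE S X" "\<And>n k. k \<in> fst K n \<Longrightarrow> cmp f n \<bullet> \<iota> n k = c n k"
proof -
  note D = levelwise_coproductD[OF lc]
  have "\<forall>n. \<exists>h. h \<in> hom E (fst S n) (fst X n) \<and> (\<forall>k\<in>fst K n. h \<bullet> \<iota> n k = c n k)"
    using coproduct_lift[OF D(2) sE_ObD(1)[OF X] c] by metis
  then obtain h where h: "\<And>n. h n \<in> hom E (fst S n) (fst X n)" "\<And>n k. k \<in> fst K n \<Longrightarrow> h n \<bullet> \<iota> n k = c n k"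
    by metis
  have "(S, X, h) \<in> hom sE S X"
  proof (rule sE_homI[OF D(1) X h(1)])
    fix m n \<alpha> assume a: "\<alpha> \<in> hom Delta m n"
    note Sa = sE_ObD(2)[OF D(1) a] and Xa = sE_ObD(2)[OF X a]
    show "snd X \<alpha> \<bullet> h n = h m \<bullet> snd S \<alpha>"
    proof (rule coproduct_eqI[OF E.category_C D(2)[of n]])
      show "snd X \<alpha> \<bullet> h n \<in> hom E (fst S n) (fst X m)" using Xa h(1) by (rule E.comp_hom)
      show "h m \<bullet> snd S \<alpha> \<in> hom E (fst S n) (fst X m)" using h(1) Sa by (rule E.comp_hom)
      fix k assume k: "k \<in> fst K n"
      note hh = D(3)[OF k] D(3)[OF D(5)[OF a k]] D(4)[OF a k] h(1)[of n] h(1)[of m] Sa Xa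
      have "(snd X \<alpha> \<bullet> h n) \<bullet> \<iota> n k = snd X \<alpha> \<bullet> c n k" using hh h(2)[OF k] by (simp add: hom_iff)
      also have "\<dots> = c m (snd K \<alpha> k) \<bullet> DA \<alpha> k" by (rule nat[OF a k])
      also have "\<dots> = h m \<bullet> \<iota> m (snd K \<alpha> k) \<bullet> DA \<alpha> k"
        using hh h(2)[OF D(5)[OF a k], symmetric] by (simp add: hom_iff)
      also have "\<dots> = h m \<bullet> snd S \<alpha> \<bullet> \<iota> n k" using D(6)[OF a k] by simp
      also have "\<dots> = (h m \<bullet> snd S \<alpha>) \<bullet> \<iota> n k" using hh by (simp add: hom_iff)
      finally show "(snd X \<alpha> \<bullet> h n) \<bullet> \<iota> n k = (h m \<bullet> snd S \<alpha>) \<bullet> \<iota> n k" .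
    qed
  qed
  then show ?thesis using that[of "(S, X, h)"] h by simp
qed

lemma levelwise_coproduct_exists:
  assumes K: "is_sset K" and cop: "\<And>n. \<exists>L \<iota>. is_coproduct E (fst K n) (D n) L \<iota>"
    and DA: "\<And>m n \<alpha> k. \<alpha> \<in> hom Delta m n \<Longrightarrow> k \<in> fst K n \<Longrightarrow> DA \<alpha> k \<in> hom E (D n k) (D m (snd K \<alpha> k))"
    and DA_id: "\<And>n k. k \<in> fst K n \<Longrightarrow> DA (Idn Delta n) k = Idn E (D n k)"
    and DA_comp: "\<And>l m n \<alpha> \<beta> k. \<alpha> \<in> hom Delta l m \<Longrightarrow> \<beta> \<in> hom Delta m n \<Longrightarrow> k \<in> fst K n \<Longrightarrow>
      DA (\<beta> \<bullet>\<^bsub>Delta\<^esub> \<alpha>) k = DA \<alpha> (snd K \<beta> k) \<bullet> DA \<beta> k"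
  obtains S \<iota> where "levelwise_coproduct E K D DA S \<iota>"
proof -
  have K1: "snd K \<alpha> k \<in> fst K m" if "\<alpha> \<in> hom Delta m n" "k \<in> fst K n" for \<alpha> m n k
    using K that unfolding is_sset_def by blast
  have K2: "snd K (Idn Delta n) k = k" if "k \<in> fst K n" for n k using K that unfolding is_sset_def by blast
  have K3: "snd K (\<beta> \<bullet>\<^bsub>Delta\<^esub> \<alpha>) k = snd K \<alpha> (snd K \<beta> k)"
    if "\<alpha> \<in> hom Delta l m" "\<beta> \<in> hom Delta m n" "k \<in> fst K n" for l m n \<alpha> \<beta> k
    using K that unfolding is_sset_def by blast
  obtain P \<iota> where P: "\<And>n. is_coproduct E (fst K n) (D n) (P n) (\<iota> n)" using cop by metis
  have Po: "P n \<in> Ob E" for n using P[of n] by (simp add: is_coproduct_def)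
  have \<iota>: "\<iota> n k \<in> hom E (D n k) (P n)" if "k \<in> fst K n" for n k using P[of n] that by (simp add: is_coproduct_def)
  note eqI = coproduct_eqI[OF E.category_C P]
  have i_DA: "\<iota> m (snd K \<alpha> k) \<bullet> DA \<alpha> k \<in> hom E (D n k) (P m)" if "\<alpha> \<in> hom Delta m n" "k \<in> fst K n" for \<alpha> m n k
    using \<iota>[OF K1[OF that]] DA[OF that] by (rule E.comp_hom)
  have "\<exists>h. h \<in> hom E (P n) (P m) \<and> (\<forall>k\<in>fst K n. h \<bullet> \<iota> n k = \<iota> m (snd K \<alpha> k) \<bullet> DA \<alpha> k)"
    if "\<alpha> \<in> hom Delta m n" for \<alpha> m n
    using coproduct_lift[OF P[of n] Po[of m] i_DA[OF that]] by metis
  then have "\<exists>h. \<alpha> \<in> Ar Delta \<longrightarrow> h \<in> hom E (P (Cod Delta \<alpha>)) (P (Dom Delta \<alpha>)) \<and>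
      (\<forall>k\<in>fst K (Cod Delta \<alpha>). h \<bullet> \<iota> (Cod Delta \<alpha>) k = \<iota> (Dom Delta \<alpha>) (snd K \<alpha> k) \<bullet> DA \<alpha> k)" for \<alpha>
    by (metis Delta.homI)
  then obtain S1 where S1': "\<And>\<alpha>. \<alpha> \<in> Ar Delta \<longrightarrow> S1 \<alpha> \<in> hom E (P (Cod Delta \<alpha>)) (P (Dom Delta \<alpha>)) \<and>
      (\<forall>k\<in>fst K (Cod Delta \<alpha>). S1 \<alpha> \<bullet> \<iota> (Cod Delta \<alpha>) k = \<iota> (Dom Delta \<alpha>) (snd K \<alpha> k) \<bullet> DA \<alpha> k)"
    by metis
  have S1: "S1 \<alpha> \<in> hom E (P n) (P m)" "\<And>k. k \<in> fst K n \<Longrightarrow> S1 \<alpha> \<bullet> \<iota> n k = \<iota> m (snd K \<alpha> k) \<bullet> DA \<alpha> k"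
    if "\<alpha> \<in> hom Delta m n" for \<alpha> m n
    using S1'[of \<alpha>] that by (auto simp: hom_iff[of \<alpha>])
  have S1_id: "S1 (Idn Delta n) = Idn E (P n)" for n
  proof (rule eqI[OF S1(1)[OF Delta_id_hom] E.id_hom[OF Po]])
    fix k assume k: "k \<in> fst K n"
    show "S1 (Idn Delta n) \<bullet> \<iota> n k = Idn E (P n) \<bullet> \<iota> n k"
      using S1(2)[OF Delta_id_hom k] K2[OF k] DA_id[OF k] \<iota>[OF k] by (simp add: hom_iff)
  qed
  have S1_comp: "S1 (\<beta> \<bullet>\<^bsub>Delta\<^esub> \<alpha>) = S1 \<alpha> \<bullet> S1 \<beta>" if a: "\<alpha> \<in> hom Delta l m" and b: "\<beta> \<in> hom Delta m n" for \<alpha> \<beta> l m n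
  proof (rule eqI[OF S1(1)[OF Delta_comp_hom[OF b a]] E.comp_hom[OF S1(1)[OF a] S1(1)[OF b]]])
    fix k assume k: "k \<in> fst K n"
    note bk = K1[OF b k] and abk = K1[OF a K1[OF b k]]
    note hh = \<iota>[OF k] \<iota>[OF bk] \<iota>[OF abk] DA[OF b k] DA[OF a bk] S1(1)[OF a] S1(1)[OF b]
    have "(S1 \<alpha> \<bullet> S1 \<beta>) \<bullet> \<iota> n k = S1 \<alpha> \<bullet> \<iota> m (snd K \<beta> k) \<bullet> DA \<beta> k"
      using hh S1(2)[OF b k] by (simp add: hom_iff)
    also have "\<dots> = \<iota> l (snd K \<alpha> (snd K \<beta> k)) \<bullet> DA \<alpha> (snd K \<beta> k) \<bullet> DA \<beta> k"
      using hh E.square_reassoc[OF S1(2)[OF a bk]] by (simp add: hom_iff)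
    also have "\<dots> = S1 (\<beta> \<bullet>\<^bsub>Delta\<^esub> \<alpha>) \<bullet> \<iota> n k"
      using S1(2)[OF Delta_comp_hom[OF b a] k] K3[OF a b k] DA_comp[OF a b k] by simp
    finally show "S1 (\<beta> \<bullet>\<^bsub>Delta\<^esub> \<alpha>) \<bullet> \<iota> n k = (S1 \<alpha> \<bullet> S1 \<beta>) \<bullet> \<iota> n k" by simp
  qed
  define S where "S = (P, restrict S1 (Ar Delta))"
  have res: "restrict S1 (Ar Delta) \<alpha> = S1 \<alpha>" if "\<alpha> \<in> hom Delta m n" for \<alpha> m n using that by (simp add: hom_iff)
  have "S \<in> Ob sE"
    unfolding sE_Ob S_def fst_conv snd_conv
  proof (intro conjI allI ballI Po)
    fix l m n \<alpha> \<beta> assume a: "\<alpha> \<in> hom Delta l m" and b: "\<beta> \<in> hom Delta m n"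
    show "restrict S1 (Ar Delta) (\<beta> \<bullet>\<^bsub>Delta\<^esub> \<alpha>) = restrict S1 (Ar Delta) \<alpha> \<bullet> restrict S1 (Ar Delta) \<beta>"
      unfolding res[OF a] res[OF b] res[OF Delta_comp_hom[OF b a]] by (rule S1_comp[OF a b])
  qed (use S1(1) res S1_id res[OF Delta_id_hom] in simp_all)
  then have "levelwise_coproduct E K D DA S \<iota>"
    unfolding levelwise_coproduct_def using P DA K1 S1(2) res by (simp add: S_def)
  then show ?thesis using that by blast
qed

end

section \<open>Products with discrete objects, and exponentials\<close>

text \<open>The simplices of a cube.\<close>

type_synonym csimp = "nat \<Rightarrow> nat \<Rightarrow> nat"

text \<open>The properties of the base topos on which the construction rests; the index types are those of simplices of cubes and of pairs of
  such a simplex with a map of the simplex category.\<close>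

locale base_ctx = simp_ctx E for E :: "('o, 'm, 'z) cat_scheme" (structure) +
  assumes pullbacks_E: "f \<in> Ar E \<Longrightarrow> g \<in> Ar E \<Longrightarrow> Cod E f = Cod E g \<Longrightarrow> \<exists>p q. is_pullback E p q f g"
    and terminal_E: "\<exists>T. is_terminal E T"
    and coproducts_E: "\<And>(I :: csimp set) D. countable I \<Longrightarrow> (\<And>i. i \<in> I \<Longrightarrow> D i \<in> Ob E) \<Longrightarrow>
      \<exists>L \<iota>. is_coproduct E I D L \<iota>"
    and limits_E: "\<And>(A :: (dmap \<times> csimp, dmap \<times> dmap \<times> csimp) cat) D. category A \<Longrightarrow> countable (Ob A) \<Longrightarrow>
      countable (Ar A) \<Longrightarrow> is_functor A E D \<Longrightarrow> \<exists>L c. is_limit A E D L c"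
    and exponentials_E: "Y \<in> Ob E \<Longrightarrow> has_exponentials_by E Y"
begin

lemma one_terminal: "is_terminal E (one_ob E)"
  unfolding one_ob_def using terminal_E by (rule someI_ex)

sublocale S: prod_ctx sE
proof unfold_locales
  fix X Y assume "X \<in> Ob sE" "Y \<in> Ob sE"
  then show "\<exists>p q. is_product sE X Y p q" using sE_product(1)[OF pullbacks_E one_terminal] by blast
qed

lemma level_product:
  assumes "X \<in> Ob sE" "Y \<in> Ob sE"
  shows "is_product E (fst X n) (fst Y n) (cmp (pr1 sE X Y) n) (cmp (pr2 sE X Y) n)"
  using sE_product(2)[OF pullbacks_E one_terminal assms S.prod_is_product[OF assms]] by blast

lemma level_pr_hom:
  assumes "X \<in> Ob sE" "Y \<in> Ob sE"
  shows "cmp (pr1 sE X Y) n \<in> hom E (fst (prod_ob sE X Y) n) (fst X n)"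
    "cmp (pr2 sE X Y) n \<in> hom E (fst (prod_ob sE X Y) n) (fst Y n)"
  using S.pr_hom[OF assms] sE_homD(1) by blast+

lemma level_product_lift:
  assumes "X \<in> Ob sE" "Y \<in> Ob sE" "u \<in> hom E W (fst X n)" "v \<in> hom E W (fst Y n)"
  shows "\<exists>!h. h \<in> hom E W (fst (prod_ob sE X Y) n) \<and> cmp (pr1 sE X Y) n \<bullet> h = u \<and> cmp (pr2 sE X Y) n \<bullet> h = v"
proof -
  have "Dom E (cmp (pr1 sE X Y) n) = fst (prod_ob sE X Y) n"
    using level_pr_hom(1)[OF assms(1,2), of n] by (simp add: hom_iff)
  then show ?thesis using level_product[OF assms(1,2), of n] assms(3,4) unfolding is_product_def by simp
qed

lemma level_product_eqI:
  assumes XY: "X \<in> Ob sE" "Y \<in> Ob sE"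
    and h: "h \<in> hom E W (fst (prod_ob sE X Y) n)" "h' \<in> hom E W (fst (prod_ob sE X Y) n)"
    and eq: "cmp (pr1 sE X Y) n \<bullet> h = cmp (pr1 sE X Y) n \<bullet> h'" "cmp (pr2 sE X Y) n \<bullet> h = cmp (pr2 sE X Y) n \<bullet> h'"
  shows "h = h'"
  using level_product_lift[OF XY E.comp_hom[OF level_pr_hom(1)[OF XY] h(1)] E.comp_hom[OF level_pr_hom(2)[OF XY] h(1)]]
    h eq by metis

definition bang :: "'o \<Rightarrow> 'm" where
  "bang Z = (THE t. t \<in> hom E Z (one_ob E))"

lemma bang: "Z \<in> Ob E \<Longrightarrow> bang Z \<in> hom E Z (one_ob E)"
  using theI'[of "\<lambda>t. t \<in> hom E Z (one_ob E)"] one_terminal unfolding bang_def is_terminal_def by blast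

lemma bang_unique: "t \<in> hom E Z (one_ob E) \<Longrightarrow> s \<in> hom E Z (one_ob E) \<Longrightarrow> t = s"
  using one_terminal E.hom_Ob(1) unfolding is_terminal_def by blast

lemma copow_coproduct:
  fixes A :: "csimp set"
  assumes "countable A"
  shows "is_coproduct E A (\<lambda>_. one_ob E) (fst (copow E A)) (snd (copow E A))"
proof -
  have one: "one_ob E \<in> Ob E" using one_terminal by (simp add: is_terminal_def)
  obtain L \<iota> where L: "is_coproduct E A (\<lambda>_. one_ob E) L \<iota>" using coproducts_E[OF assms, of "\<lambda>_. one_ob E"] one by blast
  have "\<forall>a\<in>A. Dom E (\<iota> a) = one_ob E" using L by (simp add: is_coproduct_def hom_iff)
  then have "\<exists>Lc. is_copow E A (fst Lc) (snd Lc) \<and> (\<forall>a\<in>A. Dom E (snd Lc a) = one_ob E)"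
    using L one_terminal is_copow_iff[of E A L \<iota>] by (intro exI[of _ "(L, \<iota>)"]) auto
  from someI_ex[OF this] have *: "is_copow E A (fst (copow E A)) (snd (copow E A))"
    "\<forall>a\<in>A. Dom E (snd (copow E A) a) = one_ob E" unfolding copow_def by auto
  then obtain T where T: "is_coproduct E A (\<lambda>_. T) (fst (copow E A)) (snd (copow E A))"
    unfolding is_copow_iff by blast
  then have "\<forall>a\<in>A. T = one_ob E" using *(2) by (simp add: is_coproduct_def hom_iff)
  then show ?thesis using T by (cases "A = {}") (auto simp: is_coproduct_def)
qed

lemma copow_inj: "countable A \<Longrightarrow> k \<in> A \<Longrightarrow> snd (copow E A) k \<in> hom E (one_ob E) (fst (copow E A))"
  for A :: "csimp set"
  using copow_coproduct[of A] by (simp add: is_coproduct_def)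

lemma copow_map:
  fixes A B :: "csimp set"
  assumes A: "countable A" and B: "countable B" and f: "f \<in> A \<rightarrow> B"
  shows "copow_map E A B f \<in> hom E (fst (copow E A)) (fst (copow E B))"
    "k \<in> A \<Longrightarrow> copow_map E A B f \<bullet> snd (copow E A) k = snd (copow E B) (f k)"
proof -
  have "\<exists>!h. h \<in> hom E (fst (copow E A)) (fst (copow E B)) \<and>
            (\<forall>a\<in>A. h \<bullet> snd (copow E A) a = snd (copow E B) (f a))"
  proof -
    have "\<forall>a\<in>A. snd (copow E B) (f a) \<in> hom E (one_ob E) (fst (copow E B))" using copow_inj[OF B] f by blast
    moreover have "fst (copow E B) \<in> Ob E" using copow_coproduct[OF B] by (simp add: is_coproduct_def)
    ultimately show ?thesis using copow_coproduct[OF A] unfolding is_coproduct_def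
      by (elim conjE allE[of _ "fst (copow E B)"] allE[of _ "\<lambda>a. snd (copow E B) (f a)"]) blast
  qed
  from theI'[OF this] show "copow_map E A B f \<in> hom E (fst (copow E A)) (fst (copow E B))"
    "k \<in> A \<Longrightarrow> copow_map E A B f \<bullet> snd (copow E A) k = snd (copow E B) (f k)"
    unfolding copow_map_def by blast+
qed

definition discrete_base :: "csimp sset \<Rightarrow> bool" where
  "discrete_base K \<longleftrightarrow> is_sset K \<and> (\<forall>n. countable (fst K n)) \<and> disc E K \<in> Ob sE"

lemma discrete_baseD:
  assumes "discrete_base K"
  shows "countable (fst K n)" "disc E K \<in> Ob sE" "is_sset K"
    "\<alpha> \<in> hom Delta m n \<Longrightarrow> k \<in> fst K n \<Longrightarrow> snd K \<alpha> k \<in> fst K m"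
    "k \<in> fst K n \<Longrightarrow> snd K (Idn Delta n) k = k"
    "\<alpha> \<in> hom Delta l m \<Longrightarrow> \<beta> \<in> hom Delta m n \<Longrightarrow> k \<in> fst K n \<Longrightarrow> snd K (\<beta> \<bullet>\<^bsub>Delta\<^esub> \<alpha>) k = snd K \<alpha> (snd K \<beta> k)"
    "fst (disc E K) n = fst (copow E (fst K n))"
  using assms unfolding discrete_base_def is_sset_def disc_def fst_conv by blast+

lemma disc_transition:
  assumes K: "discrete_base K" and a: "\<alpha> \<in> hom Delta m n" and k: "k \<in> fst K n"
  shows "snd (disc E K) \<alpha> \<bullet> snd (copow E (fst K n)) k = snd (copow E (fst K m)) (snd K \<alpha> k)"
proof -
  have "snd (disc E K) \<alpha> = copow_map E (fst K n) (fst K m) (snd K \<alpha>)"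
    using a by (auto simp: disc_def hom_iff)
  then show ?thesis
    using copow_map(2)[OF discrete_baseD(1)[OF K] discrete_baseD(1)[OF K] _ k, of "snd K \<alpha>" m]
      discrete_baseD(4)[OF K a] by auto
qed

text \<open>The slice of \<open>\<Gamma>\<close> over the simplex \<open>k\<close>: the map from \<open>\<Gamma> n\<close> to level \<open>n\<close> of \<open>\<Gamma> \<times> disc K\<close> whose second component
  is constant at \<open>k\<close>.\<close>

definition at_simplex :: "csimp sset \<Rightarrow> ('o, 'm) sob \<Rightarrow> nat \<Rightarrow> csimp \<Rightarrow> 'm" where
  "at_simplex K \<Gamma> n k = (THE h. h \<in> hom E (fst \<Gamma> n) (fst (prod_ob sE \<Gamma> (disc E K)) n) \<and>
     cmp (pr1 sE \<Gamma> (disc E K)) n \<bullet> h = Idn E (fst \<Gamma> n) \<and>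
     cmp (pr2 sE \<Gamma> (disc E K)) n \<bullet> h = snd (copow E (fst K n)) k \<bullet> bang (fst \<Gamma> n))"

lemma at_simplex:
  assumes K: "discrete_base K" and G: "\<Gamma> \<in> Ob sE" and k: "k \<in> fst K n"
  shows "at_simplex K \<Gamma> n k \<in> hom E (fst \<Gamma> n) (fst (prod_ob sE \<Gamma> (disc E K)) n)"
    "cmp (pr1 sE \<Gamma> (disc E K)) n \<bullet> at_simplex K \<Gamma> n k = Idn E (fst \<Gamma> n)"
    "cmp (pr2 sE \<Gamma> (disc E K)) n \<bullet> at_simplex K \<Gamma> n k = snd (copow E (fst K n)) k \<bullet> bang (fst \<Gamma> n)"
proof -
  note D = discrete_baseD[OF K] and Gn = sE_ObD(1)[OF G]
  have "snd (copow E (fst K n)) k \<bullet> bang (fst \<Gamma> n) \<in> hom E (fst \<Gamma> n) (fst (disc E K) n)"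
    using copow_inj[OF D(1) k] bang[OF Gn] unfolding D(7) by (rule E.comp_hom)
  from theI'[OF level_product_lift[OF G D(2) E.id_hom[OF Gn] this]]
  show "at_simplex K \<Gamma> n k \<in> hom E (fst \<Gamma> n) (fst (prod_ob sE \<Gamma> (disc E K)) n)"
    "cmp (pr1 sE \<Gamma> (disc E K)) n \<bullet> at_simplex K \<Gamma> n k = Idn E (fst \<Gamma> n)"
    "cmp (pr2 sE \<Gamma> (disc E K)) n \<bullet> at_simplex K \<Gamma> n k = snd (copow E (fst K n)) k \<bullet> bang (fst \<Gamma> n)"
    unfolding at_simplex_def by blast+
qed

text \<open>Level \<open>n\<close> of \<open>disc K\<close> is a coproduct of terminal objects, and multiplication with \<open>\<Gamma> n\<close> preserves it.\<close>

lemma prod_disc_coproduct: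
  assumes K: "discrete_base K" and G: "\<Gamma> \<in> Ob sE"
  shows "levelwise_coproduct E K (\<lambda>n k. fst \<Gamma> n) (\<lambda>\<alpha> k. snd \<Gamma> \<alpha>) (prod_ob sE \<Gamma> (disc E K)) (at_simplex K \<Gamma>)"
  unfolding levelwise_coproduct_def
proof (intro conjI allI ballI)
  note D = discrete_baseD[OF K] and Gn = sE_ObD(1)[OF G] and I = at_simplex[OF K G]
  let ?P = "prod_ob sE \<Gamma> (disc E K)"
  have P: "?P \<in> Ob sE" using G D by simp
  then show "?P \<in> Ob sE" .
  note p1 = S.pr_hom(1)[OF G D(2)] and p2 = S.pr_hom(2)[OF G D(2)]
  fix n
  have DomP: "Dom E (cmp (pr1 sE \<Gamma> (disc E K)) n) = fst ?P n" using level_pr_hom(1)[OF G D(2), of n] by (simp add: hom_iff)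
  show "is_coproduct E (fst K n) (\<lambda>k. fst \<Gamma> n) (fst ?P n) (at_simplex K \<Gamma> n)"
    unfolding DomP[symmetric]
  proof (rule product_copower[OF E.category_C exponentials_E[OF Gn] one_terminal copow_coproduct[OF D(1)]])
    show "is_product E (fst \<Gamma> n) (fst (copow E (fst K n))) (cmp (pr1 sE \<Gamma> (disc E K)) n) (cmp (pr2 sE \<Gamma> (disc E K)) n)"
      using level_product[OF G D(2), of n] unfolding D(7) .
    show "bang (fst \<Gamma> n) \<in> hom E (fst \<Gamma> n) (one_ob E)" by (rule bang[OF Gn])
  qed (use I DomP in auto)
  fix m \<alpha> k assume a: "\<alpha> \<in> hom Delta m n" and k: "k \<in> fst K n"
  note Ga = sE_ObD(2)[OF G a] and Pa = sE_ObD(2)[OF P a]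
  show "snd \<Gamma> \<alpha> \<in> hom E (fst \<Gamma> n) (fst \<Gamma> m)" by (rule Ga)
  show ak: "snd K \<alpha> k \<in> fst K m" by (rule D(4)[OF a k])
  note i = I[OF k] and i' = I[OF ak]
  note q1n = level_pr_hom(1)[OF G D(2), of n] and q2n = level_pr_hom(2)[OF G D(2), of n]
    and q1m = level_pr_hom(1)[OF G D(2), of m] and q2m = level_pr_hom(2)[OF G D(2), of m]
  note ck = copow_inj[OF D(1) k] and cak = copow_inj[OF D(1) ak]
  note da = sE_ObD(2)[OF D(2) a]
  show "snd ?P \<alpha> \<bullet> at_simplex K \<Gamma> n k = at_simplex K \<Gamma> m (snd K \<alpha> k) \<bullet> snd \<Gamma> \<alpha>"
  proof (rule level_product_eqI[OF G D(2)])
    show "snd ?P \<alpha> \<bullet> at_simplex K \<Gamma> n k \<in> hom E (fst \<Gamma> n) (fst ?P m)" using Pa i(1) by (rule E.comp_hom)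
    show "at_simplex K \<Gamma> m (snd K \<alpha> k) \<bullet> snd \<Gamma> \<alpha> \<in> hom E (fst \<Gamma> n) (fst ?P m)" using i'(1) Ga by (rule E.comp_hom)
    have "cmp (pr1 sE \<Gamma> (disc E K)) m \<bullet> snd ?P \<alpha> \<bullet> at_simplex K \<Gamma> n k =
        snd \<Gamma> \<alpha> \<bullet> cmp (pr1 sE \<Gamma> (disc E K)) n \<bullet> at_simplex K \<Gamma> n k"
      by (rule E.square_reassoc[OF sE_homD(2)[OF p1 a, symmetric]]) (use q1m q1n Pa Ga i in \<open>simp_all add: hom_iff\<close>)
    also have "\<dots> = snd \<Gamma> \<alpha>" unfolding i(2) using Ga by (simp add: hom_iff)
    also have "\<dots> = cmp (pr1 sE \<Gamma> (disc E K)) m \<bullet> at_simplex K \<Gamma> m (snd K \<alpha> k) \<bullet> snd \<Gamma> \<alpha>"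
      using E.comp_reassoc[OF i'(2), of "snd \<Gamma> \<alpha>"] i'(1) q1m Ga by (simp add: hom_iff)
    finally show "cmp (pr1 sE \<Gamma> (disc E K)) m \<bullet> snd ?P \<alpha> \<bullet> at_simplex K \<Gamma> n k =
        cmp (pr1 sE \<Gamma> (disc E K)) m \<bullet> at_simplex K \<Gamma> m (snd K \<alpha> k) \<bullet> snd \<Gamma> \<alpha>" .
    have "cmp (pr2 sE \<Gamma> (disc E K)) m \<bullet> snd ?P \<alpha> \<bullet> at_simplex K \<Gamma> n k =
        snd (disc E K) \<alpha> \<bullet> cmp (pr2 sE \<Gamma> (disc E K)) n \<bullet> at_simplex K \<Gamma> n k"
      by (rule E.square_reassoc[OF sE_homD(2)[OF p2 a, symmetric]]) (use q2m q2n Pa da i in \<open>simp_all add: hom_iff\<close>)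
    also have "\<dots> = snd (copow E (fst K m)) (snd K \<alpha> k) \<bullet> bang (fst \<Gamma> n)"
      unfolding i(3)
      by (rule E.comp_reassoc[OF disc_transition[OF K a k]]) (use ck da bang[OF Gn] D(7) in \<open>simp_all add: hom_iff\<close>)
    also have "bang (fst \<Gamma> n) = bang (fst \<Gamma> m) \<bullet> snd \<Gamma> \<alpha>"
      using bang_unique[OF bang[OF Gn] E.comp_hom[OF bang[OF Gn] Ga]] .
    also have "snd (copow E (fst K m)) (snd K \<alpha> k) \<bullet> bang (fst \<Gamma> m) \<bullet> snd \<Gamma> \<alpha> =
        cmp (pr2 sE \<Gamma> (disc E K)) m \<bullet> at_simplex K \<Gamma> m (snd K \<alpha> k) \<bullet> snd \<Gamma> \<alpha>"
      by (rule E.square_reassoc[OF i'(3), symmetric]) (use i'(1) q2m Ga cak bang[OF Gn] in \<open>simp_all add: hom_iff\<close>)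
    finally show "cmp (pr2 sE \<Gamma> (disc E K)) m \<bullet> snd ?P \<alpha> \<bullet> at_simplex K \<Gamma> n k =
        cmp (pr2 sE \<Gamma> (disc E K)) m \<bullet> at_simplex K \<Gamma> m (snd K \<alpha> k) \<bullet> snd \<Gamma> \<alpha>" .
  qed
qed

lemma prod_ar_cmp:
  assumes f: "f \<in> hom sE X Y" and g: "g \<in> hom sE Z W"
  shows "cmp (prod_ar sE f g) n \<in> hom E (fst (prod_ob sE X Z) n) (fst (prod_ob sE Y W) n)"
    "cmp (pr1 sE Y W) n \<bullet> cmp (prod_ar sE f g) n = cmp f n \<bullet> cmp (pr1 sE X Z) n"
    "cmp (pr2 sE Y W) n \<bullet> cmp (prod_ar sE f g) n = cmp g n \<bullet> cmp (pr2 sE X Z) n"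
proof -
  have fg: "f \<in> Ar sE" "Dom sE f = X" "Cod sE f = Y" "g \<in> Ar sE" "Dom sE g = Z" "Cod sE g = W"
    using f g by (simp_all add: hom_iff)
  have "prod_ar sE f g \<in> hom sE (prod_ob sE X Z) (prod_ob sE Y W)" using fg by (simp add: hom_iff)
  then show "cmp (prod_ar sE f g) n \<in> hom E (fst (prod_ob sE X Z) n) (fst (prod_ob sE Y W) n)" by (rule sE_homD(1))
  show "cmp (pr1 sE Y W) n \<bullet> cmp (prod_ar sE f g) n = cmp f n \<bullet> cmp (pr1 sE X Z) n"
  proof -
    have "pr1 sE Y W \<bullet>\<^bsub>sE\<^esub> prod_ar sE f g = f \<bullet>\<^bsub>sE\<^esub> pr1 sE X Z" using fg by simp
    from arg_cong[OF this, of "\<lambda>x. cmp x n"] show ?thesis unfolding sE_comp_cmp .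
  qed
  show "cmp (pr2 sE Y W) n \<bullet> cmp (prod_ar sE f g) n = cmp g n \<bullet> cmp (pr2 sE X Z) n"
  proof -
    have "pr2 sE Y W \<bullet>\<^bsub>sE\<^esub> prod_ar sE f g = g \<bullet>\<^bsub>sE\<^esub> pr2 sE X Z" using fg by simp
    from arg_cong[OF this, of "\<lambda>x. cmp x n"] show ?thesis unfolding sE_comp_cmp .
  qed
qed

lemma at_simplex_base:
  assumes K: "discrete_base K" and s: "\<sigma> \<in> hom sE \<Delta> \<Gamma>" and k: "k \<in> fst K n"
  shows "cmp (prod_ar sE \<sigma> (Idn sE (disc E K))) n \<bullet> at_simplex K \<Delta> n k = at_simplex K \<Gamma> n k \<bullet> cmp \<sigma> n"
proof -
  note D = discrete_baseD[OF K]
  have \<Delta>: "\<Delta> \<in> Ob sE" and \<Gamma>: "\<Gamma> \<in> Ob sE" using S.hom_Ob[OF s] by simp_all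
  let ?f = "cmp (prod_ar sE \<sigma> (Idn sE (disc E K))) n"
  note f = prod_ar_cmp[OF s S.id_hom[OF D(2)], of n] and sn = sE_homD(1)[OF s, of n]
  note i = at_simplex[OF K \<Delta> k] and i' = at_simplex[OF K \<Gamma> k]
  note q = level_pr_hom[OF \<Delta> D(2), of n] and q' = level_pr_hom[OF \<Gamma> D(2), of n]
  note b = bang[OF sE_ObD(1)[OF \<Delta>, of n]] and b' = bang[OF sE_ObD(1)[OF \<Gamma>, of n]] and c = copow_inj[OF D(1) k]
  have idn: "cmp (Idn sE (disc E K)) n = Idn E (fst (disc E K) n)" by (rule sE_id)
  note idh = E.id_hom[OF sE_ObD(1)[OF D(2), of n]]
  show ?thesis
  proof (rule level_product_eqI[OF \<Gamma> D(2)])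
    show "?f \<bullet> at_simplex K \<Delta> n k \<in> hom E (fst \<Delta> n) (fst (prod_ob sE \<Gamma> (disc E K)) n)" using f(1) i(1) by (rule E.comp_hom)
    show "at_simplex K \<Gamma> n k \<bullet> cmp \<sigma> n \<in> hom E (fst \<Delta> n) (fst (prod_ob sE \<Gamma> (disc E K)) n)" using i'(1) sn by (rule E.comp_hom)
    have "cmp (pr1 sE \<Gamma> (disc E K)) n \<bullet> ?f \<bullet> at_simplex K \<Delta> n k = cmp \<sigma> n \<bullet> cmp (pr1 sE \<Delta> (disc E K)) n \<bullet> at_simplex K \<Delta> n k"
      by (rule E.square_reassoc[OF f(2)]) (use f(1) q q' sn i(1) in \<open>simp_all add: hom_iff\<close>)
    also have "\<dots> = cmp \<sigma> n" unfolding i(2) using sn by (simp add: hom_iff)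
    also have "\<dots> = cmp (pr1 sE \<Gamma> (disc E K)) n \<bullet> at_simplex K \<Gamma> n k \<bullet> cmp \<sigma> n"
      using E.comp_reassoc[OF i'(2), of "cmp \<sigma> n"] i'(1) q' sn by (simp add: hom_iff)
    finally show "cmp (pr1 sE \<Gamma> (disc E K)) n \<bullet> ?f \<bullet> at_simplex K \<Delta> n k =
        cmp (pr1 sE \<Gamma> (disc E K)) n \<bullet> at_simplex K \<Gamma> n k \<bullet> cmp \<sigma> n" .
    have "cmp (pr2 sE \<Gamma> (disc E K)) n \<bullet> ?f \<bullet> at_simplex K \<Delta> n k =
        Idn E (fst (disc E K) n) \<bullet> cmp (pr2 sE \<Delta> (disc E K)) n \<bullet> at_simplex K \<Delta> n k"
      by (rule E.square_reassoc[OF f(3)[unfolded idn]]) (use f(1) q q' idh i(1) in \<open>simp_all add: hom_iff\<close>)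
    also have "\<dots> = snd (copow E (fst K n)) k \<bullet> bang (fst \<Delta> n)"
      unfolding i(3) using c b D(7)[of n] by (simp add: hom_iff)
    also have "bang (fst \<Delta> n) = bang (fst \<Gamma> n) \<bullet> cmp \<sigma> n" using bang_unique[OF b E.comp_hom[OF b' sn]] .
    also have "snd (copow E (fst K n)) k \<bullet> bang (fst \<Gamma> n) \<bullet> cmp \<sigma> n =
        cmp (pr2 sE \<Gamma> (disc E K)) n \<bullet> at_simplex K \<Gamma> n k \<bullet> cmp \<sigma> n"
      by (rule E.square_reassoc[OF i'(3), symmetric]) (use i'(1) q' sn c b' in \<open>simp_all add: hom_iff\<close>)
    finally show "cmp (pr2 sE \<Gamma> (disc E K)) n \<bullet> ?f \<bullet> at_simplex K \<Delta> n k =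
        cmp (pr2 sE \<Gamma> (disc E K)) n \<bullet> at_simplex K \<Gamma> n k \<bullet> cmp \<sigma> n" .
  qed
qed

lemma at_simplex_shape:
  assumes K: "discrete_base K" and L: "discrete_base L" and G: "\<Gamma> \<in> Ob sE"
    and j: "j \<in> hom sE (disc E K) (disc E L)" and k: "k \<in> fst K n" and kL: "k \<in> fst L n"
    and jk: "cmp j n \<bullet> snd (copow E (fst K n)) k = snd (copow E (fst L n)) k"
  shows "cmp (prod_ar sE (Idn sE \<Gamma>) j) n \<bullet> at_simplex K \<Gamma> n k = at_simplex L \<Gamma> n k"
proof -
  note D = discrete_baseD[OF K] and DL = discrete_baseD[OF L]
  let ?f = "cmp (prod_ar sE (Idn sE \<Gamma>) j) n"
  note f = prod_ar_cmp[OF S.id_hom[OF G] j, of n] and jn = sE_homD(1)[OF j, of n]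
  note i = at_simplex[OF K G k] and i' = at_simplex[OF L G kL]
  note q = level_pr_hom[OF G D(2), of n] and q' = level_pr_hom[OF G DL(2), of n]
  note b = bang[OF sE_ObD(1)[OF G, of n]] and c = copow_inj[OF D(1) k] and c' = copow_inj[OF DL(1) kL]
  have idn: "cmp (Idn sE \<Gamma>) n = Idn E (fst \<Gamma> n)" by (rule sE_id)
  note idh = E.id_hom[OF sE_ObD(1)[OF G, of n]]
  show ?thesis
  proof (rule level_product_eqI[OF G DL(2)])
    show "?f \<bullet> at_simplex K \<Gamma> n k \<in> hom E (fst \<Gamma> n) (fst (prod_ob sE \<Gamma> (disc E L)) n)" using f(1) i(1) by (rule E.comp_hom)
    show "at_simplex L \<Gamma> n k \<in> hom E (fst \<Gamma> n) (fst (prod_ob sE \<Gamma> (disc E L)) n)" by (rule i'(1))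
    have "cmp (pr1 sE \<Gamma> (disc E L)) n \<bullet> ?f \<bullet> at_simplex K \<Gamma> n k =
        Idn E (fst \<Gamma> n) \<bullet> cmp (pr1 sE \<Gamma> (disc E K)) n \<bullet> at_simplex K \<Gamma> n k"
      by (rule E.square_reassoc[OF f(2)[unfolded idn]]) (use f(1) q q' idh i(1) in \<open>simp_all add: hom_iff\<close>)
    then show "cmp (pr1 sE \<Gamma> (disc E L)) n \<bullet> ?f \<bullet> at_simplex K \<Gamma> n k = cmp (pr1 sE \<Gamma> (disc E L)) n \<bullet> at_simplex L \<Gamma> n k"
      unfolding i(2) i'(2) using idh by (simp add: hom_iff)
    have "cmp (pr2 sE \<Gamma> (disc E L)) n \<bullet> ?f \<bullet> at_simplex K \<Gamma> n k =
        cmp j n \<bullet> cmp (pr2 sE \<Gamma> (disc E K)) n \<bullet> at_simplex K \<Gamma> n k"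
      by (rule E.square_reassoc[OF f(3)]) (use f(1) q q' jn i(1) in \<open>simp_all add: hom_iff\<close>)
    also have "\<dots> = snd (copow E (fst L n)) k \<bullet> bang (fst \<Gamma> n)"
      unfolding i(3) by (rule E.comp_reassoc[OF jk]) (use c b jn D(7)[of n] in \<open>simp_all add: hom_iff\<close>)
    finally show "cmp (pr2 sE \<Gamma> (disc E L)) n \<bullet> ?f \<bullet> at_simplex K \<Gamma> n k = cmp (pr2 sE \<Gamma> (disc E L)) n \<bullet> at_simplex L \<Gamma> n k"
      unfolding i'(3) .
  qed
qed

lemma cmp_reix:
  assumes K: "discrete_base K" and s: "\<sigma> \<in> hom sE \<Delta> \<Gamma>" and x: "x \<in> hom sE (prod_ob sE \<Gamma> (disc E K)) Z" and k: "k \<in> fst K n"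
  shows "cmp (reix sE (disc E K) \<sigma> x) n \<bullet> at_simplex K \<Delta> n k = cmp x n \<bullet> at_simplex K \<Gamma> n k \<bullet> cmp \<sigma> n"
proof -
  have \<Delta>: "\<Delta> \<in> Ob sE" and \<Gamma>: "\<Gamma> \<in> Ob sE" using S.hom_Ob[OF s] by simp_all
  show ?thesis
    using at_simplex_base[OF K s k] at_simplex(1)[OF K \<Delta> k] sE_homD(1)[OF x, of n]
      prod_ar_cmp(1)[OF s S.id_hom[OF discrete_baseD(2)[OF K]], of n]
    by (simp add: reix_def hom_iff)
qed

text \<open>
  Maps \<open>\<Gamma> \<times> disc K \<rightarrow> X\<close> are families of maps \<open>\<Gamma> n \<rightarrow> X n\<close> indexed by the simplices of \<open>K\<close>, so the exponential at level \<open>n\<close>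
  is the limit of the objects \<open>X m\<close> over the pairs of a map \<open>\<alpha> : m \<rightarrow> n\<close> and an
  \<open>m\<close>-simplex \<open>k\<close> of \<open>K\<close>, which are the simplices of the product of \<open>K\<close> with the standard \<open>n\<close>-simplex.
\<close>

definition simplices_over :: "csimp sset \<Rightarrow> nat \<Rightarrow> (dmap \<times> csimp) set" where
  "simplices_over K n = {(\<alpha>, k). \<alpha> \<in> Ar Delta \<and> Cod Delta \<alpha> = n \<and> k \<in> fst K (Dom Delta \<alpha>)}"

definition simplices_cat :: "csimp sset \<Rightarrow> nat \<Rightarrow> (dmap \<times> csimp, dmap \<times> dmap \<times> csimp) cat" where
  "simplices_cat K n = \<lparr>Ob = simplices_over K n,
     Ar = {(\<beta>, x). x \<in> simplices_over K n \<and> \<beta> \<in> Ar Delta \<and> Cod Delta \<beta> = Dom Delta (fst x)},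
     Dom = snd, Cod = (\<lambda>(\<beta>, \<alpha>, k). (\<alpha> \<bullet>\<^bsub>Delta\<^esub> \<beta>, snd K \<beta> k)),
     Idn = (\<lambda>x. (Idn Delta (Dom Delta (fst x)), x)),
     Cmp = (\<lambda>(\<gamma>, y) (\<beta>, x). (\<beta> \<bullet>\<^bsub>Delta\<^esub> \<gamma>, x))\<rparr>"

lemma simplices_over_iff: "(\<alpha>, k) \<in> simplices_over K n \<longleftrightarrow> (\<exists>m. \<alpha> \<in> hom Delta m n \<and> k \<in> fst K m)"
  by (auto simp: simplices_over_def hom_iff)

lemma simplices_hom:
  "f \<in> hom (simplices_cat K n) x y \<longleftrightarrow> (\<exists>\<beta> \<alpha> k l m. f = (\<beta>, \<alpha>, k) \<and> \<alpha> \<in> hom Delta m n \<and> \<beta> \<in> hom Delta l m \<and>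
     k \<in> fst K m \<and> x = (\<alpha>, k) \<and> y = (\<alpha> \<bullet>\<^bsub>Delta\<^esub> \<beta>, snd K \<beta> k))"
  by (auto simp: simplices_cat_def simplices_over_def hom_iff)

lemma category_simplices:
  assumes K: "discrete_base K"
  shows "category (simplices_cat K n)"
  unfolding category_def
proof (intro conjI allI ballI)
  note D = discrete_baseD[OF K]
  fix f assume f: "f \<in> Ar (simplices_cat K n)"
  then obtain \<beta> \<alpha> k where g: "f = (\<beta>, \<alpha>, k)" "\<alpha> \<in> hom Delta (Dom Delta \<alpha>) n" "\<beta> \<in> hom Delta (Dom Delta \<beta>) (Dom Delta \<alpha>)" "k \<in> fst K (Dom Delta \<alpha>)"
    by (auto simp: simplices_cat_def simplices_over_def hom_iff)
  have "(\<alpha>, k) \<in> simplices_over K n" "(\<alpha> \<bullet>\<^bsub>Delta\<^esub> \<beta>, snd K \<beta> k) \<in> simplices_over K n"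
    unfolding simplices_over_iff using g Delta.comp_hom[OF g(2,3)] D(4)[OF g(3,4)] by blast+
  then show "Dom (simplices_cat K n) f \<in> Ob (simplices_cat K n)" "Cod (simplices_cat K n) f \<in> Ob (simplices_cat K n)"
    using g(1) by (simp_all add: simplices_cat_def)
next
  note D = discrete_baseD[OF K]
  fix x assume "x \<in> Ob (simplices_cat K n)"
  then obtain \<alpha> k m where x: "x = (\<alpha>, k)" "\<alpha> \<in> hom Delta m n" "k \<in> fst K m"
    by (cases x) (auto simp: simplices_cat_def simplices_over_iff)
  then have "Idn (simplices_cat K n) x = (Idn Delta m, \<alpha>, k)" "\<alpha> \<bullet>\<^bsub>Delta\<^esub> Idn Delta m = \<alpha>"
    by (auto simp: simplices_cat_def hom_iff)
  then show "Idn (simplices_cat K n) x \<in> hom (simplices_cat K n) x x"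
    unfolding simplices_hom using x D(5)[OF x(3)] Delta_id_hom[of m] by metis
next
  note D = discrete_baseD[OF K]
  fix x y z f g assume "f \<in> hom (simplices_cat K n) x y" "g \<in> hom (simplices_cat K n) y z"
  then obtain \<beta> \<alpha> k l m \<gamma> l' m' where f: "f = (\<beta>, \<alpha>, k)" "\<alpha> \<in> hom Delta m n" "\<beta> \<in> hom Delta l m" "k \<in> fst K m" "x = (\<alpha>, k)" "y = (\<alpha> \<bullet>\<^bsub>Delta\<^esub> \<beta>, snd K \<beta> k)"
    and g: "g = (\<gamma>, y)" "\<gamma> \<in> hom Delta l' m'" "\<alpha> \<bullet>\<^bsub>Delta\<^esub> \<beta> \<in> hom Delta m' n" "z = ((\<alpha> \<bullet>\<^bsub>Delta\<^esub> \<beta>) \<bullet>\<^bsub>Delta\<^esub> \<gamma>, snd K \<gamma> (snd K \<beta> k))"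
    unfolding simplices_hom by auto
  have "m' = l" using g(3) f(2,3) by (simp add: hom_iff)
  then have \<gamma>: "\<gamma> \<in> hom Delta l' l" using g by simp
  have "g \<bullet>\<^bsub>simplices_cat K n\<^esub> f = (\<beta> \<bullet>\<^bsub>Delta\<^esub> \<gamma>, \<alpha>, k)" using f g by (simp add: simplices_cat_def)
  moreover have "z = (\<alpha> \<bullet>\<^bsub>Delta\<^esub> (\<beta> \<bullet>\<^bsub>Delta\<^esub> \<gamma>), snd K (\<beta> \<bullet>\<^bsub>Delta\<^esub> \<gamma>) k)"
    using g(4) D(6)[OF \<gamma> f(3,4)] f \<gamma> by (simp add: hom_iff)
  ultimately show "g \<bullet>\<^bsub>simplices_cat K n\<^esub> f \<in> hom (simplices_cat K n) x z"
    unfolding simplices_hom using f Delta.comp_hom[OF f(3) \<gamma>] by blast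
next
  fix x y f assume "f \<in> hom (simplices_cat K n) x y"
  then obtain \<beta> \<alpha> k l m where f: "f = (\<beta>, \<alpha>, k)" "\<alpha> \<in> hom Delta m n" "\<beta> \<in> hom Delta l m" "k \<in> fst K m" "x = (\<alpha>, k)" "y = (\<alpha> \<bullet>\<^bsub>Delta\<^esub> \<beta>, snd K \<beta> k)"
    unfolding simplices_hom by blast
  then have "Idn (simplices_cat K n) x = (Idn Delta m, \<alpha>, k)" "Idn (simplices_cat K n) y = (Idn Delta l, y)"
    by (auto simp: simplices_cat_def hom_iff)
  then show "f \<bullet>\<^bsub>simplices_cat K n\<^esub> Idn (simplices_cat K n) x = f" "Idn (simplices_cat K n) y \<bullet>\<^bsub>simplices_cat K n\<^esub> f = f"
    using f by (auto simp: simplices_cat_def hom_iff)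
next
  fix w x y z f g h assume "f \<in> hom (simplices_cat K n) w x" "g \<in> hom (simplices_cat K n) x y" "h \<in> hom (simplices_cat K n) y z"
  then obtain \<beta> \<alpha> k l m \<gamma> l' m' \<delta> l'' m'' where
    f: "f = (\<beta>, \<alpha>, k)" "\<alpha> \<in> hom Delta m n" "\<beta> \<in> hom Delta l m" "x = (\<alpha> \<bullet>\<^bsub>Delta\<^esub> \<beta>, snd K \<beta> k)"
    and g: "g = (\<gamma>, x)" "fst x \<in> hom Delta m' n" "\<gamma> \<in> hom Delta l' m'" "y = (fst x \<bullet>\<^bsub>Delta\<^esub> \<gamma>, snd K \<gamma> (snd x))"
    and h: "h = (\<delta>, y)" "fst y \<in> hom Delta m'' n" "\<delta> \<in> hom Delta l'' m''"
    unfolding simplices_hom by (metis fst_conv snd_conv)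
  have "m' = l" "m'' = l'" using f g h by (simp_all add: hom_iff)
  then have "(\<beta> \<bullet>\<^bsub>Delta\<^esub> \<gamma>) \<bullet>\<^bsub>Delta\<^esub> \<delta> = \<beta> \<bullet>\<^bsub>Delta\<^esub> (\<gamma> \<bullet>\<^bsub>Delta\<^esub> \<delta>)" using f g h by (simp add: hom_iff)
  then show "h \<bullet>\<^bsub>simplices_cat K n\<^esub> g \<bullet>\<^bsub>simplices_cat K n\<^esub> f = (h \<bullet>\<^bsub>simplices_cat K n\<^esub> g) \<bullet>\<^bsub>simplices_cat K n\<^esub> f"
    using f(1) g(1) h(1) by (simp add: simplices_cat_def)
qed

lemma countable_simplices:
  assumes K: "discrete_base K"
  shows "countable (Ob (simplices_cat K n))" "countable (Ar (simplices_cat K n))"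
proof -
  have "countable (Ar Delta \<times> (\<Union>m. fst K m))" using countable_Delta discrete_baseD(1)[OF K] by simp
  moreover have "simplices_over K n \<subseteq> Ar Delta \<times> (\<Union>m. fst K m)" by (auto simp: simplices_over_def)
  ultimately have c: "countable (simplices_over K n)" by (rule countable_subset[rotated])
  then show "countable (Ob (simplices_cat K n))" by (simp add: simplices_cat_def)
  have "countable (Ar Delta \<times> simplices_over K n)" using countable_Delta c by simp
  moreover have "Ar (simplices_cat K n) \<subseteq> Ar Delta \<times> simplices_over K n" by (auto simp: simplices_cat_def)
  ultimately show "countable (Ar (simplices_cat K n))" by (rule countable_subset[rotated])
qed

theorem disc_exponential:
  assumes K: "discrete_base K" and X: "X \<in> Ob sE"
  shows "\<exists>P ev. is_exponential sE (disc E K) X P ev"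
proof -
  note D = discrete_baseD[OF K] and Xo = sE_ObD[OF X]
  define F :: "(dmap \<times> csimp \<Rightarrow> 'o) \<times> (dmap \<times> dmap \<times> csimp \<Rightarrow> 'm)" where "F = (\<lambda>x. fst X (Dom Delta (fst x)), \<lambda>f. snd X (fst f))"
  have F0: "fst F (\<alpha>, k) = fst X m" if "\<alpha> \<in> hom Delta m n" for \<alpha> :: dmap and k :: csimp and m n
    using that by (simp add: F_def hom_iff)
  have F1: "snd F (\<beta>, x) = snd X \<beta>" for \<beta> and x :: "dmap \<times> csimp" by (simp add: F_def)
  have F_functor: "is_functor (simplices_cat K n) E F" for n
    unfolding is_functor_def
  proof (intro conjI ballI allI)
    fix x assume "x \<in> Ob (simplices_cat K n)"
    then show "fst F x \<in> Ob E" by (simp add: F_def Xo)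
    show "snd F (Idn (simplices_cat K n) x) = Idn E (fst F x)" by (simp add: F_def simplices_cat_def Xo)
  next
    fix x y f assume "f \<in> hom (simplices_cat K n) x y"
    then obtain \<beta> \<alpha> k l m where f: "f = (\<beta>, \<alpha>, k)" "\<alpha> \<in> hom Delta m n" "\<beta> \<in> hom Delta l m" "x = (\<alpha>, k)" "y = (\<alpha> \<bullet>\<^bsub>Delta\<^esub> \<beta>, snd K \<beta> k)"
      unfolding simplices_hom by blast
    have "fst F x = fst X m" "fst F y = fst X l" "snd F f = snd X \<beta>"
      using f F1 F0[OF f(2)] F0[OF Delta.comp_hom[OF f(2,3)]] by simp_all
    then show "snd F f \<in> hom E (fst F x) (fst F y)" using Xo(2)[OF f(3)] by simp
  next
    fix x y z f g assume "f \<in> hom (simplices_cat K n) x y" "g \<in> hom (simplices_cat K n) y z"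
    then obtain \<beta> \<alpha> k l m \<gamma> l' m' where f: "f = (\<beta>, \<alpha>, k)" "\<alpha> \<in> hom Delta m n" "\<beta> \<in> hom Delta l m" "y = (\<alpha> \<bullet>\<^bsub>Delta\<^esub> \<beta>, snd K \<beta> k)"
      and g: "g = (\<gamma>, y)" "\<gamma> \<in> hom Delta l' m'" "\<alpha> \<bullet>\<^bsub>Delta\<^esub> \<beta> \<in> hom Delta m' n"
      unfolding simplices_hom by auto
    have "m' = l" using g(3) f(2,3) by (simp add: hom_iff)
    then have \<gamma>: "\<gamma> \<in> hom Delta l' l" using g by simp
    have "g \<bullet>\<^bsub>simplices_cat K n\<^esub> f = (\<beta> \<bullet>\<^bsub>Delta\<^esub> \<gamma>, \<alpha>, k)" using f g by (simp add: simplices_cat_def)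
    then show "snd F (g \<bullet>\<^bsub>simplices_cat K n\<^esub> f) = snd F g \<bullet> snd F f"
      using f(1) g(1) F1 Xo(4)[OF \<gamma> f(3)] by simp
  qed
  have "\<exists>L c. is_limit (simplices_cat K n) E F L c" for n
    using limits_E[OF category_simplices[OF K] countable_simplices[OF K] F_functor] .
  then obtain L c where L: "\<And>n. is_limit (simplices_cat K n) E F (L n) (c n)" by metis
  have ObS: "Ob (simplices_cat K n) = simplices_over K n" for n by (simp add: simplices_cat_def)
  have cone_iff: "is_cone (simplices_cat K n) E F Z x \<longleftrightarrow> Z \<in> Ob E \<and>
      (\<forall>m. \<forall>\<alpha>\<in>hom Delta m n. \<forall>k\<in>fst K m. x (\<alpha>, k) \<in> hom E Z (fst X m)) \<and>
      (\<forall>l m. \<forall>\<beta>\<in>hom Delta l m. \<forall>\<alpha>\<in>hom Delta m n. \<forall>k\<in>fst K m.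
        snd X \<beta> \<bullet> x (\<alpha>, k) = x (\<alpha> \<bullet>\<^bsub>Delta\<^esub> \<beta>, snd K \<beta> k))" for n Z x
  proof -
    have "(\<forall>a\<in>Ob (simplices_cat K n). x a \<in> hom E Z (fst F a)) \<longleftrightarrow>
        (\<forall>m. \<forall>\<alpha>\<in>hom Delta m n. \<forall>k\<in>fst K m. x (\<alpha>, k) \<in> hom E Z (fst X m))"
    proof (intro iffI allI ballI)
      fix m \<alpha> k assume "\<forall>a\<in>Ob (simplices_cat K n). x a \<in> hom E Z (fst F a)" and a: "\<alpha> \<in> hom Delta m n" "k \<in> fst K m"
      then have "x (\<alpha>, k) \<in> hom E Z (fst F (\<alpha>, k))" unfolding ObS using simplices_over_iff by blast
      then show "x (\<alpha>, k) \<in> hom E Z (fst X m)" using F0[OF a(1)] by simp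
    next
      fix a assume *: "\<forall>m. \<forall>\<alpha>\<in>hom Delta m n. \<forall>k\<in>fst K m. x (\<alpha>, k) \<in> hom E Z (fst X m)" and "a \<in> Ob (simplices_cat K n)"
      then obtain \<alpha> k m where a: "a = (\<alpha>, k)" "\<alpha> \<in> hom Delta m n" "k \<in> fst K m"
        unfolding ObS by (cases a) (auto simp: simplices_over_iff)
      then show "x a \<in> hom E Z (fst F a)" using * F0[OF a(2)] by simp
    qed
    moreover have "(\<forall>a b. \<forall>f\<in>hom (simplices_cat K n) a b. snd F f \<bullet> x a = x b) \<longleftrightarrow>
        (\<forall>l m. \<forall>\<beta>\<in>hom Delta l m. \<forall>\<alpha>\<in>hom Delta m n. \<forall>k\<in>fst K m.
          snd X \<beta> \<bullet> x (\<alpha>, k) = x (\<alpha> \<bullet>\<^bsub>Delta\<^esub> \<beta>, snd K \<beta> k))"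
    proof (intro iffI allI ballI)
      fix l m \<beta> \<alpha> k assume *: "\<forall>a b. \<forall>f\<in>hom (simplices_cat K n) a b. snd F f \<bullet> x a = x b"
        and a: "\<beta> \<in> hom Delta l m" "\<alpha> \<in> hom Delta m n" "k \<in> fst K m"
      have "(\<beta>, \<alpha>, k) \<in> hom (simplices_cat K n) (\<alpha>, k) (\<alpha> \<bullet>\<^bsub>Delta\<^esub> \<beta>, snd K \<beta> k)"
        unfolding simplices_hom using a by blast
      then have "snd F (\<beta>, \<alpha>, k) \<bullet> x (\<alpha>, k) = x (\<alpha> \<bullet>\<^bsub>Delta\<^esub> \<beta>, snd K \<beta> k)" using * by blast
      then show "snd X \<beta> \<bullet> x (\<alpha>, k) = x (\<alpha> \<bullet>\<^bsub>Delta\<^esub> \<beta>, snd K \<beta> k)" unfolding F1 .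
    next
      fix a b f assume *: "\<forall>l m. \<forall>\<beta>\<in>hom Delta l m. \<forall>\<alpha>\<in>hom Delta m n. \<forall>k\<in>fst K m.
          snd X \<beta> \<bullet> x (\<alpha>, k) = x (\<alpha> \<bullet>\<^bsub>Delta\<^esub> \<beta>, snd K \<beta> k)" and "f \<in> hom (simplices_cat K n) a b"
      then obtain \<beta> \<alpha> k l m where "f = (\<beta>, \<alpha>, k)" "\<alpha> \<in> hom Delta m n" "\<beta> \<in> hom Delta l m" "k \<in> fst K m" "a = (\<alpha>, k)" "b = (\<alpha> \<bullet>\<^bsub>Delta\<^esub> \<beta>, snd K \<beta> k)"
        unfolding simplices_hom by blast
      then show "snd F f \<bullet> x a = x b" using * F1 by simp
    qed
    ultimately show ?thesis unfolding is_cone_def by simp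
  qed

  \<comment> \<open>Cones are made extensional so that they are determined by their components.\<close>
  let ?F = "\<lambda>n Z. {x \<in> extensional (simplices_over K n). is_cone (simplices_cat K n) E F Z x}"
  let ?res = "\<lambda>n x h. \<lambda>a\<in>simplices_over K n. x a \<bullet> h"
  let ?tr = "\<lambda>\<theta> x. \<lambda>a\<in>simplices_over K (Dom Delta \<theta>). x (\<theta> \<bullet>\<^bsub>Delta\<^esub> fst a, snd a)"
  define u where "u n = restrict (c n) (simplices_over K n)" for n
  have coneD: "Z \<in> Ob E" "\<And>m \<alpha> k. \<alpha> \<in> hom Delta m n \<Longrightarrow> k \<in> fst K m \<Longrightarrow> x (\<alpha>, k) \<in> hom E Z (fst X m)"
    "\<And>l m \<alpha> \<beta> k. \<beta> \<in> hom Delta l m \<Longrightarrow> \<alpha> \<in> hom Delta m n \<Longrightarrow> k \<in> fst K m \<Longrightarrow>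
      snd X \<beta> \<bullet> x (\<alpha>, k) = x (\<alpha> \<bullet>\<^bsub>Delta\<^esub> \<beta>, snd K \<beta> k)"
    if "x \<in> ?F n Z" for x n Z
    using that unfolding cone_iff by blast+
  have coneI: "x \<in> ?F n Z"
    if "x \<in> extensional (simplices_over K n)" "Z \<in> Ob E"
      "\<And>m \<alpha> k. \<alpha> \<in> hom Delta m n \<Longrightarrow> k \<in> fst K m \<Longrightarrow> x (\<alpha>, k) \<in> hom E Z (fst X m)"
      "\<And>l m \<alpha> \<beta> k. \<beta> \<in> hom Delta l m \<Longrightarrow> \<alpha> \<in> hom Delta m n \<Longrightarrow> k \<in> fst K m \<Longrightarrow>
        snd X \<beta> \<bullet> x (\<alpha>, k) = x (\<alpha> \<bullet>\<^bsub>Delta\<^esub> \<beta>, snd K \<beta> k)" for x n Z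
    using that unfolding cone_iff by blast
  have so: "(\<alpha>, k) \<in> simplices_over K n" if "\<alpha> \<in> hom Delta m n" "k \<in> fst K m" for \<alpha> k m n
    using that simplices_over_iff by blast
  have so': "(\<alpha> \<bullet>\<^bsub>Delta\<^esub> \<beta>, snd K \<beta> k) \<in> simplices_over K n" if "\<beta> \<in> hom Delta l m" "\<alpha> \<in> hom Delta m n" "k \<in> fst K m" for \<alpha> \<beta> k l m n
    using so[OF Delta.comp_hom[OF that(2,1)] D(4)[OF that(1,3)]] .
  have cone_eqI: "x = y" if "x \<in> extensional (simplices_over K n)" "y \<in> extensional (simplices_over K n)"
    "\<And>m \<alpha> k. \<alpha> \<in> hom Delta m n \<Longrightarrow> k \<in> fst K m \<Longrightarrow> x (\<alpha>, k) = y (\<alpha>, k)" for x y :: "dmap \<times> csimp \<Rightarrow> 'm" and n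
  proof (rule extensionalityI[OF that(1,2)])
    fix a assume "a \<in> simplices_over K n"
    then show "x a = y a" using that(3) by (cases a) (auto simp: simplices_over_iff)
  qed
  have Lc: "is_cone (simplices_cat K n) E F (L n) (c n)" for n using L[of n] by (simp add: is_limit_iff)
  have u: "u n \<in> ?F n (L n)" for n
  proof (rule coneI)
    show "u n \<in> extensional (simplices_over K n)" by (simp add: u_def)
  qed (use Lc[of n, unfolded cone_iff] so so' in \<open>auto simp: u_def\<close>)
  have "\<exists>P. P \<in> Ob sE \<and> fst P = L \<and>
    (\<forall>m n. \<forall>\<alpha>\<in>hom Delta m n. ?res m (u m) (snd P \<alpha>) = ?tr \<alpha> (u n)) \<and>
    (\<forall>Y e. Y \<in> Ob sE \<and> (\<forall>n. e n \<in> ?F n (fst Y n)) \<and>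
      (\<forall>m n. \<forall>\<alpha>\<in>hom Delta m n. ?res m (e m) (snd Y \<alpha>) = ?tr \<alpha> (e n)) \<longrightarrow>
      (\<exists>!f. f \<in> hom sE Y P \<and> (\<forall>n. ?res n (u n) (cmp f n) = e n)))"
  proof (rule pointwise_representable[where F = ?F and res = ?res and tr = ?tr])
    show "L n \<in> Ob E" for n using Lc[of n] by (simp add: is_cone_def)
    show "u n \<in> ?F n (L n)" for n by (rule u)
  next
    fix n Z x assume x: "x \<in> ?F n Z"
    then have "\<exists>!h. h \<in> hom E Z (L n) \<and> (\<forall>a\<in>simplices_over K n. c n a \<bullet> h = x a)"
      using L[of n] unfolding is_limit_iff ObS by blast
    moreover have "?res n (u n) h = x \<longleftrightarrow> (\<forall>a\<in>simplices_over K n. c n a \<bullet> h = x a)" for h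
      using x by (auto simp: u_def fun_eq_iff extensional_def)
    ultimately show "\<exists>!h. h \<in> hom E Z (L n) \<and> ?res n (u n) h = x" by simp
  next
    fix n Z Z' x h assume x: "x \<in> ?F n Z" and h: "h \<in> hom E Z' Z"
    note xD = coneD[OF x]
    show "?res n x h \<in> ?F n Z'"
    proof (rule coneI)
      show "Z' \<in> Ob E" using E.hom_Ob[OF h] by simp
      show "?res n x h (\<alpha>, k) \<in> hom E Z' (fst X m)" if "\<alpha> \<in> hom Delta m n" "k \<in> fst K m" for m \<alpha> k
        using so[OF that] E.comp_hom[OF xD(2)[OF that] h] by simp
      fix l m \<alpha> \<beta> k assume b: "\<beta> \<in> hom Delta l m" and a: "\<alpha> \<in> hom Delta m n" and k: "k \<in> fst K m"
      have "snd X \<beta> \<bullet> x (\<alpha>, k) \<bullet> h = x (\<alpha> \<bullet>\<^bsub>Delta\<^esub> \<beta>, snd K \<beta> k) \<bullet> h"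
        by (rule E.comp_reassoc[OF xD(3)[OF b a k]]) (use xD(2)[OF a k] Xo(2)[OF b] h in \<open>simp_all add: hom_iff\<close>)
      then show "snd X \<beta> \<bullet> ?res n x h (\<alpha>, k) = ?res n x h (\<alpha> \<bullet>\<^bsub>Delta\<^esub> \<beta>, snd K \<beta> k)"
        using so[OF a k] so'[OF b a k] by simp
    qed simp
    show "?res n (?res n x h) k = ?res n x (h \<bullet> k)" if k: "k \<in> hom E Z'' Z'" for Z'' k
    proof (rule cone_eqI)
      fix m \<alpha> i assume a: "\<alpha> \<in> hom Delta m n" and i: "i \<in> fst K m"
      show "?res n (?res n x h) k (\<alpha>, i) = ?res n x (h \<bullet> k) (\<alpha>, i)"
        using so[OF a i] xD(2)[OF a i] h k by (simp add: hom_iff)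
    qed simp_all
    fix m \<theta> assume t: "\<theta> \<in> hom Delta m n"
    have Dt: "Dom Delta \<theta> = m" using t by (simp add: hom_iff)
    show "?tr \<theta> (?res n x h) = ?res m (?tr \<theta> x) h"
    proof (rule cone_eqI[of _ m])
      fix l \<alpha> i assume a: "\<alpha> \<in> hom Delta l m" and i: "i \<in> fst K l"
      show "?tr \<theta> (?res n x h) (\<alpha>, i) = ?res m (?tr \<theta> x) h (\<alpha>, i)"
        using so[OF a i] so[OF Delta.comp_hom[OF t a] i] Dt by simp
    qed (simp_all add: Dt)
  next
    fix n Z x assume x: "x \<in> ?F n Z"
    note xD = coneD[OF x]
    show "?res n x (Idn E Z) = x"
    proof (rule cone_eqI)
      show "x \<in> extensional (simplices_over K n)" using x by simp
      fix m \<alpha> k assume a: "\<alpha> \<in> hom Delta m n" and k: "k \<in> fst K m"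
      show "?res n x (Idn E Z) (\<alpha>, k) = x (\<alpha>, k)" using so[OF a k] xD(2)[OF a k] by (simp add: hom_iff)
    qed simp
    show "?tr (Idn Delta n) x = x"
    proof (rule cone_eqI)
      show "x \<in> extensional (simplices_over K n)" using x by simp
      have DI: "Dom Delta (Idn Delta n) = n" using Delta_id_hom[of n] by (simp add: hom_iff)
      show "?tr (Idn Delta n) x \<in> extensional (simplices_over K n)" by (simp add: DI)
      fix m \<alpha> k assume a: "\<alpha> \<in> hom Delta m n" and k: "k \<in> fst K m"
      show "?tr (Idn Delta n) x (\<alpha>, k) = x (\<alpha>, k)" using so[OF a k] a by (simp add: DI hom_iff)
    qed
    show "?tr \<theta> x \<in> ?F m Z" if t: "\<theta> \<in> hom Delta m n" for m \<theta>
    proof (rule coneI[OF _ xD(1)])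
      have Dt: "Dom Delta \<theta> = m" using t by (simp add: hom_iff)
      show "?tr \<theta> x \<in> extensional (simplices_over K m)" by (simp add: Dt)
      show "?tr \<theta> x (\<alpha>, k) \<in> hom E Z (fst X l)" if "\<alpha> \<in> hom Delta l m" "k \<in> fst K l" for l \<alpha> k
        using so[OF that] Dt xD(2)[OF Delta.comp_hom[OF t that(1)] that(2)] by simp
      fix l' l \<alpha> \<beta> k assume b: "\<beta> \<in> hom Delta l' l" and a: "\<alpha> \<in> hom Delta l m" and k: "k \<in> fst K l"
      have "\<theta> \<bullet>\<^bsub>Delta\<^esub> (\<alpha> \<bullet>\<^bsub>Delta\<^esub> \<beta>) = (\<theta> \<bullet>\<^bsub>Delta\<^esub> \<alpha>) \<bullet>\<^bsub>Delta\<^esub> \<beta>" using t a b by (simp add: hom_iff)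
      then show "snd X \<beta> \<bullet> ?tr \<theta> x (\<alpha>, k) = ?tr \<theta> x (\<alpha> \<bullet>\<^bsub>Delta\<^esub> \<beta>, snd K \<beta> k)"
        using so[OF a k] so'[OF b a k] Dt xD(3)[OF b Delta.comp_hom[OF t a] k] by simp
    qed
    show "?tr (\<beta> \<bullet>\<^bsub>Delta\<^esub> \<alpha>) x = ?tr \<alpha> (?tr \<beta> x)" if a: "\<alpha> \<in> hom Delta l m" and b: "\<beta> \<in> hom Delta m n" for l m \<alpha> \<beta>
    proof (rule cone_eqI[of _ l])
      have DI: "Dom Delta (\<beta> \<bullet>\<^bsub>Delta\<^esub> \<alpha>) = l" "Dom Delta \<alpha> = l" "Dom Delta \<beta> = m"
        using a b by (simp_all add: hom_iff)
      show "?tr (\<beta> \<bullet>\<^bsub>Delta\<^esub> \<alpha>) x \<in> extensional (simplices_over K l)" "?tr \<alpha> (?tr \<beta> x) \<in> extensional (simplices_over K l)"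
        by (simp_all add: DI)
      fix i \<gamma> k assume g: "\<gamma> \<in> hom Delta i l" and k: "k \<in> fst K i"
      have "(\<beta> \<bullet>\<^bsub>Delta\<^esub> \<alpha>) \<bullet>\<^bsub>Delta\<^esub> \<gamma> = \<beta> \<bullet>\<^bsub>Delta\<^esub> (\<alpha> \<bullet>\<^bsub>Delta\<^esub> \<gamma>)" using a b g by (simp add: hom_iff)
      then show "?tr (\<beta> \<bullet>\<^bsub>Delta\<^esub> \<alpha>) x (\<gamma>, k) = ?tr \<alpha> (?tr \<beta> x) (\<gamma>, k)"
        using so[OF g k] so[OF Delta.comp_hom[OF a g] k] DI by simp
    qed
  qed
  then obtain P where Pall: "P \<in> Ob sE \<and> fst P = L \<and>
    (\<forall>m n. \<forall>\<alpha>\<in>hom Delta m n. ?res m (u m) (snd P \<alpha>) = ?tr \<alpha> (u n)) \<and>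
    (\<forall>Y e. Y \<in> Ob sE \<and> (\<forall>n. e n \<in> ?F n (fst Y n)) \<and>
      (\<forall>m n. \<forall>\<alpha>\<in>hom Delta m n. ?res m (e m) (snd Y \<alpha>) = ?tr \<alpha> (e n)) \<longrightarrow>
      (\<exists>!f. f \<in> hom sE Y P \<and> (\<forall>n. ?res n (u n) (cmp f n) = e n)))" ..
  have P: "P \<in> Ob sE" "fst P = L"
    and Pnat: "\<And>m n \<theta>. \<theta> \<in> hom Delta m n \<Longrightarrow> ?res m (u m) (snd P \<theta>) = ?tr \<theta> (u n)"
    and Plift: "\<And>Y e. Y \<in> Ob sE \<Longrightarrow> (\<And>n. e n \<in> ?F n (fst Y n)) \<Longrightarrow>
      (\<And>m n \<alpha>. \<alpha> \<in> hom Delta m n \<Longrightarrow> ?res m (e m) (snd Y \<alpha>) = ?tr \<alpha> (e n)) \<Longrightarrow>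
      \<exists>!f. f \<in> hom sE Y P \<and> (\<forall>n. ?res n (u n) (cmp f n) = e n)"
    using Pall by blast+
  note uD = coneD[OF u]
  have u_nat: "u m (\<alpha>, k) \<bullet> snd P \<theta> = u n (\<theta> \<bullet>\<^bsub>Delta\<^esub> \<alpha>, k)"
    if "\<theta> \<in> hom Delta m n" "\<alpha> \<in> hom Delta l m" "k \<in> fst K l" for \<theta> \<alpha> k l m n
    using fun_cong[OF Pnat[OF that(1)], of "(\<alpha>, k)"] so[OF that(2,3)] that(1) by (simp add: hom_iff)
  have id_l: "Idn Delta n \<bullet>\<^bsub>Delta\<^esub> \<alpha> = \<alpha>" if "\<alpha> \<in> hom Delta m n" for \<alpha> m n using that by (simp add: hom_iff)
  have id_r: "\<alpha> \<bullet>\<^bsub>Delta\<^esub> Idn Delta m = \<alpha>" if "\<alpha> \<in> hom Delta m n" for \<alpha> m n using that by (simp add: hom_iff)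

  \<comment> \<open>Evaluation at \<open>k\<close> is the component of the limit at the identity of \<open>n\<close> and \<open>k\<close>.\<close>
  note lcP = prod_disc_coproduct[OF K P(1)]
  obtain ev where ev: "ev \<in> hom sE (prod_ob sE P (disc E K)) X"
    "\<And>n k. k \<in> fst K n \<Longrightarrow> cmp ev n \<bullet> at_simplex K P n k = u n (Idn Delta n, k)"
  proof (rule levelwise_coproduct_lift[OF lcP X])
    show "u n (Idn Delta n, k) \<in> hom E (fst P n) (fst X n)" if "k \<in> fst K n" for n k
      using uD(2)[OF Delta_id_hom that] P(2) by simp
    show "snd X \<alpha> \<bullet> u n (Idn Delta n, k) = u m (Idn Delta m, snd K \<alpha> k) \<bullet> snd P \<alpha>"
      if a: "\<alpha> \<in> hom Delta m n" and k: "k \<in> fst K n" for m n \<alpha> k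
      using uD(3)[OF a Delta_id_hom k] u_nat[OF a Delta_id_hom D(4)[OF a k]] id_l[OF a] id_r[OF a] by simp
  qed blast
  have "is_exponential sE (disc E K) X P ev"
    unfolding is_exponential_def
  proof (intro conjI allI impI P(1) ev(1))
    fix \<Gamma> b assume *: "\<Gamma> \<in> Ob sE \<and> b \<in> hom sE (prod_ob sE \<Gamma> (disc E K)) X"
    then have G: "\<Gamma> \<in> Ob sE" and b: "b \<in> hom sE (prod_ob sE \<Gamma> (disc E K)) X" by simp_all
    note Go = sE_ObD[OF G]
    define w where "w n k = cmp b n \<bullet> at_simplex K \<Gamma> n k" for n k
    have w: "w n k \<in> hom E (fst \<Gamma> n) (fst X n)" if "k \<in> fst K n" for n k
      unfolding w_def using sE_homD(1)[OF b] at_simplex(1)[OF K G that] by (rule E.comp_hom)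
    have w_nat: "snd X \<alpha> \<bullet> w n k = w m (snd K \<alpha> k) \<bullet> snd \<Gamma> \<alpha>" if a: "\<alpha> \<in> hom Delta m n" and k: "k \<in> fst K n" for \<alpha> m n k
      using levelwise_coproduct_natural[OF prod_disc_coproduct[OF K G] b a k]
        sE_homD(1)[OF b, of m] at_simplex(1)[OF K G D(4)[OF a k]] Go(2)[OF a] by (simp add: w_def hom_iff)
    define e where "e n = (\<lambda>a\<in>simplices_over K n. w (Dom Delta (fst a)) (snd a) \<bullet> snd \<Gamma> (fst a))" for n
    have e: "e n (\<alpha>, k) = w m k \<bullet> snd \<Gamma> \<alpha>" if "\<alpha> \<in> hom Delta m n" "k \<in> fst K m" for n \<alpha> k m
      using so[OF that] that(1) by (simp add: e_def hom_iff)
    have wG: "w m k \<bullet> snd \<Gamma> \<alpha> \<in> hom E (fst \<Gamma> n) (fst X m)" if "\<alpha> \<in> hom Delta m n" "k \<in> fst K m" for \<alpha> k m n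
      using w[OF that(2)] Go(2)[OF that(1)] by (rule E.comp_hom)
    have lift: "\<exists>!f. f \<in> hom sE \<Gamma> P \<and> (\<forall>n. ?res n (u n) (cmp f n) = e n)"
    proof (rule Plift[OF G])
      show "e n \<in> ?F n (fst \<Gamma> n)" for n
      proof (rule coneI[OF _ Go(1)])
        show "e n \<in> extensional (simplices_over K n)" by (simp add: e_def)
        show "e n (\<alpha>, k) \<in> hom E (fst \<Gamma> n) (fst X m)" if "\<alpha> \<in> hom Delta m n" "k \<in> fst K m" for m \<alpha> k
          using e[OF that] wG[OF that] by simp
        fix l m \<alpha> \<beta> k assume b: "\<beta> \<in> hom Delta l m" and a: "\<alpha> \<in> hom Delta m n" and k: "k \<in> fst K m"
        have "snd X \<beta> \<bullet> w m k \<bullet> snd \<Gamma> \<alpha> = w l (snd K \<beta> k) \<bullet> snd \<Gamma> \<beta> \<bullet> snd \<Gamma> \<alpha>"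
          by (rule E.square_reassoc[OF w_nat[OF b k]])
            (use w[OF k] w[OF D(4)[OF b k]] Xo(2)[OF b] Go(2)[OF b] Go(2)[OF a] in \<open>simp_all add: hom_iff\<close>)
        then show "snd X \<beta> \<bullet> e n (\<alpha>, k) = e n (\<alpha> \<bullet>\<^bsub>Delta\<^esub> \<beta>, snd K \<beta> k)"
          using e[OF a k] e[OF Delta.comp_hom[OF a b] D(4)[OF b k]] Go(4)[OF b a] by simp
      qed
      fix m n \<theta> assume t: "\<theta> \<in> hom Delta m n"
      have Dt: "Dom Delta \<theta> = m" using t by (simp add: hom_iff)
      show "?res m (e m) (snd \<Gamma> \<theta>) = ?tr \<theta> (e n)"
      proof (rule cone_eqI[of _ m])
        fix l \<alpha> k assume a: "\<alpha> \<in> hom Delta l m" and k: "k \<in> fst K l"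
        show "?res m (e m) (snd \<Gamma> \<theta>) (\<alpha>, k) = ?tr \<theta> (e n) (\<alpha>, k)"
          using so[OF a k] Dt e[OF a k] e[OF Delta.comp_hom[OF t a] k] Go(4)[OF a t] w[OF k] Go(2)[OF a] Go(2)[OF t]
          by (simp add: hom_iff)
      qed (simp_all add: Dt)
    qed
    have char: "reix sE (disc E K) h ev = b \<longleftrightarrow> (\<forall>n. ?res n (u n) (cmp h n) = e n)" if h: "h \<in> hom sE \<Gamma> P" for h
    proof -
      have hn: "cmp h n \<in> hom E (fst \<Gamma> n) (L n)" for n using sE_homD(1)[OF h, of n] P(2) by simp
      have r: "cmp (reix sE (disc E K) h ev) n \<bullet> at_simplex K \<Gamma> n k = u n (Idn Delta n, k) \<bullet> cmp h n" if k: "k \<in> fst K n" for n k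
      proof -
        have "cmp ev n \<bullet> at_simplex K P n k \<bullet> cmp h n = u n (Idn Delta n, k) \<bullet> cmp h n"
          by (rule E.comp_reassoc[OF ev(2)[OF k]])
            (use sE_homD(1)[OF ev(1), of n] at_simplex(1)[OF K P(1) k] hn[of n] P(2) in \<open>simp_all add: hom_iff\<close>)
        then show ?thesis using cmp_reix[OF K h ev(1) k] by simp
      qed
      have rh: "reix sE (disc E K) h ev \<in> hom sE (prod_ob sE \<Gamma> (disc E K)) X" by (rule S.reix_hom[OF h D(2) ev(1)])
      show ?thesis
      proof
        assume eq: "reix sE (disc E K) h ev = b"
        show "\<forall>n. ?res n (u n) (cmp h n) = e n"
        proof
          fix n show "?res n (u n) (cmp h n) = e n"
          proof (rule cone_eqI)
            fix m \<alpha> k assume a: "\<alpha> \<in> hom Delta m n" and k: "k \<in> fst K m"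
            have hnat: "snd P \<alpha> \<bullet> cmp h n = cmp h m \<bullet> snd \<Gamma> \<alpha>" by (rule sE_homD(2)[OF h a])
            have Pa: "snd P \<alpha> \<in> hom E (L n) (L m)" using sE_ObD(2)[OF P(1) a] P(2) by simp
            note ui = uD(2)[OF Delta_id_hom k]
            have "u n (\<alpha>, k) \<bullet> cmp h n = (u m (Idn Delta m, k) \<bullet> snd P \<alpha>) \<bullet> cmp h n"
              using u_nat[OF a Delta_id_hom k] id_r[OF a] by simp
            also have "\<dots> = u m (Idn Delta m, k) \<bullet> cmp h m \<bullet> snd \<Gamma> \<alpha>"
              using ui Pa hn[of n] hnat by (simp add: hom_iff)
            also have "\<dots> = (u m (Idn Delta m, k) \<bullet> cmp h m) \<bullet> snd \<Gamma> \<alpha>"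
              using ui hn[of m] Go(2)[OF a] by (simp add: hom_iff)
            also have "\<dots> = w m k \<bullet> snd \<Gamma> \<alpha>" using r[OF k] eq by (simp add: w_def)
            finally show "?res n (u n) (cmp h n) (\<alpha>, k) = e n (\<alpha>, k)" using e[OF a k] so[OF a k] by simp
          qed (simp_all add: e_def)
        qed
      next
        assume eq: "\<forall>n. ?res n (u n) (cmp h n) = e n"
        show "reix sE (disc E K) h ev = b"
        proof (rule levelwise_coproduct_eqI[OF prod_disc_coproduct[OF K G] rh b])
          fix n k assume k: "k \<in> fst K n"
          have "u n (Idn Delta n, k) \<bullet> cmp h n = e n (Idn Delta n, k)"
            using fun_cong[OF spec[OF eq, of n], of "(Idn Delta n, k)"] so[OF Delta_id_hom k] by simp
          also have "\<dots> = w n k" using e[OF Delta_id_hom k] Go(3) w[OF k] by (simp add: hom_iff)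
          finally show "cmp (reix sE (disc E K) h ev) n \<bullet> at_simplex K \<Gamma> n k = cmp b n \<bullet> at_simplex K \<Gamma> n k"
            using r[OF k] by (simp add: w_def)
        qed
      qed
    qed
    show "\<exists>!h. h \<in> hom sE \<Gamma> P \<and> reix sE (disc E K) h ev = b"
      using lift by (simp only: char cong: conj_cong)
  qed
  then show ?thesis by blast
qed

end

section \<open>Extending total sections along trivial cofibrations\<close>

lemma llp_coproduct:
  fixes C (structure)
  assumes C: "category C" and R: "R \<subseteq> Ar C"
    and P: "is_coproduct C I D P \<iota>" and Q: "is_coproduct C I D' Q \<iota>'"
    and t: "t \<in> hom C P Q" "\<And>k. k \<in> I \<Longrightarrow> t \<bullet> \<iota> k = \<iota>' k \<bullet> e k"
    and e: "\<And>k. k \<in> I \<Longrightarrow> e k \<in> hom C (D k) (D' k)" "\<And>k. k \<in> I \<Longrightarrow> e k \<in> llp C R"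
  shows "t \<in> llp C R"
  unfolding llp_def has_lift_def
proof (intro CollectI conjI ballI impI)
  interpret cat_ctx C by unfold_locales (rule C)
  show "t \<in> Ar C" using t by (simp add: hom_iff)
  have tD: "Dom C t = P" "Cod C t = Q" using t by (simp_all add: hom_iff)
  fix p u v assume p: "p \<in> R" and u: "u \<in> hom C (Dom C t) (Dom C p)" and v: "v \<in> hom C (Cod C t) (Cod C p)"
    and sq: "p \<bullet> u = v \<bullet> t"
  have pA: "p \<in> hom C (Dom C p) (Cod C p)" using p R by (auto intro: homI)
  have i: "\<iota> k \<in> hom C (D k) P" "\<iota>' k \<in> hom C (D' k) Q" if "k \<in> I" for k
    using P Q that by (simp_all add: is_coproduct_def)
  note u = u[unfolded tD] and v = v[unfolded tD]
  have "\<exists>d. d \<in> hom C (D' k) (Dom C p) \<and> d \<bullet> e k = u \<bullet> \<iota> k \<and> p \<bullet> d = v \<bullet> \<iota>' k" if k: "k \<in> I" for k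
  proof -
    have "p \<bullet> u \<bullet> \<iota> k = v \<bullet> t \<bullet> \<iota> k"
      by (rule square_reassoc[OF sq]) (use pA u v t i[OF k] in \<open>simp_all add: hom_iff\<close>)
    also have "\<dots> = (v \<bullet> \<iota>' k) \<bullet> e k" using t(2)[OF k] v i[OF k] e(1)[OF k] by (simp add: hom_iff)
    finally have "p \<bullet> u \<bullet> \<iota> k = (v \<bullet> \<iota>' k) \<bullet> e k" .
    moreover have "u \<bullet> \<iota> k \<in> hom C (Dom C (e k)) (Dom C p)" "v \<bullet> \<iota>' k \<in> hom C (Cod C (e k)) (Cod C p)"
      using comp_hom[OF u i(1)[OF k]] comp_hom[OF v i(2)[OF k]] e(1)[OF k] by (simp_all add: hom_iff)
    ultimately obtain d where "d \<in> hom C (Cod C (e k)) (Dom C p)" "d \<bullet> e k = u \<bullet> \<iota> k" "p \<bullet> d = v \<bullet> \<iota>' k"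
      using e(2)[OF k] p unfolding llp_def has_lift_def by blast
    then show ?thesis using e(1)[OF k] by (auto simp: hom_iff)
  qed
  then obtain d where d: "\<And>k. k \<in> I \<Longrightarrow> d k \<in> hom C (D' k) (Dom C p)"
    "\<And>k. k \<in> I \<Longrightarrow> d k \<bullet> e k = u \<bullet> \<iota> k" "\<And>k. k \<in> I \<Longrightarrow> p \<bullet> d k = v \<bullet> \<iota>' k" by metis
  obtain h where h: "h \<in> hom C Q (Dom C p)" "\<And>k. k \<in> I \<Longrightarrow> h \<bullet> \<iota>' k = d k"
    using coproduct_lift[OF Q hom_Ob(1)[OF pA] d(1)] by metis
  have "h \<bullet> t = u"
  proof (rule coproduct_eqI[OF C P comp_hom[OF h(1) t(1)] u])
    fix k assume k: "k \<in> I"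
    have "(h \<bullet> t) \<bullet> \<iota> k = h \<bullet> \<iota>' k \<bullet> e k" using h(1) t(1) i[OF k] t(2)[OF k] by (simp add: hom_iff)
    also have "\<dots> = u \<bullet> \<iota> k"
      using comp_reassoc[OF h(2)[OF k], of "e k"] h(1) i[OF k] e(1)[OF k] d(2)[OF k] by (simp add: hom_iff)
    finally show "(h \<bullet> t) \<bullet> \<iota> k = u \<bullet> \<iota> k" .
  qed
  moreover have "p \<bullet> h = v"
    by (rule coproduct_eqI[OF C Q comp_hom[OF pA h(1)] v])
      (use h pA i d(3) in \<open>simp add: hom_iff\<close>)
  ultimately show "\<exists>h\<in>hom C (Cod C t) (Dom C p). h \<bullet> t = u \<and> p \<bullet> h = v" using h(1) tD by auto
qed

lemma llp_id:
  fixes C (structure)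
  assumes C: "category C" and X: "X \<in> Ob C"
  shows "Idn C X \<in> llp C R"
proof -
  interpret cat_ctx C by unfold_locales (rule C)
  show ?thesis
    unfolding llp_def has_lift_def
  proof (intro CollectI conjI ballI impI)
    show "Idn C X \<in> Ar C" using X by simp
    fix p u v assume "u \<in> hom C (Dom C (Idn C X)) (Dom C p)" "v \<in> hom C (Cod C (Idn C X)) (Cod C p)"
      "p \<bullet> u = v \<bullet> Idn C X"
    then show "\<exists>h\<in>hom C (Cod C (Idn C X)) (Dom C p). h \<bullet> Idn C X = u \<and> p \<bullet> h = v"
      using X by (intro bexI[of _ u]) (simp_all add: hom_iff)
  qed
qed

context base_ctx
begin

text \<open>
  For \<open>i : X \<rightarrow> Y\<close>, the pushout product of \<open>i\<close> with the inclusion of \<open>disc K\<close> in \<open>disc M\<close> is, at level \<open>n\<close>, a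
  coproduct over the \<open>n\<close>-simplices \<open>k\<close> of \<open>M\<close>: of the identity of \<open>Y n\<close> if \<open>k\<close> belongs to \<open>K\<close>,
  and of \<open>i n\<close> otherwise.  So it belongs to \<open>S\<close> when \<open>i\<close> does, and \<open>\<pi>\<close> lifts against it.  The map to the domain of \<open>\<pi>\<close>
  in this lifting problem consists of \<open>a\<close> on the summands in \<open>K\<close> and of \<open>b\<close> on the others.
  If \<open>K\<close> is not contained in \<open>M\<close>, then the intersection of both takes the place of \<open>K\<close>; the lift then extends \<open>a\<close>
  because parallel arrows are equal.
\<close>

lemma extend_total_section:
  assumes K: "discrete_base K" and M: "discrete_base M" and act: "snd K = snd M"
    and j: "j \<in> hom sE (disc E K) (disc E M)"
    and jk: "\<And>n k. k \<in> fst K n \<Longrightarrow> k \<in> fst M n \<Longrightarrow>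
      cmp j n \<bullet> snd (copow E (fst K n)) k = snd (copow E (fst M n)) k"
    and incl: "(\<forall>n. fst K n \<subseteq> fst M n) \<or> (\<forall>X Y. \<forall>f\<in>hom E X Y. \<forall>g\<in>hom E X Y. f = g)"
    and R: "R \<subseteq> Ar E" and S_def: "S = {f \<in> Ar sE. \<forall>n. cmp f n \<in> llp E R}" and pi: "\<pi> \<in> rlp sE S"
    and i: "i \<in> S" and inp: "input_data sE \<pi> j (Cod sE i) A a"
    and b: "is_total_section sE \<pi> j (Dom sE i) (reix sE (Cod sE j) i A) (reix sE (Dom sE j) i a) b"
  shows "\<exists>b'. is_total_section sE \<pi> j (Cod sE i) A a b' \<and> reix sE (Cod sE j) i b' = b"
proof -
  define X where "X = Dom sE i"
  define Y where "Y = Cod sE i"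
  have i_hom: "i \<in> hom sE X Y" using i by (simp add: S_def X_def Y_def hom_iff)
  have X: "X \<in> Ob sE" and Y: "Y \<in> Ob sE" using S.hom_Ob[OF i_hom] by simp_all
  have i_llp: "cmp i n \<in> llp E R" for n using i by (simp add: S_def)
  note i_n = sE_homD(1)[OF i_hom] and i_nat = sE_homD(2)[OF i_hom]
  have jD: "Dom sE j = disc E K" "Cod sE j = disc E M" "j \<in> Ar sE" using j by (simp_all add: hom_iff)
  define Et where "Et = Dom sE \<pi>"
  define U where "U = Cod sE \<pi>"
  have pi_hom: "\<pi> \<in> hom sE Et U" using pi by (simp add: rlp_def Et_def U_def hom_iff)
  have Et: "Et \<in> Ob sE" using S.hom_Ob[OF pi_hom] by simp
  note KD = discrete_baseD[OF K] and MD = discrete_baseD[OF M]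
  let ?YK = "prod_ob sE Y (disc E K)" and ?YM = "prod_ob sE Y (disc E M)"
  let ?XK = "prod_ob sE X (disc E K)" and ?XM = "prod_ob sE X (disc E M)"
  let ?jY = "prod_ar sE (Idn sE Y) j" and ?jX = "prod_ar sE (Idn sE X) j"
  have A: "A \<in> hom sE ?YM U" and a: "a \<in> hom sE ?YK Et" and \<pi>a: "\<pi> \<bullet>\<^bsub>sE\<^esub> a = A \<bullet>\<^bsub>sE\<^esub> ?jY"
    using inp by (simp_all add: input_data_def is_family_def is_partial_section_def jD Y_def Et_def U_def)
  have b_hom: "b \<in> hom sE ?XM Et" and \<pi>b: "\<pi> \<bullet>\<^bsub>sE\<^esub> b = reix sE (disc E M) i A"
    and bj: "b \<bullet>\<^bsub>sE\<^esub> ?jX = reix sE (disc E K) i a"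
    using b by (simp_all add: is_total_section_def jD X_def Et_def)
  have jY: "?jY \<in> hom sE ?YK ?YM" and jX: "?jX \<in> hom sE ?XK ?XM"
    using X Y jD KD(2) by (simp_all add: hom_iff)
  let ?yK = "at_simplex K Y" and ?yM = "at_simplex M Y" and ?xK = "at_simplex K X" and ?xM = "at_simplex M X"
  note yK = at_simplex(1)[OF K Y] and yM = at_simplex(1)[OF M Y] and xK = at_simplex(1)[OF K X] and xM = at_simplex(1)[OF M X]
  have jY_at: "cmp ?jY n \<bullet> ?yK n k = ?yM n k" if "k \<in> fst K n" "k \<in> fst M n" for n k
    using at_simplex_shape[OF K M Y j that jk[OF that]] .
  have jX_at: "cmp ?jX n \<bullet> ?xK n k = ?xM n k" if "k \<in> fst K n" "k \<in> fst M n" for n k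
    using at_simplex_shape[OF K M X j that jk[OF that]] .

  have ab: "cmp b n \<bullet> ?xM n k = cmp a n \<bullet> ?yK n k \<bullet> cmp i n" if k: "k \<in> fst K n" "k \<in> fst M n" for n k
  proof -
    have "cmp (b \<bullet>\<^bsub>sE\<^esub> ?jX) n \<bullet> ?xK n k = cmp b n \<bullet> ?xM n k"
      using jX_at[OF k] sE_homD(1)[OF b_hom, of n] sE_homD(1)[OF jX, of n] xK[OF k(1)] by (simp add: hom_iff)
    then show ?thesis using cmp_reix[OF K i_hom a k(1)] bj by simp
  qed
  have \<pi>a_at: "cmp \<pi> n \<bullet> cmp a n \<bullet> ?yK n k = cmp A n \<bullet> ?yM n k" if k: "k \<in> fst K n" "k \<in> fst M n" for n k
  proof -
    have "cmp (\<pi> \<bullet>\<^bsub>sE\<^esub> a) n \<bullet> ?yK n k = cmp \<pi> n \<bullet> cmp a n \<bullet> ?yK n k"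
      using sE_homD(1)[OF a, of n] sE_homD(1)[OF pi_hom, of n] yK[OF k(1)] by (simp add: hom_iff)
    moreover have "cmp (A \<bullet>\<^bsub>sE\<^esub> ?jY) n \<bullet> ?yK n k = cmp A n \<bullet> ?yM n k"
      using jY_at[OF k] sE_homD(1)[OF A, of n] sE_homD(1)[OF jY, of n] yK[OF k(1)] by (simp add: hom_iff)
    ultimately show ?thesis using \<pi>a by simp
  qed
  have \<pi>b_at: "cmp \<pi> n \<bullet> cmp b n \<bullet> ?xM n k = cmp A n \<bullet> ?yM n k \<bullet> cmp i n" if k: "k \<in> fst M n" for n k
  proof -
    have "cmp (\<pi> \<bullet>\<^bsub>sE\<^esub> b) n \<bullet> ?xM n k = cmp \<pi> n \<bullet> cmp b n \<bullet> ?xM n k"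
      using sE_homD(1)[OF b_hom, of n] sE_homD(1)[OF pi_hom, of n] xM[OF k] by (simp add: hom_iff)
    then show ?thesis using cmp_reix[OF M i_hom A k] \<pi>b by simp
  qed

  \<comment> \<open>The domain \<open>P\<close> of the pushout product.\<close>
  define D where "D n k = (if k \<in> fst K n then fst Y n else fst X n)" for n k
  define e where "e n k = (if k \<in> fst K n then Idn E (fst Y n) else cmp i n)" for n k
  define DA where "DA \<alpha> k = (if k \<in> fst K (Cod Delta \<alpha>) then snd Y \<alpha>
    else if snd M \<alpha> k \<in> fst K (Dom Delta \<alpha>) then cmp i (Dom Delta \<alpha>) \<bullet> snd X \<alpha> else snd X \<alpha>)" for \<alpha> k
  have DA: "DA \<alpha> k = (if k \<in> fst K n then snd Y \<alpha> else if snd M \<alpha> k \<in> fst K m then cmp i m \<bullet> snd X \<alpha> else snd X \<alpha>)"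
    if "\<alpha> \<in> hom Delta m n" for \<alpha> m n k using that by (simp add: DA_def hom_iff)
  have Kface: "snd M \<alpha> k \<in> fst K m" if "\<alpha> \<in> hom Delta m n" "k \<in> fst K n" for \<alpha> m n k
    using KD(4)[OF that] act by simp
  note Xn = sE_ObD[OF X] and Yn = sE_ObD[OF Y]
  have e: "e n k \<in> hom E (D n k) (fst Y n)" for n k using i_n Yn(1) by (simp add: e_def D_def)
  have e_llp: "e n k \<in> llp E R" for n k using i_llp llp_id[OF E.category_C Yn(1)] by (simp add: e_def)
  have e_nat: "snd Y \<alpha> \<bullet> e n k = e m (snd M \<alpha> k) \<bullet> DA \<alpha> k" if "\<alpha> \<in> hom Delta m n" for \<alpha> m n k
  proof -
    note h = i_n[of m] i_n[of n] Xn(2)[OF that] Yn(2)[OF that] i_nat[OF that]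
    show ?thesis
      using h Kface[OF that, of k] unfolding DA[OF that] e_def by (simp add: hom_iff)
  qed
  obtain P \<iota> where P: "levelwise_coproduct E M D DA P \<iota>"
  proof (rule levelwise_coproduct_exists[OF MD(3)])
    show "\<exists>L \<iota>. is_coproduct E (fst M n) (D n) L \<iota>" for n
      by (rule coproducts_E[OF MD(1)]) (simp add: D_def Xn Yn)
    show "DA \<alpha> k \<in> hom E (D n k) (D m (snd M \<alpha> k))" if "\<alpha> \<in> hom Delta m n" "k \<in> fst M n" for m n \<alpha> k
      using Kface[OF that(1), of k] i_n[of m] Xn(2)[OF that(1)] Yn(2)[OF that(1)] E.comp_hom[OF i_n[of m] Xn(2)[OF that(1)]]
      unfolding DA[OF that(1)] D_def by simp
    show "DA (Idn Delta n) k = Idn E (D n k)" if "k \<in> fst M n" for n k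
      using MD(5)[OF that] Xn(3) Yn(3) unfolding DA[OF Delta_id_hom] D_def by simp
    fix l m n \<alpha> \<beta> k assume a: "\<alpha> \<in> hom Delta l m" and b: "\<beta> \<in> hom Delta m n" and k: "k \<in> fst M n"
    note h = i_n[of l] i_n[of m] Xn(2)[OF a] Xn(2)[OF b] Yn(2)[OF a] Yn(2)[OF b]
    have sq: "snd Y \<alpha> \<bullet> cmp i m \<bullet> snd X \<beta> = cmp i l \<bullet> snd X \<alpha> \<bullet> snd X \<beta>"
      by (rule E.square_reassoc[OF i_nat[OF a]]) (use h in \<open>simp_all add: hom_iff\<close>)
    have assoc: "(cmp i l \<bullet> snd X \<alpha>) \<bullet> snd X \<beta> = cmp i l \<bullet> snd X \<alpha> \<bullet> snd X \<beta>" using h by (simp add: hom_iff)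
    show "DA (\<beta> \<bullet>\<^bsub>Delta\<^esub> \<alpha>) k = DA \<alpha> (snd M \<beta> k) \<bullet> DA \<beta> k"
      using Kface[OF b, of k] Kface[OF a, of "snd M \<beta> k"] sq assoc
      unfolding DA[OF a] DA[OF b] DA[OF Delta_comp_hom[OF b a]] MD(6)[OF a b k] Xn(4)[OF a b] Yn(4)[OF a b] by simp
  qed
  note PD = levelwise_coproductD[OF P]
  note lcY = prod_disc_coproduct[OF M Y] and lcX = prod_disc_coproduct[OF M X] and lcK = prod_disc_coproduct[OF K Y]
  note YMD = levelwise_coproductD[OF lcY]

  \<comment> \<open>The pushout product \<open>t\<close>, and the map \<open>w\<close> on \<open>P\<close> given by \<open>a\<close> and \<open>b\<close>.\<close>
  have t_ex: "\<exists>t. t \<in> hom sE P ?YM \<and> (\<forall>n k. k \<in> fst M n \<longrightarrow> cmp t n \<bullet> \<iota> n k = ?yM n k \<bullet> e n k)"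
  proof (rule levelwise_coproduct_lift[OF P YMD(1)])
    show "?yM n k \<bullet> e n k \<in> hom E (D n k) (fst ?YM n)" if "k \<in> fst M n" for n k
      using yM[OF that] e by (rule E.comp_hom)
    fix m n \<alpha> k assume a: "\<alpha> \<in> hom Delta m n" and k: "k \<in> fst M n"
    note k' = MD(4)[OF a k]
    have "snd ?YM \<alpha> \<bullet> ?yM n k \<bullet> e n k = ?yM m (snd M \<alpha> k) \<bullet> snd Y \<alpha> \<bullet> e n k"
      by (rule E.square_reassoc[OF YMD(6)[OF a k]])
        (use yM[OF k] yM[OF k'] e[of n k] sE_ObD(2)[OF YMD(1) a] Yn(2)[OF a] in \<open>simp_all add: hom_iff\<close>)
    also have "\<dots> = (?yM m (snd M \<alpha> k) \<bullet> e m (snd M \<alpha> k)) \<bullet> DA \<alpha> k"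
      using e_nat[OF a] yM[OF k'] e[of m "snd M \<alpha> k"] PD(4)[OF a k] by (simp add: hom_iff)
    finally show "snd ?YM \<alpha> \<bullet> ?yM n k \<bullet> e n k = (?yM m (snd M \<alpha> k) \<bullet> e m (snd M \<alpha> k)) \<bullet> DA \<alpha> k" .
  qed blast
  then obtain t where t: "t \<in> hom sE P ?YM" "\<And>n k. k \<in> fst M n \<Longrightarrow> cmp t n \<bullet> \<iota> n k = ?yM n k \<bullet> e n k" by blast
  define c where "c n k = (if k \<in> fst K n then cmp a n \<bullet> ?yK n k else cmp b n \<bullet> ?xM n k)" for n k
  have a_at: "cmp a n \<bullet> ?yK n k \<in> hom E (fst Y n) (fst Et n)" if "k \<in> fst K n" for n k
    using sE_homD(1)[OF a] yK[OF that] by (rule E.comp_hom)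
  have b_at: "cmp b n \<bullet> ?xM n k \<in> hom E (fst X n) (fst Et n)" if "k \<in> fst M n" for n k
    using sE_homD(1)[OF b_hom] xM[OF that] by (rule E.comp_hom)
  have w_ex: "\<exists>w. w \<in> hom sE P Et \<and> (\<forall>n k. k \<in> fst M n \<longrightarrow> cmp w n \<bullet> \<iota> n k = c n k)"
  proof (rule levelwise_coproduct_lift[OF P Et])
    show "c n k \<in> hom E (D n k) (fst Et n)" if "k \<in> fst M n" for n k
      using a_at b_at that by (simp add: c_def D_def)
    fix m n \<alpha> k assume \<alpha>: "\<alpha> \<in> hom Delta m n" and k: "k \<in> fst M n"
    note k' = MD(4)[OF \<alpha> k]
    consider "k \<in> fst K n" | "k \<notin> fst K n" "snd M \<alpha> k \<in> fst K m" | "k \<notin> fst K n" "snd M \<alpha> k \<notin> fst K m" by blast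
    then show "snd Et \<alpha> \<bullet> c n k = c m (snd M \<alpha> k) \<bullet> DA \<alpha> k"
    proof cases
      case 1
      then have "snd Et \<alpha> \<bullet> cmp a n \<bullet> ?yK n k = cmp a m \<bullet> ?yK m (snd M \<alpha> k) \<bullet> snd Y \<alpha>"
        using levelwise_coproduct_natural[OF lcK a \<alpha>] act by simp
      then show ?thesis
        using 1 Kface[OF \<alpha> 1] yK[OF Kface[OF \<alpha> 1]] sE_homD(1)[OF a, of m] Yn(2)[OF \<alpha>] unfolding DA[OF \<alpha>] c_def
        by (simp add: hom_iff)
    next
      case 2
      have "snd Et \<alpha> \<bullet> cmp b n \<bullet> ?xM n k = (cmp b m \<bullet> ?xM m (snd M \<alpha> k)) \<bullet> snd X \<alpha>"
        using levelwise_coproduct_natural[OF lcX b_hom \<alpha> k] xM[OF k'] sE_homD(1)[OF b_hom, of m] Xn(2)[OF \<alpha>]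
        by (simp add: hom_iff)
      then show ?thesis
        using 2 ab[OF 2(2) k'] yK[OF 2(2)] sE_homD(1)[OF a, of m] Xn(2)[OF \<alpha>] i_n[of m] unfolding DA[OF \<alpha>] c_def
        by (simp add: hom_iff)
    next
      case 3
      then show ?thesis
        using levelwise_coproduct_natural[OF lcX b_hom \<alpha> k] xM[OF k'] sE_homD(1)[OF b_hom, of m] Xn(2)[OF \<alpha>]
        unfolding DA[OF \<alpha>] c_def by (simp add: hom_iff)
    qed
  qed blast
  then obtain w where w: "w \<in> hom sE P Et" "\<And>n k. k \<in> fst M n \<Longrightarrow> cmp w n \<bullet> \<iota> n k = c n k" by blast
  have "\<pi> \<bullet>\<^bsub>sE\<^esub> w = A \<bullet>\<^bsub>sE\<^esub> t"
  proof (rule levelwise_coproduct_eqI[OF P S.comp_hom[OF pi_hom w(1)] S.comp_hom[OF A t(1)]])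
    fix n k assume k: "k \<in> fst M n"
    note h = sE_homD(1)[OF pi_hom, of n] sE_homD(1)[OF w(1), of n] sE_homD(1)[OF A, of n] sE_homD(1)[OF t(1), of n]
      PD(3)[OF k] yM[OF k] e[of n k]
    have "cmp (\<pi> \<bullet>\<^bsub>sE\<^esub> w) n \<bullet> \<iota> n k = cmp \<pi> n \<bullet> c n k" using h w(2)[OF k] by (simp add: hom_iff)
    also have "\<dots> = cmp A n \<bullet> ?yM n k \<bullet> e n k"
      using \<pi>a_at[OF _ k] \<pi>b_at[OF k] yM[OF k] by (simp add: c_def e_def hom_iff)
    also have "\<dots> = cmp (A \<bullet>\<^bsub>sE\<^esub> t) n \<bullet> \<iota> n k" using h t(2)[OF k] by (simp add: hom_iff)
    finally show "cmp (\<pi> \<bullet>\<^bsub>sE\<^esub> w) n \<bullet> \<iota> n k = cmp (A \<bullet>\<^bsub>sE\<^esub> t) n \<bullet> \<iota> n k" .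
  qed
  moreover have "t \<in> S"
    unfolding S_def
  proof (intro CollectI conjI allI)
    show "t \<in> Ar sE" using t(1) by (simp add: hom_iff)
    show "cmp t n \<in> llp E R" for n
      by (rule llp_coproduct[OF E.category_C R PD(2)[of n] YMD(2)[of n] sE_homD(1)[OF t(1)] t(2) e e_llp])
  qed
  moreover have "Dom sE t = P" "Cod sE t = ?YM" using t(1) by (simp_all add: hom_iff)
  moreover have "has_lift sE t \<pi>" using pi \<open>t \<in> S\<close> by (simp add: rlp_def)
  ultimately obtain h where h: "h \<in> hom sE ?YM Et" "h \<bullet>\<^bsub>sE\<^esub> t = w" "\<pi> \<bullet>\<^bsub>sE\<^esub> h = A"
    using w(1) A unfolding has_lift_def Et_def U_def by metis
  have h_at: "cmp h n \<bullet> ?yM n k \<bullet> e n k = c n k" if k: "k \<in> fst M n" for n k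
  proof -
    have "cmp (h \<bullet>\<^bsub>sE\<^esub> t) n \<bullet> \<iota> n k = cmp h n \<bullet> ?yM n k \<bullet> e n k"
      using t(2)[OF k] sE_homD(1)[OF h(1), of n] sE_homD(1)[OF t(1), of n] PD(3)[OF k] by (simp add: hom_iff)
    then show ?thesis using h(2) w(2)[OF k] by simp
  qed
  have h_K: "cmp h n \<bullet> ?yM n k = cmp a n \<bullet> ?yK n k" if "k \<in> fst K n" "k \<in> fst M n" for n k
    using h_at[OF that(2)] that yM[OF that(2)] by (simp add: e_def c_def hom_iff)
  have "h \<bullet>\<^bsub>sE\<^esub> ?jY = a"
    using incl
  proof
    assume sub: "\<forall>n. fst K n \<subseteq> fst M n"
    show ?thesis
    proof (rule levelwise_coproduct_eqI[OF lcK S.comp_hom[OF h(1) jY] a])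
      fix n k assume k: "k \<in> fst K n"
      then have kM: "k \<in> fst M n" using sub by blast
      show "cmp (h \<bullet>\<^bsub>sE\<^esub> ?jY) n \<bullet> ?yK n k = cmp a n \<bullet> ?yK n k"
        using jY_at[OF k kM] h_K[OF k kM] sE_homD(1)[OF h(1), of n] sE_homD(1)[OF jY, of n] yK[OF k]
        by (simp add: hom_iff)
    qed
  next
    assume thin: "\<forall>X Y. \<forall>f\<in>hom E X Y. \<forall>g\<in>hom E X Y. f = g"
    note hj = S.comp_hom[OF h(1) jY]
    show ?thesis by (rule sE_eqI[OF hj a]) (use thin sE_homD(1)[OF hj] sE_homD(1)[OF a] in blast)+
  qed
  then have tot: "is_total_section sE \<pi> j Y A a h" using h by (simp add: is_total_section_def jD Et_def)
  have "reix sE (disc E M) i h = b"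
  proof (rule levelwise_coproduct_eqI[OF lcX S.reix_hom[OF i_hom MD(2) h(1)] b_hom])
    fix n k assume k: "k \<in> fst M n"
    have r: "cmp (reix sE (disc E M) i h) n \<bullet> ?xM n k = cmp h n \<bullet> ?yM n k \<bullet> cmp i n" by (rule cmp_reix[OF M i_hom h(1) k])
    show "cmp (reix sE (disc E M) i h) n \<bullet> ?xM n k = cmp b n \<bullet> ?xM n k"
    proof (cases "k \<in> fst K n")
      case True
      have "cmp h n \<bullet> ?yM n k \<bullet> cmp i n = cmp a n \<bullet> ?yK n k \<bullet> cmp i n"
        by (rule E.square_reassoc[OF h_K[OF True k]])
          (use sE_homD(1)[OF h(1), of n] sE_homD(1)[OF a, of n] yM[OF k] yK[OF True] i_n[of n] in \<open>simp_all add: hom_iff\<close>)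
      then show ?thesis using r ab[OF True k] by simp
    next
      case False
      then show ?thesis using r h_at[OF k] by (simp add: e_def c_def)
    qed
  qed
  then show ?thesis using tot unfolding jD(2) Y_def[symmetric] by blast
qed

end


section \<open>Shapes\<close>

lemma cube_term_val_restrict:
  assumes "cube_term_over n t" and a: "\<alpha> \<in> hom Delta l m" and k: "k \<le> l"
  shows "cube_term_val l (snd (cube n) \<alpha> x) t k = cube_term_val m x t (snd (snd \<alpha>) k)"
    and "snd (snd \<alpha>) k \<le> m"
proof -
  obtain f where f: "\<alpha> = (l, m, f)" "f \<in> {..l} \<rightarrow>\<^sub>E {..m}" using a unfolding Delta_hom by blast
  then show m: "snd (snd \<alpha>) k \<le> m" using k by auto
  have "Dom Delta \<alpha> = l" using a by (simp add: hom_iff)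
  then show "cube_term_val l (snd (cube n) \<alpha> x) t k = cube_term_val m x t (snd (snd \<alpha>) k)"
    using assms m by (cases t) (auto simp: cube_term_over_def cube_def compose_def)
qed

lemma cube_term_val_extensional:
  assumes "cube_term_over n t" "x \<in> fst (cube n) m" "\<not> k \<le> m"
  shows "cube_term_val m x t k = undefined"
  using assms by (cases t) (auto simp: cube_term_over_def cube_def PiE_def extensional_def Pi_def)

lemma is_sset_cube: "is_sset (cube n)"
  unfolding is_sset_def
proof (intro conjI allI ballI)
  fix m l \<alpha> assume a: "\<alpha> \<in> hom Delta l m"
  then obtain f where f: "\<alpha> = (l, m, f)" "f \<in> {..l} \<rightarrow>\<^sub>E {..m}" "mono_on {..l} f" unfolding Delta_hom by blast
  have D: "Dom Delta \<alpha> = l" using a by (simp add: hom_iff)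
  show "snd (cube n) \<alpha> \<in> fst (cube n) m \<rightarrow> fst (cube n) l"
  proof
    fix x assume x: "x \<in> fst (cube n) m"
    have "compose {..l} (x i) f \<in> {..l} \<rightarrow>\<^sub>E {..1} \<and> mono_on {..l} (compose {..l} (x i) f)" if "i < n" for i
    proof -
      have xi: "x i \<in> {..m} \<rightarrow>\<^sub>E {..1}" "mono_on {..m} (x i)" using x that by (auto simp: cube_def)
      have fm: "f r \<in> {..m}" if "r \<in> {..l}" for r using f(2) that by blast
      have "mono_on {..l} (compose {..l} (x i) f)"
      proof (rule mono_onI)
        fix r s assume rs: "r \<in> {..l}" "s \<in> {..l}" "r \<le> s"
        then have "f r \<le> f s" using f(3) by (simp add: mono_on_def)
        then have "x i (f r) \<le> x i (f s)" using xi(2) fm[OF rs(1)] fm[OF rs(2)] by (simp add: mono_on_def)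
        then show "compose {..l} (x i) f r \<le> compose {..l} (x i) f s" using rs by (simp add: compose_def)
      qed
      moreover have "compose {..l} (x i) f \<in> {..l} \<rightarrow>\<^sub>E {..1}"       proof -
        have "x i (f r) \<in> {..1}" if "r \<in> {..l}" for r using xi(1) fm[OF that] by blast
        then show ?thesis by (auto simp: compose_def)
      qed
      ultimately show ?thesis by simp
    qed
    moreover have "snd (cube n) \<alpha> x = (\<lambda>i\<in>{..<n}. compose {..l} (x i) f)" by (simp add: cube_def D, simp add: f(1))
    ultimately show "snd (cube n) \<alpha> x \<in> fst (cube n) l" by (simp add: cube_def)
  qed
next
  fix m x assume x: "x \<in> fst (cube n) m"
  have "snd (cube n) (Idn Delta m) x i = x i" for i
  proof (cases "i < n")
    case True
    then have "x i \<in> {..m} \<rightarrow>\<^sub>E {..1}" using x by (auto simp: cube_def)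
    then have "compose {..m} (x i) (\<lambda>k\<in>{..m}. k) = x i" by (auto simp: compose_def fun_eq_iff PiE_def extensional_def)
    then show ?thesis using True by (simp add: cube_def Delta_def)
  next
    case False
    then show ?thesis using x by (auto simp: cube_def PiE_def extensional_def)
  qed
  then show "snd (cube n) (Idn Delta m) x = x" by blast
next
  fix l m k \<alpha> \<beta> and x :: csimp assume a: "\<alpha> \<in> hom Delta l m" and b: "\<beta> \<in> hom Delta m k"
  then obtain f g where f: "\<alpha> = (l, m, f)" "f \<in> {..l} \<rightarrow>\<^sub>E {..m}" and g: "\<beta> = (m, k, g)" unfolding Delta_hom by blast
  have fm: "f r \<le> m" if "r \<le> l" for r using f(2) that by blast
  have "compose {..l} (x i) (compose {..l} g f) = compose {..l} (compose {..m} (x i) g) f" for i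
    using fm by (auto simp: compose_def fun_eq_iff)
  then show "snd (cube n) (\<beta> \<bullet>\<^bsub>Delta\<^esub> \<alpha>) x = snd (cube n) \<alpha> (snd (cube n) \<beta> x)"
    by (auto simp: f(1) g cube_def Delta_def fun_eq_iff)
qed

lemma tope_holds_restrict:
  assumes a: "\<alpha> \<in> hom Delta l m" and x: "x \<in> fst (cube n) m"
  shows "tope_over n P \<Longrightarrow> tope_holds m x P \<Longrightarrow> tope_holds l (snd (cube n) \<alpha> x) P"
proof (induction P)
  case (TLe s t)
  have "cube_term_val l (snd (cube n) \<alpha> x) s k \<le> cube_term_val l (snd (cube n) \<alpha> x) t k" if "k \<le> l" for k
  proof -
    have over: "cube_term_over n s" "cube_term_over n t" using TLe by simp_all
    have "cube_term_val m x s (snd (snd \<alpha>) k) \<le> cube_term_val m x t (snd (snd \<alpha>) k)"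
      using TLe(2) cube_term_val_restrict(2)[OF over(1) a that] by simp
    then show ?thesis using cube_term_val_restrict(1)[OF over(1) a that] cube_term_val_restrict(1)[OF over(2) a that] by simp
  qed
  then show ?case by simp
next
  case (TEq s t)
  have x': "snd (cube n) \<alpha> x \<in> fst (cube n) l" using is_sset_cube[of n] a x unfolding is_sset_def by blast
  \<comment> \<open>Beyond \<open>l\<close> both values are \<open>undefined\<close>.\<close>
  have "cube_term_val l (snd (cube n) \<alpha> x) s k = cube_term_val l (snd (cube n) \<alpha> x) t k" for k
  proof (cases "k \<le> l")
    case True
    then show ?thesis using TEq cube_term_val_restrict(1)[OF _ a True] by simp
  next
    case False
    then show ?thesis using TEq cube_term_val_extensional[OF _ x' False] by simp
  qed
  then show ?case by auto
qed auto

lemma is_sset_shape: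
  assumes "tope_over n P"
  shows "is_sset (shape_sset n P)"
  using is_sset_cube[of n] tope_holds_restrict[OF _ _ assms]
  unfolding is_sset_def shape_sset_def by fastforce

lemma countable_cube: "countable (fst (cube n) m)"
proof -
  have "finite {f \<in> {..m} \<rightarrow>\<^sub>E {..1 :: nat}. mono_on {..m} f}"
    by (rule finite_subset[of _ "{..m} \<rightarrow>\<^sub>E {..1}"]) (auto intro: finite_PiE)
  then have "finite (fst (cube n) m)" unfolding cube_def fst_conv by (intro finite_PiE) auto
  then show ?thesis by (rule countable_finite)
qed

lemma shape_subset: "fst (shape_sset n P) m \<subseteq> fst (cube n) m"
  by (auto simp: shape_sset_def)

lemma countable_shape: "countable (fst (shape_sset n P) m)"
  using countable_cube shape_subset by (rule countable_subset[rotated])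

context base_ctx
begin

lemma shape_discrete_base:
  assumes "tope_over n P" "shape E n P \<in> Ob sE"
  shows "discrete_base (shape_sset n P)"
  using assms is_sset_shape countable_shape unfolding discrete_base_def shape_def by blast

text \<open>A point \<open>k\<close> of \<open>M\<close> makes the map from \<open>copow M\<close> to \<open>copow Q\<close> a split monomorphism: the retraction sends the points outside
  \<open>M\<close> to \<open>k\<close>.  Thus \<open>j\<close> is determined by its composite with this map.\<close>

lemma shape_inclusion_at:
  fixes K M Q :: "csimp set"
  assumes K: "K \<subseteq> Q" and M: "M \<subseteq> Q" and Q: "countable Q" and k: "k \<in> K" "k \<in> M"
    and j: "j \<in> hom E (fst (copow E K)) (fst (copow E M))"
    and over: "copow_map E M Q (\<lambda>x. x) \<bullet> j = copow_map E K Q (\<lambda>x. x)"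
  shows "j \<bullet> snd (copow E K) k = snd (copow E M) k"
proof -
  have cK: "countable K" and cM: "countable M" using K M Q countable_subset by blast+
  define r where "r l = (if l \<in> M then l else k)" for l
  have rM: "r \<in> Q \<rightarrow> M" using k by (auto simp: r_def)
  have M': "(\<lambda>x. x) \<in> M \<rightarrow> Q" and K': "(\<lambda>x. x) \<in> K \<rightarrow> Q" using K M by auto
  note rm = copow_map[OF Q cM rM] and im = copow_map[OF cM Q M'] and ik = copow_map[OF cK Q K']
  have "copow_map E Q M r \<bullet> copow_map E M Q (\<lambda>x. x) = Idn E (fst (copow E M))"
  proof (rule coproduct_eqI[OF E.category_C copow_coproduct[OF cM]])
    show "copow_map E Q M r \<bullet> copow_map E M Q (\<lambda>x. x) \<in> hom E (fst (copow E M)) (fst (copow E M))"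
      using rm(1) im(1) by (rule E.comp_hom)
    show "Idn E (fst (copow E M)) \<in> hom E (fst (copow E M)) (fst (copow E M))"
      using copow_coproduct[OF cM] by (simp add: is_coproduct_def)
    fix l assume l: "l \<in> M"
    then have "l \<in> Q" using M by blast
    then show "(copow_map E Q M r \<bullet> copow_map E M Q (\<lambda>x. x)) \<bullet> snd (copow E M) l = Idn E (fst (copow E M)) \<bullet> snd (copow E M) l"
      using rm(1) rm(2)[of l] im(1) im(2)[OF l] copow_inj[OF cM l] l by (simp add: r_def hom_iff)
  qed
  then have "j = copow_map E Q M r \<bullet> copow_map E K Q (\<lambda>x. x)"
    using E.comp_reassoc[of "copow_map E Q M r" "copow_map E M Q (\<lambda>x. x)" _ j] rm(1) im(1) j over by (simp add: hom_iff)
  moreover have "k \<in> Q" using k K by blast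
  ultimately show ?thesis
    using rm(1) rm(2)[of k] ik(1) ik(2)[OF k(1)] copow_inj[OF cK k(1)] k by (simp add: r_def hom_iff)
qed

text \<open>
  If \<open>copow K \<rightarrow> copow M\<close> exists over \<open>copow Q\<close> although some \<open>k\<close> in \<open>K\<close> is not in \<open>M\<close>, then the point \<open>k\<close> of
  \<open>copow Q\<close> factors through \<open>copow M\<close>.  A map on \<open>Y \<times> copow Q\<close> that is \<open>f\<close> on the summand \<open>k\<close> and \<open>g\<close> on all others then
  shows \<open>f = g\<close>.
\<close>

lemma shape_inclusion_degenerate:
  fixes K M Q :: "csimp set"
  assumes K: "K \<subseteq> Q" and M: "M \<subseteq> Q" and Q: "countable Q" and k: "k \<in> K" "k \<notin> M"
    and j: "j \<in> hom E (fst (copow E K)) (fst (copow E M))"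
    and over: "copow_map E M Q (\<lambda>x. x) \<bullet> j = copow_map E K Q (\<lambda>x. x)"
    and f: "f \<in> hom E Y Z" and g: "g \<in> hom E Y Z"
  shows "f = g"
proof -
  interpret Ep: prod_ctx E
  proof unfold_locales
    fix X Y assume X: "X \<in> Ob E" and Y: "Y \<in> Ob E"
    then have b: "bang X \<in> hom E X (one_ob E)" "bang Y \<in> hom E Y (one_ob E)" using bang by blast+
    then obtain p q where "is_pullback E p q (bang X) (bang Y)" using pullbacks_E[of "bang X" "bang Y"] by (auto simp: hom_iff)
    from pullback_terminal_product[OF E.category_C one_terminal this b] show "\<exists>p q. is_product E X Y p q" by blast
  qed
  have Y: "Y \<in> Ob E" and Z: "Z \<in> Ob E" using E.hom_Ob[OF f] by simp_all
  note bY = bang[OF Y]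
  have cK: "countable K" and cM: "countable M" using K M Q countable_subset by blast+
  let ?C = "fst (copow E Q)" and ?D = "fst (copow E M)"
  let ?J = "copow_map E M Q (\<lambda>x. x)"
  have M': "(\<lambda>x. x) \<in> M \<rightarrow> Q" and K': "(\<lambda>x. x) \<in> K \<rightarrow> Q" using K M by auto
  note J = copow_map[OF cM Q M'] and JK = copow_map[OF cK Q K']
  have C: "?C \<in> Ob E" and D: "?D \<in> Ob E" using E.hom_Ob[OF J(1)] by simp_all
  have kQ: "k \<in> Q" using k K by blast
  define at where "at A l = pairing E (Idn E Y) (snd (copow E A) l \<bullet> bang Y)" for A :: "csimp set" and l
  have at: "at A l \<in> hom E Y (prod_ob E Y (fst (copow E A)))"
    "pr1 E Y (fst (copow E A)) \<bullet> at A l = Idn E Y" "pr2 E Y (fst (copow E A)) \<bullet> at A l = snd (copow E A) l \<bullet> bang Y"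
    if "countable A" "l \<in> A" for A l
    using copow_inj[OF that] bY Y by (simp_all add: at_def hom_iff)
  have cop: "is_coproduct E A (\<lambda>_. Y) (prod_ob E Y (fst (copow E A))) (at A)" if A: "countable A" for A
  proof -
    have Ao: "fst (copow E A) \<in> Ob E" using copow_coproduct[OF A] by (simp add: is_coproduct_def)
    have "is_coproduct E A (\<lambda>_. Y) (Dom E (pr1 E Y (fst (copow E A)))) (at A)"
      by (rule product_copower[OF E.category_C exponentials_E[OF Y] one_terminal copow_coproduct[OF A] Ep.prod_is_product[OF Y Ao] bY])
        (use at[OF A] Y Ao in simp_all)
    then show ?thesis using Y Ao by simp
  qed
  obtain h where h: "h \<in> hom E (prod_ob E Y ?C) Z" "\<And>l. l \<in> Q \<Longrightarrow> h \<bullet> at Q l = (if l = k then f else g)"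
    by (rule coproduct_lift[OF cop[OF Q] Z, of "\<lambda>l. if l = k then f else g"]) (use f g in auto)
  let ?\<gamma> = "prod_ar E (Idn E Y) ?J"
  have JA: "?J \<in> Ar E" "Dom E ?J = ?D" "Cod E ?J = ?C" using J(1) by (simp_all add: hom_iff)
  have \<gamma>: "?\<gamma> \<in> hom E (prod_ob E Y ?D) (prod_ob E Y ?C)" using JA Y by (simp add: hom_iff)
  \<comment> \<open>Restricted to \<open>Y \<times> copow M\<close> the map \<open>h\<close> is \<open>g\<close> on every summand.\<close>
  have hg: "h \<bullet> ?\<gamma> = g \<bullet> pr1 E Y ?D"
  proof (rule coproduct_eqI[OF E.category_C cop[OF cM] E.comp_hom[OF h(1) \<gamma>] E.comp_hom[OF g Ep.pr_hom(1)[OF Y D]]])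
    fix l assume l: "l \<in> M"
    then have lQ: "l \<in> Q" and lk: "l \<noteq> k" using M k by auto
    have "?J \<bullet> snd (copow E M) l \<bullet> bang Y = snd (copow E Q) l \<bullet> bang Y"
      by (rule E.comp_reassoc[OF J(2)[OF l]]) (use JA copow_inj[OF cM l] bY in \<open>simp_all add: hom_iff\<close>)
    then have "?\<gamma> \<bullet> at M l = at Q l"
      unfolding at_def using Ep.prod_ar_pairing[of "Idn E Y" ?J "Idn E Y" "snd (copow E M) l \<bullet> bang Y"] JA Y copow_inj[OF cM l] bY
      by (simp add: hom_iff)
    then have "(h \<bullet> ?\<gamma>) \<bullet> at M l = g" using h(2)[OF lQ] lk h(1) \<gamma> at(1)[OF cM l] by (simp add: hom_iff)
    moreover have "(g \<bullet> pr1 E Y ?D) \<bullet> at M l = g"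
      using at[OF cM l] g Ep.pr_hom(1)[OF Y D] by (simp add: hom_iff)
    ultimately show "(h \<bullet> ?\<gamma>) \<bullet> at M l = (g \<bullet> pr1 E Y ?D) \<bullet> at M l" by simp
  qed
  let ?x = "j \<bullet> snd (copow E K) k"
  let ?s = "pairing E (Idn E Y) (?x \<bullet> bang Y)"
  have x: "?x \<in> hom E (one_ob E) ?D" using j copow_inj[OF cK k(1)] by (rule E.comp_hom)
  have s: "?s \<in> hom E Y (prod_ob E Y ?D)" "pr1 E Y ?D \<bullet> ?s = Idn E Y" using x bY Y by (simp_all add: hom_iff)
  have "?J \<bullet> ?x = snd (copow E Q) k"
    using E.comp_reassoc[OF over, of "snd (copow E K) k"] JA j copow_inj[OF cK k(1)] JK(2)[OF k(1)] by (simp add: hom_iff)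
  then have "?J \<bullet> ?x \<bullet> bang Y = snd (copow E Q) k \<bullet> bang Y"
    by (rule E.comp_reassoc) (use JA x bY in \<open>simp_all add: hom_iff\<close>)
  then have "?\<gamma> \<bullet> ?s = at Q k"
    unfolding at_def using Ep.prod_ar_pairing[of "Idn E Y" ?J "Idn E Y" "?x \<bullet> bang Y"] JA Y x bY
    by (simp add: hom_iff)
  then have "f = h \<bullet> ?\<gamma> \<bullet> ?s" using h(2)[OF kQ] by simp
  also have "\<dots> = g \<bullet> pr1 E Y ?D \<bullet> ?s"
    by (rule E.square_reassoc[OF hg]) (use h(1) \<gamma> s(1) g Ep.pr_hom(1)[OF Y D] in \<open>simp_all add: hom_iff\<close>)
  also have "\<dots> = g" using s(2) g by (simp add: hom_iff)
  finally show ?thesis .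
qed

end

section \<open>Strictly stable extension types\<close>

theorem theorem3p8:
  fixes E :: "('o, 'm, 's) smcat"
    and \<kappa> :: "'u rel"
    and \<pi> j :: "('o, 'm) sar"
    and p q :: "('o, 'm) sar \<Rightarrow> ('o, 'm) sar"
    and n :: nat
    and \<phi> \<psi> :: tope
  assumes "inaccessible |UNIV :: 'u set|"
    and "type_theoretic_model_topos TYPE('u) E"
    and "inaccessible \<kappa>" and "\<kappa> <o |UNIV :: 'u set|" and "sufficiently_large \<kappa> E"
    and "universal_fibration \<kappa> E \<pi>"
    and "is_splitting (simp_cat E) \<pi> p q"
    and "tope_over n \<phi>" and "tope_over n \<psi>"
    and "small_object \<kappa> E (shape E n \<phi>)" and "fibrant E (shape E n \<phi>)"
    and "small_object \<kappa> E (shape E n \<psi>)" and "fibrant E (shape E n \<psi>)"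
    and "is_shape_inclusion E n \<phi> \<psi> j"
  shows "\<exists>Ext \<theta>.
    is_interpretation (simp_cat E) \<pi> p j Ext \<theta> \<and>
    (\<forall>\<Gamma> A a \<Delta> \<sigma>. input_data (simp_cat E) \<pi> j \<Gamma> A a \<and> \<sigma> \<in> hom (simp_cat E) \<Delta> \<Gamma> \<longrightarrow>
      (let A' = reix (simp_cat E) (Cod (simp_cat E) j) \<sigma> A;
           a' = reix (simp_cat E) (Dom (simp_cat E) j) \<sigma> a
       in
        Ext \<Gamma> A a \<bullet>\<^bsub>simp_cat E\<^esub> \<sigma> = Ext \<Delta> A' a' \<and>
        (\<forall>b. is_total_section (simp_cat E) \<pi> j \<Gamma> A a b \<longrightarrow>
          ext_lam (simp_cat E) \<pi> p q j Ext \<theta> \<Gamma> A a b \<bullet>\<^bsub>simp_cat E\<^esub> \<sigma> =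
          ext_lam (simp_cat E) \<pi> p q j Ext \<theta> \<Delta> A' a' (reix (simp_cat E) (Cod (simp_cat E) j) \<sigma> b)) \<and>
        (\<forall>f s. is_term (simp_cat E) \<pi> (Ext \<Gamma> A a) f \<and>
               s \<in> hom (simp_cat E) \<Gamma> (Cod (simp_cat E) j) \<longrightarrow>
          ext_app (simp_cat E) \<pi> p q j Ext \<theta> \<Gamma> A a f s \<bullet>\<^bsub>simp_cat E\<^esub> \<sigma> =
          ext_app (simp_cat E) \<pi> p q j Ext \<theta> \<Delta> A' a' (f \<bullet>\<^bsub>simp_cat E\<^esub> \<sigma>) (s \<bullet>\<^bsub>simp_cat E\<^esub> \<sigma>))))"
proof -
  note inacc = assms(1)
  have mc: "model_category TYPE('u) E" and enr: "simplicially_enriched E" and lccc: "simplicially_lccc E"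
    using assms(2) by (simp_all add: type_theoretic_model_topos_def simplicial_model_category_def)
  have C: "category E" and comp: "complete_cat TYPE('u) E" and cocomp: "cocomplete_cat TYPE('u) E"
    and wfs: "weak_factorization_system E (cof E \<inter> weq E) (fib E)"
    using mc by (simp_all add: model_category_def)
  have llp: "cof E \<inter> weq E = llp E (fib E)" and "fib E = rlp E (cof E \<inter> weq E)"
    using wfs unfolding weak_factorization_system_def by blast+
  moreover have "rlp E (cof E \<inter> weq E) \<subseteq> Ar E" unfolding rlp_def by blast
  ultimately have fibA: "fib E \<subseteq> Ar E" by metis
  interpret base_ctx E
  proof (unfold_locales, rule C)
    show "\<exists>p q. is_pullback E p q f g" if "f \<in> Ar E" "g \<in> Ar E" "Cod E f = Cod E g" for f g
      using complete_pullback[OF inacc comp C that] .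
    show T: "\<exists>T. is_terminal E T" using complete_terminal[OF inacc comp] .
    show "\<exists>L \<iota>. is_coproduct E I D L \<iota>" if "countable I" "\<And>i. i \<in> I \<Longrightarrow> D i \<in> Ob E" for I :: "csimp set" and D
      using cocomplete_coproduct[OF cocomp C usmall_countable[OF inacc that(1)] that(2)] .
    show "\<exists>L c. is_limit A E D L c"
      if "category A" "countable (Ob A)" "countable (Ar A)" "is_functor A E D"
      for A :: "(dmap \<times> csimp, dmap \<times> dmap \<times> csimp) cat" and D
      using complete_limit[OF comp that(1) usmall_countable[OF inacc that(2)] usmall_countable[OF inacc that(3)] that(4)] .
    show "has_exponentials_by E Y" if "Y \<in> Ob E" for Y
      using T lccc_exponentials[OF lccc enr _ complete_product[OF inacc comp C] that] by blast
  qed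
  let ?K = "shape_sset n \<phi>" and ?M = "shape_sset n \<psi>"
  have j: "j \<in> hom sE (disc E ?K) (disc E ?M)" and jI: "shape_incl E n \<psi> \<bullet>\<^bsub>sE\<^esub> j = shape_incl E n \<phi>"
    using assms(14) by (simp_all add: is_shape_inclusion_def shape_def)
  have K: "discrete_base ?K" and M: "discrete_base ?M"
    using shape_discrete_base[OF assms(8)] shape_discrete_base[OF assms(9)] S.hom_Ob[OF j] by (simp_all add: shape_def)
  have over: "copow_map E (fst ?M m) (fst (cube n) m) (\<lambda>x. x) \<bullet>\<^bsub>E\<^esub> cmp j m = copow_map E (fst ?K m) (fst (cube n) m) (\<lambda>x. x)" for m
    using arg_cong[OF jI, of "\<lambda>x. cmp x m"] by (simp add: shape_incl_def disc_map_def)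
  have jm: "cmp j m \<in> hom E (fst (copow E (fst ?K m))) (fst (copow E (fst ?M m)))" for m
    using sE_homD(1)[OF j, of m] by (simp add: disc_def)
  \<comment> \<open>In the trivial topos there are maps between shapes that are not contained in each other.\<close>
  have incl: "(\<forall>m. fst ?K m \<subseteq> fst ?M m) \<or> (\<forall>X Y. \<forall>f\<in>hom E X Y. \<forall>g\<in>hom E X Y. f = g)"
  proof (rule disjCI)
    assume "\<not> (\<forall>X Y. \<forall>f\<in>hom E X Y. \<forall>g\<in>hom E X Y. f = g)"
    then obtain X Y f g where "f \<in> hom E X Y" "g \<in> hom E X Y" "f \<noteq> g" by blast
    then show "\<forall>m. fst ?K m \<subseteq> fst ?M m"
      using shape_inclusion_degenerate[OF shape_subset shape_subset countable_cube _ _ jm over] by blast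
  qed
  have S_def: "inj_cof E \<inter> inj_weq E = {f \<in> Ar sE. \<forall>n. cmp f n \<in> llp E (fib E)}"
    unfolding inj_cof_def inj_weq_def llp[symmetric] by blast
  have pi: "\<pi> \<in> small_fib \<kappa> E" and univ: "\<And>f. f \<in> small_fib \<kappa> E \<Longrightarrow> \<exists>A q. is_pullback sE f q A \<pi>"
    using assms(6) by (simp_all add: universal_fibration_def)
  have pi': "\<pi> \<in> rlp sE (inj_cof E \<inter> inj_weq E)" using pi by (simp add: small_fib_def inj_fib_def)
  have piA: "\<pi> \<in> Ar sE" using pi' by (simp add: rlp_def)
  have jA: "j \<in> Ar sE" "Dom sE j = shape E n \<phi>" "Cod sE j = shape E n \<psi>" using j by (simp_all add: hom_iff shape_def)
  interpret X: ext_ctx sE \<pi> j by unfold_locales (use piA jA in simp_all)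
  obtain One where One: "is_terminal sE One" using sE_terminal[OF one_terminal] by blast
  obtain W A0 a0 r e where gen: "is_generic_data sE \<pi> j W A0 a0" and se: "is_sem_ext sE \<pi> j W A0 a0 r e"
    and r: "r \<in> small_fib \<kappa> E"
  proof (rule X.generic_small_fibration[where S = "inj_cof E \<inter> inj_weq E" and Sm = "small_fib \<kappa> E" and u = "TYPE('u)" and \<kappa> = \<kappa> and One = One])
    show "\<exists>p q. is_pullback sE p q f g" if "f \<in> Ar sE" "g \<in> Ar sE" "Cod sE f = Cod sE g" for f g
    proof -
      have "f \<in> hom sE (Dom sE f) (Cod sE f)" "g \<in> hom sE (Dom sE g) (Cod sE f)" using that by (simp_all add: hom_iff)
      from sE_pullback[OF pullbacks_E this] show ?thesis by blast
    qed
    show "\<exists>P ev. is_exponential sE X Z P ev" if "X \<in> {Dom sE j, Cod sE j}" "Z \<in> Ob sE" for X Z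
    proof -
      have "X = disc E ?K \<or> X = disc E ?M" using that(1) jA(2,3) by (auto simp: shape_def)
      then show ?thesis using disc_exponential[OF K that(2)] disc_exponential[OF M that(2)] by blast
    qed
    show "inj_cof E \<inter> inj_weq E \<subseteq> Ar sE" unfolding S_def by blast
    show "small_fib \<kappa> E = {f \<in> rlp sE (inj_cof E \<inter> inj_weq E). relatively_presentable TYPE('u) \<kappa> sE f}"
      by (simp add: small_fib_def inj_fib_def)
    show "presentable TYPE('u) \<kappa> sE (Dom sE p)"
      if "is_pullback sE p q f g" "presentable TYPE('u) \<kappa> sE (Dom sE f)" "presentable TYPE('u) \<kappa> sE (Dom sE g)"
        "presentable TYPE('u) \<kappa> sE (Cod sE f)" for p q f g
      using assms(5) that unfolding sufficiently_large_def by blast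
    show "p \<in> small_fib \<kappa> E" if "f \<in> small_fib \<kappa> E" "g \<in> small_fib \<kappa> E" "is_dep_prod sE f g p q1 q2 \<epsilon>" for f g p q1 q2 \<epsilon>
      using assms(5) that unfolding sufficiently_large_def by blast
    show "\<pi> \<in> small_fib \<kappa> E" by (rule pi)
    show "is_terminal sE One" by (rule One)
    show "f \<in> small_fib \<kappa> E" if "X \<in> {Dom sE j, Cod sE j}" "f \<in> hom sE X One" for X f
    proof -
      have "X = shape E n \<phi> \<or> X = shape E n \<psi>" using that(1) jA(2,3) by auto
      then have "fibrant E X" "small_object \<kappa> E X" using assms(10-13) by blast+
      then show ?thesis using that(2) One unfolding small_fib_def small_object_def fibrant_def by blast
    qed
    show "\<exists>b'. is_total_section sE \<pi> j (Cod sE i) A a b' \<and> reix sE (Cod sE j) i b' = b"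
      if "i \<in> inj_cof E \<inter> inj_weq E" "input_data sE \<pi> j (Cod sE i) A a"
        "is_total_section sE \<pi> j (Dom sE i) (reix sE (Cod sE j) i A) (reix sE (Dom sE j) i a) b" for i A a b
    proof (rule extend_total_section[OF K M _ j _ incl fibA S_def pi' that])
      show "snd ?K = snd ?M" by (simp add: shape_sset_def)
      show "cmp j m \<bullet>\<^bsub>E\<^esub> snd (copow E (fst ?K m)) k = snd (copow E (fst ?M m)) k"
        if "k \<in> fst ?K m" "k \<in> fst ?M m" for m k
        using shape_inclusion_at[OF shape_subset shape_subset countable_cube that jm over] .
    qed
  qed blast
  obtain T q0 where T: "is_pullback sE r q0 T \<pi>" using univ[OF r] by blast
  show ?thesis using X.strict_interpretation[OF gen se T assms(7)] .
qed

end
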